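(* Consider the Boomerang Sampler on $\mathcal H\times\mathcal H$ described in the context. Assume that $\Phi$ satisfies Assumption (G) and is twice continuously differentiable with $\nabla_x^2\Phi$ bounded on bounded sets, and assume also that condition (I) of the context holds. Let $(\mathcal L,D_{L^2_\mu})$ be the generator of the strongly continuous semigroup on $L^2_\mu$ which extends $\mathcal P_t$. Then $\mathcal FC_c^\infty(\mathcal H\times\mathcal H)$ is a core for $(\mathcal L,D_{L^2_\mu})$.
   Context: $\mathcal H$ is an infinite dimensional separable real Hilbert space, $\Sigma$ a positive definite self-adjoint trace class operator on it, $\pi_0=\nu_0=\mathcal N(0,\Sigma)$, $\mu_0=\pi_0\times\nu_0$ on $\mathcal H\times\mathcal H$. For $\Phi:\mathcal H\to\mathbb R$, $\mu$ is the probability measure $\mu(dx,dv)\propto e^{-\Phi(x)}\mu_0(dx,dv)$. Assumption (G) on $\Phi$: (1) $0\le\Phi(x)\le K(1+\|x\|^2)$ for some $K$; (2) $\Phi$ is Fréchet differentiable, $\nabla\Phi$ is Lipschitz on bounded sets and $\|\nabla\Phi(x)\|\le K(1+\|x\|)$; (3) $\Phi=\Phi_1+\Phi_2$ with $\Phi_1$ convex and bounded from below, $\Phi_2$ bounded with bounded first and second order derivatives. Boomerang Sampler: $\lambda_{\mathrm r}>0$ is a constant and $(R_n)_{n\ge1}$ are linear operators on $\mathcal H$ with $R_n^2=1$, $\|R_nv\|=\|v\|$, $\langle\Sigma q,q\rangle=\langle R_n\Sigma R_n^*q,q\rangle$ for all $q$, and $\sum_n\|(1-R_n)v\|^2=4\|v\|^2$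 for all $v$. Put $\lambda_n(x,v)=\frac12(\langle\nabla_x\Phi(x),v-R_nv\rangle)^+$. The process $(X_t,V_t)$ follows the flow $\varphi_t$ of $\dot x=v,\ \dot v=-x$; from $(x,v)$, at rate $\lambda_n(x,v)$ it jumps to $(x,R_nv)$, and at rate $\lambda_{\mathrm r}$ it jumps to $(x,w)$ with $w\sim\nu_0$. Its total rate is $\lambda=\lambda_{\mathrm r}+\sum_n\lambda_n$ and jump kernel $Q=\lambda^{-1}(\sum_n\lambda_n\delta_{(x,R_nv)}+\lambda_{\mathrm r}\,\delta_x\times\nu_0)$. $\mathcal P_tf(x,v)=\mathbb E_{(x,v)}[f(X_t,V_t)]$. On smooth $f$ its generator is $$\mathcal Lf=\langle v,\nabla_xf\rangle-\langle x,\nabla_vf\rangle+\lambda_{\mathrm r}\int[f(x,w)-f(x,v)]\nu_0(dw)+\sum_n\lambda_n(x,v)[f(x,R_nv)-f(x,v)].$$ Condition (I): the following two hold with $\mathcal Z=\mathcal H\times\mathcal H$. (a) With respect to a norm $\|\cdot\|_{\mathcal Z}$ on $\mathcal Z$ inducing its topology (balls $B_R$), and with $\lambda_{\mathrm b}=\sum_n\lambda_n$, $Q_{\mathrm b}=\lambda_{\mathrm b}^{-1}\sum_n\lambda_n\delta_{(x,R_nv)}$, $Q_{\mathrm r}=\delta_x\times\nu_0$: (i) $\lambda_{\mathrm r},\lambda_{\mathrm b}$ measurable; (ii) $Q_{\mathrm b},Q_{\mathrm r}$ are Markov kernels, measurable in the starting point; (iii) $Q_{\mathrm b}(z,\{\|y\|_{\mathcal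 Z}\le\|z\|_{\mathcal Z}\})=1$ for all $z$; (iv) for all $\varepsilon>0$ there is $R>0$ with $Q_{\mathrm r}(z,B_R)>1-\varepsilon$ for all $z\in B_R$; (v) $\lambda_{\mathrm b}$ is bounded on bounded sets; (vi) $\lambda_{\mathrm r}$ is bounded; (vii) $\|\varphi_t(z)\|_{\mathcal Z}\le c_t(1+\|z\|_{\mathcal Z})$ for a continuous $t\mapsto c_t\in(0,\infty)$; (viii) $\lambda_{\mathrm r},\lambda_{\mathrm b}$ are continuous and $Q_{\mathrm b}f,Q_{\mathrm r}f$ are continuous for bounded continuous $f$. (b) Let $L_{\mathfrak X}$ be the derivative along $\varphi_t$, $L_{\mathfrak X}f=\frac{d}{dt}f\circ\varphi_t|_{t=0}$, $L_{\mathfrak X}^*$ its adjoint in $L^2_{\mu_0}$, and $Q^*$ the kernel with $\int\int g(y,z)Q^*(y,dz)\mu_0(dy)=\int\int g(y,z)Q(z,dy)\mu_0(dz)$ for all $g\in C_b(\mathcal Z\times\mathcal Z)$; then, viewing $\Phi$ as a function on $\mathcal Z$, $e^{\Phi(z)}L_{\mathfrak X}^*(e^{-\Phi})(z)+\int\lambda(y)e^{\Phi(z)-\Phi(y)}Q^*(z,dy)-\lambda(z)=0$. Under these assumptions $\mu$ is invariant for $\mathcal P_t$, and $\mathcal P_t$ extends from $C_0(\mathcal H\times\mathcal H)=\{f\in C_b(\mathcal H\times\mathcal H):\|\mathcal P_tf-f\|_\infty\to0 \text{ as } t\to0\}$ to a strongly continuous semigroup on $L^2_\mu$. $\mathcal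 FC_c^\infty(\mathcal H\times\mathcal H)$ is the set of functions $F(z)=f(\langle h_1,z\rangle,\dots,\langle h_n,z\rangle)$ with $n\in\mathbb N$, $h_1,\dots,h_n\in\mathcal H\times\mathcal H$, $f\in C_c^\infty(\mathbb R^n)$. A core is a subspace of the domain dense in it for the graph norm.
   Formalization: FC_c^∞ is not closed under addition, so it cannot be a core in the sense of a subspace; what is proved is that FC_c^∞ itself lies in the domain and is dense in it for the graph norm, and that its linear span is a core. *)

theory Defs
  imports "HOL-Probability.Probability"
begin

section \<open>Operators and Gaussian measures\<close>

definition infinite_dimensional :: "'a::real_vector itself \<Rightarrow> bool" where
  "infinite_dimensional _ \<longleftrightarrow> (\<nexists>B::'a set. finite B \<and> span B = UNIV)"

definition orthonormal_basis :: "'a::real_inner set \<Rightarrow> bool" where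
  "orthonormal_basis B \<longleftrightarrow>
     (\<forall>e\<in>B. norm e = 1) \<and> pairwise orthogonal B \<and> closure (span B) = UNIV"

text \<open>For a positive operator being trace class means that the trace is finite.\<close>

definition positive_trace_class :: "('a::real_inner \<Rightarrow> 'a) \<Rightarrow> bool" where
  "positive_trace_class S \<longleftrightarrow>
     bounded_linear S \<and>
     (\<forall>x y. S x \<bullet> y = x \<bullet> S y) \<and>
     (\<forall>x. x \<noteq> 0 \<longrightarrow> 0 < S x \<bullet> x) \<and>
     (\<forall>B. orthonormal_basis B \<longrightarrow> (\<lambda>e. S e \<bullet> e) summable_on B)"

text \<open>\<open>gaussian S \<nu>\<close>: the Borel probability \<open>\<nu>\<close> is the centred Gaussian measure with (positive
  definite) covariance \<open>S\<close>; it is determined by its one-dimensional marginals.\<close>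

definition gaussian :: "('a::{real_inner, second_countable_topology} \<Rightarrow> 'a) \<Rightarrow> 'a measure \<Rightarrow> bool" where
  "gaussian S \<nu> \<longleftrightarrow>
     prob_space \<nu> \<and> sets \<nu> = sets borel \<and>
     (\<forall>h. h \<noteq> 0 \<longrightarrow>
        distributed \<nu> lborel (\<lambda>x. h \<bullet> x) (\<lambda>y. ennreal (normal_density 0 (sqrt (S h \<bullet> h)) y)))"


section \<open>Gradients and assumptions on the potential\<close>

definition grad :: "('a::real_inner \<Rightarrow> real) \<Rightarrow> 'a \<Rightarrow> 'a" where
  "grad f x = (THE D. GDERIV f x :> D)"

definition twice_differentiable :: "('a::real_inner \<Rightarrow> real) \<Rightarrow> bool" where
  "twice_differentiable f \<longleftrightarrow> (\<forall>x. f differentiable (at x)) \<and> (\<forall>x. grad f differentiable (at x))"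

definition hess :: "('a::real_inner \<Rightarrow> real) \<Rightarrow> 'a \<Rightarrow> 'a \<Rightarrow>\<^sub>L 'a" where
  "hess f x = Blinfun (frechet_derivative (grad f) (at x))"

definition assumption_G :: "('a::real_inner \<Rightarrow> real) \<Rightarrow> bool" where
  "assumption_G \<Phi> \<longleftrightarrow>
     (\<exists>K. (\<forall>x. 0 \<le> \<Phi> x \<and> \<Phi> x \<le> K * (1 + (norm x)\<^sup>2)) \<and>
          (\<forall>x. \<Phi> differentiable (at x)) \<and>
          (\<forall>B. bounded B \<longrightarrow> (\<exists>L. L-lipschitz_on B (grad \<Phi>))) \<and>
          (\<forall>x. norm (grad \<Phi> x) \<le> K * (1 + norm x))) \<and>
     (\<exists>\<Phi>1 \<Phi>2. (\<forall>x. \<Phi> x = \<Phi>1 x + \<Phi>2 x) \<and>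
          convex_on UNIV \<Phi>1 \<and> (\<exists>c. \<forall>x. c \<le> \<Phi>1 x) \<and>
          bounded (range \<Phi>2) \<and> twice_differentiable \<Phi>2 \<and>
          bounded (range (grad \<Phi>2)) \<and> bounded (range (hess \<Phi>2)))"

definition C2_hess_locally_bounded :: "('a::real_inner \<Rightarrow> real) \<Rightarrow> bool" where
  "C2_hess_locally_bounded \<Phi> \<longleftrightarrow>
     twice_differentiable \<Phi> \<and> continuous_on UNIV (hess \<Phi>) \<and>
     (\<forall>B. bounded B \<longrightarrow> bounded (hess \<Phi> ` B))"


section \<open>Piecewise deterministic Markov processes\<close>

text \<open>A process is given by a flow \<open>\<phi>\<close>, a jump rate \<open>r\<close> and a jump kernel \<open>Q\<close>.  Its law from
  \<open>z\<close> is a measure on sequences of pairs (jump time, post-jump state), starting with \<open>(0, z)\<close>.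
  After \<open>(t, y)\<close>, the waiting time \<open>s\<close> has hazard rate \<open>r (\<phi> s y)\<close> and the next state is
  drawn from \<open>Q (\<phi> s y)\<close>; the law of the sequence is the Ionescu-Tulcea limit.\<close>

definition pdmp_wait ::
  "(real \<Rightarrow> 'z \<Rightarrow> 'z) \<Rightarrow> ('z \<Rightarrow> real) \<Rightarrow> 'z \<Rightarrow> real measure" where
  "pdmp_wait \<phi> r z =
     density lborel (\<lambda>s. ennreal (if 0 \<le> s
        then r (\<phi> s z) * exp (- integral {0..s} (\<lambda>u. r (\<phi> u z))) else 0))"

definition pdmp_step ::
  "(real \<Rightarrow> 'z \<Rightarrow> 'z) \<Rightarrow> ('z \<Rightarrow> real) \<Rightarrow> ('z \<Rightarrow> 'z measure) \<Rightarrow> real \<times> 'z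
    \<Rightarrow> (real \<times> 'z::topological_space) measure" where
  "pdmp_step \<phi> r Q p =
     pdmp_wait \<phi> r (snd p) \<bind> (\<lambda>s. distr (Q (\<phi> s (snd p))) borel (\<lambda>y. (fst p + s, y)))"

definition pdmp_law ::
  "(real \<Rightarrow> 'z \<Rightarrow> 'z) \<Rightarrow> ('z \<Rightarrow> real) \<Rightarrow> ('z \<Rightarrow> 'z measure) \<Rightarrow> 'z
    \<Rightarrow> (nat \<Rightarrow> real \<times> 'z::topological_space) measure" where
  "pdmp_law \<phi> r Q z =
     projective_family.lim UNIV
       (Ionescu_Tulcea.CI
         (\<lambda>i \<omega>. case i of 0 \<Rightarrow> return borel (0, z) | Suc k \<Rightarrow> pdmp_step \<phi> r Q (\<omega> k))
         (\<lambda>_. borel))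
       (\<lambda>_. borel)"

definition pdmp_state :: "(real \<Rightarrow> 'z \<Rightarrow> 'z) \<Rightarrow> real \<Rightarrow> (nat \<Rightarrow> real \<times> 'z) \<Rightarrow> 'z" where
  "pdmp_state \<phi> t \<omega> =
     (let k = (LEAST k. t < fst (\<omega> (Suc k))) in \<phi> (t - fst (\<omega> k)) (snd (\<omega> k)))"

definition pdmp_semigroup ::
  "(real \<Rightarrow> 'z \<Rightarrow> 'z) \<Rightarrow> ('z \<Rightarrow> real) \<Rightarrow> ('z \<Rightarrow> 'z measure) \<Rightarrow> real \<Rightarrow> ('z \<Rightarrow> real)
    \<Rightarrow> 'z::topological_space \<Rightarrow> real" where
  "pdmp_semigroup \<phi> r Q t f z = (\<integral>\<omega>. f (pdmp_state \<phi> t \<omega>) \<partial>(pdmp_law \<phi> r Q z))"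


section \<open>The Boomerang Sampler\<close>

definition boomerang_flow :: "real \<Rightarrow> 'a::real_vector \<times> 'a \<Rightarrow> 'a \<times> 'a" where
  "boomerang_flow t z =
     (cos t *\<^sub>R fst z + sin t *\<^sub>R snd z, cos t *\<^sub>R snd z - sin t *\<^sub>R fst z)"

lemma boomerang_flow_0: "boomerang_flow 0 z = z"
  by (simp add: boomerang_flow_def)

lemma boomerang_flow_ode:
  fixes z :: "'a::real_normed_vector \<times> 'a"
  shows "((\<lambda>t. boomerang_flow t z) has_vector_derivative
           (snd (boomerang_flow t z), - fst (boomerang_flow t z))) (at t)"
  unfolding boomerang_flow_def
  by (auto intro!: derivative_eq_intros simp: has_vector_derivative_def algebra_simps)

definition boomerang_reflections ::
  "('a::real_inner \<Rightarrow> 'a) \<Rightarrow> (nat \<Rightarrow> 'a \<Rightarrow> 'a) \<Rightarrow> bool" where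
  "boomerang_reflections S R \<longleftrightarrow>
     (\<forall>n. linear (R n) \<and> (\<forall>v. R n (R n v) = v) \<and> (\<forall>v. norm (R n v) = norm v) \<and>
          (\<forall>q. S q \<bullet> q = R n (S (adjoint (R n) q)) \<bullet> q)) \<and>
     (\<forall>v. (\<lambda>n. (norm (v - R n v))\<^sup>2) sums (4 * (norm v)\<^sup>2))"

definition bounce_rate ::
  "('a::real_inner \<Rightarrow> real) \<Rightarrow> (nat \<Rightarrow> 'a \<Rightarrow> 'a) \<Rightarrow> nat \<Rightarrow> 'a \<times> 'a \<Rightarrow> real" where
  "bounce_rate \<Phi> R n z = max 0 (grad \<Phi> (fst z) \<bullet> (snd z - R n (snd z))) / 2"

definition total_bounce_rate ::
  "('a::real_inner \<Rightarrow> real) \<Rightarrow> (nat \<Rightarrow> 'a \<Rightarrow> 'a) \<Rightarrow> 'a \<times> 'a \<Rightarrow> real" where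
  "total_bounce_rate \<Phi> R z = (\<Sum>n. bounce_rate \<Phi> R n z)"

definition jump_rate ::
  "('a::real_inner \<Rightarrow> real) \<Rightarrow> real \<Rightarrow> (nat \<Rightarrow> 'a \<Rightarrow> 'a) \<Rightarrow> 'a \<times> 'a \<Rightarrow> real" where
  "jump_rate \<Phi> lr R z = lr + total_bounce_rate \<Phi> R z"

definition refresh_kernel :: "'a::topological_space measure \<Rightarrow> 'a \<times> 'a \<Rightarrow> ('a \<times> 'a) measure" where
  "refresh_kernel \<nu> z = distr \<nu> borel (\<lambda>w. (fst z, w))"

text \<open>The next measure is \<open>(\<Sum>n. \<lambda>\<^sub>n \<delta>\<^bsub>(x, R\<^sub>n v)\<^esub>) / \<lambda>\<^sub>b\<close>; it is meaningful only where \<open>\<lambda>\<^sub>b > 0\<close>.\<close>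

definition bounce_measure ::
  "('a::real_inner \<Rightarrow> real) \<Rightarrow> (nat \<Rightarrow> 'a \<Rightarrow> 'a) \<Rightarrow> 'a \<times> 'a \<Rightarrow> ('a \<times> 'a) measure" where
  "bounce_measure \<Phi> R z =
     distr (density (count_space UNIV) (\<lambda>n. ennreal (bounce_rate \<Phi> R n z / total_bounce_rate \<Phi> R z)))
       borel (\<lambda>n. (fst z, R n (snd z)))"

definition jump_kernel ::
  "'a::{real_inner, second_countable_topology} measure \<Rightarrow> ('a \<Rightarrow> real) \<Rightarrow> real \<Rightarrow> (nat \<Rightarrow> 'a \<Rightarrow> 'a)
    \<Rightarrow> 'a \<times> 'a \<Rightarrow> ('a \<times> 'a) measure" where
  "jump_kernel \<nu> \<Phi> lr R z =
     measure_of UNIV (sets borel) (\<lambda>A.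
       ((\<Sum>n. ennreal (bounce_rate \<Phi> R n z) * indicator A (fst z, R n (snd z)))
         + ennreal lr * emeasure (refresh_kernel \<nu> z) A) / ennreal (jump_rate \<Phi> lr R z))"

lemma space_jump_kernel: "space (jump_kernel \<nu> \<Phi> lr R z) = UNIV"
  by (simp add: jump_kernel_def space_measure_of_conv)

lemma sets_jump_kernel:
  fixes z :: "'a::{real_inner, second_countable_topology} \<times> 'a"
  shows "sets (jump_kernel \<nu> \<Phi> lr R z) = sets borel"
  using sets.sets_measure_of_eq[of "borel :: ('a \<times> 'a) measure"] by (simp add: jump_kernel_def)

lemma emeasure_jump_kernel:
  fixes z :: "'a::{real_inner, second_countable_topology} \<times> 'a"
  assumes "A \<in> sets borel"
  shows "emeasure (jump_kernel \<nu> \<Phi> lr R z) A =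
       ((\<Sum>n. ennreal (bounce_rate \<Phi> R n z) * indicator A (fst z, R n (snd z)))
         + ennreal lr * emeasure (refresh_kernel \<nu> z) A) / ennreal (jump_rate \<Phi> lr R z)"
proof -
  let ?M = "distr (density (count_space UNIV) (\<lambda>n. ennreal (bounce_rate \<Phi> R n z)))
              borel (\<lambda>n. (fst z, R n (snd z)))"
  let ?F = "\<lambda>A. ((\<Sum>n. ennreal (bounce_rate \<Phi> R n z) * indicator A (fst z, R n (snd z)))
         + ennreal lr * emeasure (refresh_kernel \<nu> z) A) / ennreal (jump_rate \<Phi> lr R z)"
  have M: "(\<Sum>n. ennreal (bounce_rate \<Phi> R n z) * indicator B (fst z, R n (snd z))) = emeasure ?M B"
    if "B \<in> sets borel" for B
  proof -
    have "emeasure ?M B = (\<integral>\<^sup>+n. ennreal (bounce_rate \<Phi> R n z)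
        * indicator ((\<lambda>n. (fst z, R n (snd z))) -` B) n \<partial>count_space UNIV)"
      using that by (subst emeasure_distr) (simp_all add: emeasure_density)
    then show ?thesis
      by (simp add: nn_integral_count_space_nat indicator_def)
  qed
  have "countably_additive (sets borel) ?F"
  proof (rule countably_additiveI)
    fix B :: "nat \<Rightarrow> ('a \<times> 'a) set"
    assume B: "range B \<subseteq> sets borel" "disjoint_family B" "\<Union>(range B) \<in> sets borel"
    have "(\<Sum>i. ?F (B i)) =
        (\<Sum>i. (emeasure ?M (B i) + ennreal lr * emeasure (refresh_kernel \<nu> z) (B i))
               / ennreal (jump_rate \<Phi> lr R z))"
      using B(1) by (intro suminf_cong) (simp add: M range_subsetD)
    also have "\<dots> = ((\<Sum>i. emeasure ?M (B i)) + ennreal lr * (\<Sum>i. emeasure (refresh_kernel \<nu> z) (B i)))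
               / ennreal (jump_rate \<Phi> lr R z)"
      by (simp add: divide_ennreal_def ennreal_suminf_multc ennreal_suminf_cmult suminf_add[symmetric])
    also have "\<dots> = ?F (\<Union>(range B))"
      using B by (simp add: M suminf_emeasure refresh_kernel_def)
    finally show "(\<Sum>i. ?F (B i)) = ?F (\<Union>(range B))" .
  qed
  moreover have "positive (sets borel) ?F"
    by (simp add: positive_def divide_ennreal_def)
  ultimately show ?thesis
    using assms by (intro emeasure_measure_of[OF jump_kernel_def]) (simp_all add: sets_jump_kernel)
qed

text \<open>The semigroup \<open>\<P>\<^sub>t\<close> acting on bounded measurable functions.\<close>

definition boomerang_semigroup ::
  "'a::{real_inner, second_countable_topology} measure \<Rightarrow> ('a \<Rightarrow> real) \<Rightarrow> real \<Rightarrow> (nat \<Rightarrow> 'a \<Rightarrow> 'a)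
    \<Rightarrow> real \<Rightarrow> ('a \<times> 'a \<Rightarrow> real) \<Rightarrow> 'a \<times> 'a \<Rightarrow> real" where
  "boomerang_semigroup \<nu> \<Phi> lr R =
     pdmp_semigroup boomerang_flow (jump_rate \<Phi> lr R) (jump_kernel \<nu> \<Phi> lr R)"

definition boomerang_C0 ::
  "'a::{real_inner, second_countable_topology} measure \<Rightarrow> ('a \<Rightarrow> real) \<Rightarrow> real \<Rightarrow> (nat \<Rightarrow> 'a \<Rightarrow> 'a)
    \<Rightarrow> ('a \<times> 'a \<Rightarrow> real) set" where
  "boomerang_C0 \<nu> \<Phi> lr R =
     {f. continuous_on UNIV f \<and> bounded (range f) \<and>
         uniform_limit UNIV (\<lambda>t. boomerang_semigroup \<nu> \<Phi> lr R t f) f (at_right 0)}"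

definition boomerang_target ::
  "'a::{real_inner, second_countable_topology} measure \<Rightarrow> ('a \<Rightarrow> real) \<Rightarrow> ('a \<times> 'a) measure" where
  "boomerang_target \<nu> \<Phi> =
     density (\<nu> \<Otimes>\<^sub>M \<nu>)
       (\<lambda>z. ennreal (exp (- \<Phi> (fst z)) / (\<integral>y. exp (- \<Phi> (fst y)) \<partial>(\<nu> \<Otimes>\<^sub>M \<nu>))))"


section \<open>Semigroups on \<open>L\<^sup>2\<close>, generators and cores\<close>

text \<open>Elements of \<open>L\<^sup>2\<close> are handled through representatives, equality being almost-everywhere
  equality.  A generator is the set of all pairs \<open>(f, g)\<close> of representatives with \<open>g = \<L> f\<close>;
  it is closed under changing \<open>f\<close> and \<open>g\<close> on null sets.\<close>

definition L2 :: "'z measure \<Rightarrow> ('z \<Rightarrow> real) set" where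
  "L2 \<mu> = {f \<in> borel_measurable \<mu>. integrable \<mu> (\<lambda>z. (f z)\<^sup>2)}"

definition L2_norm :: "'z measure \<Rightarrow> ('z \<Rightarrow> real) \<Rightarrow> real" where
  "L2_norm \<mu> f = sqrt (\<integral>z. (f z)\<^sup>2 \<partial>\<mu>)"

definition strongly_continuous_semigroup ::
  "'z measure \<Rightarrow> (real \<Rightarrow> ('z \<Rightarrow> real) \<Rightarrow> 'z \<Rightarrow> real) \<Rightarrow> bool" where
  "strongly_continuous_semigroup \<mu> T \<longleftrightarrow>
     (\<forall>t\<ge>0. \<forall>f\<in>L2 \<mu>. T t f \<in> L2 \<mu>) \<and>
     (\<forall>t\<ge>0. \<forall>f\<in>L2 \<mu>. \<forall>g\<in>L2 \<mu>. (AE z in \<mu>. f z = g z) \<longrightarrow> (AE z in \<mu>. T t f z = T t g z)) \<and>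
     (\<forall>t\<ge>0. \<forall>f\<in>L2 \<mu>. \<forall>g\<in>L2 \<mu>. \<forall>a b.
        AE z in \<mu>. T t (\<lambda>y. a * f y + b * g y) z = a * T t f z + b * T t g z) \<and>
     (\<forall>t\<ge>0. \<exists>C. \<forall>f\<in>L2 \<mu>. L2_norm \<mu> (T t f) \<le> C * L2_norm \<mu> f) \<and>
     (\<forall>f\<in>L2 \<mu>. AE z in \<mu>. T 0 f z = f z) \<and>
     (\<forall>s\<ge>0. \<forall>t\<ge>0. \<forall>f\<in>L2 \<mu>. AE z in \<mu>. T (s + t) f z = T s (T t f) z) \<and>
     (\<forall>f\<in>L2 \<mu>. ((\<lambda>t. L2_norm \<mu> (\<lambda>z. T t f z - f z)) \<longlongrightarrow> 0) (at_right 0))"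

definition semigroup_generator ::
  "'z measure \<Rightarrow> (real \<Rightarrow> ('z \<Rightarrow> real) \<Rightarrow> 'z \<Rightarrow> real) \<Rightarrow> (('z \<Rightarrow> real) \<times> ('z \<Rightarrow> real)) set" where
  "semigroup_generator \<mu> T =
     {(f, g). f \<in> L2 \<mu> \<and> g \<in> L2 \<mu> \<and>
        ((\<lambda>t. L2_norm \<mu> (\<lambda>z. (T t f z - f z) / t - g z)) \<longlongrightarrow> 0) (at_right 0)}"

definition graph_dense ::
  "'z measure \<Rightarrow> (('z \<Rightarrow> real) \<times> ('z \<Rightarrow> real)) set \<Rightarrow> ('z \<Rightarrow> real) set \<Rightarrow> bool" where
  "graph_dense \<mu> G D \<longleftrightarrow>
     D \<subseteq> Domain G \<and>
     (\<forall>(f, g)\<in>G. \<forall>\<epsilon>>0. \<exists>(f', g')\<in>G. f' \<in> D \<and>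
        L2_norm \<mu> (\<lambda>z. f z - f' z) + L2_norm \<mu> (\<lambda>z. g z - g' z) < \<epsilon>)"

definition is_core ::
  "'z measure \<Rightarrow> (('z \<Rightarrow> real) \<times> ('z \<Rightarrow> real)) set \<Rightarrow> ('z \<Rightarrow> real) set \<Rightarrow> bool" where
  "is_core \<mu> G D \<longleftrightarrow>
     (\<lambda>_. 0) \<in> D \<and> (\<forall>f\<in>D. \<forall>g\<in>D. \<forall>a b. (\<lambda>z. a * f z + b * g z) \<in> D) \<and> graph_dense \<mu> G D"


section \<open>Smooth cylinder functions\<close>

text \<open>A function on \<open>\<real>\<^sup>n\<close> is represented by a function of sequences that depends on the first \<open>n\<close>
  coordinates only; the product topology on sequences then induces the topology of \<open>\<real>\<^sup>n\<close>.\<close>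

primrec iterated_partial ::
  "nat list \<Rightarrow> ((nat \<Rightarrow> real) \<Rightarrow> real) \<Rightarrow> (nat \<Rightarrow> real) \<Rightarrow> real" where
  "iterated_partial [] f = f"
| "iterated_partial (i # is) f = (\<lambda>x. deriv (\<lambda>s. iterated_partial is f (x(i := s))) (x i))"

definition smooth_compact_support :: "nat \<Rightarrow> ((nat \<Rightarrow> real) \<Rightarrow> real) \<Rightarrow> bool" where
  "smooth_compact_support n f \<longleftrightarrow>
     (\<forall>x y. (\<forall>i<n. x i = y i) \<longrightarrow> f x = f y) \<and>
     (\<forall>is. set is \<subseteq> {..<n} \<longrightarrow>
        continuous_on UNIV (iterated_partial is f) \<and>
        (\<forall>i<n. \<forall>x. (\<lambda>s. iterated_partial is f (x(i := s))) differentiable (at (x i)))) \<and>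
     (\<exists>r. \<forall>x. (\<exists>i<n. r < \<bar>x i\<bar>) \<longrightarrow> f x = 0)"

definition smooth_cylinder_functions :: "('z::real_inner \<Rightarrow> real) set" where
  "smooth_cylinder_functions =
     {\<lambda>z. f (\<lambda>i. h i \<bullet> z) | n h f. smooth_compact_support n f}"

text \<open>\<open>smooth_cylinder_functions\<close> is not closed under addition: \<open>f \<langle>h\<^sub>1, z\<rangle> + g \<langle>h\<^sub>2, z\<rangle>\<close> is in general
  not a compactly supported function of finitely many linear functionals.  Where a subspace is
  required, the linear span is used.\<close>

definition linear_span :: "('z \<Rightarrow> real) set \<Rightarrow> ('z \<Rightarrow> real) set" where
  "linear_span D = {\<lambda>z. \<Sum>i<k. c i * F i z | (k::nat) c F. \<forall>i<k. F i \<in> D}"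


section \<open>Condition (I)\<close>

definition norm_inducing_topology :: "('z::real_normed_vector \<Rightarrow> real) \<Rightarrow> bool" where
  "norm_inducing_topology N \<longleftrightarrow>
     (\<forall>z. N z = 0 \<longleftrightarrow> z = 0) \<and> (\<forall>a z. N (a *\<^sub>R z) = \<bar>a\<bar> * N z) \<and> (\<forall>y z. N (y + z) \<le> N y + N z) \<and>
     Metric_space.mtopology UNIV (\<lambda>y z. N (y - z)) = euclidean"

definition condition_Ia ::
  "(real \<Rightarrow> 'z \<Rightarrow> 'z) \<Rightarrow> ('z \<Rightarrow> real) \<Rightarrow> ('z \<Rightarrow> real) \<Rightarrow> ('z \<Rightarrow> 'z measure) \<Rightarrow> ('z \<Rightarrow> 'z measure)
    \<Rightarrow> ('z::real_normed_vector \<Rightarrow> real) \<Rightarrow> bool" where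
  "condition_Ia \<phi> lr lb Qr Qb N \<longleftrightarrow>
     lr \<in> borel_measurable borel \<and> lb \<in> borel_measurable borel \<and>
     Qr \<in> borel \<rightarrow>\<^sub>M prob_algebra borel \<and> Qb \<in> borel \<rightarrow>\<^sub>M prob_algebra borel \<and>
     (\<forall>z. measure (Qb z) {y. N y \<le> N z} = 1) \<and>
     (\<forall>\<epsilon>>0. \<exists>\<rho>>0. \<forall>z. N z < \<rho> \<longrightarrow> measure (Qr z) {y. N y < \<rho>} > 1 - \<epsilon>) \<and>
     (\<forall>B. bounded B \<longrightarrow> bounded (lb ` B)) \<and>
     bounded (range lr) \<and>
     (\<exists>c. continuous_on {0..} c \<and> (\<forall>t\<ge>0. 0 < c t \<and> (\<forall>z. N (\<phi> t z) \<le> c t * (1 + N z)))) \<and>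
     continuous_on UNIV lr \<and> continuous_on UNIV lb \<and>
     (\<forall>f::'z \<Rightarrow> real. continuous_on UNIV f \<and> bounded (range f) \<longrightarrow>
        continuous_on UNIV (\<lambda>z. \<integral>y. f y \<partial>(Qr z)) \<and> continuous_on UNIV (\<lambda>z. \<integral>y. f y \<partial>(Qb z)))"

definition flow_derivative ::
  "'z measure \<Rightarrow> (real \<Rightarrow> 'z \<Rightarrow> 'z) \<Rightarrow> (('z \<Rightarrow> real) \<times> ('z \<Rightarrow> real)) set" where
  "flow_derivative \<mu>0 \<phi> =
     {(f, g). f \<in> L2 \<mu>0 \<and> g \<in> L2 \<mu>0 \<and> (\<forall>z. ((\<lambda>t. f (\<phi> t z)) has_real_derivative g z) (at 0))}"

definition adjoint_graph ::
  "'z measure \<Rightarrow> (('z \<Rightarrow> real) \<times> ('z \<Rightarrow> real)) set \<Rightarrow> (('z \<Rightarrow> real) \<times> ('z \<Rightarrow> real)) set" where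
  "adjoint_graph \<mu>0 A =
     {(f, g). f \<in> L2 \<mu>0 \<and> g \<in> L2 \<mu>0 \<and>
        (\<forall>(u, w)\<in>A. (\<integral>z. w z * f z \<partial>\<mu>0) = (\<integral>z. u z * g z \<partial>\<mu>0))}"

text \<open>\<open>Q*\<close> need not be a Markov kernel: \<open>\<mu>0\<close> is in general not invariant under \<open>Q\<close>.\<close>

definition adjoint_kernel ::
  "'z measure \<Rightarrow> ('z \<Rightarrow> 'z measure) \<Rightarrow> ('z::topological_space \<Rightarrow> 'z measure) \<Rightarrow> bool" where
  "adjoint_kernel \<mu>0 Q Qst \<longleftrightarrow>
     (\<forall>z. finite_measure (Qst z) \<and> sets (Qst z) = sets borel) \<and>
     (\<forall>A\<in>sets borel. (\<lambda>z. emeasure (Qst z) A) \<in> borel_measurable borel) \<and>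
     (\<forall>g::'z \<times> 'z \<Rightarrow> real. continuous_on UNIV g \<and> bounded (range g) \<longrightarrow>
        (\<integral>y. (\<integral>z. g (y, z) \<partial>(Qst y)) \<partial>\<mu>0) = (\<integral>z. (\<integral>y. g (y, z) \<partial>(Q z)) \<partial>\<mu>0))"

definition condition_Ib ::
  "'z::topological_space measure \<Rightarrow> (real \<Rightarrow> 'z \<Rightarrow> 'z) \<Rightarrow> ('z \<Rightarrow> real) \<Rightarrow> ('z \<Rightarrow> 'z measure)
    \<Rightarrow> ('z \<Rightarrow> real) \<Rightarrow> bool" where
  "condition_Ib \<mu>0 \<phi> r Q \<Psi> \<longleftrightarrow>
     (\<exists>Qst k. adjoint_kernel \<mu>0 Q Qst \<and>
        (\<lambda>z. exp (- \<Psi> z), k) \<in> adjoint_graph \<mu>0 (flow_derivative \<mu>0 \<phi>) \<and>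
        (AE z in \<mu>0. exp (\<Psi> z) * k z + (\<integral>y. r y * exp (\<Psi> z - \<Psi> y) \<partial>(Qst z)) - r z = 0))"

text \<open>The bounce kernel is prescribed only where \<open>\<lambda>\<^sub>b > 0\<close> (elsewhere its defining formula is
  \<open>0/0\<close>); any choice on \<open>{\<lambda>\<^sub>b = 0}\<close> is admitted.\<close>

definition condition_I ::
  "'a::{real_inner, second_countable_topology} measure \<Rightarrow> ('a \<Rightarrow> real) \<Rightarrow> real \<Rightarrow> (nat \<Rightarrow> 'a \<Rightarrow> 'a) \<Rightarrow> bool" where
  "condition_I \<nu> \<Phi> lr R \<longleftrightarrow>
     (\<exists>N Qb. norm_inducing_topology N \<and>
        (\<forall>z. total_bounce_rate \<Phi> R z > 0 \<longrightarrow> Qb z = bounce_measure \<Phi> R z) \<and>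
        condition_Ia boomerang_flow (\<lambda>_. lr) (total_bounce_rate \<Phi> R) (refresh_kernel \<nu>) Qb N) \<and>
     condition_Ib (\<nu> \<Otimes>\<^sub>M \<nu>) boomerang_flow (jump_rate \<Phi> lr R) (jump_kernel \<nu> \<Phi> lr R) (\<lambda>z. \<Phi> (fst z))"

end

theory Submission
  imports Defs "HOL-Computational_Algebra.Polynomial"
begin

text \<open>The flow \<open>\<phi>\<close> and the bounces preserve the norm of \<open>\<H> \<times> \<H>\<close>, so every cut-off that depends on the
  norm only is invariant under them and refreshment is the only source of large velocities.  This gives
  non-explosion and, for bounded \<open>u\<close> whose derivative \<open>X u\<close> along \<open>\<phi>\<close> grows at most linearly, membership
  of \<open>u\<close> in the domain of the generator, with \<open>\<L> u = X u + \<Sum>\<^sub>n \<lambda>\<^sub>n (u \<circ> R\<^sub>n - u) + \<lambda>\<^sub>r (\<integral> u d\<nu>\<^sub>0 - u)\<close>: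
  Dynkin's formula for bounded \<open>\<L> u\<close>, then removal of the cut-off, since the generator is closed and
  the bounce rate is square integrable.

  For density, solve \<open>(\<alpha> - \<L>) u = f\<close> approximately for bounded continuous \<open>f\<close>.  With the bounces thinned
  by the factor \<open>\<rho> / (\<rho> + \<lambda>\<^sub>b)\<close> the jump part \<open>G\<close> is a bounded operator on bounded continuous functions,
  and the equation becomes the contraction \<open>u = (\<beta> - X)\<^sup>-\<^sup>1 (f + G u)\<close> with \<open>\<beta> = \<alpha> + \<rho> + \<lambda>\<^sub>r\<close>; the error vanishes in
  \<open>L\<^sup>2\<close> as \<open>\<rho> \<rightarrow> \<infinity>\<close>.  The solution is a resolvent of the flow applied to a bounded continuous function, and
  on such functions the graph norm is controlled by bounded pointwise convergence.  As the flow rotates each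
  coordinate plane spanned by \<open>(e, 0)\<close> and \<open>(0, e)\<close>, the resolvent of a polynomial in finitely many
  coordinates is again one; multiplying it by a bump function of the norm of these coordinates gives the
  approximating smooth cylinder functions.\<close>

section \<open>The boomerang flow\<close>

text \<open>About \<open>T\<close> only this is known: it consists of bounded operators, is strongly
  continuous on \<open>L2\<close>, and agrees almost everywhere with the pathwise semigroup on
  \<open>boomerang_C0\<close>. Bounds on its growth therefore have to be extracted by a uniform
  boundedness argument, and every element of its generator has to be reached from functions in
  \<open>boomerang_C0\<close>. The obstacle is the unbounded bounce rate: already for a cylinder
  function \<L> u is in general unbounded. It is dominated by a weight that is a product of a
  function of the position and one of the velocity, so that two second moments of the Gaussian
  measure make it square integrable.

  Density becomes a range condition: \<open>resolvent_estimate\<close> bounds w by (a - \<L>) w,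
  hence for (f, g) in the generator it suffices to approximate a f - g by (a - \<L>) v with v a
  cylinder function. The intermediate solution u need not be differentiable in any direction other
  than that of the flow. This is enough, because a resolvent of the flow is differentiable along
  orbits even if the function it is applied to is merely continuous.\<close>

lemma boomerang_flow_add: "boomerang_flow s (boomerang_flow t z) = boomerang_flow (s + t) z"
  by (simp add: boomerang_flow_def cos_add sin_add algebra_simps)

lemma norm_boomerang_flow: "norm (boomerang_flow t z) = norm (z :: 'a::real_inner \<times> 'a)"
proof -
  have *: "(norm (c *\<^sub>R fst z + s *\<^sub>R snd z, c *\<^sub>R snd z - s *\<^sub>R fst z))\<^sup>2 = (c\<^sup>2 + s\<^sup>2) * (norm z)\<^sup>2" for c s
    unfolding power2_norm_eq_inner
    by (simp add: inner_prod_def inner_add_left inner_add_right inner_diff_left inner_diff_right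
        inner_commute[of "snd z" "fst z"] power2_eq_square algebra_simps)
  show ?thesis
    using *[of "cos t" "sin t"] by (simp add: boomerang_flow_def)
qed

lemma continuous_on_boomerang_flow [continuous_intros]:
  fixes g :: "'b::t2_space \<Rightarrow> 'a::real_normed_vector \<times> 'a"
  assumes "continuous_on A f" "continuous_on A g"
  shows "continuous_on A (\<lambda>x. boomerang_flow (f x) (g x))"
  unfolding boomerang_flow_def using assms by (intro continuous_intros)

text \<open>By the group property a derivative at time 0 from every starting point is a derivative
  at every time. Differentiability along the flow is therefore always assumed at time 0
  only.\<close>

lemma boomerang_flow_derivative:
  fixes u :: "'a::real_normed_vector \<times> 'a \<Rightarrow> real"
  assumes "\<And>z. ((\<lambda>t. u (boomerang_flow t z)) has_real_derivative Xu z) (at 0)"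
  shows "((\<lambda>t. u (boomerang_flow t z)) has_real_derivative Xu (boomerang_flow s z)) (at s within A)"
proof -
  have "((\<lambda>t. u (boomerang_flow t (boomerang_flow s z))) has_real_derivative Xu (boomerang_flow s z)) (at (s + - s))"
    using assms by simp
  then have "((\<lambda>t. u (boomerang_flow (t + - s) (boomerang_flow s z))) has_real_derivative Xu (boomerang_flow s z)) (at s)"
    by (subst (asm) DERIV_shift)
  then show ?thesis
    by (simp add: boomerang_flow_add has_field_derivative_at_within)
qed

section \<open>Rates and kernels\<close>

text \<open>Collects what the probabilistic part uses about the rates;
  \<open>boomerang_locale\<close> derives it from the growth of the gradient, the reflections and
  condition (I). The last two assumptions are the Feller properties of \<lambda>_b Q_b and of Q_r.
  The product \<lambda>_b Q_b makes sense at points with \<lambda>_b = 0 as well, where Q_b itself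
  is not determined.\<close>

locale boomerang =
  fixes \<nu> :: "'h::{real_inner, banach, second_countable_topology} measure"
    and \<Phi> :: "'h \<Rightarrow> real" and lr :: real and R :: "nat \<Rightarrow> 'h \<Rightarrow> 'h"
  assumes lr_pos: "0 < lr"
    and prob_nu: "prob_space \<nu>"
    and sets_nu [measurable_cong]: "sets \<nu> = sets borel"
    and norm_R: "norm (R n v) = norm v"
    and continuous_R: "continuous_on UNIV (R n)"
    and continuous_bounce_rate: "continuous_on UNIV (bounce_rate \<Phi> R n)"
    and summable_bounce_rate: "summable (\<lambda>n. bounce_rate \<Phi> R n z)"
    and continuous_total_rate: "continuous_on UNIV (total_bounce_rate \<Phi> R)"
    and bounded_total_rate: "bounded B \<Longrightarrow> bounded (total_bounce_rate \<Phi> R ` B)"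
    and continuous_bounce: "continuous_on UNIV u \<Longrightarrow> bounded (range u) \<Longrightarrow>
      continuous_on UNIV (\<lambda>z. \<Sum>n. bounce_rate \<Phi> R n z * u (fst z, R n (snd z)))"
    and continuous_refresh: "continuous_on UNIV u \<Longrightarrow> bounded (range u) \<Longrightarrow>
      continuous_on UNIV (\<lambda>z :: 'h \<times> 'h. (\<integral>w. u (fst z, w) \<partial>\<nu>) :: real)"
begin

abbreviation "lam \<equiv> bounce_rate \<Phi> R"
abbreviation "lb \<equiv> total_bounce_rate \<Phi> R"
abbreviation "rate \<equiv> jump_rate \<Phi> lr R"
abbreviation "jumpk \<equiv> jump_kernel \<nu> \<Phi> lr R"

definition bounce :: "nat \<Rightarrow> 'h \<times> 'h \<Rightarrow> 'h \<times> 'h" where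
  "bounce n z = (fst z, R n (snd z))"

definition bounce_sum :: "('h \<times> 'h \<Rightarrow> real) \<Rightarrow> 'h \<times> 'h \<Rightarrow> real" where
  "bounce_sum u z = (\<Sum>n. lam n z * u (bounce n z))"

definition refresh :: "('h \<times> 'h \<Rightarrow> real) \<Rightarrow> 'h \<times> 'h \<Rightarrow> real" where
  "refresh u z = (\<integral>w. u (fst z, w) \<partial>\<nu>)"

sublocale nu: prob_space \<nu> by (rule prob_nu)

lemma space_nu [simp]: "space \<nu> = UNIV"
  using sets_eq_imp_space_eq[OF sets_nu] by simp

lemma prob_nu_UNIV [simp]: "measure \<nu> UNIV = 1" "emeasure \<nu> UNIV = 1"
  using nu.prob_space nu.emeasure_space_1 by simp_all

lemma lam_nonneg [simp]: "0 \<le> lam n z"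
  by (simp add: bounce_rate_def)

lemma lam_sums: "(\<lambda>n. lam n z) sums lb z"
  unfolding total_bounce_rate_def by (rule summable_sums[OF summable_bounce_rate])

lemma lb_nonneg [simp]: "0 \<le> lb z"
  unfolding total_bounce_rate_def by (intro suminf_nonneg summable_bounce_rate) simp

lemma rate_pos: "0 < rate z"
  using lr_pos lb_nonneg[of z] unfolding jump_rate_def by linarith

lemma lr_le_rate: "lr \<le> rate z"
  by (simp add: jump_rate_def)

lemma continuous_rate: "continuous_on UNIV rate"
  unfolding jump_rate_def[abs_def] by (intro continuous_intros continuous_total_rate)

lemma norm_bounce: "norm (bounce n z) = norm z"
  by (cases z) (simp add: bounce_def norm_Pair norm_R)

lemma lam_measurable [measurable]: "lam n \<in> borel_measurable borel"
  by (intro borel_measurable_continuous_onI continuous_bounce_rate)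

lemma rate_measurable [measurable]: "rate \<in> borel_measurable borel"
  by (intro borel_measurable_continuous_onI continuous_rate)

lemma bounce_measurable [measurable]: "bounce n \<in> borel \<rightarrow>\<^sub>M borel"
  unfolding bounce_def[abs_def]
  by (intro borel_measurable_continuous_onI continuous_intros continuous_on_compose2[OF continuous_R]) auto

lemma flow_measurable [measurable (raw)]:
  fixes g :: "'b \<Rightarrow> 'h \<times> 'h"
  assumes [measurable]: "f \<in> borel_measurable N" "g \<in> borel_measurable N"
  shows "(\<lambda>x. boomerang_flow (f x) (g x)) \<in> borel_measurable N"
proof -
  have "(\<lambda>p::real \<times> ('h \<times> 'h). boomerang_flow (fst p) (snd p)) \<in> borel_measurable borel"
    by (intro borel_measurable_continuous_onI continuous_intros)
  then have [measurable]: "(\<lambda>p::real \<times> ('h \<times> 'h). boomerang_flow (fst p) (snd p)) \<in> borel_measurable (borel \<Otimes>\<^sub>M borel)"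
    by (simp add: borel_prod)
  have "(\<lambda>x. (\<lambda>p. boomerang_flow (fst p) (snd p)) (f x, g x)) \<in> borel_measurable N"
    by measurable
  then show ?thesis by simp
qed

lemma Pair_borel_measurable [measurable (raw)]:
  fixes f :: "'b \<Rightarrow> 'c::second_countable_topology" and g :: "'b \<Rightarrow> 'd::second_countable_topology"
  assumes [measurable]: "f \<in> borel_measurable N" "g \<in> borel_measurable N"
  shows "(\<lambda>x. (f x, g x)) \<in> borel_measurable N"
  unfolding borel_prod[symmetric] by measurable

lemma fst_borel_measurable [measurable]: "(fst :: 'c::second_countable_topology \<times> 'd::second_countable_topology \<Rightarrow> 'c) \<in> borel \<rightarrow>\<^sub>M borel"
  by (intro borel_measurable_continuous_onI continuous_intros)

lemma snd_borel_measurable [measurable]: "(snd :: 'c::second_countable_topology \<times> 'd::second_countable_topology \<Rightarrow> 'd) \<in> borel \<rightarrow>\<^sub>M borel"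
  by (intro borel_measurable_continuous_onI continuous_intros)

text \<open>The third bound is for the bounce part \<lambda>_b (Q_b u - u) of the generator. It
  grows like \<open>lb\<close> and is, besides the flow derivative, the only unbounded contribution
  for bounded \<open>u\<close>.\<close>

lemma bounce_summable:
  assumes "\<And>y. \<bar>u y\<bar> \<le> C"
  shows "summable (\<lambda>n. lam n z * u (bounce n z))"
    and "\<bar>bounce_sum u z\<bar> \<le> C * lb z"
    and "\<bar>bounce_sum u z - lb z * u z\<bar> \<le> 2 * C * lb z"
proof -
  have le: "norm (lam n z * u (bounce n z)) \<le> C * lam n z" for n
    using mult_left_mono[OF assms[of "bounce n z"], of "lam n z"] by (simp add: abs_mult mult.commute)
  show s: "summable (\<lambda>n. lam n z * u (bounce n z))"
    by (rule summable_comparison_test'[OF summable_mult[OF summable_bounce_rate], of 0]) (rule le)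
  have "\<bar>bounce_sum u z\<bar> \<le> (\<Sum>n. C * lam n z)"
    unfolding bounce_sum_def real_norm_def[symmetric]
    by (rule norm_suminf_le[OF le summable_mult[OF summable_bounce_rate]])
  also have "\<dots> = C * lb z"
    by (simp add: suminf_mult summable_bounce_rate total_bounce_rate_def)
  finally show 1: "\<bar>bounce_sum u z\<bar> \<le> C * lb z" .
  have "\<bar>lb z * u z\<bar> \<le> C * lb z"
    using mult_left_mono[OF assms[of z], of "lb z"] by (simp add: abs_mult mult.commute)
  with 1 show "\<bar>bounce_sum u z - lb z * u z\<bar> \<le> 2 * C * lb z"
    by linarith
qed

lemma continuous_bounce_sum:
  "continuous_on UNIV u \<Longrightarrow> bounded (range u) \<Longrightarrow> continuous_on UNIV (bounce_sum u)"
  using continuous_bounce[of u] by (simp add: bounce_sum_def[abs_def] bounce_def)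

lemma continuous_refresh':
  "continuous_on UNIV u \<Longrightarrow> bounded (range u) \<Longrightarrow> continuous_on UNIV (refresh u)"
  using continuous_refresh[of u] by (simp add: refresh_def[abs_def])

lemma abs_refresh_le:
  assumes "\<And>y. \<bar>u y\<bar> \<le> C"
  shows "\<bar>refresh u z\<bar> \<le> C"
proof -
  have C: "0 \<le> C" using assms[of z] by linarith
  show ?thesis
  \<comment> \<open>\<open>u\<close> need not be measurable here. The integral of a non-integrable
    function is 0 by convention, and the bound survives because \<open>C\<close> is
    nonnegative.\<close>
  proof (cases "integrable \<nu> (\<lambda>w. u (fst z, w))")
    case True
    have "\<bar>refresh u z\<bar> \<le> (\<integral>w. \<bar>u (fst z, w)\<bar> \<partial>\<nu>)"
      unfolding refresh_def by (rule integral_abs_bound)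
    also have "\<dots> \<le> (\<integral>w. C \<partial>\<nu>)"
      using True assms by (intro integral_mono) auto
    finally show ?thesis by (simp add: nu.prob_space)
  qed (use C in \<open>simp add: refresh_def not_integrable_integral_eq\<close>)
qed

section \<open>Measurability of the kernels and integration against the jump kernel\<close>

lemma refresh_kernel_measurable [measurable]: "refresh_kernel \<nu> \<in> borel \<rightarrow>\<^sub>M prob_algebra borel"
  unfolding refresh_kernel_def[abs_def]
proof (rule measurable_distr_prob_space2[where M=borel])
  show "(\<lambda>x. \<nu>) \<in> borel \<rightarrow>\<^sub>M prob_algebra borel"
    using prob_nu sets_nu by (intro measurable_const) (simp add: space_prob_algebra)
qed measurable

text \<open>The kernel is known through its values on sets, so the formula is lifted from indicators
  by induction over measurable functions. Multiplying by the rate removes the normalisation and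
  leaves the plain sum of jump intensities.\<close>

lemma nn_integral_jumpk:
  assumes u [measurable]: "u \<in> borel_measurable borel"
  shows "ennreal (rate z) * (\<integral>\<^sup>+y. u y \<partial>jumpk z) =
    (\<Sum>n. ennreal (lam n z) * u (bounce n z)) + ennreal lr * (\<integral>\<^sup>+w. u (fst z, w) \<partial>\<nu>)"
proof -
  have [simp]: "sets (jumpk z) = sets borel" "space (jumpk z) = UNIV"
    by (simp_all add: sets_jump_kernel space_jump_kernel)
  have rz: "ennreal (rate z) * (x / ennreal (rate z)) = x" for x
    using rate_pos[of z] by (simp add: ennreal_times_divide mult_divide_eq_ennreal mult.commute)
  from u show ?thesis
  proof (induction u rule: borel_measurable_induct)
    case (cong f g)
    then show ?case by (simp add: fun_eq_iff)
  next
    case (set A)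
    then have [measurable]: "A \<in> sets borel" .
    have "emeasure (refresh_kernel \<nu> z) A = (\<integral>\<^sup>+w. indicator A (fst z, w) \<partial>\<nu>)"
      unfolding refresh_kernel_def
      by (simp add: nn_integral_distr flip: nn_integral_indicator)
    then show ?case
      using set by (simp add: emeasure_jump_kernel rz bounce_def)
  next
    case (mult u c)
    then have [measurable]: "u \<in> borel_measurable borel" by simp
    have "ennreal (rate z) * (\<integral>\<^sup>+y. c * u y \<partial>jumpk z) = c * (ennreal (rate z) * (\<integral>\<^sup>+y. u y \<partial>jumpk z))"
      using mult by (simp add: nn_integral_cmult measurable_cong_sets[OF \<open>sets (jumpk z) = sets borel\<close> refl] ac_simps)
    also have "\<dots> = (\<Sum>n. c * (ennreal (lam n z) * u (bounce n z))) + c * (ennreal lr * (\<integral>\<^sup>+w. u (fst z, w) \<partial>\<nu>))"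
      using mult by (simp add: distrib_left ennreal_suminf_cmult)
    also have "\<dots> = (\<Sum>n. ennreal (lam n z) * (c * u (bounce n z))) + ennreal lr * (\<integral>\<^sup>+w. c * u (fst z, w) \<partial>\<nu>)"
      by (simp add: nn_integral_cmult ac_simps)
    finally show ?case .
  next
    case (add u v)
    then have [measurable]: "u \<in> borel_measurable borel" "v \<in> borel_measurable borel" by simp_all
    have "(\<integral>\<^sup>+y. v y + u y \<partial>jumpk z) = (\<integral>\<^sup>+y. v y \<partial>jumpk z) + (\<integral>\<^sup>+y. u y \<partial>jumpk z)"
      using add by (intro nn_integral_add) (simp_all add: measurable_cong_sets[OF \<open>sets (jumpk z) = sets borel\<close> refl])
    moreover have "(\<Sum>n. ennreal (lam n z) * (v (bounce n z) + u (bounce n z))) =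
        (\<Sum>n. ennreal (lam n z) * v (bounce n z)) + (\<Sum>n. ennreal (lam n z) * u (bounce n z))"
      by (simp add: distrib_left suminf_add[symmetric])
    ultimately show ?case
      using add by (simp add: distrib_left nn_integral_add ac_simps)
  next
    case (seq U)
    then have [measurable]: "U i \<in> borel_measurable borel" for i by simp
    have "ennreal (rate z) * (\<integral>\<^sup>+y. (SUP i. U i y) \<partial>jumpk z) = (SUP i. ennreal (rate z) * (\<integral>\<^sup>+y. U i y \<partial>jumpk z))"
      using seq by (subst nn_integral_monotone_convergence_SUP)
        (simp_all add: measurable_cong_sets[OF \<open>sets (jumpk z) = sets borel\<close> refl] SUP_mult_left_ennreal)
    also have "\<dots> = (SUP i. (\<Sum>n. ennreal (lam n z) * U i (bounce n z)) + ennreal lr * (\<integral>\<^sup>+w. U i (fst z, w) \<partial>\<nu>))"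
      using seq by simp
    also have "\<dots> = (SUP i. \<Sum>n. ennreal (lam n z) * U i (bounce n z)) + (SUP i. ennreal lr * (\<integral>\<^sup>+w. U i (fst z, w) \<partial>\<nu>))"
    proof (rule ennreal_SUP_add)
      show "incseq (\<lambda>i. \<Sum>n. ennreal (lam n z) * U i (bounce n z))"
        using seq by (intro monoI suminf_le mult_left_mono) (auto simp: mono_def le_fun_def simp del: split_paired_All)
      show "incseq (\<lambda>i. ennreal lr * (\<integral>\<^sup>+w. U i (fst z, w) \<partial>\<nu>))"
        using seq by (intro monoI mult_left_mono nn_integral_mono) (auto simp: mono_def le_fun_def)
    qed
    also have "(SUP i. \<Sum>n. ennreal (lam n z) * U i (bounce n z)) = (\<Sum>n. SUP i. ennreal (lam n z) * U i (bounce n z))"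
      using seq by (intro ennreal_suminf_SUP_eq[symmetric]) (auto simp: incseq_def le_fun_def intro!: mult_left_mono simp del: split_paired_All)
    also have "\<dots> = (\<Sum>n. ennreal (lam n z) * (SUP i. U i (bounce n z)))"
      by (simp add: SUP_mult_left_ennreal)
    also have "(SUP i. ennreal lr * (\<integral>\<^sup>+w. U i (fst z, w) \<partial>\<nu>)) = ennreal lr * (\<integral>\<^sup>+w. (SUP i. U i (fst z, w)) \<partial>\<nu>)"
      using seq by (subst nn_integral_monotone_convergence_SUP)
         (auto simp: SUP_mult_left_ennreal incseq_def le_fun_def)
    finally show ?case by (simp add: SUP_apply image_image)
  qed
qed

lemma jumpk_prob_space: "prob_space (jumpk z)"
proof
  have "ennreal (rate z) * emeasure (jumpk z) UNIV = ennreal (rate z)"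
  proof -
    have "ennreal (rate z) * emeasure (jumpk z) UNIV = ennreal (rate z) * (\<integral>\<^sup>+y. 1 \<partial>jumpk z)"
      by (simp add: space_jump_kernel)
    also have "\<dots> = (\<Sum>n. ennreal (lam n z)) + ennreal lr"
      by (subst nn_integral_jumpk) (simp_all add: nu.emeasure_space_1[simplified])
    also have "(\<Sum>n. ennreal (lam n z)) = ennreal (lb z)"
      by (intro suminf_ennreal_eq lam_sums) simp
    also have "ennreal (lb z) + ennreal lr = ennreal (rate z)"
      using lr_pos by (simp add: jump_rate_def ennreal_plus[symmetric] add.commute del: ennreal_plus)
    finally show ?thesis .
  qed
  then show "emeasure (jumpk z) (space (jumpk z)) = 1"
    using rate_pos[of z] by (simp add: space_jump_kernel)
      (metis ennreal_eq_0_iff ennreal_mult_cancel_left ennreal_neq_top mult.right_neutral not_le)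
qed

lemma jumpk_measurable [measurable]: "jumpk \<in> borel \<rightarrow>\<^sub>M prob_algebra borel"
proof (rule measurable_prob_algebraI[OF jumpk_prob_space], rule measurable_subprob_algebra)
  show "subprob_space (jumpk z)" for z
    by (rule prob_space_imp_subprob_space[OF jumpk_prob_space])
  fix A :: "('h \<times> 'h) set" assume [measurable]: "A \<in> sets borel"
  have [measurable]: "(\<lambda>z. emeasure (refresh_kernel \<nu> z) A) \<in> borel_measurable borel"
    by (rule measurable_compose[OF measurable_prob_algebraD[OF refresh_kernel_measurable] measurable_emeasure_subprob_algebra]) simp
  have "(\<lambda>z. ((\<Sum>n. ennreal (lam n z) * indicator A (bounce n z)) + ennreal lr * emeasure (refresh_kernel \<nu> z) A)
      / ennreal (rate z)) \<in> borel_measurable borel"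
    by measurable
  then show "(\<lambda>z. emeasure (jumpk z) A) \<in> borel_measurable borel"
    by (simp add: emeasure_jump_kernel bounce_def)
qed (simp add: sets_jump_kernel)

lemma integral_jumpk:
  assumes u [measurable]: "u \<in> borel_measurable borel" and bnd: "\<And>y. \<bar>u y\<bar> \<le> C"
  shows "rate z * (\<integral>y. u y \<partial>jumpk z) = bounce_sum u z + lr * refresh u z"
proof -
  interpret K: prob_space "jumpk z" by (rule jumpk_prob_space)
  have sK [measurable_cong]: "sets (jumpk z) = sets borel" by (simp add: sets_jump_kernel)
  have C: "0 \<le> C" using bnd[of z] by linarith
  \<comment> \<open>Adding \<open>C\<close> makes the integrand nonnegative, so that the
    extended-real formula applies. Both sides of the claim then change by
    \<open>C * rate z\<close>.\<close>
  define w where "w y = u y + C" for y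
  have w0: "0 \<le> w y" for y using bnd[of y] by (simp add: w_def)
  have w2: "\<bar>w y\<bar> \<le> 2 * C" for y using bnd[of y] by (simp add: w_def)
  have [measurable]: "w \<in> borel_measurable borel" unfolding w_def[abs_def] by measurable
  have int: "integrable (jumpk z) u"
    by (rule K.integrable_const_bound[where B=C]) (use bnd in auto)
  have intw: "integrable (jumpk z) w"
    by (rule K.integrable_const_bound[where B="2 * C"]) (use w2 in auto)
  have intn: "integrable \<nu> (\<lambda>v. w (fst z, v))"
    by (rule nu.integrable_const_bound[where B="2 * C"]) (use w2 in auto)
  have intn': "integrable \<nu> (\<lambda>v. u (fst z, v))"
    by (rule nu.integrable_const_bound[where B="C"]) (use bnd in auto)
  note su = bounce_summable(1)[of u, OF bnd] and sw = bounce_summable(1)[of w, OF w2]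
  have bs0: "0 \<le> bounce_sum w z"
    unfolding bounce_sum_def by (rule suminf_nonneg[OF sw mult_nonneg_nonneg[OF lam_nonneg w0]])
  have rf0: "0 \<le> refresh w z"
    unfolding refresh_def by (rule Bochner_Integration.integral_nonneg[OF w0])
  have "ennreal (rate z * (\<integral>y. w y \<partial>jumpk z)) = ennreal (rate z) * (\<integral>\<^sup>+y. ennreal (w y) \<partial>jumpk z)"
    using rate_pos[of z] w0 intw by (subst nn_integral_eq_integral) (auto simp: ennreal_mult)
  also have "\<dots> = (\<Sum>n. ennreal (lam n z * w (bounce n z))) + ennreal lr * (\<integral>\<^sup>+v. ennreal (w (fst z, v)) \<partial>\<nu>)"
    by (subst nn_integral_jumpk) (simp_all add: ennreal_mult w0)
  also have "(\<Sum>n. ennreal (lam n z * w (bounce n z))) = ennreal (bounce_sum w z)"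
    unfolding bounce_sum_def by (intro suminf_ennreal2 sw) (simp add: w0)
  also have "(\<integral>\<^sup>+v. ennreal (w (fst z, v)) \<partial>\<nu>) = ennreal (refresh w z)"
    unfolding refresh_def using w0 intn by (intro nn_integral_eq_integral) auto
  also have "ennreal (bounce_sum w z) + ennreal lr * ennreal (refresh w z) = ennreal (bounce_sum w z + lr * refresh w z)"
    using lr_pos bs0 rf0 by (subst ennreal_plus) (auto simp: ennreal_mult)
  finally have "rate z * (\<integral>y. w y \<partial>jumpk z) = bounce_sum w z + lr * refresh w z"
    using rate_pos[of z] lr_pos bs0 rf0 Bochner_Integration.integral_nonneg[of "jumpk z" w, OF w0]
    by (subst (asm) ennreal_inj) auto
  moreover have "(\<integral>y. w y \<partial>jumpk z) = (\<integral>y. u y \<partial>jumpk z) + C"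
    unfolding w_def using int by (simp add: K.prob_space)
  moreover have "refresh w z = refresh u z + C"
    unfolding w_def refresh_def using intn' by (simp add: nu.prob_space)
  moreover have "bounce_sum w z = bounce_sum u z + C * lb z"
  proof -
    have "bounce_sum w z = (\<Sum>n. lam n z * u (bounce n z) + C * lam n z)"
      by (simp add: bounce_sum_def w_def algebra_simps)
    also have "\<dots> = bounce_sum u z + (\<Sum>n. C * lam n z)"
      unfolding bounce_sum_def by (intro suminf_add[symmetric] su summable_mult summable_bounce_rate)
    finally show ?thesis
      by (simp add: suminf_mult summable_bounce_rate total_bounce_rate_def)
  qed
  ultimately show ?thesis
    by (simp add: jump_rate_def algebra_simps)
qed

end

section \<open>Jump times\<close>

text \<open>A primitive of \<open>f\<close> vanishing at 0, written over a fixed interval of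
  integration. In this form it makes sense for negative \<open>s\<close> too, has a two-sided
  derivative at 0, and is jointly continuous if \<open>f\<close> depends on a parameter.\<close>

lemma
  fixes f :: "real \<Rightarrow> real"
  assumes f: "continuous_on UNIV f"
  shows stretched_integral_derivative: "((\<lambda>s. s * integral {0..1} (\<lambda>u. f (s * u))) has_real_derivative f s) (at s)"
    and stretched_integral_eq: "0 \<le> s \<Longrightarrow> s * integral {0..1} (\<lambda>u. f (s * u)) = integral {0..s} f"
proof -
  \<comment> \<open>The interval from \<open>- a\<close> to \<open>a\<close> contains 0 and has
    \<open>s\<close> in its interior, so that a derivative within it is a full derivative at
    \<open>s\<close>.\<close>
  define a where "a = \<bar>s\<bar> + 1"
  define h where "h t = integral {- a..t} f" for t
  have f': "continuous_on A f" for A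
    using f continuous_on_subset by blast
  have h: "(h has_real_derivative f t) (at t within {- a..a})" if "t \<in> {- a..a}" for t
    unfolding h_def by (rule integral_has_real_derivative[OF f' that])
  have eq: "x * integral {0..1} (\<lambda>u. f (x * u)) = h x - h 0" if x: "\<bar>x\<bar> \<le> a" for x
  proof -
    have "((\<lambda>u. f (x * u) * x) has_integral (h (x * 1) - h (x * 0))) {0..1}"
    proof (rule fundamental_theorem_of_calculus)
      fix u :: real assume u: "u \<in> {0..1}"
      have im: "(*) x ` {0..1} \<subseteq> {- a..a}"
      proof safe
        fix v :: real assume "v \<in> {0..1}"
        then have "\<bar>x * v\<bar> \<le> \<bar>x\<bar> * 1"
          unfolding abs_mult by (intro mult_left_mono) auto
        with x show "x * v \<in> {- a..a}" by auto
      qed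
      have "(h has_real_derivative f (x * u)) (at (x * u) within (*) x ` {0..1})"
        using DERIV_subset[OF h im] im u by blast
      moreover have "((*) x has_real_derivative x) (at u within {0..1})"
        by (auto intro!: derivative_eq_intros)
      ultimately have "(h \<circ> (*) x has_real_derivative f (x * u) * x) (at u within {0..1})"
        by (rule DERIV_image_chain)
      then show "((\<lambda>u. h (x * u)) has_vector_derivative f (x * u) * x) (at u within {0..1})"
        by (simp add: comp_def has_real_derivative_iff_has_vector_derivative)
    qed simp
    then have "integral {0..1} (\<lambda>u. f (x * u) * x) = h x - h 0"
      by (simp only: integral_unique mult_1_right mult_zero_right)
    then show ?thesis
      by (simp add: mult.commute)
  qed
  have "(h has_real_derivative f s) (at s)"
  proof -
    have "at s within {- a..a} = at s"
      by (rule at_within_interior) (auto simp: a_def)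
    moreover have "s \<in> {- a..a}"
      by (auto simp: a_def)
    ultimately show ?thesis
      using h by metis
  qed
  then have "((\<lambda>x. h x - h 0) has_real_derivative f s) (at s)"
    by (auto intro!: derivative_eq_intros)
  then show "((\<lambda>s. s * integral {0..1} (\<lambda>u. f (s * u))) has_real_derivative f s) (at s)"
    by (rule has_field_derivative_transform_within_open[where S="{- a<..<a}"]) (auto simp: a_def eq)
  show "s * integral {0..1} (\<lambda>u. f (s * u)) = integral {0..s} f" if s: "0 \<le> s"
  proof -
    have "integral {- a..0} f + integral {0..s} f = integral {- a..s} f"
      using s by (intro Henstock_Kurzweil_Integration.integral_combine integrable_continuous_real f') (auto simp: a_def)
    then show ?thesis
      using eq[of s] by (simp add: h_def a_def)
  qed
qed

context boomerang
begin

text \<open>The jump rate integrated along the flow, in the stretched form for which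
  \<open>continuous_hazard\<close> follows from continuity of integrals over a fixed compact
  interval.\<close>

definition hazard :: "real \<Rightarrow> 'h \<times> 'h \<Rightarrow> real" where
  "hazard s z = s * integral {0..1} (\<lambda>u. rate (boomerang_flow (s * u) z))"

definition surv :: "real \<Rightarrow> 'h \<times> 'h \<Rightarrow> real" where
  "surv s z = exp (- hazard s z)"

lemma continuous_rate_flow: "continuous_on A (\<lambda>u. rate (boomerang_flow u z))"
  by (rule continuous_on_compose2[OF continuous_rate]) (auto intro!: continuous_intros)

lemma hazard_eq: "0 \<le> s \<Longrightarrow> hazard s z = integral {0..s} (\<lambda>u. rate (boomerang_flow u z))"
  unfolding hazard_def by (rule stretched_integral_eq[OF continuous_rate_flow])

lemma hazard_0 [simp]: "hazard 0 z = 0"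
  by (simp add: hazard_def)

lemma surv_0 [simp]: "surv 0 z = 1"
  by (simp add: surv_def)

lemma surv_pos: "0 < surv s z"
  by (simp add: surv_def)

lemma hazard_derivative: "((\<lambda>s. hazard s z) has_real_derivative rate (boomerang_flow s z)) (at s within A)"
  unfolding hazard_def using stretched_integral_derivative[OF continuous_rate_flow]
  by (rule has_field_derivative_at_within)

lemma surv_derivative:
  "((\<lambda>s. surv s z) has_real_derivative - (rate (boomerang_flow s z) * surv s z)) (at s within A)"
  unfolding surv_def by (auto intro!: derivative_eq_intros hazard_derivative)

lemma continuous_hazard: "continuous_on UNIV (\<lambda>p. hazard (fst p) (snd p))"
proof -
  have "continuous_on (UNIV \<times> cbox 0 1) (\<lambda>(p, u). rate (boomerang_flow (fst p * u) (snd p :: 'h \<times> 'h)))"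
    unfolding split_beta
    by (rule continuous_on_compose2[OF continuous_rate]) (auto intro!: continuous_intros)
  from integral_continuous_on_param[OF this]
  have "continuous_on UNIV (\<lambda>p. integral {0..1} (\<lambda>u. rate (boomerang_flow (fst p * u) (snd p))))"
    by simp
  then show ?thesis
    unfolding hazard_def[abs_def] by (intro continuous_intros)
qed

lemma surv_measurable [measurable (raw)]:
  assumes [measurable]: "f \<in> borel_measurable N" "g \<in> borel_measurable N"
  shows "(\<lambda>x. surv (f x) (g x)) \<in> borel_measurable N"
proof -
  have "(\<lambda>p. surv (fst p) (snd p)) \<in> borel_measurable borel"
    unfolding surv_def by (intro borel_measurable_continuous_onI continuous_intros continuous_hazard)
  then have "(\<lambda>x. (\<lambda>p. surv (fst p) (snd p)) (f x, g x)) \<in> borel_measurable N"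
    by measurable
  then show ?thesis by simp
qed

lemma continuous_surv: "continuous_on A (\<lambda>s. surv s z)"
  by (rule DERIV_continuous_on[OF surv_derivative])

text \<open>Refreshment alone contributes \<open>lr * s\<close>. Hence the survival probability
  tends to 0 and the waiting time is finite almost surely.\<close>

lemma hazard_ge: "0 \<le> s \<Longrightarrow> lr * s \<le> hazard s z"
proof -
  assume s: "0 \<le> s"
  have "integral {0..s} (\<lambda>u. lr) \<le> integral {0..s} (\<lambda>u. rate (boomerang_flow u z))"
    by (intro integral_le integrable_continuous_real continuous_rate_flow continuous_intros lr_le_rate)
  with s show ?thesis by (simp add: hazard_eq mult.commute)
qed

lemma surv_tendsto_0: "((\<lambda>s. surv s z) \<longlongrightarrow> 0) at_top"
proof (rule tendsto_sandwich[where f="\<lambda>_. 0"])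
  have "LIM s at_top. lr * s :> at_top"
    using lr_pos by (intro filterlim_tendsto_pos_mult_at_top[OF tendsto_const] filterlim_ident)
  then show "((\<lambda>s. exp (- (lr * s))) \<longlongrightarrow> 0) at_top"
    by (intro filterlim_compose[OF exp_at_bot]) (simp add: filterlim_uminus_at_top)
  show "\<forall>\<^sub>F s in at_top. surv s z \<le> exp (- (lr * s))"
    using eventually_ge_at_top[of 0] by eventually_elim (simp add: surv_def hazard_ge)
qed (auto simp: surv_def)

section \<open>The waiting time and the transition law of the jump chain\<close>

definition wait_density :: "'h \<times> 'h \<Rightarrow> real \<Rightarrow> real" where
  "wait_density z s = indicator {0..} s * (rate (boomerang_flow s z) * surv s z)"

lemma wait_density_nonneg [simp]: "0 \<le> wait_density z s"
  using rate_pos[of "boomerang_flow s z"] surv_pos[of s z]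
  by (simp add: wait_density_def indicator_def)

lemma wait_density_measurable [measurable (raw)]:
  assumes [measurable]: "f \<in> borel_measurable N" "g \<in> borel_measurable N"
  shows "(\<lambda>x. wait_density (g x) (f x)) \<in> borel_measurable N"
  unfolding wait_density_def by measurable

abbreviation "waitm \<equiv> pdmp_wait boomerang_flow rate"
abbreviation "step \<equiv> pdmp_step boomerang_flow rate jumpk"

lemma wait_eq: "waitm z = density lborel (\<lambda>s. ennreal (wait_density z s))"
  unfolding pdmp_wait_def
  by (intro arg_cong[where f="density lborel"] ext)
     (auto simp: wait_density_def surv_def hazard_eq)

lemma sets_wait [measurable_cong, simp]: "sets (waitm z) = sets borel"
  by (simp add: wait_eq)

lemma wait_prob_space: "prob_space (waitm z)"
proof
  have "emeasure (waitm z) (space (waitm z)) = (\<integral>\<^sup>+s. ennreal (wait_density z s) \<partial>lborel)"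
    by (simp add: wait_eq emeasure_density)
  also have "\<dots> = (\<integral>\<^sup>+s. ennreal (rate (boomerang_flow s z) * surv s z) * indicator {0..} s \<partial>lborel)"
    by (intro nn_integral_cong) (auto simp: wait_density_def indicator_def)
  also have "\<dots> = ennreal (0 - (- surv 0 z))"
  proof (rule nn_integral_FTC_atLeast)
    show "((\<lambda>s. - surv s z) has_real_derivative rate (boomerang_flow s z) * surv s z) (at s)" for s
      by (auto intro!: derivative_eq_intros surv_derivative)
    show "((\<lambda>s. - surv s z) \<longlongrightarrow> 0) at_top"
      using tendsto_minus[OF surv_tendsto_0] by simp
    show "0 \<le> rate (boomerang_flow s z) * surv s z" for s
      using rate_pos[of "boomerang_flow s z"] surv_pos[of s z] by simp
  qed measurable
  finally show "emeasure (waitm z) (space (waitm z)) = 1" by simp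
qed

lemma wait_measurable [measurable]: "waitm \<in> borel \<rightarrow>\<^sub>M prob_algebra borel"
proof (rule measurable_prob_algebraI[OF wait_prob_space], rule measurable_subprob_algebra)
  show "subprob_space (waitm z)" for z
    by (rule prob_space_imp_subprob_space[OF wait_prob_space])
  fix A :: "real set" assume [measurable]: "A \<in> sets borel"
  have "(\<lambda>z. \<integral>\<^sup>+s. ennreal (wait_density z s) * indicator A s \<partial>lborel) \<in> borel_measurable borel"
    by measurable
  then show "(\<lambda>z. emeasure (waitm z) A) \<in> borel_measurable borel"
    by (simp add: wait_eq emeasure_density)
qed simp

lemma step_kernel_measurable: "(\<lambda>s. distr (jumpk (boomerang_flow s y)) borel (\<lambda>y'. (t + s, y'))) \<in> borel \<rightarrow>\<^sub>M prob_algebra borel"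
  by (rule measurable_distr_prob_space2[where M=borel]) measurable

lemma step_measurable [measurable]: "step \<in> borel \<rightarrow>\<^sub>M prob_algebra borel"
  unfolding pdmp_step_def[abs_def]
proof (rule measurable_bind_prob_space2[where N=borel])
  show "(\<lambda>p :: real \<times> 'h \<times> 'h. waitm (snd p)) \<in> borel \<rightarrow>\<^sub>M prob_algebra borel"
    by (rule measurable_compose[OF snd_borel_measurable wait_measurable])
  have "(\<lambda>q. distr (jumpk (boomerang_flow (snd q) (snd (fst q)))) borel (\<lambda>y. (fst (fst q) + snd q, y)))
     \<in> borel \<rightarrow>\<^sub>M prob_algebra borel"
  proof (rule measurable_distr_prob_space2[where M=borel])
    have "(\<lambda>q. boomerang_flow (snd q) (snd (fst q))) \<in> borel_measurable (borel :: ((real \<times> 'h \<times> 'h) \<times> real) measure)"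
      by (intro borel_measurable_continuous_onI continuous_intros)
    from measurable_compose[OF this jumpk_measurable]
    show "(\<lambda>q :: (real \<times> 'h \<times> 'h) \<times> real. jumpk (boomerang_flow (snd q) (snd (fst q)))) \<in> borel \<rightarrow>\<^sub>M prob_algebra borel" .
    show "(\<lambda>(q :: (real \<times> 'h \<times> 'h) \<times> real, y :: 'h \<times> 'h). (fst (fst q) + snd q, y)) \<in> borel \<Otimes>\<^sub>M borel \<rightarrow>\<^sub>M borel"
      unfolding borel_prod split_beta by (intro borel_measurable_continuous_onI continuous_intros)
  qed
  then show "(\<lambda>(p, s). distr (jumpk (boomerang_flow s (snd p))) borel (\<lambda>y. (fst p + s, y)))
     \<in> borel \<Otimes>\<^sub>M borel \<rightarrow>\<^sub>M prob_algebra borel"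
    by (simp add: split_beta borel_prod)
qed

lemma step_prob_space: "prob_space (step p)"
  using measurable_space[OF step_measurable, of p] by (simp add: space_prob_algebra)

lemma sets_step [measurable_cong, simp]: "sets (step p) = sets borel"
  using measurable_space[OF step_measurable, of p] by (simp add: space_prob_algebra)

text \<open>The factor \<open>rate\<close> in the density of the waiting time cancels the
  normalisation of the jump kernel. What remains is the survival probability times the unnormalised
  intensities of bounces and refreshment.\<close>

lemma nn_integral_step:
  assumes [measurable]: "V \<in> borel_measurable borel"
  shows "(\<integral>\<^sup>+q. V q \<partial>step (t, y)) =
    (\<integral>\<^sup>+s. ennreal (indicator {0..} s * surv s y) *
       ((\<Sum>n. ennreal (lam n (boomerang_flow s y)) * V (t + s, bounce n (boomerang_flow s y)))
        + ennreal lr * (\<integral>\<^sup>+w. V (t + s, (fst (boomerang_flow s y), w)) \<partial>\<nu>)) \<partial>lborel)"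
proof -
  have "(\<integral>\<^sup>+q. V q \<partial>step (t, y)) =
      (\<integral>\<^sup>+s. \<integral>\<^sup>+q. V q \<partial>distr (jumpk (boomerang_flow s y)) borel (\<lambda>y'. (t + s, y')) \<partial>waitm y)"
    unfolding pdmp_step_def fst_conv snd_conv
    using measurable_prob_algebraD[OF step_kernel_measurable[of y t]]
    by (intro nn_integral_bind[where B=borel]) (simp_all add: measurable_cong_sets[OF sets_wait refl])
  also have "\<dots> = (\<integral>\<^sup>+s. \<integral>\<^sup>+y'. V (t + s, y') \<partial>jumpk (boomerang_flow s y) \<partial>waitm y)"
    by (intro nn_integral_cong nn_integral_distr)
       (simp_all add: measurable_cong_sets[OF sets_jump_kernel refl])
  also have "\<dots> = (\<integral>\<^sup>+s. ennreal (wait_density y s) * (\<integral>\<^sup>+y'. V (t + s, y') \<partial>jumpk (boomerang_flow s y)) \<partial>lborel)"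
  proof -
    have "(\<lambda>s. \<integral>\<^sup>+y'. V (t + s, y') \<partial>jumpk (boomerang_flow s y)) \<in> borel_measurable borel"
      by (rule nn_integral_measurable_subprob_algebra2[where N=borel])
         (use measurable_prob_algebraD[OF jumpk_measurable] in \<open>auto intro: measurable_compose\<close>)
    then show ?thesis
      unfolding wait_eq by (intro nn_integral_density) auto
  qed
  also have "\<dots> = (\<integral>\<^sup>+s. ennreal (indicator {0..} s * surv s y) *
      (ennreal (rate (boomerang_flow s y)) * (\<integral>\<^sup>+y'. V (t + s, y') \<partial>jumpk (boomerang_flow s y))) \<partial>lborel)"
    using surv_pos rate_pos
    by (intro nn_integral_cong)
       (auto simp: wait_density_def indicator_def ennreal_mult less_imp_le mult.assoc mult.left_commute)
  finally show ?thesis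
    by (subst (asm) nn_integral_jumpk) auto
qed

lemma integral_step:
  assumes [measurable]: "V \<in> borel_measurable borel" and bnd: "\<And>q. \<bar>V q\<bar> \<le> C"
  shows "(\<integral>q. V q \<partial>step (t, y)) =
    (\<integral>s. indicator {0..} s * (surv s y * (rate (boomerang_flow s y) *
        (\<integral>y'. V (t + s, y') \<partial>jumpk (boomerang_flow s y)))) \<partial>lborel)"
proof -
  have "(\<integral>q. V q \<partial>step (t, y)) =
      (\<integral>s. \<integral>q. V q \<partial>distr (jumpk (boomerang_flow s y)) borel (\<lambda>y'. (t + s, y')) \<partial>waitm y)"
    unfolding pdmp_step_def fst_conv snd_conv
  proof (rule integral_bind[where K=borel and B=C and B'=1])
    show "(\<lambda>s. distr (jumpk (boomerang_flow s y)) borel (Pair (t + s))) \<in> waitm y \<rightarrow>\<^sub>M subprob_algebra borel"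
      using measurable_prob_algebraD[OF step_kernel_measurable[of y t]]
      by (simp add: measurable_cong_sets[OF sets_wait refl])
    show "finite_measure (waitm y)"
      by (rule prob_space.finite_measure[OF wait_prob_space])
    show "AE s in waitm y. emeasure (distr (jumpk (boomerang_flow s y)) borel (Pair (t + s)))
        (space (distr (jumpk (boomerang_flow s y)) borel (Pair (t + s)))) \<le> ennreal 1"
    proof (rule AE_I2)
      fix s
      interpret prob_space "distr (jumpk (boomerang_flow s y)) borel (Pair (t + s))"
        by (rule prob_space.prob_space_distr[OF jumpk_prob_space])
           (simp add: measurable_cong_sets[OF sets_jump_kernel refl])
      show "emeasure (distr (jumpk (boomerang_flow s y)) borel (Pair (t + s)))
        (space (distr (jumpk (boomerang_flow s y)) borel (Pair (t + s)))) \<le> ennreal 1"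
        using emeasure_space_1 by simp
    qed
  qed (use bnd in auto)
  also have "\<dots> = (\<integral>s. \<integral>y'. V (t + s, y') \<partial>jumpk (boomerang_flow s y) \<partial>waitm y)"
    by (intro Bochner_Integration.integral_cong integral_distr refl)
       (simp_all add: measurable_cong_sets[OF sets_jump_kernel refl])
  also have "\<dots> = (\<integral>s. wait_density y s * (\<integral>y'. V (t + s, y') \<partial>jumpk (boomerang_flow s y)) \<partial>lborel)"
  proof -
    have "(\<lambda>s. integral\<^sup>L (distr (jumpk (boomerang_flow s y)) borel (\<lambda>y'. (t + s, y'))) V) \<in> borel_measurable borel"
      by (rule measurable_compose[OF measurable_prob_algebraD[OF step_kernel_measurable]
            integral_measurable_subprob_algebra]) measurable
    then have "(\<lambda>s. \<integral>y'. V (t + s, y') \<partial>jumpk (boomerang_flow s y)) \<in> borel_measurable borel"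
      by (simp add: integral_distr measurable_cong_sets[OF sets_jump_kernel refl])
    then show ?thesis
      unfolding wait_eq by (subst integral_density) auto
  qed
  finally show ?thesis
    by (simp add: wait_density_def ac_simps)
qed

end

section \<open>The law of the jump chain\<close>

context boomerang
begin

text \<open>Names the kernel family written inline in \<open>pdmp_law\<close>, so that the locale
  \<open>Ionescu_Tulcea\<close> can be interpreted for it. Only the previous coordinate of the
  history matters.\<close>

definition chain_kernel :: "'h \<times> 'h \<Rightarrow> nat \<Rightarrow> (nat \<Rightarrow> real \<times> 'h \<times> 'h) \<Rightarrow> (real \<times> 'h \<times> 'h) measure" where
  "chain_kernel z i \<omega> = (case i of 0 \<Rightarrow> return borel (0, z) | Suc k \<Rightarrow> step (\<omega> k))"

abbreviation "law \<equiv> pdmp_law boomerang_flow rate jumpk"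

lemma chain_Ionescu_Tulcea: "Ionescu_Tulcea (chain_kernel z) (\<lambda>_. borel)"
proof (rule Ionescu_Tulcea.intro)
  show "chain_kernel z i \<in> PiM {0..<i} (\<lambda>_. borel) \<rightarrow>\<^sub>M subprob_algebra borel" for i
  proof (cases i)
    case 0
    then show ?thesis
      using prob_space_imp_subprob_space[OF prob_space_return, of "(0, z)" borel]
      by (simp add: chain_kernel_def[abs_def] space_subprob_algebra)
  next
    case (Suc k)
    have "(\<lambda>\<omega>. step (\<omega> k)) \<in> PiM {0..<i} (\<lambda>_. borel) \<rightarrow>\<^sub>M subprob_algebra borel"
      by (rule measurable_compose[where g=step and N=borel])
         (use Suc in \<open>auto intro!: measurable_component_singleton measurable_prob_algebraD[OF step_measurable]\<close>)
    with Suc show ?thesis by (simp add: chain_kernel_def[abs_def])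
  qed
  fix i and \<omega> :: "nat \<Rightarrow> real \<times> 'h \<times> 'h" assume "\<omega> \<in> space (PiM {0..<i} (\<lambda>_. borel))"
  show "prob_space (chain_kernel z i \<omega>)"
    by (auto simp: chain_kernel_def prob_space_return step_prob_space split: nat.split)
qed

lemma law_eq: "law z = projective_family.lim UNIV (Ionescu_Tulcea.CI (chain_kernel z) (\<lambda>_. borel)) (\<lambda>_. borel)"
  by (simp add: pdmp_law_def chain_kernel_def[abs_def])

lemma sets_law [measurable_cong]: "sets (law z) = sets (PiM UNIV (\<lambda>_. borel))"
proof -
  interpret IT: Ionescu_Tulcea "chain_kernel z" "\<lambda>_. borel" by (rule chain_Ionescu_Tulcea)
  show ?thesis unfolding law_eq by (rule IT.PF.sets_lim)
qed

lemma law_prob_space: "prob_space (law z)"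
proof -
  interpret IT: Ionescu_Tulcea "chain_kernel z" "\<lambda>_. borel" by (rule chain_Ionescu_Tulcea)
  show ?thesis
  proof
    have "emeasure IT.PF.lim (IT.PF.emb UNIV {} (space (PiM {} (\<lambda>_. borel)))) = emeasure (IT.CI {}) (space (PiM {} (\<lambda>_. borel)))"
      by (rule IT.lim) auto
    also have "IT.PF.emb UNIV {} (space (PiM {} (\<lambda>_. borel))) = space IT.PF.lim"
      by (auto simp: prod_emb_def IT.PF.space_lim space_PiM)
    also have "emeasure (IT.CI {}) (space (PiM {} (\<lambda>_. borel))) = 1"
    proof -
      interpret C: prob_space "IT.CI {}" by (rule IT.PF.prob_space_P) auto
      show ?thesis using C.emeasure_space_1 by (simp add: IT.CI_def)
    qed
    finally show "emeasure (law z) (space (law z)) = 1" unfolding law_eq .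
  qed
qed

text \<open>The passage from the projective limit to a finite composition of kernels, in which the
  last kernel can be split off.\<close>

lemma distr_law_restrict:
  "distr (law z) (PiM {0..<n} (\<lambda>_. borel)) (\<lambda>\<omega>. restrict \<omega> {0..<n}) =
    Ionescu_Tulcea.C (chain_kernel z) (\<lambda>_. borel) 0 n (\<lambda>_. undefined)"
proof -
  interpret IT: Ionescu_Tulcea "chain_kernel z" "\<lambda>_. borel" by (rule chain_Ionescu_Tulcea)
  have u: "(\<lambda>_. undefined) \<in> space (PiM {0..<0} (\<lambda>_. borel))" by (auto simp: space_PiM PiE_def extensional_def)
  note sC = IT.sets_C[OF u, of n, simplified]
  show ?thesis
  proof (rule measure_eqI)
    fix X assume "X \<in> sets (distr (law z) (PiM {0..<n} (\<lambda>_. borel)) (\<lambda>\<omega>. restrict \<omega> {0..<n}))"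
    then have X: "X \<in> sets (PiM {0..<n} (\<lambda>_. borel))" by simp
    have "emeasure (distr (law z) (PiM {0..<n} (\<lambda>_. borel)) (\<lambda>\<omega>. restrict \<omega> {0..<n})) X
        = emeasure IT.PF.lim (IT.PF.emb UNIV {0..<n} X)"
      unfolding law_eq using X by (intro emeasure_distr_restrict IT.PF.sets_lim) auto
    also have "\<dots> = emeasure (IT.CI {0..<n}) X"
      using X by (intro IT.lim) auto
    also have "\<dots> = emeasure (IT.C 0 n (\<lambda>_. undefined)) (IT.PF.emb {0..<n} {0..<n} X)"
      using X by (intro IT.emeasure_CI) auto
    also have "IT.PF.emb {0..<n} {0..<n} X = X"
      using sets.sets_into_space[OF X] by (auto simp: prod_emb_id space_PiM)
    finally show "emeasure (distr (law z) (PiM {0..<n} (\<lambda>_. borel)) (\<lambda>\<omega>. restrict \<omega> {0..<n})) X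
        = emeasure (IT.C 0 n (\<lambda>_. undefined)) X" .
  qed (use sC in simp)
qed

lemma nn_integral_law_restrict:
  assumes "f \<in> borel_measurable (PiM {0..<n} (\<lambda>_. borel))"
  shows "(\<integral>\<^sup>+\<omega>. f (restrict \<omega> {0..<n}) \<partial>law z) =
    (\<integral>\<^sup>+\<omega>. f \<omega> \<partial>Ionescu_Tulcea.C (chain_kernel z) (\<lambda>_. borel) 0 n (\<lambda>_. undefined))"
  unfolding distr_law_restrict[symmetric]
proof (rule nn_integral_distr[symmetric])
  show "(\<lambda>\<omega>. restrict \<omega> {0..<n}) \<in> law z \<rightarrow>\<^sub>M PiM {0..<n} (\<lambda>_. borel)"
    unfolding measurable_cong_sets[OF sets_law refl] by (rule measurable_restrict_subset) simp
qed (use assms in simp)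

text \<open>The one-step Markov property of the jump chain. It holds because the composition up to
  index \<open>Suc k\<close> is the one up to \<open>k\<close> followed by \<open>step\<close>. All
  later conditioning is of this form.\<close>

lemma nn_integral_law_Suc:
  assumes F [measurable]: "F \<in> borel_measurable borel"
  shows "(\<integral>\<^sup>+\<omega>. F (\<omega> k, \<omega> (Suc k)) \<partial>law z) = (\<integral>\<^sup>+\<omega>. \<integral>\<^sup>+y. F (\<omega> k, y) \<partial>step (\<omega> k) \<partial>law z)"
proof -
  interpret IT: Ionescu_Tulcea "chain_kernel z" "\<lambda>_. borel" by (rule chain_Ionescu_Tulcea)
  have u: "(\<lambda>_. undefined) \<in> space (PiM {0..<0} (\<lambda>_. borel))" by (auto simp: space_PiM PiE_def extensional_def)
  let ?n = "Suc k" and ?f = "\<lambda>\<omega>. F (\<omega> k, \<omega> (Suc k))"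
  have F': "F \<in> borel_measurable (borel \<Otimes>\<^sub>M borel)"
    by (simp add: borel_prod)
  have f1: "?f \<in> borel_measurable (PiM {0..<Suc ?n} (\<lambda>_. borel))"
    by (rule measurable_compose[OF _ F]) (measurable; simp)
  have G: "(\<lambda>p. \<integral>\<^sup>+y. F (p, y) \<partial>step p) \<in> borel_measurable borel"
    by (rule nn_integral_measurable_subprob_algebra2[where N=borel])
       (use F' measurable_prob_algebraD[OF step_measurable] in auto)
  have f2: "(\<lambda>\<omega>. \<integral>\<^sup>+y. F (\<omega> k, y) \<partial>step (\<omega> k)) \<in> borel_measurable (PiM {0..<?n} (\<lambda>_. borel))"
    by (rule measurable_compose[OF _ G]) (auto intro: measurable_component_singleton)
  have C_Suc: "IT.C 0 (Suc ?n) (\<lambda>_. undefined) = IT.C 0 ?n (\<lambda>_. undefined) \<bind> IT.eP ?n"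
    by (subst IT.C.simps(2)) (simp only: add_0)
  have "(\<integral>\<^sup>+\<omega>. F (\<omega> k, \<omega> (Suc k)) \<partial>law z) = (\<integral>\<^sup>+\<omega>. ?f (restrict \<omega> {0..<Suc ?n}) \<partial>law z)"
    by simp
  also have "\<dots> = (\<integral>\<^sup>+\<omega>. ?f \<omega> \<partial>IT.C 0 (Suc ?n) (\<lambda>_. undefined))"
    by (rule nn_integral_law_restrict[OF f1])
  also have "\<dots> = (\<integral>\<^sup>+\<omega>. \<integral>\<^sup>+x. ?f x \<partial>IT.eP ?n \<omega> \<partial>IT.C 0 ?n (\<lambda>_. undefined))"
    unfolding C_Suc
  proof (rule nn_integral_bind[OF f1])
    show "IT.eP ?n \<in> IT.C 0 ?n (\<lambda>_. undefined) \<rightarrow>\<^sub>M subprob_algebra (PiM {0..<Suc ?n} (\<lambda>_. borel))"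
      using IT.measurable_eP[of ?n]
      by (simp only: measurable_cong_sets[OF IT.sets_C[OF u, of ?n] refl] add_0)
  qed
  also have "\<dots> = (\<integral>\<^sup>+\<omega>. \<integral>\<^sup>+y. F (\<omega> k, y) \<partial>step (\<omega> k) \<partial>IT.C 0 ?n (\<lambda>_. undefined))"
  proof (rule nn_integral_cong)
    fix \<omega> assume "\<omega> \<in> space (IT.C 0 ?n (\<lambda>_. undefined))"
    then have \<omega>: "\<omega> \<in> space (PiM {0..<?n} (\<lambda>_. borel))"
      using IT.space_C[OF u, of ?n] by simp
    show "(\<integral>\<^sup>+x. ?f x \<partial>IT.eP ?n \<omega>) = (\<integral>\<^sup>+y. F (\<omega> k, y) \<partial>step (\<omega> k))"
      using IT.nn_integral_eP[OF \<omega> f1] by (simp add: chain_kernel_def)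
  qed
  also have "\<dots> = (\<integral>\<^sup>+\<omega>. (\<lambda>\<omega>. \<integral>\<^sup>+y. F (\<omega> k, y) \<partial>step (\<omega> k)) (restrict \<omega> {0..<?n}) \<partial>law z)"
    by (rule nn_integral_law_restrict[OF f2, symmetric])
  also have "\<dots> = (\<integral>\<^sup>+\<omega>. \<integral>\<^sup>+y. F (\<omega> k, y) \<partial>step (\<omega> k) \<partial>law z)"
    by simp
  finally show ?thesis .
qed

lemma nn_integral_law_0:
  assumes F [measurable]: "F \<in> borel_measurable borel"
  shows "(\<integral>\<^sup>+\<omega>. F (\<omega> 0) \<partial>law z) = F (0, z)"
proof -
  interpret IT: Ionescu_Tulcea "chain_kernel z" "\<lambda>_. borel" by (rule chain_Ionescu_Tulcea)
  have u: "(\<lambda>_. undefined) \<in> space (PiM {0..<0} (\<lambda>_. borel))" by (auto simp: space_PiM PiE_def extensional_def)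
  have f1: "(\<lambda>\<omega>. F (\<omega> 0)) \<in> borel_measurable (PiM {0..<Suc 0} (\<lambda>_. borel))"
    by (rule measurable_compose[OF _ F]) (measurable; simp)
  have "(\<integral>\<^sup>+\<omega>. F (\<omega> 0) \<partial>law z) = (\<integral>\<^sup>+\<omega>. (\<lambda>\<omega>. F (\<omega> 0)) (restrict \<omega> {0..<Suc 0}) \<partial>law z)"
    by simp
  also have "\<dots> = (\<integral>\<^sup>+\<omega>. F (\<omega> 0) \<partial>IT.C 0 (Suc 0) (\<lambda>_. undefined))"
    by (rule nn_integral_law_restrict[OF f1])
  also have "IT.C 0 (Suc 0) (\<lambda>_. undefined) = IT.eP 0 (\<lambda>_. undefined)"
    using IT.measurable_eP[of 0] u by (simp add: bind_return)
  also have "(\<integral>\<^sup>+\<omega>. F (\<omega> 0) \<partial>IT.eP 0 (\<lambda>_. undefined)) = F (0, z)"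
    by (subst IT.nn_integral_eP[OF u f1]) (simp add: chain_kernel_def nn_integral_return)
  finally show ?thesis .
qed

lemma component_law_measurable [measurable]: "(\<lambda>\<omega>. \<omega> k) \<in> law z \<rightarrow>\<^sub>M borel"
  by (simp add: measurable_cong_sets[OF sets_law refl])

lemma AE_law_0: "AE \<omega> in law z. \<omega> 0 = (0, z)"
proof -
  have "(\<integral>\<^sup>+\<omega>. indicator (- {(0, z)}) (\<omega> 0) \<partial>law z) = (0 :: ennreal)"
    by (subst nn_integral_law_0) auto
  moreover have "(\<lambda>\<omega>. indicator (- {(0, z)}) (\<omega> 0) :: ennreal) \<in> borel_measurable (law z)"
    by (rule measurable_compose[OF component_law_measurable]) auto
  ultimately have "AE \<omega> in law z. (indicator (- {(0, z)}) (\<omega> 0) :: ennreal) = 0"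
    by (subst (asm) nn_integral_0_iff_AE) auto
  then show ?thesis
    by eventually_elim (auto simp: indicator_def split: if_splits)
qed

lemma integral_step_measurable:
  fixes F :: "_ \<Rightarrow> real"
  assumes F [measurable]: "F \<in> borel_measurable borel"
  shows "(\<lambda>p. \<integral>y. F (p, y) \<partial>step p) \<in> borel_measurable borel"
proof -
  have "(\<lambda>p. distr (step p) borel (\<lambda>y. (p, y))) \<in> borel \<rightarrow>\<^sub>M prob_algebra borel"
    by (rule measurable_distr_prob_space2[where M=borel]) (measurable, simp add: borel_prod split_beta)
  then have "(\<lambda>p. integral\<^sup>L (distr (step p) borel (\<lambda>y. (p, y))) F) \<in> borel_measurable borel"
    by (rule measurable_compose[OF measurable_prob_algebraD integral_measurable_subprob_algebra]) measurable
  then show ?thesis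
    by (simp add: integral_distr measurable_cong_sets[OF sets_step refl])
qed

lemma integral_law_Suc:
  fixes F :: "_ \<Rightarrow> real"
  assumes F [measurable]: "F \<in> borel_measurable borel" and bnd: "\<And>x. \<bar>F x\<bar> \<le> C"
  shows "(\<integral>\<omega>. F (\<omega> k, \<omega> (Suc k)) \<partial>law z) = (\<integral>\<omega>. \<integral>y. F (\<omega> k, y) \<partial>step (\<omega> k) \<partial>law z)"
proof -
  interpret L: prob_space "law z" by (rule law_prob_space)
  define G where "G p = (\<integral>y. F (p, y) \<partial>step p)" for p
  have G [measurable]: "G \<in> borel_measurable borel"
    unfolding G_def using F by (rule integral_step_measurable)
  \<comment> \<open>As for the jump kernel, a shift by \<open>C\<close> reduces the signed integral
    to the nonnegative one.\<close>
  have F0: "0 \<le> F x + C" for x using bnd[of x] by linarith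
  have step_int: "integrable (step p) (\<lambda>y. F (p, y))" for p
  proof -
    interpret S: prob_space "step p" by (rule step_prob_space)
    show ?thesis
      by (rule S.integrable_const_bound[where B=C])
         (use bnd in \<open>auto simp: measurable_cong_sets[OF sets_step refl]\<close>)
  qed
  have G_bnd: "\<bar>G p\<bar> \<le> C" for p
  proof -
    interpret S: prob_space "step p" by (rule step_prob_space)
    have "\<bar>G p\<bar> \<le> (\<integral>y. \<bar>F (p, y)\<bar> \<partial>step p)"
      unfolding G_def by (rule integral_abs_bound)
    also have "\<dots> \<le> (\<integral>y. C \<partial>step p)"
      using step_int[of p] bnd by (intro integral_mono) auto
    finally show ?thesis by (simp add: S.prob_space)
  qed
  have step_G: "(\<integral>\<^sup>+y. ennreal (F (p, y) + C) \<partial>step p) = ennreal (G p + C)" for p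
  proof -
    interpret S: prob_space "step p" by (rule step_prob_space)
    have "(\<integral>\<^sup>+y. ennreal (F (p, y) + C) \<partial>step p) = ennreal (\<integral>y. F (p, y) + C \<partial>step p)"
      using step_int[of p] F0 by (intro nn_integral_eq_integral) auto
    then show ?thesis
      using step_int[of p] by (simp add: G_def S.prob_space)
  qed
  have int1: "integrable (law z) (\<lambda>\<omega>. F (\<omega> k, \<omega> (Suc k)))"
    by (rule L.integrable_const_bound[where B=C]) (use bnd in auto)
  have int2: "integrable (law z) (\<lambda>\<omega>. G (\<omega> k))"
    by (rule L.integrable_const_bound[where B=C]) (use G_bnd in auto)
  have G0: "0 \<le> G x + C" for x using G_bnd[of x] by linarith
  have "ennreal (\<integral>\<omega>. F (\<omega> k, \<omega> (Suc k)) + C \<partial>law z) = (\<integral>\<^sup>+\<omega>. ennreal (F (\<omega> k, \<omega> (Suc k)) + C) \<partial>law z)"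
    using int1 F0 by (intro nn_integral_eq_integral[symmetric]) auto
  also have "\<dots> = (\<integral>\<^sup>+\<omega>. ennreal (G (\<omega> k) + C) \<partial>law z)"
    by (subst nn_integral_law_Suc) (auto simp: step_G)
  also have "\<dots> = ennreal (\<integral>\<omega>. G (\<omega> k) + C \<partial>law z)"
    using int2 G0 by (intro nn_integral_eq_integral) auto
  finally have "(\<integral>\<omega>. F (\<omega> k, \<omega> (Suc k)) + C \<partial>law z) = (\<integral>\<omega>. G (\<omega> k) + C \<partial>law z)"
    using F0 G0 by (subst (asm) ennreal_inj) (auto intro!: Bochner_Integration.integral_nonneg)
  then show ?thesis
    using int1 int2 by (simp add: L.prob_space G_def)
qed

end

section \<open>Non-explosion\<close>

context boomerang
begin

lemma AE_law_mono: "AE \<omega> in law z. \<forall>k. fst (\<omega> k) \<le> fst (\<omega> (Suc k))"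
proof -
  have "AE \<omega> in law z. fst (\<omega> k) \<le> fst (\<omega> (Suc k))" for k
  proof -
    define D where "D = {x :: (real \<times> 'h \<times> 'h) \<times> (real \<times> 'h \<times> 'h). fst (snd x) < fst (fst x)}"
    have D_iff: "(p, q) \<in> D \<longleftrightarrow> fst q < fst p" for p q
      by (simp add: D_def)
    let ?F = "\<lambda>x. indicator D x :: ennreal"
    have "open D"
      unfolding D_def by (intro open_Collect_less continuous_intros)
    then have F: "?F \<in> borel_measurable borel"
      by (intro borel_measurable_indicator) auto
    \<comment> \<open>The waiting-time density vanishes for negative times, so no step can move the
      clock backwards.\<close>
    have in_step: "(\<integral>\<^sup>+y. ?F (p, y) \<partial>step p) = 0" for p
    proof -
      obtain t y where Pair: "p = (t, y)" by (rule prod.exhaust)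
      have Fp: "(\<lambda>q. ?F (p, q)) \<in> borel_measurable borel"
        by (rule measurable_compose[OF _ F]) measurable
      have "(\<integral>\<^sup>+q. ?F (p, q) \<partial>step p) = (\<integral>\<^sup>+s. 0 \<partial>(lborel :: real measure))"
        unfolding Pair nn_integral_step[OF Fp, unfolded Pair]
      proof (intro nn_integral_cong)
        fix s :: real
        show "ennreal (indicator {0..} s * surv s y) *
            ((\<Sum>n. ennreal (lam n (boomerang_flow s y)) * ?F ((t, y), (t + s, bounce n (boomerang_flow s y))))
            + ennreal lr * (\<integral>\<^sup>+w. ?F ((t, y), (t + s, (fst (boomerang_flow s y), w))) \<partial>\<nu>)) = 0"
          by (cases "0 \<le> s") (simp_all add: indicator_def D_iff)
      qed
      then show ?thesis by simp
    qed
    have "(\<integral>\<^sup>+\<omega>. ?F (\<omega> k, \<omega> (Suc k)) \<partial>law z) = 0"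
      using nn_integral_law_Suc[OF F, where k=k and z=z] in_step by simp
    then have "AE \<omega> in law z. ?F (\<omega> k, \<omega> (Suc k)) = 0"
      by (subst (asm) nn_integral_0_iff_AE)
         (rule measurable_compose[OF _ F], measurable)
    then show ?thesis
      by eventually_elim (auto simp: indicator_def D_iff split: if_splits)
  qed
  then show ?thesis by (simp add: AE_all_countable)
qed

text \<open>The operator that sends \<open>f\<close> to the expectation of \<open>exp (- T\<^sub>1) * f Y\<^sub>1\<close>, where \<open>T\<^sub>1\<close> is the first jump
  time and \<open>Y\<^sub>1\<close> the state after it.\<close>

definition jump_op :: "('h \<times> 'h \<Rightarrow> ennreal) \<Rightarrow> 'h \<times> 'h \<Rightarrow> ennreal" where
  "jump_op f y = (\<integral>\<^sup>+q. ennreal (exp (- fst q)) * f (snd q) \<partial>step (0, y))"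

lemma exp_snd_measurable [measurable]:
  assumes [measurable]: "f \<in> borel_measurable borel"
  shows "(\<lambda>q :: real \<times> 'h \<times> 'h. ennreal (exp (- fst q)) * f (snd q)) \<in> borel_measurable borel"
proof (rule borel_measurable_times_ennreal)
  show "(\<lambda>q :: real \<times> 'h \<times> 'h. f (snd q)) \<in> borel_measurable borel"
    by (rule measurable_compose[OF snd_borel_measurable assms])
  show "(\<lambda>q :: real \<times> 'h \<times> 'h. ennreal (exp (- fst q))) \<in> borel_measurable borel"
    by (rule measurable_compose[OF fst_borel_measurable]) measurable
qed

lemma jump_op_eq:
  assumes [measurable]: "f \<in> borel_measurable borel"
  shows "(\<integral>\<^sup>+q. ennreal (exp (- fst q)) * f (snd q) \<partial>step (t, y)) = ennreal (exp (- t)) *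
    (\<integral>\<^sup>+s. ennreal (indicator {0..} s * (exp (- s) * surv s y)) *
       ((\<Sum>n. ennreal (lam n (boomerang_flow s y)) * f (bounce n (boomerang_flow s y)))
        + ennreal lr * (\<integral>\<^sup>+w. f (fst (boomerang_flow s y), w) \<partial>\<nu>)) \<partial>lborel)"
proof -
  have "(\<integral>\<^sup>+q. ennreal (exp (- fst q)) * f (snd q) \<partial>step (t, y)) =
    (\<integral>\<^sup>+s. ennreal (exp (- t)) * (ennreal (indicator {0..} s * (exp (- s) * surv s y)) *
       ((\<Sum>n. ennreal (lam n (boomerang_flow s y)) * f (bounce n (boomerang_flow s y)))
        + ennreal lr * (\<integral>\<^sup>+w. f (fst (boomerang_flow s y), w) \<partial>\<nu>))) \<partial>lborel)"
    unfolding nn_integral_step[OF exp_snd_measurable[OF assms]]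
  proof (rule nn_integral_cong)
    fix s
    let ?e = "ennreal (exp (- (t + s)))" and ?z = "boomerang_flow s y"
    let ?A = "\<Sum>n. ennreal (lam n ?z) * f (bounce n ?z)" and ?B = "\<integral>\<^sup>+w. f (fst ?z, w) \<partial>\<nu>"
    have "(\<Sum>n. ennreal (lam n ?z) * (?e * f (bounce n ?z))) = (\<Sum>n. ?e * (ennreal (lam n ?z) * f (bounce n ?z)))"
      by (intro suminf_cong mult.left_commute)
    also have "\<dots> = ?e * ?A"
      by (rule ennreal_suminf_cmult)
    finally have "(\<Sum>n. ennreal (lam n ?z) * (?e * f (bounce n ?z))) = ?e * ?A" .
    moreover have "(\<integral>\<^sup>+w. ?e * f (fst ?z, w) \<partial>\<nu>) = ?e * ?B"
      by (rule nn_integral_cmult) measurable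
    moreover have "ennreal (indicator {0..} s * surv s y) * ?e =
        ennreal (exp (- t)) * ennreal (indicator {0..} s * (exp (- s) * surv s y))"
      using surv_pos[of s y]
      by (auto simp: indicator_def ennreal_mult[symmetric] exp_diff exp_minus exp_add field_simps)
    ultimately show "ennreal (indicator {0..} s * surv s y) *
        ((\<Sum>n. ennreal (lam n ?z) * (ennreal (exp (- fst (t + s, bounce n ?z))) * f (snd (t + s, bounce n ?z))))
        + ennreal lr * (\<integral>\<^sup>+w. ennreal (exp (- fst (t + s, fst ?z, w))) * f (snd (t + s, fst ?z, w)) \<partial>\<nu>)) =
        ennreal (exp (- t)) * (ennreal (indicator {0..} s * (exp (- s) * surv s y)) * (?A + ennreal lr * ?B))"
    proof -
      assume A: "(\<Sum>n. ennreal (lam n ?z) * (?e * f (bounce n ?z))) = ?e * ?A"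
        and B: "(\<integral>\<^sup>+w. ?e * f (fst ?z, w) \<partial>\<nu>) = ?e * ?B"
        and W: "ennreal (indicator {0..} s * surv s y) * ?e =
          ennreal (exp (- t)) * ennreal (indicator {0..} s * (exp (- s) * surv s y))"
      have "?e * ?A + ennreal lr * (?e * ?B) = ?e * (?A + ennreal lr * ?B)"
        by (simp only: distrib_left mult.left_commute)
      then show ?thesis
        unfolding fst_conv snd_conv A B by (simp only: mult.assoc[symmetric] W)
    qed
  qed
  also have "\<dots> = ennreal (exp (- t)) *
    (\<integral>\<^sup>+s. ennreal (indicator {0..} s * (exp (- s) * surv s y)) *
       ((\<Sum>n. ennreal (lam n (boomerang_flow s y)) * f (bounce n (boomerang_flow s y)))
        + ennreal lr * (\<integral>\<^sup>+w. f (fst (boomerang_flow s y), w) \<partial>\<nu>)) \<partial>lborel)"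
    by (rule nn_integral_cmult) measurable
  finally show ?thesis .
qed

text \<open>A step started at a later time is the same step with a shifted clock. The shift leaves
  the integral as a factor, which makes the discounted expectations iterates of one
  operator.\<close>

lemma jump_op_shift:
  assumes [measurable]: "f \<in> borel_measurable borel"
  shows "(\<integral>\<^sup>+q. ennreal (exp (- fst q)) * f (snd q) \<partial>step p) = ennreal (exp (- fst p)) * jump_op f (snd p)"
  using jump_op_eq[OF assms, of "fst p" "snd p"] jump_op_eq[OF assms, of 0 "snd p"]
  by (simp add: jump_op_def)

lemma jump_op_measurable [measurable]:
  assumes [measurable]: "f \<in> borel_measurable borel"
  shows "jump_op f \<in> borel_measurable borel"
proof -
  have "(\<lambda>y. step (0, y)) \<in> borel \<rightarrow>\<^sub>M subprob_algebra borel"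
    by (rule measurable_compose[OF _ measurable_prob_algebraD[OF step_measurable]]) measurable
  then show ?thesis
    unfolding jump_op_def[abs_def]
    by (rule measurable_compose[OF _ nn_integral_measurable_subprob_algebra]) measurable
qed

lemma jump_op_pow_measurable [measurable]:
  "f \<in> borel_measurable borel \<Longrightarrow> (jump_op ^^ k) f \<in> borel_measurable borel"
  by (induction k) auto

text \<open>For constant \<open>f = 1\<close> this is the Laplace transform at 1 of the
  \<open>k\<close>-th jump time. Explosion with positive probability would keep it away from 0 as
  \<open>k\<close> grows.\<close>

lemma nn_integral_exp_jump_time:
  assumes "f \<in> borel_measurable borel"
  shows "(\<integral>\<^sup>+\<omega>. ennreal (exp (- fst (\<omega> k))) * f (snd (\<omega> k)) \<partial>law z) = (jump_op ^^ k) f z"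
  using assms
proof (induction k arbitrary: f)
  case 0
  then show ?case
    using nn_integral_law_0[of "\<lambda>q. ennreal (exp (- fst q)) * f (snd q)" z] by simp
next
  case (Suc k)
  let ?F = "\<lambda>x :: (real \<times> 'h \<times> 'h) \<times> (real \<times> 'h \<times> 'h). ennreal (exp (- fst (snd x))) * f (snd (snd x))"
  have "?F \<in> borel_measurable borel"
    by (rule measurable_compose[OF snd_borel_measurable exp_snd_measurable[OF Suc.prems]])
  then have "(\<integral>\<^sup>+\<omega>. ennreal (exp (- fst (\<omega> (Suc k)))) * f (snd (\<omega> (Suc k))) \<partial>law z) =
      (\<integral>\<^sup>+\<omega>. \<integral>\<^sup>+q. ennreal (exp (- fst q)) * f (snd q) \<partial>step (\<omega> k) \<partial>law z)"
    using nn_integral_law_Suc[of ?F z k] by simp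
  also have "\<dots> = (\<integral>\<^sup>+\<omega>. ennreal (exp (- fst (\<omega> k))) * jump_op f (snd (\<omega> k)) \<partial>law z)"
    by (simp add: jump_op_shift[OF Suc.prems])
  also have "\<dots> = (jump_op ^^ k) (jump_op f) z"
    by (rule Suc.IH) (use Suc.prems in measurable)
  finally show ?case
    by (simp add: funpow_swap1)
qed

lemma jump_op_mono: "(\<And>y. f y \<le> g y) \<Longrightarrow> jump_op f y \<le> jump_op g y"
  unfolding jump_op_def by (intro nn_integral_mono mult_left_mono) auto

text \<open>The integrand is minus the derivative of \<open>exp (- s) * surv s y\<close>. It is the
  density of the minimum of the first jump time and an independent exponential time of rate
  1.\<close>

lemma nn_integral_surv_rate:
  "(\<integral>\<^sup>+s. ennreal (indicator {0..} s * (exp (- s) * surv s y) * (1 + rate (boomerang_flow s y))) \<partial>lborel) = 1"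
proof -
  let ?f = "\<lambda>s. exp (- s) * surv s y * (1 + rate (boomerang_flow s y))"
  have "(\<integral>\<^sup>+s. ennreal (indicator {0..} s * (exp (- s) * surv s y) * (1 + rate (boomerang_flow s y))) \<partial>lborel)
      = (\<integral>\<^sup>+s. ennreal (?f s) * indicator {0..} s \<partial>lborel)"
    by (intro nn_integral_cong) (auto simp: indicator_def)
  also have "\<dots> = ennreal (0 - - (exp (- 0) * surv 0 y))"
  proof (rule nn_integral_FTC_atLeast)
    show "((\<lambda>s. - (exp (- s) * surv s y)) has_real_derivative ?f s) (at s)" for s
      by (auto intro!: derivative_eq_intros surv_derivative simp: algebra_simps)
    have "((\<lambda>s. exp (- s)) \<longlongrightarrow> (0::real)) at_top"
      by (intro filterlim_compose[OF exp_at_bot] filterlim_uminus_at_bot_at_top)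
    from tendsto_minus[OF tendsto_mult[OF this surv_tendsto_0[of y]]]
    show "((\<lambda>s. - (exp (- s) * surv s y)) \<longlongrightarrow> 0) at_top" by simp
    show "0 \<le> ?f s" for s
      using rate_pos[of "boomerang_flow s y"] surv_pos[of s y] by simp
  qed measurable
  finally show ?thesis by simp
qed

text \<open>Along the flow and at bounces the norm is preserved, so on a ball the jump rate is bounded as
  long as no refreshment happens.  This makes a fixed point \<open>p\<close> of the operator smaller on the ball by
  the factor \<open>lr / (1 + lr)\<close> than its global bound \<open>c\<close>.\<close>

lemma jump_op_fixpoint_contraction:
  assumes [measurable]: "p \<in> borel_measurable borel"
    and p0: "\<And>y. 0 \<le> p y" and pc: "\<And>y. p y \<le> c"
    and fix_p: "\<And>y. ennreal (p y) \<le> jump_op (\<lambda>y. ennreal (p y)) y"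
  shows "p z \<le> lr / (1 + lr) * c"
proof (rule ccontr)
  assume neg: "\<not> ?thesis"
  define N where "N = norm z"
  \<comment> \<open>The ball through \<open>z\<close> is invariant under flow and bounces. On it
    \<open>p\<close> is bounded by \<open>m\<close>, whereas after a refreshment only the global
    bound \<open>c\<close> is available.\<close>
  define m where "m = (SUP y\<in>cball 0 N. p y)"
  have bdd: "bdd_above (p ` cball 0 N)"
    using pc by (rule bdd_aboveI2)
  have p_m: "p y \<le> m" if "norm y \<le> N" for y
    unfolding m_def using that bdd by (intro cSUP_upper) auto
  have m: "lr / (1 + lr) * c < m"
    using neg p_m[of z] by (simp add: N_def)
  have c0: "0 \<le> c" using p0[of z] pc[of z] by simp
  have m0: "0 < m"
    using m c0 lr_pos by (auto intro: le_less_trans[rotated])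
  obtain \<Lambda> where \<Lambda>: "\<And>y. norm y \<le> N \<Longrightarrow> lb y \<le> \<Lambda>"
    using bounded_total_rate[of "cball 0 N"] unfolding bounded_iff by fastforce
  have \<Lambda>0: "0 \<le> \<Lambda>"
    using order_trans[OF lb_nonneg \<Lambda>[of z]] by (simp add: N_def)
  define d where "d = (1 + lr) * m - lr * c"
  have d: "0 < d"
    using m lr_pos by (simp add: d_def field_simps)
  \<comment> \<open>The negated claim says that \<open>d\<close> is positive, so there is slack in
    the balance of intensities. The denominator involves the largest value of
    \<open>1 + rate\<close> on the ball, so that the slack suffices at every point of it.\<close>
  define \<epsilon> where "\<epsilon> = d / ((1 + lr + \<Lambda>) * m)"
  have \<epsilon>: "0 < \<epsilon>"
    using d m0 lr_pos \<Lambda>0 by (simp add: \<epsilon>_def)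
  have key: "lb y * m + lr * c \<le> (1 - \<epsilon>) * m * (1 + rate y)" if "norm y \<le> N" for y
  proof -
    have "\<epsilon> * (m * (1 + rate y)) \<le> \<epsilon> * (m * (1 + lr + \<Lambda>))"
      using \<epsilon> m0 \<Lambda>[OF that] by (intro mult_left_mono) (auto simp: jump_rate_def)
    also have "\<dots> = \<epsilon> * ((1 + lr + \<Lambda>) * m)"
      by (simp add: mult.commute)
    also have "\<dots> = d"
    proof -
      have "(1 + lr + \<Lambda>) * m \<noteq> 0" using m0 lr_pos \<Lambda>0 by simp
      then show ?thesis unfolding \<epsilon>_def times_divide_eq_left by (rule nonzero_mult_div_cancel_right)
    qed
    finally show ?thesis
      by (simp add: d_def jump_rate_def algebra_simps)
  qed
  \<comment> \<open>The absolute value keeps the factor nonnegative under \<open>ennreal\<close>.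
    That \<open>(1 - \<epsilon>) * m\<close> is nonnegative is read off from \<open>key\<close> at
    \<open>z\<close> afterwards.\<close>
  have bound: "p y \<le> \<bar>(1 - \<epsilon>) * m\<bar>" if y: "norm y \<le> N" for y
  proof -
    have "ennreal (p y) \<le> jump_op (\<lambda>y. ennreal (p y)) y" by (rule fix_p)
    also have "\<dots> = (\<integral>\<^sup>+s. ennreal (indicator {0..} s * (exp (- s) * surv s y)) *
       ((\<Sum>n. ennreal (lam n (boomerang_flow s y)) * ennreal (p (bounce n (boomerang_flow s y))))
        + ennreal lr * (\<integral>\<^sup>+w. ennreal (p (fst (boomerang_flow s y), w)) \<partial>\<nu>)) \<partial>lborel)"
      unfolding jump_op_def by (subst jump_op_eq) auto
    also have "\<dots> \<le> (\<integral>\<^sup>+s. ennreal \<bar>(1 - \<epsilon>) * m\<bar> *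
        ennreal (indicator {0..} s * (exp (- s) * surv s y) * (1 + rate (boomerang_flow s y))) \<partial>lborel)"
    proof (intro nn_integral_mono)
      fix s
      let ?z = "boomerang_flow s y"
      have nz: "norm ?z \<le> N" using y by (simp add: norm_boomerang_flow)
      have "(\<Sum>n. ennreal (lam n ?z) * ennreal (p (bounce n ?z))) \<le> (\<Sum>n. ennreal (lam n ?z) * ennreal m)"
        using nz by (intro suminf_le mult_left_mono ennreal_leI p_m) (auto simp: norm_bounce)
      also have "\<dots> = ennreal (lb ?z) * ennreal m"
      proof -
        have "(\<Sum>n. ennreal (lam n ?z)) = ennreal (lb ?z)"
          by (rule suminf_ennreal_eq[OF _ lam_sums]) simp
        then show ?thesis by (simp only: ennreal_suminf_multc)
      qed
      also have "\<dots> = ennreal (lb ?z * m)"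
        using m0 by (simp add: ennreal_mult)
      finally have 1: "(\<Sum>n. ennreal (lam n ?z) * ennreal (p (bounce n ?z))) \<le> ennreal (lb ?z * m)" .
      have "(\<integral>\<^sup>+w. ennreal (p (fst ?z, w)) \<partial>\<nu>) \<le> (\<integral>\<^sup>+w. ennreal c \<partial>\<nu>)"
        by (intro nn_integral_mono ennreal_leI pc)
      then have "ennreal lr * (\<integral>\<^sup>+w. ennreal (p (fst ?z, w)) \<partial>\<nu>) \<le> ennreal lr * ennreal c"
        by (intro mult_left_mono) auto
      also have "\<dots> = ennreal (lr * c)"
        using lr_pos c0 by (simp add: ennreal_mult)
      finally have "(\<Sum>n. ennreal (lam n ?z) * ennreal (p (bounce n ?z)))
          + ennreal lr * (\<integral>\<^sup>+w. ennreal (p (fst ?z, w)) \<partial>\<nu>) \<le> ennreal (lb ?z * m) + ennreal (lr * c)"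
        using 1 by (intro add_mono)
      also have "\<dots> = ennreal (lb ?z * m + lr * c)"
        using m0 lr_pos c0 by (intro ennreal_plus[symmetric]) auto
      also have "\<dots> \<le> ennreal (\<bar>(1 - \<epsilon>) * m\<bar> * (1 + rate ?z))"
        using key[OF nz] rate_pos[of ?z]
        by (intro ennreal_leI) (auto intro!: order_trans[OF key[OF nz]] mult_right_mono)
      finally have 2: "(\<Sum>n. ennreal (lam n ?z) * ennreal (p (bounce n ?z)))
          + ennreal lr * (\<integral>\<^sup>+w. ennreal (p (fst ?z, w)) \<partial>\<nu>) \<le> ennreal (\<bar>(1 - \<epsilon>) * m\<bar> * (1 + rate ?z))" .
      have "ennreal (indicator {0..} s * (exp (- s) * surv s y)) * ennreal (\<bar>(1 - \<epsilon>) * m\<bar> * (1 + rate ?z)) =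
          ennreal \<bar>(1 - \<epsilon>) * m\<bar> * ennreal (indicator {0..} s * (exp (- s) * surv s y) * (1 + rate ?z))"
        using rate_pos[of ?z] surv_pos[of s y]
        by (simp add: ennreal_mult[symmetric] ac_simps)
      with mult_left_mono[OF 2, of "ennreal (indicator {0..} s * (exp (- s) * surv s y))"]
      show "ennreal (indicator {0..} s * (exp (- s) * surv s y)) *
         ((\<Sum>n. ennreal (lam n ?z) * ennreal (p (bounce n ?z)))
          + ennreal lr * (\<integral>\<^sup>+w. ennreal (p (fst ?z, w)) \<partial>\<nu>)) \<le>
          ennreal \<bar>(1 - \<epsilon>) * m\<bar> * ennreal (indicator {0..} s * (exp (- s) * surv s y) * (1 + rate ?z))"
        by simp
    qed
    also have "\<dots> = ennreal \<bar>(1 - \<epsilon>) * m\<bar>"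
      by (subst nn_integral_cmult) (measurable, simp add: nn_integral_surv_rate)
    finally show ?thesis by simp
  qed
  have "0 \<le> (1 - \<epsilon>) * m"
  proof -
    have "0 \<le> lb z * m + lr * c" using m0 lr_pos c0 by simp
    also have "\<dots> \<le> (1 - \<epsilon>) * m * (1 + rate z)" by (rule key) (simp add: N_def)
    finally show ?thesis
      using rate_pos[of z] by (simp add: zero_le_mult_iff)
  qed
  then have "p y \<le> (1 - \<epsilon>) * m" if "y \<in> cball 0 N" for y
    using bound[of y] that by simp
  then have "(SUP y\<in>cball 0 N. p y) \<le> (1 - \<epsilon>) * m"
    by (intro cSUP_least) (auto simp: N_def)
  then have "m \<le> (1 - \<epsilon>) * m"
    unfolding m_def[symmetric] .
  with mult_pos_pos[OF \<epsilon> m0] show False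
    by (simp add: algebra_simps)
qed

text \<open>The iterates of 1 decrease, and by monotone convergence their limit \<open>p\<close>
  satisfies \<open>p \<le> jump_op p\<close>. For the supremum \<open>c\<close> of \<open>p\<close>
  the contraction lemma then gives \<open>c \<le> lr / (1 + lr) * c\<close>, so \<open>c\<close> is
  0.\<close>

lemma INF_jump_op_pow: "(INF k. (jump_op ^^ k) (\<lambda>_. 1) z) = 0"
proof -
  define \<psi> where "\<psi> k = (jump_op ^^ k) (\<lambda>_. 1)" for k
  define p where "p y = enn2real (INF k. \<psi> k y)" for y
  have [measurable]: "\<psi> k \<in> borel_measurable borel" for k
    unfolding \<psi>_def by (rule jump_op_pow_measurable) simp
  have op1: "jump_op (\<lambda>_. 1) y \<le> 1" for y
  proof -
    interpret S: prob_space "step (0, y)" by (rule step_prob_space)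
    have "jump_op (\<lambda>_. 1) y = (\<integral>\<^sup>+s. ennreal (indicator {0..} s * (exp (- s) * surv s y)) *
       ((\<Sum>n. ennreal (lam n (boomerang_flow s y)) * 1) + ennreal lr * (\<integral>\<^sup>+w. 1 \<partial>\<nu>)) \<partial>lborel)"
      unfolding jump_op_def by (subst jump_op_eq) auto
    also have "\<dots> \<le> (\<integral>\<^sup>+s. ennreal (indicator {0..} s * (exp (- s) * surv s y) * (1 + rate (boomerang_flow s y))) \<partial>lborel)"
    proof (intro nn_integral_mono)
      fix s
      let ?z = "boomerang_flow s y"
      have "(\<Sum>n. ennreal (lam n ?z)) = ennreal (lb ?z)"
        by (rule suminf_ennreal_eq[OF _ lam_sums]) simp
      then have "(\<Sum>n. ennreal (lam n ?z) * 1) + ennreal lr * (\<integral>\<^sup>+w. 1 \<partial>\<nu>) = ennreal (lb ?z + lr)"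
        using lr_pos by simp
      also have "\<dots> \<le> ennreal (1 + rate ?z)"
        by (intro ennreal_leI) (simp add: jump_rate_def)
      finally have "ennreal (indicator {0..} s * (exp (- s) * surv s y)) *
          ((\<Sum>n. ennreal (lam n ?z) * 1) + ennreal lr * (\<integral>\<^sup>+w. 1 \<partial>\<nu>)) \<le>
          ennreal (indicator {0..} s * (exp (- s) * surv s y)) * ennreal (1 + rate ?z)"
        by (intro mult_left_mono) auto
      then show "ennreal (indicator {0..} s * (exp (- s) * surv s y)) *
          ((\<Sum>n. ennreal (lam n ?z) * 1) + ennreal lr * (\<integral>\<^sup>+w. 1 \<partial>\<nu>)) \<le>
          ennreal (indicator {0..} s * (exp (- s) * surv s y) * (1 + rate ?z))"
        using surv_pos[of s y] rate_pos[of ?z]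
        by (subst (2) ennreal_mult) (auto simp del: ennreal_plus)
    qed
    also have "\<dots> = 1" by (rule nn_integral_surv_rate)
    finally show ?thesis .
  qed
  have dec: "\<psi> (Suc k) y \<le> \<psi> k y" for k y
  proof (induction k arbitrary: y)
    case 0
    show ?case using op1 by (simp add: \<psi>_def)
  next
    case (Suc k)
    then have "jump_op (\<psi> (Suc k)) y \<le> jump_op (\<psi> k) y" by (rule jump_op_mono)
    then show ?case by (simp add: \<psi>_def)
  qed
  have \<psi>1: "(INF k. \<psi> k y) \<le> 1" for y
    by (rule INF_lower2[of 0]) (auto simp: \<psi>_def)
  then have fin: "(INF k. \<psi> k y) < top" for y
    using le_less_trans ennreal_one_less_top by blast
  have p_eq: "ennreal (p y) = (INF k. \<psi> k y)" for y
    unfolding p_def using fin[of y] by simp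
  have [measurable]: "p \<in> borel_measurable borel"
    unfolding p_def[abs_def] by measurable
  have p0: "0 \<le> p y" for y by (simp add: p_def)
  have p1: "p y \<le> 1" for y
    using \<psi>1[of y] unfolding p_eq[symmetric] by simp
  have fix_p: "ennreal (p y) \<le> jump_op (\<lambda>y. ennreal (p y)) y" for y
  proof -
    have "ennreal (p y) \<le> (INF k. \<psi> (Suc k) y)"
      unfolding p_eq by (rule INF_greatest) (rule INF_lower, simp)
    also have "\<dots> = (INF k. jump_op (\<psi> k) y)"
      by (simp add: \<psi>_def)
    also have "\<dots> = (INF k. \<integral>\<^sup>+q. ennreal (exp (- fst q)) * \<psi> k (snd q) \<partial>step (0, y))"
      by (simp add: jump_op_def)
    also have "\<dots> = (\<integral>\<^sup>+q. (INF k. ennreal (exp (- fst q)) * \<psi> k (snd q)) \<partial>step (0, y))"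
    proof (rule nn_integral_monotone_convergence_INF_AE[symmetric])
      show "AE q in step (0, y). ennreal (exp (- fst q)) * \<psi> (Suc k) (snd q) \<le> ennreal (exp (- fst q)) * \<psi> k (snd q)" for k
        by (intro AE_I2 mult_left_mono dec) simp
      show "(\<lambda>q. ennreal (exp (- fst q)) * \<psi> k (snd q)) \<in> borel_measurable (step (0, y))" for k
        using exp_snd_measurable[of "\<psi> k"] by (simp add: measurable_cong_sets[OF sets_step refl])
      have "(\<integral>\<^sup>+q. ennreal (exp (- fst q)) * \<psi> 0 (snd q) \<partial>step (0, y)) = jump_op (\<lambda>_. 1) y"
        by (simp add: jump_op_def \<psi>_def)
      also have "\<dots> < \<infinity>"
        using op1[of y] le_less_trans[OF _ ennreal_one_less_top] by simp
      finally show "(\<integral>\<^sup>+q. ennreal (exp (- fst q)) * \<psi> 0 (snd q) \<partial>step (0, y)) < \<infinity>" .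
    qed
    also have "\<dots> \<le> jump_op (\<lambda>y. ennreal (p y)) y"
      unfolding jump_op_def p_eq
    proof (rule nn_integral_mono)
      fix q :: "real \<times> 'h \<times> 'h"
      \<comment> \<open>The factor \<open>?a\<close> is positive and finite with inverse
        \<open>?b\<close>; multiplying by the inverse is how the constant is moved out of the
        infimum.\<close>
      let ?a = "ennreal (exp (- fst q))" and ?b = "ennreal (exp (fst q))"
      have ab: "?a * (?b * x) = x" "?b * (?a * x) = x" for x
        by (simp_all add: ennreal_mult[symmetric] mult.assoc[symmetric] exp_add[symmetric])
      have "?b * (INF k. ?a * \<psi> k (snd q)) \<le> \<psi> k (snd q)" for k
      proof -
        have "?b * (INF k. ?a * \<psi> k (snd q)) \<le> ?b * (?a * \<psi> k (snd q))"
          by (intro mult_left_mono INF_lower) auto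
        then show ?thesis by (simp only: ab)
      qed
      then have "?a * (?b * (INF k. ?a * \<psi> k (snd q))) \<le> ?a * (INF k. \<psi> k (snd q))"
        by (intro mult_left_mono INF_greatest) auto
      then show "(INF k. ?a * \<psi> k (snd q)) \<le> ?a * (INF k. \<psi> k (snd q))"
        by (simp only: ab)
    qed
    finally show ?thesis .
  qed
  define c where "c = (SUP y. p y)"
  have bdd: "bdd_above (range p)"
    using p1 by (rule bdd_aboveI2)
  have pc: "p y \<le> c" for y
    unfolding c_def using bdd by (intro cSUP_upper) auto
  have "p y \<le> lr / (1 + lr) * c" for y
    by (rule jump_op_fixpoint_contraction[OF _ p0 pc fix_p]) simp
  then have "c \<le> lr / (1 + lr) * c"
    by (subst c_def) (rule cSUP_least, auto)
  then have "c \<le> 0"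
    using lr_pos by (simp add: field_simps)
  then have "p z = 0"
    using pc[of z] p0[of z] by simp
  then have "(INF k. \<psi> k z) = 0"
    using p_eq[of z] by simp
  then show ?thesis by (simp add: \<psi>_def)
qed

text \<open>If all jump times stayed below \<open>t\<close>, the infimum of
  \<open>exp (- fst (\<omega> k))\<close> would be at least \<open>exp (- t)\<close>. Its
  expectation is 0 by the preceding result.\<close>

lemma AE_law_nonexplosive: "AE \<omega> in law z. \<forall>t. \<exists>k. t < fst (\<omega> k)"
proof -
  have "(\<integral>\<^sup>+\<omega>. (INF k. ennreal (exp (- fst (\<omega> k)))) \<partial>law z) \<le> (INF k. \<integral>\<^sup>+\<omega>. ennreal (exp (- fst (\<omega> k))) \<partial>law z)"
    by (intro INF_greatest nn_integral_mono INF_lower) simp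
  also have "\<dots> = 0"
    using nn_integral_exp_jump_time[of "\<lambda>_. 1" z] INF_jump_op_pow[of z] by simp
  finally have "(\<integral>\<^sup>+\<omega>. (INF k. ennreal (exp (- fst (\<omega> k)))) \<partial>law z) = 0"
    by simp
  moreover have "(\<lambda>\<omega>. ennreal (exp (- fst (\<omega> k)))) \<in> borel_measurable (law z)" for k
    by (rule measurable_compose[OF component_law_measurable, of "\<lambda>q. ennreal (exp (- fst q))"])
       (use exp_snd_measurable[of "\<lambda>_. 1"] in simp)
  ultimately have "AE \<omega> in law z. (INF k. ennreal (exp (- fst (\<omega> k)))) = 0"
    by (subst (asm) nn_integral_0_iff_AE) auto
  then show ?thesis
  proof eventually_elim
    case (elim \<omega>)
    show ?case
    proof (rule allI, rule ccontr)
      fix t assume "\<nexists>k. t < fst (\<omega> k)"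
      then have "ennreal (exp (- t)) \<le> (INF k. ennreal (exp (- fst (\<omega> k))))"
        by (intro INF_greatest ennreal_leI) (simp add: not_less)
      with elim show False by simp
    qed
  qed
qed

end

section \<open>Dynkin's formula\<close>

context boomerang
begin

text \<open>The flow derivative is a separate argument, since \<open>u\<close> is only assumed
  differentiable along the flow and its derivative is usually known in closed form. The bounce terms
  are bracketed as in the third bound of \<open>bounce_summable\<close>.\<close>

definition generator :: "('h \<times> 'h \<Rightarrow> real) \<Rightarrow> ('h \<times> 'h \<Rightarrow> real) \<Rightarrow> 'h \<times> 'h \<Rightarrow> real" where
  "generator u Xu z = Xu z + (bounce_sum u z - lb z * u z) + lr * (refresh u z - u z)"

lemma continuous_generator:
  assumes "continuous_on UNIV u" "bounded (range u)" "continuous_on UNIV Xu"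
  shows "continuous_on UNIV (generator u Xu)"
  unfolding generator_def[abs_def]
  by (intro continuous_intros assms continuous_bounce_sum continuous_refresh' continuous_total_rate)

text \<open>Dynkin's formula for a single jump: it evaluates the expectation of \<open>u\<close>
  plus \<open>c\<close> times the clock at the first jump or at time \<open>t\<close>, whichever
  comes first. The linear term in time will later give the drift a constant sign.\<close>

lemma integral_step_stopped:
  assumes u: "continuous_on UNIV u" and A: "\<And>z. \<bar>u z\<bar> \<le> A" and Xu: "continuous_on UNIV Xu"
    and deriv: "\<And>z. ((\<lambda>t. u (boomerang_flow t z)) has_real_derivative Xu z) (at 0)"
    and a: "0 \<le> a" "a \<le> t"
  shows "(\<integral>q. (if fst q \<le> t then u (snd q) + c * max 0 (fst q) else u (boomerang_flow (t - a) y) + c * t) \<partial>step (a, y)) =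
    u y + c * a + integral {0..t - a} (\<lambda>s. surv s y * (generator u Xu (boomerang_flow s y) + c))"
proof -
  define D where "D = u (boomerang_flow (t - a) y) + c * t"
  \<comment> \<open>The value \<open>D\<close> is taken when no jump occurs up to time
    \<open>t\<close>. The \<open>max\<close> keeps \<open>V\<close> bounded at negative clock times,
    which have probability 0.\<close>
  define V where "V q = (if fst q \<le> t then u (snd q) + c * max 0 (fst q) else D)" for q :: "real \<times> 'h \<times> 'h"
  let ?z = "\<lambda>s. boomerang_flow s y"
  have bu: "bounded (range u)"
    using A unfolding bounded_iff by auto
  have um [measurable]: "u \<in> borel_measurable borel"
    by (rule borel_measurable_continuous_onI[OF u])
  have "(\<lambda>q :: real \<times> 'h \<times> 'h. u (snd q)) \<in> borel_measurable borel"
    by (rule measurable_compose[OF snd_borel_measurable um])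
  moreover have "{q :: real \<times> 'h \<times> 'h. fst q \<le> t} \<in> sets borel"
    by (intro borel_closed closed_Collect_le continuous_intros)
  ultimately have Vm: "V \<in> borel_measurable borel"
    unfolding V_def
    by (intro measurable_If borel_measurable_add borel_measurable_times borel_measurable_max
        borel_measurable_const fst_borel_measurable) auto
  have VB: "\<bar>V q\<bar> \<le> A + \<bar>c\<bar> * t + \<bar>D\<bar>" for q
  proof (cases "fst q \<le> t")
    case True
    have "\<bar>c * max 0 (fst q)\<bar> \<le> \<bar>c\<bar> * t"
      unfolding abs_mult using True a by (intro mult_left_mono) auto
    with A[of "snd q"] True show ?thesis
      by (simp add: V_def)
  next
    case False
    with A[of "snd q"] a show ?thesis by (simp add: V_def add_increasing)
  qed
  define B where "B z = bounce_sum u z + lr * refresh u z" for z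
  have cB: "continuous_on UNIV B"
    unfolding B_def by (intro continuous_intros continuous_bounce_sum continuous_refresh' u bu)
  have cflow: "continuous_on S (\<lambda>s. f (?z s))" if "continuous_on UNIV f" for f :: "'h \<times> 'h \<Rightarrow> real" and S
    by (rule continuous_on_compose2[OF that]) (auto intro!: continuous_intros)
  define h where "h s = surv s y * (B (?z s) + rate (?z s) * (c * (a + s)) - rate (?z s) * D)" for s
  have ch: "continuous_on S h" for S
    unfolding h_def by (intro continuous_intros continuous_surv cflow cB continuous_rate)
  have inner: "rate (?z s) * (\<integral>y'. V (a + s, y') \<partial>jumpk (?z s)) =
      (if a + s \<le> t then B (?z s) + rate (?z s) * (c * (a + s)) else rate (?z s) * D)" if s: "0 \<le> s" for s
  proof -
    interpret K: prob_space "jumpk (?z s)" by (rule jumpk_prob_space)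
    show ?thesis
    proof (cases "a + s \<le> t")
      case True
      have "integrable (jumpk (?z s)) u"
        by (rule K.integrable_const_bound[where B=A])
           (use A in \<open>auto simp: measurable_cong_sets[OF sets_jump_kernel refl]\<close>)
      then have "(\<integral>y'. V (a + s, y') \<partial>jumpk (?z s)) = (\<integral>y'. u y' \<partial>jumpk (?z s)) + c * (a + s)"
        using True s a by (simp add: V_def K.prob_space)
      then show ?thesis
        using True integral_jumpk[OF um A, of "?z s"] by (simp add: B_def algebra_simps)
    next
      case False
      then show ?thesis by (simp add: V_def K.prob_space)
    qed
  qed
  have wait_int: "integrable lborel (wait_density y)" "(\<integral>s. wait_density y s \<partial>lborel) = 1"
  proof -
    interpret W: prob_space "waitm y" by (rule wait_prob_space)
    have "(\<integral>\<^sup>+s. ennreal (wait_density y s) \<partial>lborel) = 1"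
      using W.emeasure_space_1 by (simp add: wait_eq emeasure_density)
    then show "integrable lborel (wait_density y)" "(\<integral>s. wait_density y s \<partial>lborel) = 1"
      by (auto intro!: integrableI_nonneg simp: integral_eq_nn_integral)
  qed
  have hint: "integrable lborel (\<lambda>s. indicator {0..t - a} s *\<^sub>R h s)"
    using borel_integrable_compact[of "{0..t - a}" h] ch by (simp add: set_integrable_def)
  have "(\<integral>q. V q \<partial>step (a, y)) = (\<integral>s. indicator {0..} s * (surv s y * (rate (?z s) *
        (\<integral>y'. V (a + s, y') \<partial>jumpk (?z s)))) \<partial>lborel)"
    by (rule integral_step[OF Vm VB])
  \<comment> \<open>The waiting time has total mass 1, so the constant \<open>D\<close> can be split
    off over the whole half-line. The remainder \<open>h\<close> lives on a compact interval, where
    it is continuous.\<close>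
  also have "\<dots> = (\<integral>s. indicator {0..t - a} s *\<^sub>R h s + D * wait_density y s \<partial>lborel)"
  proof (intro Bochner_Integration.integral_cong refl)
    fix s
    show "indicator {0..} s * (surv s y * (rate (?z s) * (\<integral>y'. V (a + s, y') \<partial>jumpk (?z s)))) =
        indicator {0..t - a} s *\<^sub>R h s + D * wait_density y s"
      using inner[of s] by (cases "0 \<le> s"; cases "a + s \<le> t") (auto simp: h_def wait_density_def algebra_simps)
  qed
  also have "\<dots> = (\<integral>s. indicator {0..t - a} s *\<^sub>R h s \<partial>lborel) + D"
    using hint wait_int by simp
  also have "(\<integral>s. indicator {0..t - a} s *\<^sub>R h s \<partial>lborel) = integral {0..t - a} h"
    using set_borel_integral_eq_integral(2)[of "{0..t - a}" h] hint
    by (simp add: set_lebesgue_integral_def set_integrable_def)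
  also have "integral {0..t - a} h =
      integral {0..t - a} (\<lambda>s. surv s y * (generator u Xu (?z s) + c)) + u y + c * a - D"
  proof -
    \<comment> \<open>By the choice of \<open>D\<close> this function vanishes at
      \<open>t - a\<close>. Its derivative contains the flow part of the generator and the loss of
      mass at rate \<open>rate\<close>, while \<open>h\<close> contains the gain from jumps.\<close>
    define F where "F s = surv s y * (u (?z s) + c * (a + s) - D)" for s
    define F' where "F' s = surv s y * (Xu (?z s) + c) - rate (?z s) * surv s y * (u (?z s) + c * (a + s) - D)" for s
    have "(F' has_integral (F (t - a) - F 0)) {0..t - a}"
    proof (rule fundamental_theorem_of_calculus)
      fix s
      have "(F has_real_derivative F' s) (at s within {0..t - a})"
        unfolding F_def F'_def
        by (auto intro!: derivative_eq_intros surv_derivative boomerang_flow_derivative[OF deriv] simp: algebra_simps)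
      then show "(F has_vector_derivative F' s) (at s within {0..t - a})"
        by (simp add: has_real_derivative_iff_has_vector_derivative)
    qed (use a in simp)
    then have "integral {0..t - a} F' = F (t - a) - F 0" and F'i: "F' integrable_on {0..t - a}"
      by (rule integral_unique, rule has_integral_integrable)
    then have F': "integral {0..t - a} F' = D - u y - c * a"
      by (simp add: F_def D_def boomerang_flow_0)
    have "integral {0..t - a} h + integral {0..t - a} F' = integral {0..t - a} (\<lambda>s. h s + F' s)"
      by (intro integral_add[symmetric] F'i integrable_continuous_real ch)
    also have "(\<lambda>s. h s + F' s) = (\<lambda>s. surv s y * (generator u Xu (?z s) + c))"
      by (auto simp: h_def F'_def B_def generator_def jump_rate_def algebra_simps)
    finally show ?thesis using F' by simp
  qed
  finally show ?thesis
    by (simp add: V_def D_def cong: if_cong)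
qed

abbreviation "state \<equiv> pdmp_state boomerang_flow"

lemma state_measurable: "state t \<in> law z \<rightarrow>\<^sub>M borel"
proof -
  have c: "(\<lambda>\<omega>. boomerang_flow (t - fst (\<omega> k)) (snd (\<omega> k))) \<in> law z \<rightarrow>\<^sub>M borel" for k
  proof (rule measurable_compose[OF component_law_measurable])
    show "(\<lambda>q :: real \<times> 'h \<times> 'h. boomerang_flow (t - fst q) (snd q)) \<in> borel \<rightarrow>\<^sub>M borel"
      by (intro borel_measurable_continuous_onI continuous_intros)
  qed
  have p: "(\<lambda>\<omega>. t < fst (\<omega> (Suc k))) \<in> law z \<rightarrow>\<^sub>M count_space UNIV" for k
  proof (rule measurable_compose[OF component_law_measurable])
    have "{q :: real \<times> 'h \<times> 'h. t < fst q} \<in> sets borel"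
      by (intro borel_open open_Collect_less continuous_intros)
    then show "(\<lambda>q :: real \<times> 'h \<times> 'h. t < fst q) \<in> borel \<rightarrow>\<^sub>M count_space UNIV"
      by (simp add: pred_def)
  qed
  show ?thesis
    unfolding pdmp_state_def[abs_def] Let_def
    by (rule measurable_compose_countable[OF c measurable_Least[OF p]])
qed

text \<open>For \<open>c = \<plusminus> C\<close> the drift \<open>\<L> u + c\<close> has constant sign, so the expectation of \<open>u + c t\<close> at the time
  \<open>t \<and> T\<^sub>k\<close>, with \<open>T\<^sub>k\<close> the \<open>k\<close>-th jump time, is monotone in \<open>k\<close>.  Comparing \<open>k = 1\<close> with the limit
  gives both bounds without the Markov property.\<close>

lemma
  assumes u: "continuous_on UNIV u" and A: "\<And>z. \<bar>u z\<bar> \<le> A" and Xu: "continuous_on UNIV Xu"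
    and deriv: "\<And>z. ((\<lambda>t. u (boomerang_flow t z)) has_real_derivative Xu z) (at 0)"
    and C: "\<And>z. \<bar>generator u Xu z\<bar> \<le> C" and t: "0 \<le> t"
  shows semigroup_lower: "u z + integral {0..t} (\<lambda>s. surv s z * (generator u Xu (boomerang_flow s z) + C)) - C * t
      \<le> boomerang_semigroup \<nu> \<Phi> lr R t u z"
    and semigroup_upper: "boomerang_semigroup \<nu> \<Phi> lr R t u z
      \<le> u z + integral {0..t} (\<lambda>s. surv s z * (generator u Xu (boomerang_flow s z) - C)) + C * t"
proof -
  interpret L: prob_space "law z" by (rule law_prob_space)
  have bu: "bounded (range u)"
    using A unfolding bounded_iff by auto
  have um [measurable]: "u \<in> borel_measurable borel"
    by (rule borel_measurable_continuous_onI[OF u])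
  have A0: "0 \<le> A" using A[of z] by linarith
  have usm: "(\<lambda>q :: real \<times> 'h \<times> 'h. u (snd q)) \<in> borel_measurable borel"
    by (rule measurable_compose[OF snd_borel_measurable um])
  have tm: "{q :: real \<times> 'h \<times> 'h. fst q \<le> t} \<in> sets borel"
    by (intro borel_closed closed_Collect_le continuous_intros)
  \<comment> \<open>\<open>U c k\<close> below is \<open>u + c * time\<close> evaluated at the
    minimum of \<open>t\<close> and the \<open>k\<close>-th jump time, \<open>V\<close> is its
    increment over one jump as a function of two consecutive chain states, and \<open>G\<close> is
    the conditional expectation of that increment. The guards keep \<open>V\<close> bounded on the
    null set of negative times.\<close>
  define G where "G c p = (if 0 \<le> fst p \<and> fst p \<le> t then integral {0..t - fst p}
      (\<lambda>s. surv s (snd p) * (generator u Xu (boomerang_flow s (snd p)) + c)) else 0)" for c and p :: "real \<times> 'h \<times> 'h"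
  define V where "V c x = (if 0 \<le> fst (fst x) \<and> fst (fst x) \<le> t then
      (if fst (snd x) \<le> t then u (snd (snd x)) + c * max 0 (fst (snd x))
       else u (boomerang_flow (t - fst (fst x)) (snd (fst x))) + c * t) - (u (snd (fst x)) + c * fst (fst x))
      else 0)" for c and x :: "(real \<times> 'h \<times> 'h) \<times> (real \<times> 'h \<times> 'h)"
  define U where "U c k \<omega> = (if fst (\<omega> k) \<le> t then u (snd (\<omega> k)) + c * max 0 (fst (\<omega> k))
      else u (state t \<omega>) + c * t)" for c k and \<omega> :: "nat \<Rightarrow> real \<times> 'h \<times> 'h"
  have clamp: "\<bar>c * max 0 r\<bar> \<le> \<bar>c\<bar> * t" if "r \<le> t" for c r
    unfolding abs_mult using that t by (intro mult_left_mono) auto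
  have clamp': "\<bar>c * t\<bar> \<le> \<bar>c\<bar> * t" for c
    using t by (simp add: abs_mult)
  have UB: "\<bar>U c k \<omega>\<bar> \<le> A + \<bar>c\<bar> * t" for c k \<omega>
    unfolding U_def using clamp[of "fst (\<omega> k)" c] clamp'[of c] A[of "snd (\<omega> k)"] A[of "state t \<omega>"]
    by (auto intro!: order_trans[OF abs_triangle_ineq] add_mono)
  have VB: "\<bar>V c x\<bar> \<le> 2 * (A + \<bar>c\<bar> * t)" for c x
  proof (cases "0 \<le> fst (fst x) \<and> fst (fst x) \<le> t")
    case True
    have "\<bar>u (snd (fst x)) + c * fst (fst x)\<bar> \<le> A + \<bar>c\<bar> * t"
      using clamp[of "fst (fst x)" c] A[of "snd (fst x)"] True
      by (auto intro!: order_trans[OF abs_triangle_ineq] add_mono)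
    moreover have "\<bar>if fst (snd x) \<le> t then u (snd (snd x)) + c * max 0 (fst (snd x))
       else u (boomerang_flow (t - fst (fst x)) (snd (fst x))) + c * t\<bar> \<le> A + \<bar>c\<bar> * t"
      using clamp[of "fst (snd x)" c] clamp'[of c] A[of "snd (snd x)"]
        A[of "boomerang_flow (t - fst (fst x)) (snd (fst x))"]
      by (auto intro!: order_trans[OF abs_triangle_ineq] add_mono)
    moreover have "\<bar>a - b\<bar> \<le> 2 * r" if "\<bar>b\<bar> \<le> r" "\<bar>a\<bar> \<le> r" for a b r :: real
      using that by linarith
    ultimately show ?thesis
      using True unfolding V_def by (simp only: if_True simp_thms)
  next
    case False
    then show ?thesis using A0 t by (auto simp: V_def)
  qed
  have Vm: "V c \<in> borel_measurable borel" for c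
  proof -
    have f1: "(\<lambda>x :: (real \<times> 'h \<times> 'h) \<times> (real \<times> 'h \<times> 'h). f (fst x)) \<in> borel_measurable borel"
      "(\<lambda>x :: (real \<times> 'h \<times> 'h) \<times> (real \<times> 'h \<times> 'h). f (snd x)) \<in> borel_measurable borel"
      if "f \<in> borel_measurable borel" for f :: "real \<times> 'h \<times> 'h \<Rightarrow> real"
      using measurable_compose[OF fst_borel_measurable that] measurable_compose[OF snd_borel_measurable that] by auto
    have fl: "(\<lambda>q :: real \<times> 'h \<times> 'h. u (boomerang_flow (t - fst q) (snd q))) \<in> borel_measurable borel"
      by (intro borel_measurable_continuous_onI continuous_on_compose2[OF u] continuous_intros) auto
    have "{x :: (real \<times> 'h \<times> 'h) \<times> (real \<times> 'h \<times> 'h). 0 \<le> fst (fst x) \<and> fst (fst x) \<le> t} \<in> sets borel"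
      by (intro borel_closed closed_Collect_conj closed_Collect_le continuous_intros)
    moreover have "{x :: (real \<times> 'h \<times> 'h) \<times> (real \<times> 'h \<times> 'h). fst (snd x) \<le> t} \<in> sets borel"
      by (intro borel_closed closed_Collect_le continuous_intros)
    ultimately show ?thesis
      unfolding V_def
      by (intro measurable_If borel_measurable_add borel_measurable_diff borel_measurable_times borel_measurable_max
          borel_measurable_const f1[OF usm] f1[OF fl] f1[OF fst_borel_measurable]) auto
  qed
  have VG: "(\<integral>q. V c (p, q) \<partial>step p) = G c p" for c p
  proof (cases "0 \<le> fst p \<and> fst p \<le> t")
    case True
    interpret S: prob_space "step p" by (rule step_prob_space)
    obtain a y where p: "p = (a, y)" by (rule prod.exhaust)
    let ?W = "\<lambda>q. if fst q \<le> t then u (snd q) + c * max 0 (fst q) else u (boomerang_flow (t - a) y) + c * t"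
    have "?W \<in> borel_measurable borel"
      using tm by (intro measurable_If borel_measurable_add borel_measurable_times borel_measurable_max
        borel_measurable_const fst_borel_measurable usm) auto
    moreover have "\<bar>?W q\<bar> \<le> A + \<bar>c\<bar> * t" for q
      using clamp[of "fst q" c] clamp'[of c] A[of "snd q"] A[of "boomerang_flow (t - a) y"]
      by (auto intro!: order_trans[OF abs_triangle_ineq] add_mono)
    ultimately have "integrable (step p) ?W"
      by (intro S.integrable_const_bound[where B="A + \<bar>c\<bar> * t"])
         (auto simp: measurable_cong_sets[OF sets_step refl])
    then have W: "integrable (step (a, y)) ?W"
      by (simp only: p)
    have "V c (p, q) = ?W q - (u y + c * a)" for q
      using True by (simp add: V_def p)
    then have "(\<integral>q. V c (p, q) \<partial>step p) = (\<integral>q. ?W q - (u y + c * a) \<partial>step (a, y))"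
      by (simp only: p)
    also have "\<dots> = (\<integral>q. ?W q \<partial>step (a, y)) - (u y + c * a)"
      using W finite_measure.integrable_const[of "step (a, y)" "u y + c * a"] S.finite_measure_axioms by (subst Bochner_Integration.integral_diff)
        (auto simp: p S.prob_space[unfolded p])
    also have "\<dots> = G c p"
      using True p integral_step_stopped[OF u A Xu deriv, of a t y c] by (simp add: G_def)
    finally show ?thesis .
  next
    case False
    then show ?thesis by (auto simp: V_def G_def)
  qed
  have Um: "U c k \<in> borel_measurable (law z)" for c k
  proof -
    have "(\<lambda>\<omega>. u (state t \<omega>)) \<in> borel_measurable (law z)"
      by (rule measurable_compose[OF state_measurable um])
    moreover have "{\<omega> \<in> space (law z). fst (\<omega> k) \<le> t} \<in> sets (law z)"
      using measurable_sets[OF component_law_measurable tm, of k z] by (simp add: vimage_def Int_def conj_commute)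
    ultimately show ?thesis
      unfolding U_def
      by (intro measurable_If borel_measurable_add borel_measurable_times borel_measurable_max
          borel_measurable_const measurable_compose[OF component_law_measurable usm]
          measurable_compose[OF component_law_measurable fst_borel_measurable]) auto
  qed
  have Ui: "integrable (law z) (U c k)" for c k
    by (rule L.integrable_const_bound[where B="A + \<bar>c\<bar> * t"]) (use UB Um in auto)
  have Vi: "integrable (law z) (\<lambda>\<omega>. V c (\<omega> k, \<omega> (Suc k)))" for c k
    by (rule L.integrable_const_bound[where B="2 * (A + \<bar>c\<bar> * t)"])
       (use VB Vm in \<open>auto intro!: measurable_compose[OF Pair_borel_measurable[OF component_law_measurable component_law_measurable]]\<close>)
  have good: "AE \<omega> in law z. \<omega> 0 = (0, z) \<and> (\<forall>k. 0 \<le> fst (\<omega> k)) \<and> mono (\<lambda>k. fst (\<omega> k)) \<and> (\<exists>k. t < fst (\<omega> k))"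
    using AE_law_0[of z] AE_law_mono[of z] AE_law_nonexplosive[of z]
  proof eventually_elim
    case (elim \<omega>)
    then have m: "mono (\<lambda>k. fst (\<omega> k))"
      by (intro incseq_SucI) auto
    then have "fst (\<omega> 0) \<le> fst (\<omega> k)" for k
      by (rule monoD) simp
    with m elim show ?case by auto
  qed
  have UV: "AE \<omega> in law z. U c (Suc k) \<omega> - U c k \<omega> = V c (\<omega> k, \<omega> (Suc k))" for c k
    using good
  proof eventually_elim
    case (elim \<omega>)
    then have m: "mono (\<lambda>k. fst (\<omega> k))" and nn: "\<And>k. 0 \<le> fst (\<omega> k)" by auto
    have le: "fst (\<omega> k) \<le> fst (\<omega> (Suc k))"
      using m by (rule monoD) simp
    \<comment> \<open>This identifies the true state with the flow from the \<open>k\<close>-th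
      jump. Monotone jump times make \<open>k\<close> the least index whose successor lies beyond
      \<open>t\<close>.\<close>
    have st: "state t \<omega> = boomerang_flow (t - fst (\<omega> k)) (snd (\<omega> k))" if "fst (\<omega> k) \<le> t" "t < fst (\<omega> (Suc k))"
    proof -
      have "(LEAST j. t < fst (\<omega> (Suc j))) = k"
      proof (rule Least_equality)
        fix j assume j: "t < fst (\<omega> (Suc j))"
        show "k \<le> j"
        proof (rule ccontr)
          assume "\<not> k \<le> j"
          then have "fst (\<omega> (Suc j)) \<le> fst (\<omega> k)"
            by (intro monoD[OF m]) simp
          with j that show False by simp
        qed
      qed fact
      then show ?thesis by (simp add: pdmp_state_def)
    qed
    show ?case
      using le nn st by (auto simp: U_def V_def)
  qed
  have EU: "(\<integral>\<omega>. U c (Suc k) \<omega> \<partial>law z) = (\<integral>\<omega>. U c k \<omega> \<partial>law z) + (\<integral>\<omega>. G c (\<omega> k) \<partial>law z)" for c k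
  proof -
    have "(\<integral>\<omega>. U c (Suc k) \<omega> \<partial>law z) - (\<integral>\<omega>. U c k \<omega> \<partial>law z) = (\<integral>\<omega>. U c (Suc k) \<omega> - U c k \<omega> \<partial>law z)"
      using Ui by (intro Bochner_Integration.integral_diff[symmetric])
    also have "\<dots> = (\<integral>\<omega>. V c (\<omega> k, \<omega> (Suc k)) \<partial>law z)"
      using UV Ui Vi by (intro integral_cong_AE) auto
    also have "\<dots> = (\<integral>\<omega>. G c (\<omega> k) \<partial>law z)"
      using integral_law_Suc[OF Vm[of c] VB[of c], where k=k and z=z] by (simp add: VG)
    finally show ?thesis by simp
  qed
  have EU0: "(\<integral>\<omega>. U c 0 \<omega> \<partial>law z) = u z" for c
  proof -
    have "AE \<omega> in law z. U c 0 \<omega> = u z"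
      using good by eventually_elim (use t in \<open>auto simp: U_def\<close>)
    then have "(\<integral>\<omega>. U c 0 \<omega> \<partial>law z) = (\<integral>\<omega>. u z \<partial>law z)"
      using Um by (intro integral_cong_AE) auto
    then show ?thesis by (simp add: L.prob_space)
  qed
  have EG0: "(\<integral>\<omega>. G c (\<omega> 0) \<partial>law z) = G c (0, z)" for c
  proof -
    have "AE \<omega> in law z. G c (\<omega> 0) = G c (0, z)"
      using AE_law_0[of z] by eventually_elim simp
    moreover have "G c \<in> borel_measurable borel"
      using integral_step_measurable[OF Vm, of c] by (simp add: VG)
    ultimately have "(\<integral>\<omega>. G c (\<omega> 0) \<partial>law z) = (\<integral>\<omega>. G c (0, z) \<partial>law z)"
      by (intro integral_cong_AE measurable_compose[OF component_law_measurable]) auto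
    then show ?thesis by (simp add: L.prob_space)
  qed
  \<comment> \<open>Non-explosion enters here: almost surely \<open>U c k\<close> is constant in
    \<open>k\<close> as soon as the \<open>k\<close>-th jump time exceeds \<open>t\<close>.\<close>
  have lim: "(\<lambda>k. \<integral>\<omega>. U c k \<omega> \<partial>law z) \<longlonglongrightarrow> boomerang_semigroup \<nu> \<Phi> lr R t u z + c * t" for c
  proof -
    have sm: "(\<lambda>\<omega>. u (state t \<omega>)) \<in> borel_measurable (law z)"
      by (rule measurable_compose[OF state_measurable um])
    have "(\<lambda>k. \<integral>\<omega>. U c k \<omega> \<partial>law z) \<longlonglongrightarrow> (\<integral>\<omega>. u (state t \<omega>) + c * t \<partial>law z)"
    proof (rule integral_dominated_convergence[where w="\<lambda>_. A + \<bar>c\<bar> * t"])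
      show "AE \<omega> in law z. (\<lambda>k. U c k \<omega>) \<longlonglongrightarrow> u (state t \<omega>) + c * t"
        using good
      proof eventually_elim
        case (elim \<omega>)
        then obtain K where K: "t < fst (\<omega> K)" and m: "mono (\<lambda>k. fst (\<omega> k))" by auto
        have "U c k \<omega> = u (state t \<omega>) + c * t" if "K \<le> k" for k
          using K monoD[OF m that] by (auto simp: U_def)
        then show ?case
          by (intro tendsto_eventually eventually_sequentiallyI[of K]) auto
      qed
    qed (use sm Um UB in auto)
    moreover have "integrable (law z) (\<lambda>\<omega>. u (state t \<omega>))"
      by (rule L.integrable_const_bound[where B=A]) (use A sm in auto)
    ultimately show ?thesis
      by (simp add: boomerang_semigroup_def pdmp_semigroup_def L.prob_space)
  qed
  have Gi: "integrable (law z) (\<lambda>\<omega>. G c (\<omega> k))" for c k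
  proof -
    have "integrable (law z) (\<lambda>\<omega>. \<integral>q. V c (\<omega> k, q) \<partial>step (\<omega> k))"
    proof (rule L.integrable_const_bound[where B="2 * (A + \<bar>c\<bar> * t)"])
      have "\<bar>\<integral>q. V c (p, q) \<partial>step p\<bar> \<le> 2 * (A + \<bar>c\<bar> * t)" for p
      proof -
        interpret S: prob_space "step p" by (rule step_prob_space)
        have "(\<lambda>q. V c (p, q)) \<in> borel_measurable borel"
          by (rule measurable_compose[OF _ Vm]) measurable
        then have "integrable (step p) (\<lambda>q. V c (p, q))"
          by (intro S.integrable_const_bound[where B="2 * (A + \<bar>c\<bar> * t)"])
             (use VB in \<open>auto simp: measurable_cong_sets[OF sets_step refl]\<close>)
        then have "(\<integral>q. \<bar>V c (p, q)\<bar> \<partial>step p) \<le> (\<integral>q. 2 * (A + \<bar>c\<bar> * t) \<partial>step p)"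
          using VB by (intro integral_mono) auto
        also have "\<dots> = 2 * (A + \<bar>c\<bar> * t)"
          by (simp add: S.prob_space)
        finally show ?thesis
          by (rule order_trans[OF integral_abs_bound])
      qed
      then show "AE \<omega> in law z. norm (\<integral>q. V c (\<omega> k, q) \<partial>step (\<omega> k)) \<le> 2 * (A + \<bar>c\<bar> * t)"
        by simp
    qed (rule measurable_compose[OF component_law_measurable integral_step_measurable[OF Vm]])
    then show ?thesis by (simp add: VG)
  qed
  have gcont: "continuous_on S (\<lambda>s. surv s y * (generator u Xu (boomerang_flow s y) + c))" for S y c
    by (intro continuous_intros continuous_surv continuous_on_compose2[OF continuous_generator[OF u bu Xu]]) auto
  have Gpos: "0 \<le> G C p" for p
  proof -
    have "0 \<le> integral {0..r} (\<lambda>s. surv s y * (generator u Xu (boomerang_flow s y) + C))" for r y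
    proof (intro integral_nonneg integrable_continuous_real gcont)
      show "0 \<le> surv s y * (generator u Xu (boomerang_flow s y) + C)" for s
        using C[of "boomerang_flow s y"] surv_pos[of s y] by (simp add: zero_le_mult_iff abs_le_iff)
    qed
    then show ?thesis by (auto simp: G_def)
  qed
  have Gneg: "G (- C) p \<le> 0" for p
  proof -
    have "integral {0..r} (\<lambda>s. surv s y * (generator u Xu (boomerang_flow s y) + - C)) \<le> integral {0..r} (\<lambda>s. 0)" for r y
    proof (intro integral_le integrable_continuous_real gcont)
      show "surv s y * (generator u Xu (boomerang_flow s y) + - C) \<le> 0" for s
        using C[of "boomerang_flow s y"] surv_pos[of s y] by (simp add: mult_le_0_iff abs_le_iff)
    qed auto
    then show ?thesis by (auto simp: G_def)
  qed
  have low: "u z + G C (0, z) \<le> (\<integral>\<omega>. U C (Suc k) \<omega> \<partial>law z)" for k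
  proof (induction k)
    case 0
    show ?case by (simp add: EU EU0 EG0)
  next
    case (Suc k)
    have "0 \<le> (\<integral>\<omega>. G C (\<omega> (Suc k)) \<partial>law z)"
      using Gpos by simp
    with Suc show ?case by (simp add: EU[of C "Suc k"])
  qed
  have up: "(\<integral>\<omega>. U (- C) (Suc k) \<omega> \<partial>law z) \<le> u z + G (- C) (0, z)" for k
  proof (induction k)
    case 0
    show ?case by (simp add: EU EU0 EG0)
  next
    case (Suc k)
    have "(\<integral>\<omega>. G (- C) (\<omega> (Suc k)) \<partial>law z) \<le> (\<integral>\<omega>. 0 \<partial>law z)"
      using Gneg Gi by (intro integral_mono) auto
    with Suc show ?case by (simp add: EU[of "- C" "Suc k"])
  qed
  have "u z + G C (0, z) \<le> boomerang_semigroup \<nu> \<Phi> lr R t u z + C * t"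
    by (rule LIMSEQ_le_const[OF LIMSEQ_Suc[OF lim]]) (use low in auto)
  then show "u z + integral {0..t} (\<lambda>s. surv s z * (generator u Xu (boomerang_flow s z) + C)) - C * t
      \<le> boomerang_semigroup \<nu> \<Phi> lr R t u z"
    using t by (simp add: G_def)
  have "boomerang_semigroup \<nu> \<Phi> lr R t u z + - C * t \<le> u z + G (- C) (0, z)"
    by (rule LIMSEQ_le_const2[OF LIMSEQ_Suc[OF lim]]) (use up in auto)
  then show "boomerang_semigroup \<nu> \<Phi> lr R t u z
      \<le> u z + integral {0..t} (\<lambda>s. surv s z * (generator u Xu (boomerang_flow s z) - C)) + C * t"
    using t by (simp add: G_def)
qed

text \<open>The integrals in the two bounds have a constant sign, which gives the Lipschitz
  estimate. Divided by \<open>t\<close> they converge to the generator plus or minus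
  \<open>C\<close>, because \<open>surv 0 z\<close> is 1, and the quotient is squeezed between
  them.\<close>

lemma
  assumes u: "continuous_on UNIV u" and A: "\<And>z. \<bar>u z\<bar> \<le> A" and Xu: "continuous_on UNIV Xu"
    and deriv: "\<And>z. ((\<lambda>t. u (boomerang_flow t z)) has_real_derivative Xu z) (at 0)"
    and C: "\<And>z. \<bar>generator u Xu z\<bar> \<le> C"
  shows semigroup_Lipschitz: "0 \<le> t \<Longrightarrow> \<bar>boomerang_semigroup \<nu> \<Phi> lr R t u z - u z\<bar> \<le> C * t"
    and semigroup_derivative:
      "((\<lambda>t. (boomerang_semigroup \<nu> \<Phi> lr R t u z - u z) / t) \<longlongrightarrow> generator u Xu z) (at_right 0)"
proof -
  have bu: "bounded (range u)"
    using A unfolding bounded_iff by auto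
  define I where "I c t = integral {0..t} (\<lambda>s. surv s z * (generator u Xu (boomerang_flow s z) + c))" for c t
  have gcont: "continuous_on S (\<lambda>s. surv s z * (generator u Xu (boomerang_flow s z) + c))" for S c
    by (intro continuous_intros continuous_surv continuous_on_compose2[OF continuous_generator[OF u bu Xu]]) auto
  have lo: "u z + I C t - C * t \<le> boomerang_semigroup \<nu> \<Phi> lr R t u z"
    and up: "boomerang_semigroup \<nu> \<Phi> lr R t u z \<le> u z + I (- C) t + C * t" if "0 \<le> t" for t
    using semigroup_lower[OF u A Xu deriv C that, of z] semigroup_upper[OF u A Xu deriv C that, of z]
    by (simp_all add: I_def)
  have I1: "0 \<le> I C t" for t
    unfolding I_def
  proof (intro integral_nonneg integrable_continuous_real gcont)
    show "0 \<le> surv s z * (generator u Xu (boomerang_flow s z) + C)" for s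
      using C[of "boomerang_flow s z"] surv_pos[of s z] by (simp add: zero_le_mult_iff abs_le_iff)
  qed
  have "I (- C) t \<le> integral {0..t} (\<lambda>s. 0)" for t
    unfolding I_def
  proof (intro integral_le integrable_continuous_real gcont)
    show "surv s z * (generator u Xu (boomerang_flow s z) + - C) \<le> 0" for s
      using C[of "boomerang_flow s z"] surv_pos[of s z] by (simp add: mult_le_0_iff abs_le_iff)
  qed auto
  then have I2: "I (- C) t \<le> 0" for t by simp
  show "\<bar>boomerang_semigroup \<nu> \<Phi> lr R t u z - u z\<bar> \<le> C * t" if "0 \<le> t"
    using lo[OF that] up[OF that] I1[of t] I2[of t] by (simp add: abs_le_iff)
  have lim: "((\<lambda>t. I c t / t) \<longlongrightarrow> generator u Xu z + c) (at_right 0)" for c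
  proof -
    have "(I c has_real_derivative surv 0 z * (generator u Xu (boomerang_flow 0 z) + c)) (at 0 within {0..1})"
      unfolding I_def by (rule integral_has_real_derivative[OF gcont]) simp
    then have "((\<lambda>t. (I c t - I c 0) / (t - 0)) \<longlongrightarrow> generator u Xu z + c) (at 0 within {0..1})"
      by (simp add: has_field_derivative_iff boomerang_flow_0)
    then have "((\<lambda>t. I c t / t) \<longlongrightarrow> generator u Xu z + c) (at 0 within {0..1})"
      by (simp add: I_def)
    moreover have "at 0 within {0..1} = at_right (0::real)"
      using at_within_Icc_at_right[of "0::real" 1] by simp
    ultimately show ?thesis by simp
  qed
  show "((\<lambda>t. (boomerang_semigroup \<nu> \<Phi> lr R t u z - u z) / t) \<longlongrightarrow> generator u Xu z) (at_right 0)"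
  proof (rule tendsto_sandwich)
    show "((\<lambda>t. I C t / t - C) \<longlongrightarrow> generator u Xu z) (at_right 0)"
      using tendsto_diff[OF lim[of C] tendsto_const[of C]] by simp
    show "((\<lambda>t. I (- C) t / t + C) \<longlongrightarrow> generator u Xu z) (at_right 0)"
      using tendsto_add[OF lim[of "- C"] tendsto_const[of C]] by simp
    have pos: "\<forall>\<^sub>F t in at_right (0::real). 0 < t"
      by (simp add: eventually_at_right_less)
    show "\<forall>\<^sub>F t in at_right 0. I C t / t - C \<le> (boomerang_semigroup \<nu> \<Phi> lr R t u z - u z) / t"
      using pos
    proof eventually_elim
      case (elim t)
      then have "(I C t - C * t) / t \<le> (boomerang_semigroup \<nu> \<Phi> lr R t u z - u z) / t"
        using lo[of t] by (intro divide_right_mono) auto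
      with elim show ?case by (simp add: diff_divide_distrib)
    qed
    show "\<forall>\<^sub>F t in at_right 0. (boomerang_semigroup \<nu> \<Phi> lr R t u z - u z) / t \<le> I (- C) t / t + C"
      using pos
    proof eventually_elim
      case (elim t)
      then have "(boomerang_semigroup \<nu> \<Phi> lr R t u z - u z) / t \<le> (I (- C) t + C * t) / t"
        using up[of t] by (intro divide_right_mono) auto
      with elim show ?case by (simp add: add_divide_distrib)
    qed
  qed
qed

end

section \<open>The space of square integrable functions\<close>

lemma L2_I: "f \<in> borel_measurable M \<Longrightarrow> integrable M (\<lambda>z. (f z)\<^sup>2) \<Longrightarrow> f \<in> L2 M"
  by (simp add: L2_def)

lemma L2_measurable: "f \<in> L2 M \<Longrightarrow> f \<in> borel_measurable M"
  by (simp add: L2_def)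

lemma L2_integrable: "f \<in> L2 M \<Longrightarrow> integrable M (\<lambda>z. (f z)\<^sup>2)"
  by (simp add: L2_def)

lemma L2_integrable_mult:
  assumes "f \<in> L2 M" "g \<in> L2 M"
  shows "integrable M (\<lambda>z. f z * g z)"
proof (rule Bochner_Integration.integrable_bound)
  show "integrable M (\<lambda>z. (f z)\<^sup>2 + (g z)\<^sup>2)"
    using assms by (simp add: L2_def)
  show "(\<lambda>z. f z * g z) \<in> borel_measurable M"
    using assms[THEN L2_measurable] by simp
  have "\<bar>a * b\<bar> \<le> \<bar>a\<^sup>2 + b\<^sup>2\<bar>" for a b :: real
  proof -
    have "0 \<le> \<bar>a\<bar> * \<bar>b\<bar>" by simp
    with sum_squares_bound[of "\<bar>a\<bar>" "\<bar>b\<bar>"] show ?thesis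
      unfolding abs_mult by (simp del: zero_le_mult_iff abs_ge_zero mult_nonneg_nonneg)
  qed
  then show "AE z in M. norm (f z * g z) \<le> norm ((f z)\<^sup>2 + (g z)\<^sup>2)"
    by simp
qed

lemma L2_lin:
  assumes "f \<in> L2 M" "g \<in> L2 M"
  shows "(\<lambda>z. a * f z + b * g z) \<in> L2 M"
proof (rule L2_I)
  have "integrable M (\<lambda>z. a\<^sup>2 * (f z)\<^sup>2 + (2 * a * b) * (f z * g z) + b\<^sup>2 * (g z)\<^sup>2)"
    using assms by (intro Bochner_Integration.integrable_add integrable_mult_right L2_integrable L2_integrable_mult) auto
  then show "integrable M (\<lambda>z. (a * f z + b * g z)\<^sup>2)"
    by (simp add: power2_eq_square algebra_simps)
qed (use assms[THEN L2_measurable] in simp)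

lemma L2_add: "f \<in> L2 M \<Longrightarrow> g \<in> L2 M \<Longrightarrow> (\<lambda>z. f z + g z) \<in> L2 M"
  using L2_lin[of f M g 1 1] by simp

lemma L2_diff: "f \<in> L2 M \<Longrightarrow> g \<in> L2 M \<Longrightarrow> (\<lambda>z. f z - g z) \<in> L2 M"
  using L2_lin[of f M g 1 "-1"] by simp

lemma L2_scale: "f \<in> L2 M \<Longrightarrow> (\<lambda>z. a * f z) \<in> L2 M"
  using L2_lin[of f M f a 0] by simp

lemma L2_divide: "f \<in> L2 M \<Longrightarrow> (\<lambda>z. f z / a) \<in> L2 M"
  using L2_scale[of f M "inverse a"] by (simp add: field_simps)

lemma L2_zero: "(\<lambda>z. 0) \<in> L2 M"
  by (simp add: L2_def)

lemma L2_sum: "(\<And>i. i \<in> I \<Longrightarrow> f i \<in> L2 M) \<Longrightarrow> (\<lambda>z. \<Sum>i\<in>I. f i z) \<in> L2 M"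
  by (induction I rule: infinite_finite_induct) (auto intro: L2_add L2_zero)

lemma L2_dominated:
  assumes "w \<in> L2 M" "f \<in> borel_measurable M" "AE z in M. \<bar>f z\<bar> \<le> w z"
  shows "f \<in> L2 M"
proof (rule L2_I)
  show "integrable M (\<lambda>z. (f z)\<^sup>2)"
  proof (rule Bochner_Integration.integrable_bound[OF L2_integrable[OF assms(1)]])
    show "AE z in M. norm ((f z)\<^sup>2) \<le> norm ((w z)\<^sup>2)"
      using assms(3) by eventually_elim (simp add: abs_le_square_iff[symmetric])
  qed (use assms in simp)
qed fact

lemma L2_norm_nonneg [simp]: "0 \<le> L2_norm M f"
  by (simp add: L2_norm_def)

lemma L2_norm_power2: "(L2_norm M f)\<^sup>2 = (\<integral>z. (f z)\<^sup>2 \<partial>M)"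
  by (simp add: L2_norm_def)

lemma L2_norm_cong_AE:
  assumes "f \<in> borel_measurable M" "g \<in> borel_measurable M" "AE z in M. f z = g z"
  shows "L2_norm M f = L2_norm M g"
  unfolding L2_norm_def
  by (rule arg_cong[where f=sqrt], rule integral_cong_AE) (use assms in auto)

lemma L2_norm_scale: "L2_norm M (\<lambda>z. a * f z) = \<bar>a\<bar> * L2_norm M f"
  by (simp add: L2_norm_def power_mult_distrib real_sqrt_mult)

lemma L2_norm_divide: "L2_norm M (\<lambda>z. f z / a) = L2_norm M f / \<bar>a\<bar>"
  using L2_norm_scale[of M "inverse a" f] by (simp add: field_simps)

lemma L2_norm_minus_commute: "L2_norm M (\<lambda>z. f z - g z) = L2_norm M (\<lambda>z. g z - f z)"
  by (simp add: L2_norm_def power2_commute)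

lemma L2_Cauchy_Schwarz:
  assumes f: "f \<in> L2 M" and g: "g \<in> L2 M"
  shows "\<bar>\<integral>z. f z * g z \<partial>M\<bar> \<le> L2_norm M f * L2_norm M g"
proof -
  define a b c where "a = (\<integral>z. (f z)\<^sup>2 \<partial>M)" and "b = (\<integral>z. f z * g z \<partial>M)" and "c = (\<integral>z. (g z)\<^sup>2 \<partial>M)"
  have q: "0 \<le> s\<^sup>2 * a + 2 * s * t * b + t\<^sup>2 * c" for s t
  proof -
    have "0 \<le> (\<integral>z. (s * f z + t * g z)\<^sup>2 \<partial>M)"
      by simp
    also have "\<dots> = (\<integral>z. s\<^sup>2 * (f z)\<^sup>2 + 2 * s * t * (f z * g z) + t\<^sup>2 * (g z)\<^sup>2 \<partial>M)"
      by (intro Bochner_Integration.integral_cong) (auto simp: power2_eq_square algebra_simps)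
    also have "\<dots> = s\<^sup>2 * a + 2 * s * t * b + t\<^sup>2 * c"
      using L2_integrable[OF f] L2_integrable[OF g] L2_integrable_mult[OF f g]
      by (simp add: a_def b_def c_def)
    finally show ?thesis .
  qed
  have a0: "0 \<le> a" and c0: "0 \<le> c"
    by (simp_all add: a_def c_def)
  have "b\<^sup>2 \<le> a * c"
  proof (cases "a = 0")
    case True
    \<comment> \<open>With \<open>a = 0\<close> the quadratic form is affine in its first variable.
      The witness below makes it equal to -1.\<close>
    have "b = 0"
    proof (rule ccontr)
      assume "b \<noteq> 0"
      then show False
        using q[of "- (c + 1) / (2 * b)" 1] True c0 by (simp add: field_simps)
    qed
    with True show ?thesis by simp
  next
    case False
    with a0 have "a > 0" by simp
    have "0 \<le> a * (a * c - b\<^sup>2)"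
      using q[of "-b" a] by (simp add: power2_eq_square algebra_simps)
    with \<open>a > 0\<close> show ?thesis
      by (simp add: zero_le_mult_iff)
  qed
  then have "sqrt (b\<^sup>2) \<le> sqrt (a * c)"
    by (rule real_sqrt_le_mono)
  then show ?thesis
    by (simp add: L2_norm_def a_def b_def c_def real_sqrt_mult)
qed

lemma L2_norm_triangle:
  assumes f: "f \<in> L2 M" and g: "g \<in> L2 M"
  shows "L2_norm M (\<lambda>z. f z + g z) \<le> L2_norm M f + L2_norm M g"
proof (rule power2_le_imp_le)
  have "(L2_norm M (\<lambda>z. f z + g z))\<^sup>2 = (\<integral>z. (f z)\<^sup>2 + 2 * (f z * g z) + (g z)\<^sup>2 \<partial>M)"
    unfolding L2_norm_power2 by (intro Bochner_Integration.integral_cong refl) (simp add: power2_sum)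
  also have "\<dots> = (L2_norm M f)\<^sup>2 + 2 * (\<integral>z. f z * g z \<partial>M) + (L2_norm M g)\<^sup>2"
    using L2_integrable[OF f] L2_integrable[OF g] L2_integrable_mult[OF f g]
    by (simp add: L2_norm_power2)
  also have "\<dots> \<le> (L2_norm M f + L2_norm M g)\<^sup>2"
    using L2_Cauchy_Schwarz[OF f g] by (simp add: power2_sum)
  finally show "(L2_norm M (\<lambda>z. f z + g z))\<^sup>2 \<le> (L2_norm M f + L2_norm M g)\<^sup>2" .
qed simp

lemma L2_norm_triangle3:
  assumes f: "f \<in> L2 M" and g: "g \<in> L2 M" and h: "h \<in> L2 M"
  shows "L2_norm M (\<lambda>z. f z - h z) \<le> L2_norm M (\<lambda>z. f z - g z) + L2_norm M (\<lambda>z. g z - h z)"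
  using L2_norm_triangle[OF L2_diff[OF f g] L2_diff[OF g h]] by simp

lemma L2_norm_le_add:
  assumes f: "f \<in> L2 M" and g: "g \<in> L2 M"
  shows "L2_norm M f \<le> L2_norm M g + L2_norm M (\<lambda>z. f z - g z)"
  using L2_norm_triangle[OF g L2_diff[OF f g]] by simp

lemma L2_norm_sum_le:
  assumes "\<And>i. i \<in> I \<Longrightarrow> f i \<in> L2 M"
  shows "L2_norm M (\<lambda>z. \<Sum>i\<in>I. f i z) \<le> (\<Sum>i\<in>I. L2_norm M (f i))"
  using assms
proof (induction I rule: infinite_finite_induct)
  case (insert i I)
  have "L2_norm M (\<lambda>z. f i z + (\<Sum>i\<in>I. f i z)) \<le> L2_norm M (f i) + L2_norm M (\<lambda>z. \<Sum>i\<in>I. f i z)"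
    using insert by (intro L2_norm_triangle L2_sum) auto
  with insert show ?case by auto
qed (auto simp: L2_norm_def)

lemma L2_norm_mono:
  assumes "w \<in> L2 M" "f \<in> borel_measurable M" "AE z in M. \<bar>f z\<bar> \<le> w z"
  shows "L2_norm M f \<le> L2_norm M w"
  unfolding L2_norm_def
proof (rule real_sqrt_le_mono, rule integral_mono_AE)
  show "AE z in M. (f z)\<^sup>2 \<le> (w z)\<^sup>2"
    using assms(3) by eventually_elim (simp add: abs_le_square_iff[symmetric])
qed (use assms L2_dominated[OF assms] in \<open>auto simp: L2_def\<close>)

lemma L2_dominated_convergence:
  assumes w: "w \<in> L2 M" and f: "f \<in> borel_measurable M" "\<And>n. s n \<in> borel_measurable M"
    and lim: "AE z in M. (\<lambda>n. s n z) \<longlonglongrightarrow> f z" and bound: "\<And>n. AE z in M. \<bar>s n z\<bar> \<le> w z"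
  shows "(\<lambda>n. L2_norm M (\<lambda>z. s n z - f z)) \<longlonglongrightarrow> 0" and "f \<in> L2 M"
proof -
  have bd: "AE z in M. \<forall>n. \<bar>s n z\<bar> \<le> w z"
    using bound by (simp add: AE_all_countable)
  have fw: "AE z in M. \<bar>f z\<bar> \<le> w z"
    using lim bd
  proof eventually_elim
    case (elim z)
    then show ?case
      by (intro tendsto_upperbound[of "\<lambda>n. \<bar>s n z\<bar>" _ sequentially]) (auto intro: tendsto_rabs)
  qed
  show "f \<in> L2 M"
    by (rule L2_dominated[OF w f(1) fw])
  have "(\<lambda>n. \<integral>z. (s n z - f z)\<^sup>2 \<partial>M) \<longlonglongrightarrow> (\<integral>z. 0 \<partial>M)"
  proof (rule integral_dominated_convergence[where w="\<lambda>z. 4 * (w z)\<^sup>2"])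
    show "AE z in M. (\<lambda>n. (s n z - f z)\<^sup>2) \<longlonglongrightarrow> 0"
      using lim by eventually_elim (auto intro!: tendsto_eq_intros)
    show "AE z in M. norm ((s n z - f z)\<^sup>2) \<le> 4 * (w z)\<^sup>2" for n
      using bd fw
    proof eventually_elim
      case (elim z)
      then have "\<bar>s n z\<bar> \<le> w z" "\<bar>f z\<bar> \<le> w z"
        by auto
      then have "\<bar>s n z - f z\<bar> \<le> \<bar>2 * w z\<bar>"
        by linarith
      then have "(s n z - f z)\<^sup>2 \<le> (2 * w z)\<^sup>2"
        by (simp add: abs_le_square_iff)
      then show ?case by (simp add: power_mult_distrib)
    qed
  qed (use f w in \<open>auto simp: L2_def\<close>)
  then show "(\<lambda>n. L2_norm M (\<lambda>z. s n z - f z)) \<longlonglongrightarrow> 0"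
    unfolding L2_norm_def using tendsto_real_sqrt by fastforce
qed

lemma nn_integral_power2_L2:
  assumes "f \<in> L2 M"
  shows "(\<integral>\<^sup>+z. ennreal ((f z)\<^sup>2) \<partial>M) = ennreal ((L2_norm M f)\<^sup>2)"
  unfolding L2_norm_power2 using assms by (intro nn_integral_eq_integral) (auto simp: L2_def)

text \<open>Applied to the squares, Fatou's lemma yields membership and the norm bound together,
  without a dominating function.\<close>

lemma L2_Fatou:
  assumes s: "\<And>n. s n \<in> L2 M" and f: "f \<in> borel_measurable M"
    and lim: "AE z in M. (\<lambda>n. s n z) \<longlonglongrightarrow> f z" and bound: "\<And>n. L2_norm M (s n) \<le> B"
  shows "f \<in> L2 M" and "L2_norm M f \<le> B"
proof -
  have B: "0 \<le> B"
    using bound[of 0] L2_norm_nonneg[of M "s 0"] by linarith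
  have "(\<integral>\<^sup>+z. ennreal ((f z)\<^sup>2) \<partial>M) = (\<integral>\<^sup>+z. liminf (\<lambda>n. ennreal ((s n z)\<^sup>2)) \<partial>M)"
  proof (rule nn_integral_cong_AE, use lim in eventually_elim)
    case (elim z)
    then have "(\<lambda>n. ennreal ((s n z)\<^sup>2)) \<longlonglongrightarrow> ennreal ((f z)\<^sup>2)"
      by (intro tendsto_ennrealI tendsto_power)
    then show ?case
      by (rule lim_imp_Liminf[OF sequentially_bot, symmetric])
  qed
  also have "\<dots> \<le> liminf (\<lambda>n. \<integral>\<^sup>+z. ennreal ((s n z)\<^sup>2) \<partial>M)"
    using s by (intro nn_integral_liminf) (auto simp: L2_def)
  also have "\<dots> \<le> liminf (\<lambda>n::nat. ennreal (B\<^sup>2))"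
    by (intro Liminf_mono always_eventually allI)
       (auto simp: nn_integral_power2_L2[OF s] intro!: ennreal_leI power_mono bound)
  also have "\<dots> = ennreal (B\<^sup>2)"
    by (simp add: Liminf_const)
  finally have *: "(\<integral>\<^sup>+z. ennreal ((f z)\<^sup>2) \<partial>M) \<le> ennreal (B\<^sup>2)" .
  show fL2: "f \<in> L2 M"
  proof (rule L2_I[OF f], rule integrableI_bounded)
    have "(\<integral>\<^sup>+z. ennreal (norm ((f z)\<^sup>2)) \<partial>M) = (\<integral>\<^sup>+z. ennreal ((f z)\<^sup>2) \<partial>M)"
      by simp
    also have "\<dots> < \<infinity>"
      using * by (rule le_less_trans) simp
    finally show "(\<integral>\<^sup>+z. ennreal (norm ((f z)\<^sup>2)) \<partial>M) < \<infinity>" .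
  qed (use f in simp)
  have "(L2_norm M f)\<^sup>2 \<le> B\<^sup>2"
    using * by (simp add: nn_integral_power2_L2[OF fL2])
  then show "L2_norm M f \<le> B"
    using B by (rule power2_le_imp_le)
qed

lemma (in finite_measure) L2_bounded:
  assumes "f \<in> borel_measurable M" "\<And>z. \<bar>f z\<bar> \<le> c"
  shows "f \<in> L2 M"
  by (rule L2_dominated[where w="\<lambda>_. c"]) (use assms in \<open>auto simp: L2_def\<close>)

text \<open>Completeness in the form that the gliding hump needs. On a finite measure Cauchy-Schwarz
  against 1 turns the \<open>L2\<close> bounds into a summable series of integrals, so the
  increments are absolutely summable almost everywhere. The constant 3 / 2 is the sum of the powers
  of 1 / 3.\<close>

lemma (in finite_measure) L2_geometric_limit:
  assumes x: "\<And>n. x n \<in> L2 M" and d: "\<And>n. L2_norm M (\<lambda>z. x (Suc n) z - x n z) \<le> (1/3)^n"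
  obtains y where "y \<in> L2 M" "\<And>n. L2_norm M (\<lambda>z. y z - x n z) \<le> 3 / 2 * (1/3)^n"
proof -
  define e where "e n z = x (Suc n) z - x n z" for n z
  define m where "m = L2_norm M (\<lambda>_. 1)"
  have e: "e n \<in> L2 M" for n
    unfolding e_def by (intro L2_diff x)
  have e_meas: "e n \<in> borel_measurable M" for n
    using e by (rule L2_measurable)
  have x_meas: "x n \<in> borel_measurable M" for n
    using x by (rule L2_measurable)
  have "(\<integral>\<^sup>+z. ennreal \<bar>e n z\<bar> \<partial>M) \<le> ennreal (m * (1/3)^n)" for n
  proof -
    have "(\<lambda>z. \<bar>e n z\<bar>) \<in> L2 M"
      using e[of n] L2_measurable[OF e[of n]] by (simp add: L2_def)
    moreover have one: "(\<lambda>z. 1) \<in> L2 M"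
      by (rule L2_bounded[where c=1]) auto
    ultimately have *: "integrable M (\<lambda>z. \<bar>e n z\<bar> * 1)"
      "\<bar>\<integral>z. \<bar>e n z\<bar> * 1 \<partial>M\<bar> \<le> L2_norm M (\<lambda>z. \<bar>e n z\<bar>) * m"
      unfolding m_def by (rule L2_integrable_mult, rule L2_Cauchy_Schwarz)
    have "L2_norm M (\<lambda>z. \<bar>e n z\<bar>) = L2_norm M (e n)"
      by (simp add: L2_norm_def)
    also have "\<dots> \<le> (1/3)^n"
      using d[of n] unfolding e_def[abs_def] .
    finally have "L2_norm M (\<lambda>z. \<bar>e n z\<bar>) * m \<le> (1/3)^n * m"
      by (intro mult_right_mono) (auto simp: m_def)
    with * have "(\<integral>z. \<bar>e n z\<bar> \<partial>M) \<le> m * (1/3)^n"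
      by (simp add: mult.commute)
    then have "ennreal (\<integral>z. \<bar>e n z\<bar> \<partial>M) \<le> ennreal (m * (1/3)^n)"
      by (rule ennreal_leI)
    then show ?thesis
      by (subst nn_integral_eq_integral) (use * in auto)
  qed
  then have "(\<integral>\<^sup>+z. (\<Sum>n. ennreal \<bar>e n z\<bar>) \<partial>M) \<le> (\<Sum>n. ennreal (m * (1/3)^n))"
    using e_meas by (subst nn_integral_suminf) (auto intro!: suminf_le)
  also have "\<dots> = ennreal (m * (\<Sum>n. (1/3)^n))"
    by (subst suminf_ennreal2) (auto simp: m_def suminf_mult summable_geometric)
  also have "\<dots> < \<infinity>"
    by simp
  finally have "AE z in M. (\<Sum>n. ennreal \<bar>e n z\<bar>) \<noteq> \<infinity>"
    using e_meas by (intro nn_integral_PInf_AE) auto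
  then have "AE z in M. summable (\<lambda>n. e n z)"
  proof eventually_elim
    case (elim z)
    then have "summable (\<lambda>n. \<bar>e n z\<bar>)"
      by (intro summable_suminf_not_top) auto
    then show ?case
      by (rule summable_rabs_cancel)
  qed
  then have lim: "AE z in M. (\<lambda>n. x n z) \<longlonglongrightarrow> lim (\<lambda>n. x n z)"
  proof eventually_elim
    case (elim z)
    then have "(\<lambda>n. \<Sum>i<n. e i z) \<longlonglongrightarrow> (\<Sum>i. e i z)"
      by (rule summable_LIMSEQ)
    then have "(\<lambda>n. x n z - x 0 z) \<longlonglongrightarrow> (\<Sum>i. e i z)"
      by (simp add: e_def sum_lessThan_telescope[of "\<lambda>n. x n z"])
    from tendsto_add[OF this tendsto_const[of "x 0 z"]] have "convergent (\<lambda>n. x n z)"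
      by (auto simp: convergent_def)
    then show ?case
      by (simp add: convergent_LIMSEQ_iff)
  qed
  \<comment> \<open>Where the sequence diverges, \<open>lim\<close> is an unspecified value;
    \<open>y\<close> is measurable all the same.\<close>
  define y where "y z = lim (\<lambda>n. x n z)" for z
  have y_meas: "y \<in> borel_measurable M"
    unfolding y_def using x_meas by (rule borel_measurable_lim_metric)
  have step: "L2_norm M (\<lambda>z. x (n + k) z - x n z) \<le> 3 / 2 * (1/3)^n" for n k
  proof -
    have "L2_norm M (\<lambda>z. \<Sum>i<k. e (n + i) z) \<le> (\<Sum>i<k. L2_norm M (e (n + i)))"
      by (intro L2_norm_sum_le e)
    also have "\<dots> \<le> (\<Sum>i<k. (1/3)^n * (1/3)^i)"
      using d by (intro sum_mono) (simp add: e_def[abs_def] power_add[symmetric] del: power_divide)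
    also have "\<dots> = (1/3)^n * (\<Sum>i<k. (1/3)^i)"
      by (simp add: sum_distrib_left)
    also have "\<dots> \<le> (1/3)^n * (3/2)"
    proof (intro mult_left_mono)
      show "(\<Sum>i<k. (1/3::real)^i) \<le> 3/2"
        by (subst sum_gp_strict) (auto simp: field_simps)
    qed simp
    finally show ?thesis
      using sum_lessThan_telescope[of "\<lambda>i. x (n + i) z" k for z]
      by (simp add: e_def mult.commute)
  qed
  have lim_n: "AE z in M. (\<lambda>k. x (n + k) z - x n z) \<longlonglongrightarrow> y z - x n z" for n
    using lim
  proof eventually_elim
    case (elim z)
    then show ?case
      unfolding y_def using LIMSEQ_ignore_initial_segment[OF elim, of n]
      by (intro tendsto_diff) (auto simp: add.commute)
  qed
  have *: "(\<lambda>z. y z - x n z) \<in> L2 M" "L2_norm M (\<lambda>z. y z - x n z) \<le> 3 / 2 * (1/3)^n" for n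
  proof -
    have "(\<lambda>z. x (n + k) z - x n z) \<in> L2 M" for k
      by (intro L2_diff x)
    moreover have "(\<lambda>z. y z - x n z) \<in> borel_measurable M"
      using x_meas y_meas by simp
    ultimately show "(\<lambda>z. y z - x n z) \<in> L2 M" "L2_norm M (\<lambda>z. y z - x n z) \<le> 3 / 2 * (1/3)^n"
      using lim_n[of n] step[of n] by (rule L2_Fatou)+
  qed
  show ?thesis
  proof
    show "y \<in> L2 M"
      using L2_add[OF *(1)[of 0] x[of 0]] by simp
  qed (use * in blast)
qed

lemma L2_norm_diff_le:
  assumes f: "f \<in> L2 M" and g: "g \<in> L2 M"
  shows "L2_norm M (\<lambda>z. f z - g z) \<le> L2_norm M f + L2_norm M g"
  using L2_norm_triangle[OF f L2_scale[OF g, of "-1"]] L2_norm_scale[of M "-1" g] by simp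

section \<open>Strongly continuous semigroups on the space of square integrable functions\<close>

locale L2_semigroup = finite_measure M for M :: "'z measure" +
  fixes T :: "real \<Rightarrow> ('z \<Rightarrow> real) \<Rightarrow> 'z \<Rightarrow> real"
  assumes semigroup: "strongly_continuous_semigroup M T"
begin

lemma T_L2: "0 \<le> t \<Longrightarrow> f \<in> L2 M \<Longrightarrow> T t f \<in> L2 M"
  using semigroup by (simp add: strongly_continuous_semigroup_def)

lemma T_cong:
  "0 \<le> t \<Longrightarrow> f \<in> L2 M \<Longrightarrow> g \<in> L2 M \<Longrightarrow> AE z in M. f z = g z \<Longrightarrow> AE z in M. T t f z = T t g z"
  using semigroup by (simp add: strongly_continuous_semigroup_def)

lemma T_lin:
  "0 \<le> t \<Longrightarrow> f \<in> L2 M \<Longrightarrow> g \<in> L2 M \<Longrightarrow>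
     AE z in M. T t (\<lambda>y. a * f y + b * g y) z = a * T t f z + b * T t g z"
  using semigroup by (simp add: strongly_continuous_semigroup_def)

lemma T_bounded: "0 \<le> t \<Longrightarrow> \<exists>C. \<forall>f\<in>L2 M. L2_norm M (T t f) \<le> C * L2_norm M f"
  using semigroup by (simp add: strongly_continuous_semigroup_def)

lemma T_zero: "f \<in> L2 M \<Longrightarrow> AE z in M. T 0 f z = f z"
  using semigroup by (simp add: strongly_continuous_semigroup_def)

lemma T_add: "0 \<le> s \<Longrightarrow> 0 \<le> t \<Longrightarrow> f \<in> L2 M \<Longrightarrow> AE z in M. T (s + t) f z = T s (T t f) z"
  using semigroup by (simp add: strongly_continuous_semigroup_def)

lemma T_continuous: "f \<in> L2 M \<Longrightarrow> ((\<lambda>t. L2_norm M (\<lambda>z. T t f z - f z)) \<longlongrightarrow> 0) (at_right 0)"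
  using semigroup by (simp add: strongly_continuous_semigroup_def)

lemma T_diff:
  "0 \<le> t \<Longrightarrow> f \<in> L2 M \<Longrightarrow> g \<in> L2 M \<Longrightarrow> AE z in M. T t (\<lambda>y. f y - g y) z = T t f z - T t g z"
  using T_lin[of t f g 1 "-1"] by simp

lemma T_scale: "0 \<le> t \<Longrightarrow> f \<in> L2 M \<Longrightarrow> AE z in M. T t (\<lambda>y. a * f y) z = a * T t f z"
  using T_lin[of t f f a 0] by simp

lemma norm_T_diff:
  assumes "0 \<le> t" "f \<in> L2 M" "g \<in> L2 M"
  shows "L2_norm M (\<lambda>z. T t f z - T t g z) = L2_norm M (T t (\<lambda>z. f z - g z))"
proof (rule L2_norm_cong_AE[symmetric])
  show "AE z in M. T t (\<lambda>z. f z - g z) z = T t f z - T t g z"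
    by (rule T_diff[OF assms])
qed (auto intro!: L2_measurable T_L2 L2_diff assms)

lemma norm_T_scale:
  assumes "0 \<le> t" "f \<in> L2 M"
  shows "L2_norm M (T t (\<lambda>z. a * f z)) = \<bar>a\<bar> * L2_norm M (T t f)"
proof -
  have "L2_norm M (T t (\<lambda>z. a * f z)) = L2_norm M (\<lambda>z. a * T t f z)"
    using T_scale[OF assms] by (intro L2_norm_cong_AE) (auto intro!: L2_measurable T_L2 L2_scale assms)
  then show ?thesis by (simp add: L2_norm_scale)
qed

text \<open>Closes the interval: \<open>s = 0\<close> is outside the scope of the right-hand limit
  and is settled by \<open>T_zero\<close>.\<close>

lemma T_continuous':
  assumes "f \<in> L2 M" "0 < \<eta>"
  obtains t where "0 < t" "\<And>s. 0 \<le> s \<Longrightarrow> s \<le> t \<Longrightarrow> L2_norm M (\<lambda>z. T s f z - f z) \<le> \<eta>"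
proof -
  have "\<forall>\<^sub>F s in at_right 0. L2_norm M (\<lambda>z. T s f z - f z) < \<eta>"
    using T_continuous[OF assms(1)] assms(2) by (rule order_tendstoD)
  then obtain b where b: "0 < b" "\<And>s. 0 < s \<Longrightarrow> s < b \<Longrightarrow> L2_norm M (\<lambda>z. T s f z - f z) < \<eta>"
    unfolding eventually_at_right_field by auto
  have "L2_norm M (\<lambda>z. T 0 f z - f z) = L2_norm M (\<lambda>z. 0)"
    using T_zero[OF assms(1)] by (intro L2_norm_cong_AE) (auto intro!: L2_measurable L2_diff T_L2 assms)
  then have 0: "L2_norm M (\<lambda>z. T 0 f z - f z) = 0"
    by (simp add: L2_norm_def)
  show ?thesis
  proof (rule that[of "b / 2"])
    show "L2_norm M (\<lambda>z. T s f z - f z) \<le> \<eta>" if "0 \<le> s" "s \<le> b / 2" for s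
      using b(2)[of s] 0 that b(1) assms(2) by (cases "s = 0") auto
  qed (use b in simp)
qed

section \<open>Operator norms and uniform boundedness near time zero\<close>

definition op_norm :: "real \<Rightarrow> real" where
  "op_norm t = Inf {C. 0 \<le> C \<and> (\<forall>f\<in>L2 M. L2_norm M (T t f) \<le> C * L2_norm M f)}"

lemma
  assumes t: "0 \<le> t"
  shows norm_T_le: "f \<in> L2 M \<Longrightarrow> L2_norm M (T t f) \<le> op_norm t * L2_norm M f"
    and op_norm_lower: "0 \<le> C \<Longrightarrow> C < op_norm t \<Longrightarrow> \<exists>f\<in>L2 M. C * L2_norm M f < L2_norm M (T t f)"
proof -
  let ?S = "{C. 0 \<le> C \<and> (\<forall>f\<in>L2 M. L2_norm M (T t f) \<le> C * L2_norm M f)}"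
  obtain C0 where C0: "\<forall>f\<in>L2 M. L2_norm M (T t f) \<le> C0 * L2_norm M f"
    using T_bounded[OF t] by blast
  have "\<bar>C0\<bar> \<in> ?S"
  proof (intro CollectI conjI ballI)
    fix f assume f: "f \<in> L2 M"
    have "L2_norm M (T t f) \<le> C0 * L2_norm M f" using C0 f by blast
    also have "\<dots> \<le> \<bar>C0\<bar> * L2_norm M f" by (intro mult_right_mono) auto
    finally show "L2_norm M (T t f) \<le> \<bar>C0\<bar> * L2_norm M f" .
  qed simp
  then have ne: "?S \<noteq> {}" by blast
  \<comment> \<open>This is the purpose of \<open>0 \<le> C\<close> in \<open>op_norm\<close>:
    without it the set would be unbounded below if all norms vanished.\<close>
  have bb: "bdd_below ?S" by (rule bdd_belowI[of _ 0]) auto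
  show "L2_norm M (T t f) \<le> op_norm t * L2_norm M f" if f: "f \<in> L2 M"
  proof (cases "L2_norm M f = 0")
    case True
    then show ?thesis using C0 f by fastforce
  next
    case False
    then have pos: "0 < L2_norm M f"
      using L2_norm_nonneg[of M f] by linarith
    have "L2_norm M (T t f) / L2_norm M f \<le> op_norm t"
      unfolding op_norm_def
    proof (rule cInf_greatest[OF ne])
      fix C assume "C \<in> ?S"
      then show "L2_norm M (T t f) / L2_norm M f \<le> C"
        using f pos by (simp add: divide_le_eq)
    qed
    then show ?thesis using pos by (simp add: divide_le_eq)
  qed
  show "\<exists>f\<in>L2 M. C * L2_norm M f < L2_norm M (T t f)" if "0 \<le> C" "C < op_norm t"
  proof (rule ccontr)
    assume "\<not> ?thesis"
    then have "C \<in> ?S" using that by force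
    then have "op_norm t \<le> C"
      unfolding op_norm_def using bb by (rule cInf_lower)
    with that show False by simp
  qed
qed

text \<open>The uniform boundedness principle by the gliding hump argument: a Baire-free proof that only
  needs limits of geometrically convergent sequences.\<close>

lemma locally_bounded:
  obtains \<delta> B where "0 < \<delta>" "1 \<le> B"
    "\<And>t f. 0 \<le> t \<Longrightarrow> t \<le> \<delta> \<Longrightarrow> f \<in> L2 M \<Longrightarrow> L2_norm M (T t f) \<le> B * L2_norm M f"
proof -
  have "\<exists>\<delta>>0. \<exists>B\<ge>1. \<forall>t. 0 \<le> t \<and> t \<le> \<delta> \<longrightarrow> (\<forall>f\<in>L2 M. L2_norm M (T t f) \<le> B * L2_norm M f)"
  proof (rule ccontr)
    assume "\<not> ?thesis"
    then have unb: "\<exists>t. 0 \<le> t \<and> t \<le> \<delta> \<and> (\<exists>f\<in>L2 M. B * L2_norm M f < L2_norm M (T t f))"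
      if "0 < \<delta>" "1 \<le> B" for \<delta> B
      using that by (meson not_le)
    \<comment> \<open>The factor \<open>3 ^ n\<close> compensates the size of the
      \<open>n\<close>-th hump, 4 compensates the share 1 / 4 that survives in \<open>big\<close>,
      and \<open>Suc n\<close> is the growth that contradicts continuity.\<close>
    have "\<exists>t. 0 \<le> t \<and> t \<le> 1 / Suc n \<and> 4 * 3^n * real (Suc n) \<le> op_norm t" for n :: nat
    proof -
      have "1 * 1 \<le> 3^n * real (Suc n)"
        by (intro mult_mono one_le_power) auto
      then have "1 \<le> 4 * 3^n * real (Suc n)"
        unfolding mult.assoc by linarith
      from unb[OF _ this, of "1 / Suc n"] obtain t f where tf: "0 \<le> t" "t \<le> 1 / Suc n" "f \<in> L2 M"
        "4 * 3^n * real (Suc n) * L2_norm M f < L2_norm M (T t f)"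
        by (metis of_nat_0_less_iff zero_less_Suc zero_less_divide_1_iff)
      then have "4 * 3^n * real (Suc n) * L2_norm M f < op_norm t * L2_norm M f"
        using norm_T_le[of t f] by simp
      then have "4 * 3^n * real (Suc n) \<le> op_norm t"
        using mult_right_mono[of "op_norm t" "4 * 3^n * real (Suc n)" "L2_norm M f"] L2_norm_nonneg[of M f] by linarith
      with tf show ?thesis by auto
    qed
    then obtain t where t: "\<And>n::nat. 0 \<le> t n" "\<And>n. t n \<le> 1 / Suc n"
      "\<And>n. 4 * 3^n * real (Suc n) \<le> op_norm (t n)"
      by metis
    have opn_pos: "0 < op_norm (t n)" for n
      by (rule less_le_trans[OF _ t(3)]) simp
    \<comment> \<open>An almost maximising function, rescaled to the size of the \<open>n\<close>-th
      hump. The fraction 3 / 4 must exceed the fraction 1 / 2 that the later humps can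
      cancel.\<close>
    have "\<exists>g\<in>L2 M. L2_norm M g = (1/3)^n \<and> 3/4 * op_norm (t n) * (1/3)^n \<le> L2_norm M (T (t n) g)" for n
    proof -
      obtain f where f: "f \<in> L2 M" "3/4 * op_norm (t n) * L2_norm M f < L2_norm M (T (t n) f)"
        using op_norm_lower[of "t n" "3/4 * op_norm (t n)"] t(1) opn_pos[of n] by auto
      have "L2_norm M f \<noteq> 0"
        using f norm_T_le[of "t n" f] t(1) by force
      then have pos: "0 < L2_norm M f"
        using L2_norm_nonneg[of M f] by linarith
      define a where "a = (1/3)^n / L2_norm M f"
      have a: "0 < a" using pos by (simp add: a_def)
      have na: "L2_norm M (\<lambda>z. a * f z) = (1/3)^n"
        using pos a by (simp add: L2_norm_scale) (simp add: a_def)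
      have "3/4 * op_norm (t n) * (1/3)^n = a * (3/4 * op_norm (t n) * L2_norm M f)"
        using pos by (simp add: a_def)
      also have "\<dots> \<le> a * L2_norm M (T (t n) f)"
        using f a by (intro mult_left_mono) auto
      also have "\<dots> = L2_norm M (T (t n) (\<lambda>z. a * f z))"
        using a f t(1) by (simp add: norm_T_scale)
      finally have "3/4 * op_norm (t n) * (1/3)^n \<le> L2_norm M (T (t n) (\<lambda>z. a * f z))" .
      with na f show ?thesis
        by (intro bexI[of _ "\<lambda>z. a * f z"] conjI L2_scale) auto
    qed
    then obtain g where g: "\<And>n. g n \<in> L2 M" "\<And>n. L2_norm M (g n) = (1/3)^n"
      "\<And>n. 3/4 * op_norm (t n) * (1/3)^n \<le> L2_norm M (T (t n) (g n))"
      by metis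
    \<comment> \<open>The sign of each hump is chosen so that the image under \<open>T (t n)\<close>
      does not shrink below that of \<open>g n\<close>. One of the two signs works, since
      \<open>2 * g n\<close> is the difference of the two candidates.\<close>
    define x where "x = rec_nat (\<lambda>z. 0) (\<lambda>n y.
       if L2_norm M (T (t n) (g n)) \<le> L2_norm M (T (t n) (\<lambda>z. y z + g n z))
       then (\<lambda>z. y z + g n z) else (\<lambda>z. y z - g n z))"
    have x_Suc: "x (Suc n) = (if L2_norm M (T (t n) (g n)) \<le> L2_norm M (T (t n) (\<lambda>z. x n z + g n z))
       then (\<lambda>z. x n z + g n z) else (\<lambda>z. x n z - g n z))" for n
      by (simp add: x_def)
    have x: "x n \<in> L2 M" for n
    proof (induction n)
      case 0
      then show ?case using L2_zero by (simp add: x_def)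
    next
      case (Suc n)
      then show ?case unfolding x_Suc using g(1)[of n] by (auto intro: L2_add L2_diff)
    qed
    have "L2_norm M (\<lambda>z. x (Suc n) z - x n z) \<le> (1/3)^n" for n
      using g(2)[of n] L2_norm_scale[of M "-1" "g n"] by (simp add: x_Suc)
    then obtain y where y: "y \<in> L2 M" "\<And>n. L2_norm M (\<lambda>z. y z - x n z) \<le> 3 / 2 * (1/3)^n"
      using L2_geometric_limit[of x] x by blast
    have hump: "L2_norm M (T (t n) (g n)) \<le> L2_norm M (T (t n) (x (Suc n)))" for n
    proof (cases "L2_norm M (T (t n) (g n)) \<le> L2_norm M (T (t n) (\<lambda>z. x n z + g n z))")
      case False
      have *: "(\<lambda>z. x n z + g n z) \<in> L2 M" "(\<lambda>z. x n z - g n z) \<in> L2 M"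
        using x g by (auto intro: L2_add L2_diff)
      have "2 * L2_norm M (T (t n) (g n)) = L2_norm M (T (t n) (\<lambda>z. 2 * g n z))"
        using t g by (simp add: norm_T_scale)
      also have "(\<lambda>z. 2 * g n z) = (\<lambda>z. (x n z + g n z) - (x n z - g n z))"
        by auto
      also have "L2_norm M (T (t n) \<dots>) =
          L2_norm M (\<lambda>z. T (t n) (\<lambda>z. x n z + g n z) z - T (t n) (\<lambda>z. x n z - g n z) z)"
        using t * by (intro norm_T_diff[symmetric]) auto
      also have "\<dots> \<le> L2_norm M (T (t n) (\<lambda>z. x n z + g n z)) + L2_norm M (T (t n) (\<lambda>z. x n z - g n z))"
        using t * by (intro L2_norm_diff_le T_L2) auto
      finally show ?thesis using False by (simp add: x_Suc)
    qed (simp add: x_Suc)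
    \<comment> \<open>The tail after step \<open>n\<close> has norm at most
      \<open>3 / 2 * (1/3) ^ Suc n\<close>, which is half of \<open>(1/3) ^ n\<close>. So 3 / 4 - 1
      / 2 = 1 / 4 of the operator norm remains visible.\<close>
    have big: "real (Suc n) \<le> L2_norm M (T (t n) y)" for n
    proof -
      have "L2_norm M (T (t n) (x (Suc n))) \<le>
          L2_norm M (T (t n) y) + L2_norm M (\<lambda>z. T (t n) (x (Suc n)) z - T (t n) y z)"
        using t x y by (intro L2_norm_le_add T_L2) auto
      also have "L2_norm M (\<lambda>z. T (t n) (x (Suc n)) z - T (t n) y z) = L2_norm M (T (t n) (\<lambda>z. y z - x (Suc n) z))"
        using t x y by (subst L2_norm_minus_commute) (auto intro: norm_T_diff)
      also have "\<dots> \<le> op_norm (t n) * L2_norm M (\<lambda>z. y z - x (Suc n) z)"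
        using t x y by (intro norm_T_le L2_diff) auto
      also have "\<dots> \<le> op_norm (t n) * (3 / 2 * (1/3)^Suc n)"
        using opn_pos[of n] y(2)[of "Suc n"] by (intro mult_left_mono) auto
      also have "\<dots> = 1/2 * op_norm (t n) * (1/3)^n"
        by simp
      finally have "1/4 * op_norm (t n) * (1/3)^n \<le> L2_norm M (T (t n) y)"
        using hump[of n] g(3)[of n] by simp
      moreover have "1/4 * (4 * 3^n * real (Suc n)) * (1/3)^n \<le> 1/4 * op_norm (t n) * (1/3)^n"
        using t(3)[of n] by (intro mult_right_mono mult_left_mono) (auto simp del: of_nat_Suc)
      moreover have "1/4 * (4 * 3^n * real (Suc n)) * (1/3)^n = real (Suc n)"
        by (simp add: power_one_over del: of_nat_Suc)
      ultimately show ?thesis by linarith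
    qed
    \<comment> \<open>The times \<open>t n\<close> tend to 0, and by strong continuity at the single
      function \<open>y\<close> the norms of \<open>T (t n) y\<close> are eventually at most
      \<open>L2_norm M y + 1\<close>.\<close>
    obtain s where s: "0 < s" "\<And>r. 0 \<le> r \<Longrightarrow> r \<le> s \<Longrightarrow> L2_norm M (\<lambda>z. T r y z - y z) \<le> 1"
      using T_continuous'[OF y(1), of 1] by auto
    obtain n :: nat where n: "max (1 / s) (L2_norm M y + 1) < n"
      using reals_Archimedean2 by blast
    then have "1 / Suc n \<le> s"
      using s by (simp add: field_simps)
    then have "L2_norm M (\<lambda>z. T (t n) y z - y z) \<le> 1"
      using t[of n] by (intro s) auto
    then have "L2_norm M (T (t n) y) \<le> L2_norm M y + 1"
      using L2_norm_le_add[OF T_L2[OF t(1) y(1)] y(1), of n] by simp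
    with big[of n] n show False by simp
  qed
  then show ?thesis using that by blast
qed

section \<open>Linearity and closedness of the generator\<close>

lemma generator_lin:
  assumes "(f, g) \<in> semigroup_generator M T" "(f', g') \<in> semigroup_generator M T"
  shows "(\<lambda>z. a * f z + b * f' z, \<lambda>z. a * g z + b * g' z) \<in> semigroup_generator M T"
proof -
  note A = assms[unfolded semigroup_generator_def]
  have f: "f \<in> L2 M" "g \<in> L2 M" "f' \<in> L2 M" "g' \<in> L2 M" using A by auto
  let ?q = "\<lambda>f g t. L2_norm M (\<lambda>z. (T t f z - f z) / t - g z)"
  have "(?q (\<lambda>z. a * f z + b * f' z) (\<lambda>z. a * g z + b * g' z) \<longlongrightarrow> 0) (at_right 0)"
  proof (rule tendsto_sandwich[where f="\<lambda>_. 0"])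
    show "((\<lambda>t. \<bar>a\<bar> * ?q f g t + \<bar>b\<bar> * ?q f' g' t) \<longlongrightarrow> 0) (at_right 0)"
      using A by (auto intro!: tendsto_eq_intros)
    have "?q (\<lambda>z. a * f z + b * f' z) (\<lambda>z. a * g z + b * g' z) t \<le> \<bar>a\<bar> * ?q f g t + \<bar>b\<bar> * ?q f' g' t"
      if t: "0 < t" for t
    proof -
      have m: "(\<lambda>z. (T t f z - f z) / t - g z) \<in> L2 M" "(\<lambda>z. (T t f' z - f' z) / t - g' z) \<in> L2 M"
        "(\<lambda>z. (T t (\<lambda>z. a * f z + b * f' z) z - (a * f z + b * f' z)) / t - (a * g z + b * g' z)) \<in> L2 M"
        using f t by (auto intro!: L2_diff L2_divide T_L2 L2_lin)
      have "?q (\<lambda>z. a * f z + b * f' z) (\<lambda>z. a * g z + b * g' z) t =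
          L2_norm M (\<lambda>z. a * ((T t f z - f z) / t - g z) + b * ((T t f' z - f' z) / t - g' z))"
      proof (rule L2_norm_cong_AE)
        show "AE z in M. (T t (\<lambda>z. a * f z + b * f' z) z - (a * f z + b * f' z)) / t - (a * g z + b * g' z) =
           a * ((T t f z - f z) / t - g z) + b * ((T t f' z - f' z) / t - g' z)"
          using T_lin[of t f f' a b] f t by (auto simp: field_simps)
      qed (use m in \<open>auto intro!: L2_measurable L2_lin\<close>)
      also have "\<dots> \<le> L2_norm M (\<lambda>z. a * ((T t f z - f z) / t - g z)) + L2_norm M (\<lambda>z. b * ((T t f' z - f' z) / t - g' z))"
        using m by (intro L2_norm_triangle L2_scale) auto
      finally show ?thesis by (simp add: L2_norm_scale)
    qed
    then show "\<forall>\<^sub>F t in at_right 0. ?q (\<lambda>z. a * f z + b * f' z) (\<lambda>z. a * g z + b * g' z) t \<le> \<bar>a\<bar> * ?q f g t + \<bar>b\<bar> * ?q f' g' t"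
      by (auto simp: eventually_at_right_field intro: exI[of _ 1])
  qed auto
  with f show ?thesis
    by (auto simp: semigroup_generator_def intro: L2_lin)
qed

lemma generator_diff:
  "(f, g) \<in> semigroup_generator M T \<Longrightarrow> (f', g') \<in> semigroup_generator M T \<Longrightarrow>
    (\<lambda>z. f z - f' z, \<lambda>z. g z - g' z) \<in> semigroup_generator M T"
  using generator_lin[of f g f' g' 1 "-1"] by simp

text \<open>Telescoping replaces the formula \<open>T\<^sub>t f - f = \<integral>\<^sub>0\<^sup>t T\<^sub>s \<L> f ds\<close> and so avoids vector-valued integrals.\<close>

lemma T_telescope:
  assumes "0 \<le> h" "f \<in> L2 M"
  shows "AE z in M. T (real n * h) f z - f z = (\<Sum>j<n. T (real j * h) (\<lambda>y. T h f y - f y) z)"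
proof (induction n)
  case 0
  then show ?case using T_zero[OF assms(2)] by simp
next
  case (Suc n)
  have "AE z in M. T (real n * h + h) f z = T (real n * h) (T h f) z"
    using assms by (intro T_add) auto
  moreover have "AE z in M. T (real n * h) (\<lambda>y. T h f y - f y) z = T (real n * h) (T h f) z - T (real n * h) f z"
    using assms by (intro T_diff T_L2) auto
  ultimately show ?case
    using Suc by eventually_elim (simp add: algebra_simps)
qed

text \<open>With steps \<open>h = t / n\<close> the quotient at time \<open>t\<close> is the average
  of \<open>T (j * h)\<close> applied to the quotient at time \<open>h\<close>. Replacing the latter
  by \<open>k\<close> costs \<open>B\<close> times its distance from \<open>k\<close>, moving
  \<open>k\<close> by the semigroup costs \<eta>, and as \<open>n\<close> grows the quotient at
  \<open>h\<close> converges to \<open>g\<close>.\<close>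

lemma generator_diff_quotient:
  assumes fg: "(f, g) \<in> semigroup_generator M T" and k: "k \<in> L2 M" and t: "0 < t"
    and B: "\<And>s u. 0 \<le> s \<Longrightarrow> s \<le> t \<Longrightarrow> u \<in> L2 M \<Longrightarrow> L2_norm M (T s u) \<le> B * L2_norm M u"
    and \<eta>: "\<And>s. 0 \<le> s \<Longrightarrow> s \<le> t \<Longrightarrow> L2_norm M (\<lambda>z. T s k z - k z) \<le> \<eta>"
  shows "L2_norm M (\<lambda>z. (T t f z - f z) / t - k z) \<le> B * L2_norm M (\<lambda>z. g z - k z) + \<eta>"
proof -
  have f: "f \<in> L2 M" and g: "g \<in> L2 M"
    and lim: "((\<lambda>t. L2_norm M (\<lambda>z. (T t f z - f z) / t - g z)) \<longlongrightarrow> 0) (at_right 0)"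
    using fg by (auto simp: semigroup_generator_def)
  let ?q = "\<lambda>h. L2_norm M (\<lambda>z. (T h f z - f z) / h - k z)"
  have main: "?q t \<le> B * ?q h + \<eta>" if h: "h = t / real n" "0 < n" for h n
  proof -
    define e where "e y = (T h f y - f y) / h - k y" for y
    have h0: "0 < h" using h t by simp
    have e: "e \<in> L2 M"
      unfolding e_def using h0 f k by (auto intro!: L2_diff L2_divide T_L2)
    have jh: "0 \<le> real j * h" "real j * h \<le> t" if "j < n" for j
    proof -
      have "real j * h \<le> real n * h" using that h0 by (intro mult_right_mono) auto
      also have "real n * h = t" using h by simp
      finally show "real j * h \<le> t" .
    qed (use h0 in simp)
    have tn: "real n * h = t" using h by simp
    have Te: "AE z in M. \<forall>j\<in>{..<n}. T (real j * h) (\<lambda>y. T h f y - f y) z = h * T (real j * h) e z + h * T (real j * h) k z"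
    proof (rule AE_finite_allI)
      fix j assume "j \<in> {..<n}"
      have "AE z in M. T (real j * h) (\<lambda>y. h * e y + h * k y) z = h * T (real j * h) e z + h * T (real j * h) k z"
        using h0 by (intro T_lin e k) auto
      also have "(\<lambda>y. h * e y + h * k y) = (\<lambda>y. T h f y - f y)"
        using h0 by (auto simp: e_def field_simps)
      finally show "AE z in M. T (real j * h) (\<lambda>y. T h f y - f y) z = h * T (real j * h) e z + h * T (real j * h) k z" .
    qed simp
    have eq: "AE z in M. (T t f z - f z) / t - k z =
       (1 / real n) * (\<Sum>j<n. T (real j * h) e z + (T (real j * h) k z - k z))"
      using Te T_telescope[OF less_imp_le[OF h0] f, of n]
    proof eventually_elim
      case (elim z)
      have "T t f z - f z = (\<Sum>j<n. h * T (real j * h) e z + h * T (real j * h) k z)"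
        using elim tn by simp
      also have "\<dots> = h * (\<Sum>j<n. T (real j * h) e z + T (real j * h) k z)"
        by (simp add: sum_distrib_left distrib_left)
      finally have "(T t f z - f z) / t = (1 / real n) * (\<Sum>j<n. T (real j * h) e z + T (real j * h) k z)"
        using h(2) h0 unfolding tn[symmetric] by (simp add: field_simps)
      moreover have "(1 / real n) * (\<Sum>j<n. k z) = k z"
        using h by simp
      ultimately show ?case
        by (simp add: sum.distrib sum_subtractf algebra_simps)
    qed
    have L: "T (real j * h) e \<in> L2 M" "(\<lambda>z. T (real j * h) k z - k z) \<in> L2 M" for j
      using h0 e k by (auto intro!: T_L2 L2_diff)
    have "?q t = L2_norm M (\<lambda>z. (1 / real n) * (\<Sum>j<n. T (real j * h) e z + (T (real j * h) k z - k z)))"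
    proof (rule L2_norm_cong_AE[OF _ _ eq])
      show "(\<lambda>z. (T t f z - f z) / t - k z) \<in> borel_measurable M"
        using t f k by (auto intro!: L2_measurable L2_diff L2_divide T_L2)
      show "(\<lambda>z. (1 / real n) * (\<Sum>j<n. T (real j * h) e z + (T (real j * h) k z - k z))) \<in> borel_measurable M"
        by (intro L2_measurable L2_scale L2_sum L2_add L)
    qed
    also have "\<dots> = (1 / real n) * L2_norm M (\<lambda>z. \<Sum>j<n. T (real j * h) e z + (T (real j * h) k z - k z))"
      by (subst L2_norm_scale) simp
    also have "\<dots> \<le> (1 / real n) * (\<Sum>j<n. L2_norm M (\<lambda>z. T (real j * h) e z + (T (real j * h) k z - k z)))"
      by (intro mult_left_mono L2_norm_sum_le L2_add L) auto
    also have "\<dots> \<le> (1 / real n) * (\<Sum>j<n. B * L2_norm M e + \<eta>)"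
    proof (intro mult_left_mono sum_mono)
      fix j assume j: "j \<in> {..<n}"
      have "L2_norm M (\<lambda>z. T (real j * h) e z + (T (real j * h) k z - k z)) \<le>
          L2_norm M (T (real j * h) e) + L2_norm M (\<lambda>z. T (real j * h) k z - k z)"
        by (intro L2_norm_triangle L)
      also have "\<dots> \<le> B * L2_norm M e + \<eta>"
        using jh[of j] j by (intro add_mono B \<eta> e) auto
      finally show "L2_norm M (\<lambda>z. T (real j * h) e z + (T (real j * h) k z - k z)) \<le> B * L2_norm M e + \<eta>" .
    qed simp
    also have "\<dots> = B * ?q h + \<eta>"
      using h(2) by (simp add: e_def[abs_def] del: h)
    finally show ?thesis .
  qed
  have seq: "filterlim (\<lambda>n. t / real (Suc n)) (at_right 0) sequentially"
    unfolding filterlim_at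
  proof
    have "(\<lambda>n. t * inverse (real (Suc n))) \<longlonglongrightarrow> t * 0"
      by (intro tendsto_mult tendsto_const LIMSEQ_inverse_real_of_nat)
    then show "(\<lambda>n. t / real (Suc n)) \<longlonglongrightarrow> 0"
      by (simp add: divide_inverse)
  qed (use t in auto)
  \<comment> \<open>No sign of \<open>B\<close> is assumed. The bound at time 0 forces it to be
    nonnegative unless all norms vanish, and then the estimate is trivial.\<close>
  have B0: "0 \<le> B \<or> (\<forall>u\<in>L2 M. L2_norm M u = 0)"
  proof (rule disjCI, rule ccontr)
    assume "\<not> (\<forall>u\<in>L2 M. L2_norm M u = 0)" "\<not> 0 \<le> B"
    then obtain u where u: "u \<in> L2 M" "L2_norm M u \<noteq> 0" "B < 0" by auto
    then have "0 < L2_norm M u" using L2_norm_nonneg[of M u] by linarith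
    then have "B * L2_norm M u < 0" using u by (simp add: mult_neg_pos)
    then show False
      using B[of 0 u] u t L2_norm_nonneg[of M "T 0 u"] by linarith
  qed
  have "?q t \<le> B * (L2_norm M (\<lambda>z. (T (t / real (Suc n)) f z - f z) / (t / real (Suc n)) - g z) +
      L2_norm M (\<lambda>z. g z - k z)) + \<eta>" for n
  proof -
    let ?h = "t / real (Suc n)"
    have m: "(\<lambda>z. (T ?h f z - f z) / ?h) \<in> L2 M"
      using t f by (intro L2_diff L2_divide T_L2) auto
    have "B * ?q ?h \<le> B * (L2_norm M (\<lambda>z. (T ?h f z - f z) / ?h - g z) + L2_norm M (\<lambda>z. g z - k z))"
    proof (cases "0 \<le> B")
      case True
      then show ?thesis
        by (intro mult_left_mono L2_norm_triangle3 m g k)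
    next
      case False
      with B0 have "\<forall>u\<in>L2 M. L2_norm M u = 0" by blast
      moreover have "(\<lambda>z. (T ?h f z - f z) / ?h - k z) \<in> L2 M" "(\<lambda>z. (T ?h f z - f z) / ?h - g z) \<in> L2 M"
          "(\<lambda>z. g z - k z) \<in> L2 M"
        by (intro L2_diff m g k)+
      ultimately show ?thesis by simp
    qed
    with main[of ?h "Suc n"] show ?thesis by simp
  qed
  moreover have "(\<lambda>n. B * (L2_norm M (\<lambda>z. (T (t / real (Suc n)) f z - f z) / (t / real (Suc n)) - g z) +
      L2_norm M (\<lambda>z. g z - k z)) + \<eta>) \<longlonglongrightarrow> B * (0 + L2_norm M (\<lambda>z. g z - k z)) + \<eta>"
    by (intro tendsto_intros filterlim_compose[OF lim seq])
  ultimately show ?thesis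
    by (intro tendsto_lowerbound[where F=sequentially and a="?q t"]) auto
qed

text \<open>At a fixed time \<open>t\<close> the distance of the quotients of \<open>f n\<close> and
  \<open>f'\<close> is at most \<open>(B + 1) / t\<close> times a null sequence, so \<open>n\<close>
  is sent to infinity first. The preceding estimate with \<open>k = g'\<close> is uniform in
  \<open>n\<close> and leaves only the modulus of continuity of \<open>T\<close> at
  \<open>g'\<close>, which vanishes as \<open>t\<close> tends to 0.\<close>

lemma generator_closed:
  assumes fg: "\<And>n. (f n, g n) \<in> semigroup_generator M T" and f': "f' \<in> L2 M" and g': "g' \<in> L2 M"
    and lim_f: "(\<lambda>n. L2_norm M (\<lambda>z. f n z - f' z)) \<longlonglongrightarrow> 0"
    and lim_g: "(\<lambda>n. L2_norm M (\<lambda>z. g n z - g' z)) \<longlonglongrightarrow> 0"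
  shows "(f', g') \<in> semigroup_generator M T"
proof -
  obtain \<delta> B where \<delta>: "0 < \<delta>" "1 \<le> B"
    "\<And>t f. 0 \<le> t \<Longrightarrow> t \<le> \<delta> \<Longrightarrow> f \<in> L2 M \<Longrightarrow> L2_norm M (T t f) \<le> B * L2_norm M f"
    using locally_bounded by blast
  have f: "f n \<in> L2 M" for n using fg[of n] by (simp add: semigroup_generator_def)
  have key: "L2_norm M (\<lambda>z. (T t f' z - f' z) / t - g' z) \<le> \<eta>"
    if t: "0 < t" "t \<le> \<delta>" and \<eta>: "\<And>s. 0 \<le> s \<Longrightarrow> s \<le> t \<Longrightarrow> L2_norm M (\<lambda>z. T s g' z - g' z) \<le> \<eta>" for t \<eta>
  proof -
    have "L2_norm M (\<lambda>z. (T t f' z - f' z) / t - g' z) \<le>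
        (B + 1) / t * L2_norm M (\<lambda>z. f n z - f' z) + (B * L2_norm M (\<lambda>z. g n z - g' z) + \<eta>)" for n
    proof -
      have m: "(\<lambda>z. (T t f' z - f' z) / t) \<in> L2 M" "(\<lambda>z. (T t (f n) z - f n z) / t) \<in> L2 M"
        using t f f' by (auto intro!: L2_diff L2_divide T_L2)
      have d: "(\<lambda>z. f n z - f' z) \<in> L2 M" using f f' by (intro L2_diff)
      have "L2_norm M (\<lambda>z. (T t f' z - f' z) / t - (T t (f n) z - f n z) / t) =
          L2_norm M (\<lambda>z. (T t (\<lambda>z. f n z - f' z) z - (f n z - f' z)) / t)"
        using T_diff[of t "f n" f'] t f f' d
        by (subst L2_norm_minus_commute, intro L2_norm_cong_AE)
           (auto intro!: L2_measurable L2_diff L2_divide T_L2 simp: diff_divide_distrib)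
      also have "\<dots> = L2_norm M (\<lambda>z. T t (\<lambda>z. f n z - f' z) z - (f n z - f' z)) / t"
        using t by (subst L2_norm_divide) simp
      also have "\<dots> \<le> (L2_norm M (T t (\<lambda>z. f n z - f' z)) + L2_norm M (\<lambda>z. f n z - f' z)) / t"
        using t d by (intro divide_right_mono L2_norm_diff_le T_L2) auto
      also have "\<dots> \<le> (B * L2_norm M (\<lambda>z. f n z - f' z) + L2_norm M (\<lambda>z. f n z - f' z)) / t"
        using t by (intro divide_right_mono add_right_mono \<delta>(3) d) auto
      also have "\<dots> = (B + 1) / t * L2_norm M (\<lambda>z. f n z - f' z)"
        by (simp add: field_simps)
      finally have 1: "L2_norm M (\<lambda>z. (T t f' z - f' z) / t - (T t (f n) z - f n z) / t) \<le>
          (B + 1) / t * L2_norm M (\<lambda>z. f n z - f' z)" .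
      have "L2_norm M (\<lambda>z. (T t (f n) z - f n z) / t - g' z) \<le> B * L2_norm M (\<lambda>z. g n z - g' z) + \<eta>"
        using t by (intro generator_diff_quotient[OF fg g'] \<delta>(3) \<eta>) auto
      with 1 L2_norm_triangle3[OF m g'] show ?thesis by linarith
    qed
    moreover have "(\<lambda>n. (B + 1) / t * L2_norm M (\<lambda>z. f n z - f' z) + (B * L2_norm M (\<lambda>z. g n z - g' z) + \<eta>))
        \<longlonglongrightarrow> (B + 1) / t * 0 + (B * 0 + \<eta>)"
      by (intro tendsto_intros lim_f lim_g)
    ultimately show ?thesis
      by (intro tendsto_lowerbound[where F=sequentially and a="L2_norm M (\<lambda>z. (T t f' z - f' z) / t - g' z)"]) auto
  qed
  have "((\<lambda>t. L2_norm M (\<lambda>z. (T t f' z - f' z) / t - g' z)) \<longlongrightarrow> 0) (at_right 0)"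
  proof (rule order_tendstoI)
    fix a :: real assume "0 < a"
    then obtain t where t: "0 < t" "\<And>s. 0 \<le> s \<Longrightarrow> s \<le> t \<Longrightarrow> L2_norm M (\<lambda>z. T s g' z - g' z) \<le> a / 2"
      using T_continuous'[OF g', of "a / 2"] by auto
    have "L2_norm M (\<lambda>z. (T s f' z - f' z) / s - g' z) < a" if "0 < s" "s < min t \<delta>" for s
    proof -
      have "L2_norm M (\<lambda>z. (T s f' z - f' z) / s - g' z) \<le> a / 2"
        using that by (intro key t) auto
      with \<open>0 < a\<close> show ?thesis by linarith
    qed
    then show "\<forall>\<^sub>F s in at_right 0. L2_norm M (\<lambda>z. (T s f' z - f' z) / s - g' z) < a"
      using t(1) \<delta>(1) unfolding eventually_at_right_field by (intro exI[of _ "min t \<delta>"]) auto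
  qed (auto intro!: always_eventually intro: less_le_trans)
  with f' g' show ?thesis by (simp add: semigroup_generator_def)
qed

section \<open>Exponential rescaling and the a priori bound for the resolvent\<close>

lemma rescaled_semigroup: "L2_semigroup M (\<lambda>t f z. exp (- a * t) * T t f z)"
proof
  show "strongly_continuous_semigroup M (\<lambda>t f z. exp (- a * t) * T t f z)"
    unfolding strongly_continuous_semigroup_def
  proof (intro conjI ballI allI impI)
    fix t b c :: real and f g assume *: "0 \<le> t" "f \<in> L2 M" "g \<in> L2 M"
    show "AE z in M. exp (- a * t) * T t (\<lambda>y. b * f y + c * g y) z =
        b * (exp (- a * t) * T t f z) + c * (exp (- a * t) * T t g z)"
      using T_lin[OF *, of b c] by eventually_elim (simp add: algebra_simps)
  next
    fix t :: real and f g assume *: "0 \<le> t" "f \<in> L2 M" "g \<in> L2 M" "AE z in M. f z = g z"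
    then show "AE z in M. exp (- a * t) * T t f z = exp (- a * t) * T t g z"
      using T_cong by auto
  next
    fix t :: real assume "0 \<le> t"
    then show "\<exists>C. \<forall>f\<in>L2 M. L2_norm M (\<lambda>z. exp (- a * t) * T t f z) \<le> C * L2_norm M f"
      using norm_T_le[of t]
      by (intro exI[of _ "exp (- a * t) * op_norm t"]) (auto simp: L2_norm_scale mult.assoc)
  next
    fix s t :: real and f assume *: "0 \<le> s" "0 \<le> t" "f \<in> L2 M"
    have "AE z in M. T s (\<lambda>y. exp (- a * t) * T t f y) z = exp (- a * t) * T s (T t f) z"
      using * by (intro T_scale T_L2) auto
    then show "AE z in M. exp (- a * (s + t)) * T (s + t) f z =
        exp (- a * s) * T s (\<lambda>z. exp (- a * t) * T t f z) z"
      using T_add[OF *] by eventually_elim (simp add: algebra_simps exp_add[symmetric] flip: mult.assoc)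
  next
    fix f assume f: "f \<in> L2 M"
    then show "AE z in M. exp (- a * 0) * T 0 f z = f z"
      using T_zero by simp
    show "((\<lambda>t. L2_norm M (\<lambda>z. exp (- a * t) * T t f z - f z)) \<longlongrightarrow> 0) (at_right 0)"
    proof (rule tendsto_sandwich[where f="\<lambda>_. 0"])
      have "((\<lambda>t. exp (- a * t)) \<longlongrightarrow> exp (- a * 0)) (at_right 0)"
        by (intro tendsto_intros)
      then have "((\<lambda>t. \<bar>exp (- a * t)\<bar> * L2_norm M (\<lambda>z. T t f z - f z) + \<bar>exp (- a * t) - 1\<bar> * L2_norm M f)
          \<longlongrightarrow> \<bar>exp (- a * 0)\<bar> * 0 + \<bar>exp (- a * 0) - 1\<bar> * L2_norm M f) (at_right 0)"
        by (intro tendsto_intros T_continuous f)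
      then show "((\<lambda>t. \<bar>exp (- a * t)\<bar> * L2_norm M (\<lambda>z. T t f z - f z) + \<bar>exp (- a * t) - 1\<bar> * L2_norm M f)
          \<longlongrightarrow> 0) (at_right 0)"
        by simp
      have "L2_norm M (\<lambda>z. exp (- a * t) * T t f z - f z) \<le>
          \<bar>exp (- a * t)\<bar> * L2_norm M (\<lambda>z. T t f z - f z) + \<bar>exp (- a * t) - 1\<bar> * L2_norm M f" if "0 < t" for t
      proof -
        have "L2_norm M (\<lambda>z. exp (- a * t) * (T t f z - f z) + (exp (- a * t) - 1) * f z) \<le>
          L2_norm M (\<lambda>z. exp (- a * t) * (T t f z - f z)) + L2_norm M (\<lambda>z. (exp (- a * t) - 1) * f z)"
          using that f by (intro L2_norm_triangle L2_scale L2_diff T_L2) auto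
        also have "(\<lambda>z. exp (- a * t) * (T t f z - f z) + (exp (- a * t) - 1) * f z) =
            (\<lambda>z. exp (- a * t) * T t f z - f z)"
          by (auto simp: algebra_simps)
        finally show ?thesis by (simp only: L2_norm_scale)
      qed
      then show "\<forall>\<^sub>F t in at_right 0. L2_norm M (\<lambda>z. exp (- a * t) * T t f z - f z) \<le>
          \<bar>exp (- a * t)\<bar> * L2_norm M (\<lambda>z. T t f z - f z) + \<bar>exp (- a * t) - 1\<bar> * L2_norm M f"
        by (auto simp: eventually_at_right_field intro: exI[of _ 1])
    qed auto
  qed (auto intro: T_L2 L2_scale)
qed

text \<open>A product rule: the error consists of the original one times the exponential, the
  deviation of the exponential from 1 acting on \<open>v\<close>, and the error of its difference
  quotient acting on \<open>w\<close>.\<close>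

lemma rescaled_generator:
  assumes "(w, v) \<in> semigroup_generator M T"
  shows "(w, \<lambda>z. v z - a * w z) \<in> semigroup_generator M (\<lambda>t f z. exp (- a * t) * T t f z)"
proof -
  have w: "w \<in> L2 M" and v: "v \<in> L2 M"
    and lim: "((\<lambda>t. L2_norm M (\<lambda>z. (T t w z - w z) / t - v z)) \<longlongrightarrow> 0) (at_right 0)"
    using assms by (auto simp: semigroup_generator_def)
  have e: "((\<lambda>t. exp (- a * t)) \<longlongrightarrow> 1) (at_right 0)"
    by (rule tendsto_eq_intros refl | simp)+
  have "((\<lambda>t. exp (- a * t)) has_real_derivative - a) (at 0)"
    by (auto intro!: derivative_eq_intros)
  then have "((\<lambda>t. (exp (- a * t) - 1) / t) \<longlongrightarrow> - a) (at 0)"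
    by (simp add: DERIV_def)
  then have d: "((\<lambda>t. (exp (- a * t) - 1) / t) \<longlongrightarrow> - a) (at_right 0)"
    by (rule tendsto_mono[OF at_le, rotated]) simp
  let ?R = "\<lambda>t. \<bar>exp (- a * t)\<bar> * L2_norm M (\<lambda>z. (T t w z - w z) / t - v z) +
        (\<bar>exp (- a * t) - 1\<bar> * L2_norm M v + \<bar>(exp (- a * t) - 1) / t + a\<bar> * L2_norm M w)"
  have "((\<lambda>t. L2_norm M (\<lambda>z. (exp (- a * t) * T t w z - w z) / t - (v z - a * w z))) \<longlongrightarrow> 0) (at_right 0)"
  proof (rule tendsto_sandwich[where f="\<lambda>_. 0"])
    have "(?R \<longlongrightarrow> \<bar>1\<bar> * 0 + (\<bar>1 - 1\<bar> * L2_norm M v + \<bar>- a + a\<bar> * L2_norm M w)) (at_right 0)"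
      by (intro tendsto_intros lim e d)
    then show "(?R \<longlongrightarrow> 0) (at_right 0)" by simp
    have "L2_norm M (\<lambda>z. (exp (- a * t) * T t w z - w z) / t - (v z - a * w z)) \<le> ?R t" if t: "0 < t" for t
    proof -
      have m: "(\<lambda>z. (T t w z - w z) / t - v z) \<in> L2 M"
        using t w v by (intro L2_diff L2_divide T_L2) auto
      have "L2_norm M (\<lambda>z. exp (- a * t) * ((T t w z - w z) / t - v z) +
          ((exp (- a * t) - 1) * v z + ((exp (- a * t) - 1) / t + a) * w z)) \<le>
          L2_norm M (\<lambda>z. exp (- a * t) * ((T t w z - w z) / t - v z)) +
          (L2_norm M (\<lambda>z. (exp (- a * t) - 1) * v z) + L2_norm M (\<lambda>z. ((exp (- a * t) - 1) / t + a) * w z))"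
        by (rule order_trans[OF L2_norm_triangle add_left_mono[OF L2_norm_triangle]])
           (intro L2_scale L2_add m w v)+
      also have "(\<lambda>z. exp (- a * t) * ((T t w z - w z) / t - v z) +
          ((exp (- a * t) - 1) * v z + ((exp (- a * t) - 1) / t + a) * w z)) =
          (\<lambda>z. (exp (- a * t) * T t w z - w z) / t - (v z - a * w z))"
        using t by (auto simp: field_simps)
      finally show ?thesis by (simp only: L2_norm_scale)
    qed
    then show "\<forall>\<^sub>F t in at_right 0. L2_norm M (\<lambda>z. (exp (- a * t) * T t w z - w z) / t - (v z - a * w z)) \<le> ?R t"
      by (auto simp: eventually_at_right_field intro: exI[of _ 1])
  qed auto
  with w v show ?thesis
    by (auto simp: semigroup_generator_def intro: L2_diff L2_scale)
qed

text \<open>The value of \<open>a\<close> makes \<open>exp (- a * \<delta>) * B\<close> equal to 1 /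
  2, so the rescaled semigroup at time \<delta> halves norms. The change of \<open>w\<close> up to
  that time is at most \<open>\<delta> * B\<close> times the norm of \<open>a * w - v\<close>, by
  \<open>generator_diff_quotient\<close> compared with 0. Absorbing the half gives the constant
  \<open>2 * \<delta> * B\<close>.\<close>

lemma resolvent_estimate:
  obtains a C where "0 < a" "0 < C"
    "\<And>w v. (w, v) \<in> semigroup_generator M T \<Longrightarrow> L2_norm M w \<le> C * L2_norm M (\<lambda>z. a * w z - v z)"
proof -
  obtain \<delta> B where \<delta>: "0 < \<delta>" "1 \<le> B"
    "\<And>t f. 0 \<le> t \<Longrightarrow> t \<le> \<delta> \<Longrightarrow> f \<in> L2 M \<Longrightarrow> L2_norm M (T t f) \<le> B * L2_norm M f"
    using locally_bounded by blast
  define a where "a = ln (2 * B) / \<delta>"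
  have a: "0 < a" using \<delta> by (simp add: a_def)
  interpret S: L2_semigroup M "\<lambda>t f z. exp (- a * t) * T t f z"
    by (rule rescaled_semigroup)
  have eB: "exp (- a * \<delta>) * B = 1 / 2"
    using \<delta> by (simp add: a_def exp_minus field_simps)
  show ?thesis
  proof (rule that[OF a, of "2 * \<delta> * B"])
    fix w v assume wv: "(w, v) \<in> semigroup_generator M T"
    then have w: "w \<in> L2 M" and v: "v \<in> L2 M" by (auto simp: semigroup_generator_def)
    let ?S = "\<lambda>z. exp (- a * \<delta>) * T \<delta> w z"
    have Sw: "?S \<in> L2 M" using w \<delta> by (intro L2_scale T_L2) auto
    have "L2_norm M (\<lambda>z. (?S z - w z) / \<delta> - 0) \<le> B * L2_norm M (\<lambda>z. (v z - a * w z) - 0) + 0"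
    proof (rule S.generator_diff_quotient[OF rescaled_generator[OF wv] L2_zero \<delta>(1)])
      fix s u assume s: "0 \<le> s" "s \<le> \<delta>" "u \<in> L2 M"
      have "exp (- a * s) * L2_norm M (T s u) \<le> 1 * L2_norm M (T s u)"
        using a s by (intro mult_right_mono) auto
      also have "\<dots> \<le> B * L2_norm M u"
        using \<delta>(3)[of s u] s by simp
      finally show "L2_norm M (\<lambda>z. exp (- a * s) * T s u z) \<le> B * L2_norm M u"
        by (simp add: L2_norm_scale)
    next
      fix s assume s: "0 \<le> s" "s \<le> \<delta>"
      have "L2_norm M (T s (\<lambda>z. 0)) \<le> B * L2_norm M (\<lambda>z. 0)"
        using s by (intro \<delta>(3) L2_zero)
      moreover have "L2_norm M (\<lambda>z. 0) = 0" by (simp add: L2_norm_def)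
      ultimately show "L2_norm M (\<lambda>z. exp (- a * s) * T s (\<lambda>z. 0) z - 0) \<le> 0"
        by (simp add: L2_norm_scale mult_le_0_iff)
    qed
    then have *: "L2_norm M (\<lambda>z. w z - ?S z) \<le> \<delta> * B * L2_norm M (\<lambda>z. a * w z - v z)"
      using \<delta>(1) L2_norm_minus_commute[of M ?S w] L2_norm_minus_commute[of M v "\<lambda>z. a * w z"]
      by (simp add: L2_norm_divide field_simps)
    have "L2_norm M ?S \<le> exp (- a * \<delta>) * (B * L2_norm M w)"
      using \<delta>(3)[of \<delta> w] \<delta>(1) w by (simp add: L2_norm_scale)
    also have "\<dots> = L2_norm M w / 2"
      using eB by (simp flip: mult.assoc)
    finally have "L2_norm M w \<le> L2_norm M w / 2 + L2_norm M (\<lambda>z. w z - ?S z)"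
      using L2_norm_le_add[OF w Sw] by linarith
    with * show "L2_norm M w \<le> 2 * \<delta> * B * L2_norm M (\<lambda>z. a * w z - v z)"
      by simp
  qed (use \<delta> in auto)
qed

end

section \<open>A smooth bump function\<close>

definition flat :: "real poly \<Rightarrow> real \<Rightarrow> real" where
  "flat p x = (if 0 < x then poly p (1 / x) * exp (- (1 / x)) else 0)"

lemma poly_times_exp_tendsto_0: "((\<lambda>y. poly p y * exp (- y)) \<longlongrightarrow> (0::real)) at_top"
proof -
  have "((\<lambda>y. \<Sum>i\<le>degree p. coeff p i * (y ^ i / exp y)) \<longlongrightarrow> (\<Sum>i\<le>degree p. coeff p i * 0)) at_top"
    by (intro tendsto_intros tendsto_power_div_exp_0)
  then show ?thesis
    by (simp add: poly_altdef sum_distrib_right exp_minus divide_inverse mult.assoc)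
qed

lemma flat_tendsto_0: "(flat p \<longlongrightarrow> 0) (at 0)"
proof (rule filterlim_split_at)
  have "(flat p \<longlongrightarrow> 0) (at_right 0) \<longleftrightarrow> ((\<lambda>x. poly p (inverse x) * exp (- inverse x)) \<longlongrightarrow> 0) (at_right 0)"
    by (intro filterlim_cong refl)
       (auto simp: flat_def eventually_at_right_field inverse_eq_divide intro: exI[of _ 1])
  also have "\<dots>"
    by (rule filterlim_compose[OF poly_times_exp_tendsto_0 filterlim_inverse_at_top_right])
  finally show "(flat p \<longlongrightarrow> 0) (at_right 0)" .
  show "(flat p \<longlongrightarrow> 0) (at_left 0)"
    by (rule tendsto_eventually) (auto simp: flat_def eventually_at_left_field intro: exI[of _ "-1"])
qed

text \<open>The derivative of p(1/x) exp(-1/x) is (p - p')(1/x) exp(-1/x) / x^2, and the coefficient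
  list is the polynomial X^2. Functions of the form \<open>flat p\<close> are thus closed under
  differentiation.\<close>

definition flat_step :: "real poly \<Rightarrow> real poly" where
  "flat_step p = [:0, 0, 1:] * (p - pderiv p)"

lemma flat_derivative: "(flat p has_real_derivative flat (flat_step p) x) (at x)"
proof -
  consider "0 < x" | "x < 0" | "x = 0" by linarith
  then show ?thesis
  proof cases
    case 1
    have "((\<lambda>x. poly p (1 / x) * exp (- (1 / x))) has_real_derivative flat (flat_step p) x) (at x)"
      using 1 by (auto intro!: derivative_eq_intros poly_DERIV[THEN DERIV_chain2]
          simp: flat_def flat_step_def field_simps power2_eq_square)
    then show ?thesis
      by (rule has_field_derivative_transform_within_open[where S="{0<..}"]) (use 1 in \<open>auto simp: flat_def\<close>)
  next
    case 2
    have "((\<lambda>x. 0) has_real_derivative flat (flat_step p) x) (at x)"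
      using 2 by (simp add: flat_def)
    then show ?thesis
      by (rule has_field_derivative_transform_within_open[where S="{..<0}"]) (use 2 in \<open>auto simp: flat_def\<close>)
  next
    case 3
    \<comment> \<open>Dividing by \<open>h\<close> multiplies the polynomial by its variable, so the
      difference quotient at 0 is again of the form \<open>flat\<close> and tends to 0.\<close>
    have "flat p h / h = flat (pCons 0 p) h" for h
      by (simp add: flat_def)
    with flat_tendsto_0[of "pCons 0 p"] show ?thesis
      using 3 by (simp add: DERIV_def flat_def[of _ 0])
  qed
qed

text \<open>The \<open>k\<close>-th derivative of e exp(-1/(1 - s)), extended by 0 from
  \<open>s = 1\<close> on. The sign is that of the inner derivative, and \<open>exp 1\<close>
  normalises the value of \<open>bump 0\<close> at 0 to 1.\<close>

definition bump :: "nat \<Rightarrow> real \<Rightarrow> real" where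
  "bump k s = (- 1) ^ k * exp 1 * flat ((flat_step ^^ k) 1) (1 - s)"

lemma bump_derivative: "(bump k has_real_derivative bump (Suc k) s) (at s)"
  unfolding bump_def
  by (auto intro!: derivative_eq_intros DERIV_chain2[OF flat_derivative])

lemma continuous_bump: "continuous_on A (bump k)"
  by (rule DERIV_continuous_on[OF has_field_derivative_at_within[OF bump_derivative]])

lemma bump_0: "bump 0 0 = 1"
  by (simp add: bump_def flat_def exp_add[symmetric])

lemma bump_nonneg: "0 \<le> bump 0 s"
  by (simp add: bump_def flat_def)

lemma bump_le_1: "0 \<le> s \<Longrightarrow> bump 0 s \<le> 1"
  by (auto simp: bump_def flat_def exp_add[symmetric])

lemma bump_eq_0: "1 \<le> s \<Longrightarrow> bump 0 s = 0"
  by (simp add: bump_def flat_def)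

section \<open>Smooth functions of finitely many coordinates\<close>

inductive coord_poly :: "nat \<Rightarrow> ((nat \<Rightarrow> real) \<Rightarrow> real) \<Rightarrow> bool" for n where
  const: "coord_poly n (\<lambda>x. c)"
| coord: "i < n \<Longrightarrow> coord_poly n (\<lambda>x. x i)"
| add: "coord_poly n f \<Longrightarrow> coord_poly n g \<Longrightarrow> coord_poly n (\<lambda>x. f x + g x)"
| mult: "coord_poly n f \<Longrightarrow> coord_poly n g \<Longrightarrow> coord_poly n (\<lambda>x. f x * g x)"

text \<open>Admitting all \<open>bump k\<close> makes this class closed under partial derivatives.
  Smoothness of every order thereby reduces to the first partial derivatives in
  \<open>coord_smooth_partial\<close>.\<close>

inductive coord_smooth :: "nat \<Rightarrow> ((nat \<Rightarrow> real) \<Rightarrow> real) \<Rightarrow> bool" for n where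
  const: "coord_smooth n (\<lambda>x. c)"
| coord: "i < n \<Longrightarrow> coord_smooth n (\<lambda>x. x i)"
| add: "coord_smooth n f \<Longrightarrow> coord_smooth n g \<Longrightarrow> coord_smooth n (\<lambda>x. f x + g x)"
| mult: "coord_smooth n f \<Longrightarrow> coord_smooth n g \<Longrightarrow> coord_smooth n (\<lambda>x. f x * g x)"
| bump: "coord_smooth n f \<Longrightarrow> coord_smooth n (\<lambda>x. bump k (f x))"

lemma coord_poly_smooth: "coord_poly n f \<Longrightarrow> coord_smooth n f"
  by (induction rule: coord_poly.induct) (auto intro: coord_smooth.intros)

lemma coord_smooth_sum: "(\<And>i. i \<in> I \<Longrightarrow> coord_smooth n (f i)) \<Longrightarrow> coord_smooth n (\<lambda>x. \<Sum>i\<in>I. f i x)"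
  by (induction I rule: infinite_finite_induct) (auto intro: coord_smooth.intros)

lemma coord_smooth_local: "coord_smooth n f \<Longrightarrow> (\<And>i. i < n \<Longrightarrow> x i = y i) \<Longrightarrow> f x = f y"
  by (induction rule: coord_smooth.induct) auto

lemma coord_smooth_continuous: "coord_smooth n f \<Longrightarrow> continuous_on UNIV f"
proof (induction rule: coord_smooth.induct)
  case (bump f k)
  then show ?case
    by (intro continuous_on_compose2[OF continuous_bump]) auto
qed (auto intro!: continuous_intros continuous_on_product_coordinates)

lemma coord_smooth_partial:
  assumes "coord_smooth n f" "i < n"
  shows "\<exists>f'. coord_smooth n f' \<and> (\<forall>x. ((\<lambda>s. f (x(i := s))) has_real_derivative f' x) (at (x i)))"
  using assms(1)
proof (induction rule: coord_smooth.induct)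
  case (const c)
  show ?case by (rule exI[of _ "\<lambda>x. 0"]) (auto intro: coord_smooth.const)
next
  case (coord j)
  show ?case
    by (rule exI[of _ "\<lambda>x. if j = i then 1 else 0"]) (auto intro!: coord_smooth.const derivative_eq_intros)
next
  case (add f g)
  then obtain f' g' where "coord_smooth n f'" "coord_smooth n g'"
    and d: "\<And>x. ((\<lambda>s. f (x(i := s))) has_real_derivative f' x) (at (x i))"
    "\<And>x. ((\<lambda>s. g (x(i := s))) has_real_derivative g' x) (at (x i))" by blast
  moreover have "((\<lambda>s. f (x(i := s)) + g (x(i := s))) has_real_derivative f' x + g' x) (at (x i))" for x
    using DERIV_add[OF d(1)[of x] d(2)[of x]] .
  ultimately show ?case
    by (blast intro: coord_smooth.add)
next
  case (mult f g)
  then obtain f' g' where s: "coord_smooth n f'" "coord_smooth n g'"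
    and d: "\<And>x. ((\<lambda>s. f (x(i := s))) has_real_derivative f' x) (at (x i))"
    "\<And>x. ((\<lambda>s. g (x(i := s))) has_real_derivative g' x) (at (x i))" by blast
  have "((\<lambda>s. f (x(i := s)) * g (x(i := s))) has_real_derivative f' x * g x + g' x * f x) (at (x i))" for x
    using DERIV_mult[OF d(1)[of x] d(2)[of x]] by (simp add: fun_upd_triv)
  moreover have "coord_smooth n (\<lambda>x. f' x * g x + g' x * f x)"
    using s mult(1,2) by (intro coord_smooth.intros)
  ultimately show ?case by blast
next
  case (bump f k)
  then obtain f' where s: "coord_smooth n f'"
    and d: "\<And>x. ((\<lambda>s. f (x(i := s))) has_real_derivative f' x) (at (x i))" by blast
  have "((\<lambda>s. bump k (f (x(i := s)))) has_real_derivative bump (Suc k) (f x) * f' x) (at (x i))" for x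
    using DERIV_chain2[OF bump_derivative d[of x]] by (simp add: fun_upd_triv)
  moreover have "coord_smooth n (\<lambda>x. bump (Suc k) (f x) * f' x)"
    using s bump(1) by (intro coord_smooth.intros)
  ultimately show ?case by blast
qed

lemma coord_smooth_iterated_partial:
  assumes "coord_smooth n f"
  shows "set js \<subseteq> {..<n} \<Longrightarrow> coord_smooth n (iterated_partial js f)"
proof (induction js)
  case Nil
  with assms show ?case by simp
next
  case (Cons i js)
  then obtain f' where f': "coord_smooth n f'"
    "\<And>x. ((\<lambda>s. iterated_partial js f (x(i := s))) has_real_derivative f' x) (at (x i))"
    using coord_smooth_partial[of n "iterated_partial js f" i] by auto
  then have "iterated_partial (i # js) f = f'"
    by (auto simp: DERIV_imp_deriv)
  with f' show ?case by simp
qed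

lemma coord_smooth_compact_support:
  assumes f: "coord_smooth n f" and supp: "\<And>x i. i < n \<Longrightarrow> r < \<bar>x i\<bar> \<Longrightarrow> f x = 0"
  shows "smooth_compact_support n f"
  unfolding smooth_compact_support_def
proof (intro conjI allI impI)
  show "f x = f y" if "\<forall>i<n. x i = y i" for x y
    using coord_smooth_local[OF f, of x y] that by auto
  fix js assume js: "set js \<subseteq> {..<n}"
  note s = coord_smooth_iterated_partial[OF f js]
  show "continuous_on UNIV (iterated_partial js f)"
    by (rule coord_smooth_continuous[OF s])
  fix i x assume "i < n"
  with coord_smooth_partial[OF s] show "(\<lambda>s. iterated_partial js f (x(i := s))) differentiable (at (x i))"
    by (meson real_differentiable_def)
next
  show "\<exists>r. \<forall>x. (\<exists>i<n. r < \<bar>x i\<bar>) \<longrightarrow> f x = 0"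
    using supp by blast
qed

lemma bump_smooth_compact_support:
  assumes P: "coord_poly n P" and a: "0 < a"
  shows "smooth_compact_support n (\<lambda>x. bump 0 (a * (\<Sum>i<n. (x i)\<^sup>2)) * P x)"
proof (rule coord_smooth_compact_support)
  have "coord_smooth n (\<lambda>x. \<Sum>i<n. x i * x i)"
    by (intro coord_smooth_sum coord_smooth.intros) auto
  then show "coord_smooth n (\<lambda>x. bump 0 (a * (\<Sum>i<n. (x i)\<^sup>2)) * P x)"
    unfolding power2_eq_square
    by (intro coord_smooth.mult coord_smooth.bump coord_poly_smooth[OF P] coord_smooth.const)
  fix x i assume i: "i < n" "1 / sqrt a < \<bar>x i\<bar>"
  then have "1 < a * (x i)\<^sup>2"
  proof -
    have "(1 / sqrt a)\<^sup>2 < \<bar>x i\<bar>\<^sup>2"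
      using i a by (intro power_strict_mono) auto
    then show ?thesis
      using a by (simp add: power_divide field_simps)
  qed
  also have "a * (x i)\<^sup>2 \<le> a * (\<Sum>i<n. (x i)\<^sup>2)"
    using i a by (intro mult_left_mono member_le_sum) auto
  finally show "bump 0 (a * (\<Sum>i<n. (x i)\<^sup>2)) * P x = 0"
    by (simp add: bump_eq_0)
qed

section \<open>Averaging polynomials along the flow\<close>

text \<open>The flow in coordinates: index \<open>2 * i\<close> is the position and index
  \<open>Suc (2 * i)\<close> the velocity component along the \<open>i\<close>-th vector, as in
  \<open>pair_coord\<close>.\<close>

definition rotate_coords :: "real \<Rightarrow> (nat \<Rightarrow> real) \<Rightarrow> nat \<Rightarrow> real" where
  "rotate_coords t x i = (if even i then cos t * x i + sin t * x (Suc i) else cos t * x i - sin t * x (i - 1))"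

text \<open>Polynomials with continuous time-dependent coefficients, kept as sums of separated
  terms. A time integral then acts on the coefficients only and returns a polynomial.\<close>

inductive time_poly :: "nat \<Rightarrow> (real \<Rightarrow> (nat \<Rightarrow> real) \<Rightarrow> real) \<Rightarrow> bool" for n where
  base: "continuous_on UNIV a \<Longrightarrow> coord_poly n q \<Longrightarrow> time_poly n (\<lambda>t x. a t * q x)"
| add: "time_poly n f \<Longrightarrow> time_poly n g \<Longrightarrow> time_poly n (\<lambda>t x. f t x + g t x)"

lemma time_poly_mult:
  assumes "time_poly n f" "time_poly n g"
  shows "time_poly n (\<lambda>t x. f t x * g t x)"
  using assms(1)
proof (induction rule: time_poly.induct)
  case (base a q)
  from assms(2) show ?case
  proof (induction rule: time_poly.induct)
    case (base b p)
    then have "time_poly n (\<lambda>t x. (a t * b t) * (q x * p x))"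
      using \<open>continuous_on UNIV a\<close> \<open>coord_poly n q\<close>
      by (intro time_poly.base continuous_intros coord_poly.mult)
    then show ?case by (simp add: ac_simps)
  next
    case (add f g)
    then show ?case
      using time_poly.add[of n] by (simp add: distrib_left)
  qed
next
  case (add f f')
  then show ?case
    using time_poly.add[of n] by (simp add: distrib_right)
qed

lemma coord_poly_rotate:
  assumes "coord_poly (2 * m) P"
  shows "time_poly (2 * m) (\<lambda>t x. P (rotate_coords t x))"
  using assms
proof (induction rule: coord_poly.induct)
  case (const c)
  show ?case
    using time_poly.base[of "\<lambda>t. 1" "2 * m" "\<lambda>x. c"] by (simp add: coord_poly.const)
next
  case (coord i)
  show ?case
  proof (cases "even i")
    case True
    \<comment> \<open>The rotation pairs an even index with its successor. This is why the number of
      coordinates is always even.\<close>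
    with coord have "Suc i < 2 * m" by (auto elim!: evenE)
    then have "time_poly (2 * m) (\<lambda>t x. cos t * x i + sin t * x (Suc i))"
      using coord by (intro time_poly.intros coord_poly.intros continuous_intros) auto
    with True show ?thesis by (simp add: rotate_coords_def)
  next
    case False
    have "time_poly (2 * m) (\<lambda>t x. cos t * x i + (- sin t) * x (i - 1))"
      using coord by (intro time_poly.intros coord_poly.intros continuous_intros) auto
    with False show ?thesis by (simp add: rotate_coords_def)
  qed
next
  case (add f g)
  then show ?case by (intro time_poly.add)
next
  case (mult f g)
  then show ?case by (intro time_poly_mult)
qed

text \<open>Continuity in time is carried along in the induction, because splitting the integral of
  a sum needs integrable summands.\<close>

lemma time_poly_integral:
  assumes "time_poly n f" "continuous_on UNIV w"
  shows "coord_poly n (\<lambda>x. integral {a..b} (\<lambda>t. w t * f t x)) \<and> (\<forall>x. continuous_on UNIV (\<lambda>t. w t * f t x))"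
  using assms(1)
proof (induction rule: time_poly.induct)
  case (base c q)
  have "integral {a..b} (\<lambda>t. w t * (c t * q x)) = integral {a..b} (\<lambda>t. w t * c t) * q x" for x
    by (simp flip: mult.assoc)
  with base show ?case
    by (auto intro!: coord_poly.intros continuous_intros assms(2))
next
  case (add f g)
  have "integral {a..b} (\<lambda>t. w t * (f t x + g t x)) =
      integral {a..b} (\<lambda>t. w t * f t x) + integral {a..b} (\<lambda>t. w t * g t x)" for x
    unfolding distrib_left using add
    by (intro Henstock_Kurzweil_Integration.integral_add integrable_continuous_real)
       (auto intro: continuous_on_subset)
  then have "coord_poly n (\<lambda>x. integral {a..b} (\<lambda>t. w t * (f t x + g t x)))"
    using add by (auto intro: coord_poly.add)
  moreover have "continuous_on UNIV (\<lambda>t. w t * (f t x + g t x))" for x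
    unfolding distrib_left using add by (intro continuous_on_add) auto
  ultimately show ?case by blast
qed

text \<open>The flow has period \<open>2 \<pi>\<close>; the quotient is therefore \<open>\<integral>\<^sub>0\<^sup>\<infinity> exp (- \<beta> t) F (\<phi>\<^sub>t z) dt\<close>, the
  resolvent of the flow.\<close>

definition flow_average :: "real \<Rightarrow> ('a::real_vector \<times> 'a \<Rightarrow> real) \<Rightarrow> 'a \<times> 'a \<Rightarrow> real" where
  "flow_average \<beta> F z = integral {0..2 * pi} (\<lambda>t. exp (- \<beta> * t) * F (boomerang_flow t z)) / (1 - exp (- 2 * pi * \<beta>))"

definition pair_coord :: "(nat \<Rightarrow> 'a::real_inner) \<Rightarrow> nat \<Rightarrow> 'a \<times> 'a" where
  "pair_coord e i = (if even i then (e (i div 2), 0) else (0, e (i div 2)))"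

lemma pair_coord_flow:
  "(\<lambda>i. pair_coord e i \<bullet> boomerang_flow t z) = rotate_coords t (\<lambda>i. pair_coord e i \<bullet> z)"
proof
  fix i
  show "pair_coord e i \<bullet> boomerang_flow t z = rotate_coords t (\<lambda>i. pair_coord e i \<bullet> z) i"
    by (cases "even i")
       (auto simp: pair_coord_def rotate_coords_def boomerang_flow_def inner_prod_def inner_add_right inner_diff_right
          elim!: evenE oddE)
qed

lemma sum_pairs: "(\<Sum>i<2 * m. f i) = (\<Sum>i<m. f (2 * i) + f (Suc (2 * i)))" for f :: "nat \<Rightarrow> real"
  by (induction m) auto

text \<open>Consequently a cut-off that depends on the sum of squares is constant along the flow and
  contributes nothing to the flow derivative.\<close>

lemma rotate_coords_sum_squares: "(\<Sum>i<2 * m. (rotate_coords t x i)\<^sup>2) = (\<Sum>i<2 * m. (x i)\<^sup>2)"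
proof -
  have *: "(c * a + s * b)\<^sup>2 + (c * b - s * a)\<^sup>2 = (c\<^sup>2 + s\<^sup>2) * (a\<^sup>2 + b\<^sup>2)" for a b c s :: real
    by (simp add: power2_eq_square algebra_simps)
  show ?thesis
    unfolding sum_pairs
  proof (intro sum.cong refl)
    fix i
    show "(rotate_coords t x (2 * i))\<^sup>2 + (rotate_coords t x (Suc (2 * i)))\<^sup>2 = (x (2 * i))\<^sup>2 + (x (Suc (2 * i)))\<^sup>2"
      using *[of "cos t" "x (2 * i)" "sin t" "x (Suc (2 * i))"] by (simp add: rotate_coords_def)
  qed
qed

lemma smooth_cylinder_bump_average:
  fixes e :: "nat \<Rightarrow> 'a::real_inner"
  assumes P: "coord_poly (2 * m) P" and a: "0 < a"
  shows "(\<lambda>z. bump 0 (a * (\<Sum>i<2 * m. (pair_coord e i \<bullet> z)\<^sup>2)) *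
      flow_average \<beta> (\<lambda>z. P (\<lambda>i. pair_coord e i \<bullet> z)) z) \<in> smooth_cylinder_functions"
proof -
  define Q where "Q x = integral {0..2 * pi} (\<lambda>t. exp (- \<beta> * t) * P (rotate_coords t x)) * (1 / (1 - exp (- 2 * pi * \<beta>)))" for x
  have "coord_poly (2 * m) Q"
    unfolding Q_def
    by (intro coord_poly.mult coord_poly.const conjunct1[OF time_poly_integral] coord_poly_rotate[OF P] continuous_intros)
  from bump_smooth_compact_support[OF this a]
  have "smooth_compact_support (2 * m) (\<lambda>x. bump 0 (a * (\<Sum>i<2 * m. (x i)\<^sup>2)) * Q x)" .
  moreover have "flow_average \<beta> (\<lambda>z. P (\<lambda>i. pair_coord e i \<bullet> z)) z = Q (\<lambda>i. pair_coord e i \<bullet> z)" for z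
    unfolding flow_average_def Q_def pair_coord_flow by simp
  ultimately show ?thesis
    unfolding smooth_cylinder_functions_def
    by (intro CollectI exI[of _ "2 * m"] exI[of _ "pair_coord e"]
        exI[of _ "\<lambda>x. bump 0 (a * (\<Sum>i<2 * m. (x i)\<^sup>2)) * Q x"]) auto
qed

section \<open>Resolvents of the flow\<close>

lemma boomerang_flow_2pi: "boomerang_flow (t + 2 * pi) z = boomerang_flow t z"
  by (simp add: boomerang_flow_def)

lemma flow_average_continuous:
  fixes F :: "'a::real_normed_vector \<times> 'a \<Rightarrow> real"
  assumes "continuous_on UNIV F"
  shows "continuous_on UNIV (flow_average \<beta> F)"
proof -
  have "continuous_on (UNIV \<times> cbox 0 (2 * pi)) (\<lambda>(z, t). exp (- \<beta> * t) * F (boomerang_flow t z))"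
    unfolding split_beta
    by (intro continuous_intros continuous_on_compose2[OF assms]) auto
  from integral_continuous_on_param[OF this] show ?thesis
    unfolding flow_average_def[abs_def] divide_inverse by (intro continuous_on_mult continuous_on_const) simp
qed

lemma one_minus_exp_pos: "0 < \<beta> \<Longrightarrow> 0 < 1 - exp (- 2 * pi * \<beta>)"
  by simp

text \<open>The integral of exp(-\<beta> t) over one period is (1 - exp(-2 pi \<beta>)) / \<beta>,
  so the normalisation turns it into 1 / \<beta>. Two functions and two base points are allowed, to
  serve both the contraction argument and the comparison of a point with its projection.\<close>

lemma flow_average_diff_le:
  fixes F G :: "'a::real_normed_vector \<times> 'a \<Rightarrow> real"
  assumes \<beta>: "0 < \<beta>" and F: "continuous_on UNIV F" and G: "continuous_on UNIV G"
    and le: "\<And>t. \<bar>F (boomerang_flow t z) - G (boomerang_flow t y)\<bar> \<le> C"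
  shows "\<bar>flow_average \<beta> F z - flow_average \<beta> G y\<bar> \<le> C / \<beta>"
proof -
  let ?N = "1 - exp (- 2 * pi * \<beta>)"
  let ?d = "\<lambda>t. exp (- \<beta> * t) * (F (boomerang_flow t z) - G (boomerang_flow t y))"
  have c: "continuous_on S (\<lambda>t. exp (- \<beta> * t) * F (boomerang_flow t z))"
    "continuous_on S (\<lambda>t. exp (- \<beta> * t) * G (boomerang_flow t y))" for S
    by (intro continuous_intros continuous_on_compose2[OF F] continuous_on_compose2[OF G]; auto)+
  have "integral {0..2 * pi} ?d = integral {0..2 * pi} (\<lambda>t. exp (- \<beta> * t) * F (boomerang_flow t z)) -
      integral {0..2 * pi} (\<lambda>t. exp (- \<beta> * t) * G (boomerang_flow t y))"
    unfolding right_diff_distrib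
    by (intro Henstock_Kurzweil_Integration.integral_diff integrable_continuous_real c)
  then have eq: "flow_average \<beta> F z - flow_average \<beta> G y = integral {0..2 * pi} ?d / ?N"
    by (simp add: flow_average_def diff_divide_distrib[symmetric])
  have e: "((\<lambda>t. exp (- \<beta> * t) * C) has_integral (C / \<beta> * ?N)) {0..2 * pi}"
  proof -
    have "((\<lambda>t. exp (- \<beta> * t) * C) has_integral ((- C / \<beta> * exp (- \<beta> * (2 * pi))) - (- C / \<beta> * exp (- \<beta> * 0)))) {0..2 * pi}"
      using \<beta> by (intro fundamental_theorem_of_calculus)
        (auto intro!: derivative_eq_intros simp flip: has_real_derivative_iff_has_vector_derivative)
    then show ?thesis by (simp add: algebra_simps)
  qed
  have "norm (integral {0..2 * pi} ?d) \<le> integral {0..2 * pi} (\<lambda>t. exp (- \<beta> * t) * C)"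
  proof (rule integral_norm_bound_integral)
    show "?d integrable_on {0..2 * pi}"
      using c by (auto intro!: integrable_continuous_real continuous_on_diff simp: right_diff_distrib)
    show "norm (?d t) \<le> exp (- \<beta> * t) * C" for t
      using le[of t] by (simp add: abs_mult)
  qed (use e in auto)
  then have "\<bar>integral {0..2 * pi} ?d\<bar> \<le> C / \<beta> * ?N"
    using integral_unique[OF e] by simp
  then show ?thesis
    unfolding eq using one_minus_exp_pos[OF \<beta>] by (simp add: abs_divide divide_le_eq)
qed

lemma flow_average_bound:
  fixes F :: "'a::real_normed_vector \<times> 'a \<Rightarrow> real"
  assumes "0 < \<beta>" "continuous_on UNIV F" "\<And>t. \<bar>F (boomerang_flow t z)\<bar> \<le> C"
  shows "\<bar>flow_average \<beta> F z\<bar> \<le> C / \<beta>"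
  using flow_average_diff_le[OF assms(1,2), of "\<lambda>_. 0" z z C] assms(3)
  by (simp add: flow_average_def)

text \<open>The resolvent equation \<beta> u - X u = F for merely continuous \<open>F\<close>:
  starting later on the orbit shifts the time interval, so after a substitution the parameter
  appears in an exponential factor and in the end points of the integral only.\<close>

lemma flow_average_derivative:
  fixes F :: "'a::real_normed_vector \<times> 'a \<Rightarrow> real"
  assumes \<beta>: "0 < \<beta>" and F: "continuous_on UNIV F"
  shows "((\<lambda>t. flow_average \<beta> F (boomerang_flow t z)) has_real_derivative
    \<beta> * flow_average \<beta> F z - F z) (at 0)"
proof -
  define N where "N = 1 - exp (- 2 * pi * \<beta>)"
  have N: "0 < N" unfolding N_def by (rule one_minus_exp_pos[OF \<beta>])
  define g where "g t = F (boomerang_flow t z)" for t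
  define f where "f t = exp (- \<beta> * t) * g t" for t
  have cg: "continuous_on S g" for S
    unfolding g_def by (intro continuous_intros continuous_on_compose2[OF F]) auto
  have cf: "continuous_on UNIV f"
    unfolding f_def by (intro continuous_intros cg)
  define h where "h s = s * integral {0..1} (\<lambda>u. f (s * u))" for s
  have h: "(h has_real_derivative f s) (at s)" for s
    unfolding h_def by (rule stretched_integral_derivative[OF cf])
  have eq: "flow_average \<beta> F (boomerang_flow s z) = exp (\<beta> * s) * (h (2 * pi + s) - h s) / N" for s
  proof -
    have "((\<lambda>t. exp (- \<beta> * t) * F (boomerang_flow t (boomerang_flow s z))) has_integral
        (exp (\<beta> * s) * h (2 * pi + s) - exp (\<beta> * s) * h (0 + s))) {0..2 * pi}"
    proof (rule fundamental_theorem_of_calculus)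
      fix t
      have "((\<lambda>t. h (t + s)) has_real_derivative f (t + s)) (at t)"
        using h[of "t + s"] by (rule iffD1[OF DERIV_shift])
      then have "((\<lambda>t. exp (\<beta> * s) * h (t + s)) has_real_derivative exp (\<beta> * s) * f (t + s)) (at t within {0..2 * pi})"
        by (rule has_field_derivative_at_within[OF DERIV_cmult])
      moreover have "exp (\<beta> * s) * f (t + s) = exp (- \<beta> * t) * F (boomerang_flow t (boomerang_flow s z))"
      proof -
        have "exp (\<beta> * s) * exp (- \<beta> * (t + s)) = exp (- \<beta> * t)"
          by (subst exp_add[symmetric]) (simp add: algebra_simps)
        then show ?thesis
          by (simp only: f_def g_def boomerang_flow_add mult.assoc[symmetric])
      qed
      ultimately show "((\<lambda>t. exp (\<beta> * s) * h (t + s)) has_vector_derivative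
          exp (- \<beta> * t) * F (boomerang_flow t (boomerang_flow s z))) (at t within {0..2 * pi})"
        by (simp add: has_real_derivative_iff_has_vector_derivative)
    qed simp
    from integral_unique[OF this] show ?thesis
      by (simp add: flow_average_def N_def algebra_simps)
  qed
  \<comment> \<open>Periodicity makes both boundary terms multiples of \<open>F z\<close>; together
    they give \<open>- N * F z\<close>, and the division by \<open>N\<close> cancels.\<close>
  have "f (2 * pi) = exp (- 2 * pi * \<beta>) * F z"
    using boomerang_flow_2pi[of 0 z] by (simp add: f_def g_def boomerang_flow_0 ac_simps)
  moreover have "f 0 = F z" by (simp add: f_def g_def boomerang_flow_0)
  moreover have "((\<lambda>s. exp (\<beta> * s) * (h (2 * pi + s) - h s) / N) has_real_derivative
      (\<beta> * (h (2 * pi) - h 0) + (f (2 * pi) - f 0)) / N) (at 0)"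
  proof -
    have "((\<lambda>s. h (2 * pi + s)) has_real_derivative f (2 * pi)) (at 0)"
      using iffD1[OF DERIV_shift[of h "f (2 * pi)" 0 "2 * pi"]] h[of "2 * pi"] by (simp add: add.commute)
    from DERIV_diff[OF this h[of 0]]
    have "((\<lambda>s. h (2 * pi + s) - h s) has_real_derivative f (2 * pi) - f 0) (at 0)" .
    moreover have "((\<lambda>s. exp (\<beta> * s)) has_real_derivative \<beta>) (at 0)"
      by (auto intro!: derivative_eq_intros)
    ultimately have "((\<lambda>s. exp (\<beta> * s) * (h (2 * pi + s) - h s)) has_real_derivative
        \<beta> * (h (2 * pi + 0) - h 0) + (f (2 * pi) - f 0) * exp (\<beta> * 0)) (at 0)"
      by (rule DERIV_mult[rotated])
    from DERIV_cdivide[OF this, of N] show ?thesis by simp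
  qed
  ultimately have "((\<lambda>s. exp (\<beta> * s) * (h (2 * pi + s) - h s) / N) has_real_derivative
      (\<beta> * (h (2 * pi) - h 0) + (exp (- 2 * pi * \<beta>) * F z - F z)) / N) (at 0)"
    by simp
  moreover have "(\<beta> * (h (2 * pi) - h 0) + (exp (- 2 * pi * \<beta>) * F z - F z)) / N =
      \<beta> * flow_average \<beta> F z - F z"
  proof -
    have "flow_average \<beta> F z = (h (2 * pi) - h 0) / N"
      using eq[of 0] by (simp add: boomerang_flow_0)
    moreover have "exp (- 2 * pi * \<beta>) * F z - F z = - (N * F z)"
      by (simp add: N_def algebra_simps)
    ultimately show ?thesis
      using N by (simp add: diff_divide_distrib right_diff_distrib)
  qed
  ultimately show ?thesis
    by (simp add: eq)
qed

section \<open>Approximation by smooth cylinder functions\<close>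

locale orthonormal_family =
  fixes e :: "nat \<Rightarrow> 'h::real_inner"
  assumes orth: "i \<noteq> j \<Longrightarrow> e i \<bullet> e j = 0"
    and normalized: "e i = 0 \<or> norm (e i) = 1"
begin

definition proj :: "nat \<Rightarrow> 'h \<Rightarrow> 'h" where
  "proj m x = (\<Sum>i<m. (e i \<bullet> x) *\<^sub>R e i)"

lemma proj_lin: "proj m (a *\<^sub>R x + b *\<^sub>R y) = a *\<^sub>R proj m x + b *\<^sub>R proj m y"
  by (simp add: proj_def inner_add_right scaleR_add_left scaleR_sum_right sum.distrib)

lemma proj_norm2: "(norm (proj m x))\<^sup>2 = (\<Sum>i<m. (e i \<bullet> x)\<^sup>2)"
proof -
  have "(norm (proj m x))\<^sup>2 = (\<Sum>i<m. \<Sum>j<m. (e i \<bullet> x) * ((e j \<bullet> x) * (e j \<bullet> e i)))"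
    unfolding power2_norm_eq_inner proj_def by (simp add: inner_sum_left inner_sum_right sum_distrib_left)
  also have "\<dots> = (\<Sum>i<m. \<Sum>j<m. if i = j then (e i \<bullet> x)\<^sup>2 else 0)"
  proof (intro sum.cong refl)
    fix i j
    show "(e i \<bullet> x) * ((e j \<bullet> x) * (e j \<bullet> e i)) = (if i = j then (e i \<bullet> x)\<^sup>2 else 0)"
    proof (cases "i = j")
      case True
      then show ?thesis
        using normalized[of i] by (auto simp: power2_eq_square norm_eq_sqrt_inner)
    qed (simp add: orth)
  qed
  also have "\<dots> = (\<Sum>i<m. (e i \<bullet> x)\<^sup>2)" by simp
  finally show ?thesis .
qed

end

locale orthonormal_system = orthonormal_family e for e :: "nat \<Rightarrow> 'h::real_inner" +
  assumes complete: "(\<lambda>m. proj m x) \<longlonglongrightarrow> x"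
begin

definition pair_proj :: "nat \<Rightarrow> 'h \<times> 'h \<Rightarrow> 'h \<times> 'h" where
  "pair_proj m z = (proj m (fst z), proj m (snd z))"

definition synth :: "nat \<Rightarrow> (nat \<Rightarrow> real) \<Rightarrow> 'h \<times> 'h" where
  "synth m x = (\<Sum>i<m. x (2 * i) *\<^sub>R e i, \<Sum>i<m. x (Suc (2 * i)) *\<^sub>R e i)"

definition coords :: "'h \<times> 'h \<Rightarrow> nat \<Rightarrow> real" where
  "coords z i = pair_coord e i \<bullet> z"

definition coord_norm2 :: "nat \<Rightarrow> 'h \<times> 'h \<Rightarrow> real" where
  "coord_norm2 m z = (\<Sum>i<2 * m. (coords z i)\<^sup>2)"

lemma coords_even: "coords z (2 * i) = e i \<bullet> fst z" and coords_odd: "coords z (Suc (2 * i)) = e i \<bullet> snd z"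
  by (simp_all add: coords_def pair_coord_def inner_prod_def)

lemma synth_coords: "synth m (coords z) = pair_proj m z"
  by (simp add: synth_def pair_proj_def proj_def coords_even coords_odd)

lemma coords_flow: "coords (boomerang_flow t z) = rotate_coords t (coords z)"
  unfolding coords_def using pair_coord_flow[of e t z] by simp

lemma coord_norm2_flow: "coord_norm2 m (boomerang_flow t z) = coord_norm2 m z"
  unfolding coord_norm2_def coords_flow by (rule rotate_coords_sum_squares)

text \<open>The projection acts in the same way on positions and velocities, and the rotation mixes
  only these two.\<close>

lemma pair_proj_flow: "pair_proj m (boomerang_flow t z) = boomerang_flow t (pair_proj m z)"
  using proj_lin[of m "cos t" "fst z" "sin t" "snd z"] proj_lin[of m "cos t" "snd z" "- sin t" "fst z"]
  by (simp add: pair_proj_def boomerang_flow_def)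

lemma pair_proj_tendsto: "(\<lambda>m. pair_proj m z) \<longlonglongrightarrow> z"
proof -
  have "(\<lambda>m. (proj m (fst z), proj m (snd z))) \<longlonglongrightarrow> (fst z, snd z)"
    by (intro tendsto_Pair complete)
  then show ?thesis by (simp add: pair_proj_def)
qed

lemma coord_norm2_eq: "coord_norm2 m z = (norm (pair_proj m z))\<^sup>2"
  by (simp add: coord_norm2_def sum_pairs coords_even coords_odd sum.distrib proj_norm2[symmetric]
      pair_proj_def norm_Pair)

lemma coord_poly_approx:
  fixes F :: "'h \<times> 'h \<Rightarrow> real"
  assumes F: "continuous_on UNIV F" and \<eta>: "0 < \<eta>"
  obtains P where "coord_poly (2 * m) P"
    "\<And>z. coord_norm2 m z \<le> r\<^sup>2 \<Longrightarrow> \<bar>P (coords z) - F (pair_proj m z)\<bar> \<le> \<eta>"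
proof -
  \<comment> \<open>The coordinates from \<open>2 * m\<close> on are frozen at 0. This makes the
    cube compact and lets polynomials in the first \<open>2 * m\<close> coordinates separate its
    points, as the Stone-Weierstrass theorem demands.\<close>
  define S where "S = PiE UNIV (\<lambda>i. if i < 2 * m then {- \<bar>r\<bar>..\<bar>r\<bar>} else {0::real})"
  have "compact S"
  proof -
    have "compactin (product_topology (\<lambda>i. euclidean) UNIV) S"
      unfolding S_def compactin_PiE by auto
    then show ?thesis
      by (simp add: euclidean_product_topology)
  qed
  interpret function_ring_on "Collect (coord_poly (2 * m))" S
  proof
    show "compact S" by fact
    show "continuous_on S f" if "f \<in> Collect (coord_poly (2 * m))" for f
      using coord_smooth_continuous[OF coord_poly_smooth] that continuous_on_subset by blast
    show "\<exists>f\<in>Collect (coord_poly (2 * m)). f x \<noteq> f y" if "x \<in> S" "y \<in> S" "x \<noteq> y" for x y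
    proof -
      from \<open>x \<noteq> y\<close> obtain i where i: "x i \<noteq> y i" by auto
      with that have "i < 2 * m"
        by (cases "i < 2 * m") (auto simp: S_def PiE_iff dest!: spec[of _ i])
      then show ?thesis
        using i by (intro bexI[of _ "\<lambda>x. x i"]) (auto intro: coord_poly.coord)
    qed
  qed (auto intro: coord_poly.intros)
  have "continuous_on UNIV (synth m)"
    unfolding synth_def[abs_def]
    by (intro continuous_intros continuous_on_product_coordinates)
  then have "continuous_on S (\<lambda>x. F (synth m x))"
    by (intro continuous_on_compose2[OF F]) (auto intro: continuous_on_subset)
  from Stone_Weierstrass_basic[OF this \<eta>] obtain P where P: "coord_poly (2 * m) P"
    "\<And>x. x \<in> S \<Longrightarrow> \<bar>F (synth m x) - P x\<bar> < \<eta>" by auto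
  show ?thesis
  proof (rule that[OF P(1)])
    fix z assume z: "coord_norm2 m z \<le> r\<^sup>2"
    define x where "x i = (if i < 2 * m then coords z i else 0)" for i
    have "\<bar>coords z i\<bar> \<le> \<bar>r\<bar>" if "i < 2 * m" for i
    proof -
      have "(coords z i)\<^sup>2 \<le> coord_norm2 m z"
        unfolding coord_norm2_def using that by (intro member_le_sum) auto
      with z show ?thesis by (simp add: abs_le_square_iff)
    qed
    then have "- \<bar>r\<bar> \<le> coords z i \<and> coords z i \<le> \<bar>r\<bar>" if "i < 2 * m" for i
      using that by (auto simp: abs_le_iff minus_le_iff)
    then have "x \<in> S"
      by (auto simp: S_def x_def)
    moreover have "P x = P (coords z)"
      by (rule coord_smooth_local[OF coord_poly_smooth[OF P(1)]]) (simp add: x_def)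
    moreover have "synth m x = synth m (coords z)"
      by (simp add: synth_def x_def)
    ultimately show "\<bar>P (coords z) - F (pair_proj m z)\<bar> \<le> \<eta>"
      using P(2)[of x] by (simp add: synth_coords abs_minus_commute)
  qed
qed

lemma continuous_coords: "continuous_on UNIV coords"
  unfolding coords_def[abs_def]
  by (intro continuous_on_coordinatewise_then_product continuous_intros)

text \<open>On a ball of growing radius, \<open>F\<close> of the projection is approximated by a
  polynomial, which is averaged along the flow and cut off. The ball in coordinates is invariant
  under the flow, so the average sees the polynomial only where it is close to \<open>F\<close>.
  Outside the cut-off vanishes, hence the bounds are global; the 1 in \<open>C + 1\<close> is the
  largest approximation error.\<close>

theorem smooth_cylinder_approx:
  fixes F :: "'h \<times> 'h \<Rightarrow> real"
  assumes \<beta>: "0 < \<beta>" and F: "continuous_on UNIV F" and C: "\<And>z. \<bar>F z\<bar> \<le> C"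
  obtains v Y where "\<And>k. v k \<in> smooth_cylinder_functions"
    "\<And>k. continuous_on UNIV (v k)" "\<And>k. continuous_on UNIV (Y k)"
    "\<And>k z. ((\<lambda>t. v k (boomerang_flow t z)) has_real_derivative Y k z) (at 0)"
    "\<And>k z. \<bar>v k z\<bar> \<le> (C + 1) / \<beta>" "\<And>k z. \<bar>Y k z\<bar> \<le> 2 * (C + 1)"
    "\<And>z. (\<lambda>k. v k z) \<longlonglongrightarrow> flow_average \<beta> F z"
    "\<And>z. (\<lambda>k. Y k z) \<longlonglongrightarrow> \<beta> * flow_average \<beta> F z - F z"
proof -
  define r where "r k = real (Suc k)" for k
  define \<eta> where "\<eta> k = 1 / r k" for k
  have \<eta>: "0 < \<eta> k" "\<eta> k \<le> 1" for k by (simp_all add: \<eta>_def r_def)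
  have "\<exists>P. coord_poly (2 * k) P \<and> (\<forall>z. coord_norm2 k z \<le> (r k)\<^sup>2 \<longrightarrow> \<bar>P (coords z) - F (pair_proj k z)\<bar> \<le> \<eta> k)" for k
    using coord_poly_approx[OF F \<eta>(1)[of k], of k "r k"] by metis
  then obtain P where P: "\<And>k. coord_poly (2 * k) (P k)"
    "\<And>k z. coord_norm2 k z \<le> (r k)\<^sup>2 \<Longrightarrow> \<bar>P k (coords z) - F (pair_proj k z)\<bar> \<le> \<eta> k"
    by metis
  define Q where "Q k z = P k (coords z)" for k z
  define a where "a k = 1 / (r k)\<^sup>2" for k
  have a: "0 < a k" for k by (simp add: a_def r_def)
  define b where "b k z = bump 0 (a k * coord_norm2 k z)" for k z
  define w where "w k z = flow_average \<beta> (Q k) z" for k z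
  define v where "v k z = b k z * w k z" for k z
  \<comment> \<open>The factor \<open>b k\<close> is constant along orbits, so the flow derivative
    of \<open>v k\<close> is \<open>b k\<close> times that of \<open>w k\<close>.\<close>
  define Y where "Y k z = b k z * (\<beta> * w k z - Q k z)" for k z
  have cQ: "continuous_on UNIV (Q k)" for k
    unfolding Q_def
    by (rule continuous_on_compose2[OF coord_smooth_continuous[OF coord_poly_smooth[OF P(1)]] continuous_coords]) auto
  have cw: "continuous_on UNIV (w k)" for k
    using flow_average_continuous[OF cQ] by (simp add: w_def[abs_def])
  have cb: "continuous_on UNIV (b k)" for k
    unfolding b_def[abs_def] coord_norm2_def
    by (intro continuous_on_compose2[OF continuous_bump] continuous_intros
        continuous_on_compose2[OF continuous_on_product_coordinates continuous_coords]) auto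
  have b01: "0 \<le> b k z" "b k z \<le> 1" for k z
    using a[of k] by (auto simp: b_def bump_nonneg coord_norm2_eq intro!: bump_le_1)
  have b0: "b k z = 0" if "\<not> coord_norm2 k z \<le> (r k)\<^sup>2" for k z
    unfolding b_def by (rule bump_eq_0) (use that in \<open>simp add: a_def r_def field_simps\<close>)
  have Q_near: "\<bar>Q k z - F (pair_proj k z)\<bar> \<le> \<eta> k" if "coord_norm2 k z \<le> (r k)\<^sup>2" for k z
    using P(2)[OF that] by (simp add: Q_def)
  \<comment> \<open>The orbit of \<open>z\<close> stays in the ball, and projecting it gives the
    orbit of the projected point. The polynomial error therefore holds uniformly in time.\<close>
  have w_near: "\<bar>w k z - flow_average \<beta> F (pair_proj k z)\<bar> \<le> \<eta> k / \<beta>" if "coord_norm2 k z \<le> (r k)\<^sup>2" for k z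
    unfolding w_def
    by (rule flow_average_diff_le[OF \<beta> cQ F])
       (use that in \<open>simp add: Q_near coord_norm2_flow flip: pair_proj_flow\<close>)
  have avF: "\<bar>flow_average \<beta> F z\<bar> \<le> C / \<beta>" for z
    by (rule flow_average_bound[OF \<beta> F C])
  have w_bd: "\<bar>w k z\<bar> \<le> (C + 1) / \<beta>" if "coord_norm2 k z \<le> (r k)\<^sup>2" for k z
  proof -
    have "\<eta> k / \<beta> \<le> 1 / \<beta>" using \<eta>(2)[of k] \<beta> by (intro divide_right_mono) auto
    then show ?thesis
      using w_near[OF that] avF[of "pair_proj k z"] by (simp add: add_divide_distrib)
  qed
  have Q_bd: "\<bar>Q k z\<bar> \<le> C + 1" if "coord_norm2 k z \<le> (r k)\<^sup>2" for k z
    using Q_near[OF that] \<eta>(2)[of k] C[of "pair_proj k z"] by linarith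
  have C0: "0 \<le> C" using C[of 0] by linarith
  show ?thesis
  proof (rule that[of v Y])
    fix k z
    show "v k \<in> smooth_cylinder_functions"
      using smooth_cylinder_bump_average[OF P(1)[of k] a[of k], of e \<beta>]
      by (simp add: v_def[abs_def] b_def w_def Q_def[abs_def] coord_norm2_def coords_def[abs_def])
    show "continuous_on UNIV (v k)"
      unfolding v_def[abs_def] by (intro continuous_intros cb cw)
    show "continuous_on UNIV (Y k)"
      unfolding Y_def[abs_def] by (intro continuous_intros cb cw cQ)
    have "((\<lambda>t. b k z * w k (boomerang_flow t z)) has_real_derivative b k z * (\<beta> * w k z - Q k z)) (at 0)"
      unfolding w_def by (rule DERIV_cmult[OF flow_average_derivative[OF \<beta> cQ]])
    then show "((\<lambda>t. v k (boomerang_flow t z)) has_real_derivative Y k z) (at 0)"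
      by (simp add: v_def Y_def b_def coord_norm2_flow)
    show "\<bar>v k z\<bar> \<le> (C + 1) / \<beta>"
    proof (cases "coord_norm2 k z \<le> (r k)\<^sup>2")
      case True
      have "\<bar>b k z\<bar> * \<bar>w k z\<bar> \<le> 1 * ((C + 1) / \<beta>)"
        using b01[of k z] w_bd[OF True] by (intro mult_mono) auto
      then show ?thesis by (simp add: v_def abs_mult)
    qed (use C0 \<beta> in \<open>simp add: v_def b0\<close>)
    show "\<bar>Y k z\<bar> \<le> 2 * (C + 1)"
    proof (cases "coord_norm2 k z \<le> (r k)\<^sup>2")
      case True
      have "\<beta> * \<bar>w k z\<bar> \<le> C + 1"
        using w_bd[OF True] \<beta> by (simp add: field_simps)
      then have "\<bar>\<beta> * w k z - Q k z\<bar> \<le> 2 * (C + 1)"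
        using Q_bd[OF True] \<beta> abs_triangle_ineq4[of "\<beta> * w k z" "Q k z"] by (simp add: abs_mult)
      then have "\<bar>b k z\<bar> * \<bar>\<beta> * w k z - Q k z\<bar> \<le> 1 * (2 * (C + 1))"
        using b01[of k z] by (intro mult_mono) auto
      then show ?thesis by (simp add: Y_def abs_mult)
    qed (use C0 in \<open>simp add: Y_def b0\<close>)
  next
    fix z
    have r: "filterlim r at_top sequentially"
      unfolding r_def by (intro filterlim_compose[OF filterlim_real_sequentially] filterlim_Suc)
    have \<eta>0: "\<eta> \<longlonglongrightarrow> 0"
      unfolding \<eta>_def[abs_def] by (intro tendsto_divide_0[OF tendsto_const] filterlim_at_top_imp_at_infinity r)
    have cn: "(\<lambda>k. coord_norm2 k z) \<longlonglongrightarrow> (norm z)\<^sup>2"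
      unfolding coord_norm2_eq by (intro tendsto_intros pair_proj_tendsto)
    have "(\<lambda>k. (\<eta> k)\<^sup>2 * coord_norm2 k z) \<longlonglongrightarrow> 0\<^sup>2 * (norm z)\<^sup>2"
      by (intro tendsto_intros \<eta>0 cn)
    then have ac: "(\<lambda>k. a k * coord_norm2 k z) \<longlonglongrightarrow> 0"
      by (simp add: a_def \<eta>_def power_divide)
    have "isCont (bump 0) 0"
      using bump_derivative DERIV_isCont by blast
    from isCont_tendsto_compose[OF this ac] have b1: "(\<lambda>k. b k z) \<longlonglongrightarrow> 1"
      by (simp add: b_def bump_0)
    have ev: "\<forall>\<^sub>F k in sequentially. coord_norm2 k z \<le> (r k)\<^sup>2"
    proof -
      have "\<forall>\<^sub>F k in sequentially. a k * coord_norm2 k z < 1"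
        using order_tendstoD(2)[OF ac, of 1] by simp
      then show ?thesis
        by eventually_elim (simp add: a_def r_def field_simps)
    qed
    have lim_near: "(\<lambda>k. f k z) \<longlonglongrightarrow> G z"
      if G: "continuous_on UNIV G" and d: "\<And>k. coord_norm2 k z \<le> (r k)\<^sup>2 \<Longrightarrow> \<bar>f k z - G (pair_proj k z)\<bar> \<le> \<eta> k * c"
      for f :: "nat \<Rightarrow> 'h \<times> 'h \<Rightarrow> real" and G c
    proof -
      have "(\<lambda>k. f k z - G (pair_proj k z)) \<longlonglongrightarrow> 0"
      proof (rule Lim_null_comparison)
        show "\<forall>\<^sub>F k in sequentially. norm (f k z - G (pair_proj k z)) \<le> \<eta> k * c"
          using ev by eventually_elim (simp add: d)
        show "(\<lambda>k. \<eta> k * c) \<longlonglongrightarrow> 0"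
          using tendsto_mult_right[OF \<eta>0, of c] by simp
      qed
      moreover have "(\<lambda>k. G (pair_proj k z)) \<longlonglongrightarrow> G z"
        by (rule continuous_on_tendsto_compose[OF G pair_proj_tendsto]) auto
      ultimately have "(\<lambda>k. (f k z - G (pair_proj k z)) + G (pair_proj k z)) \<longlonglongrightarrow> 0 + G z"
        by (rule tendsto_add)
      then show ?thesis by simp
    qed
    have w: "(\<lambda>k. w k z) \<longlonglongrightarrow> flow_average \<beta> F z"
      by (rule lim_near[OF flow_average_continuous[OF F], where c="1 / \<beta>"]) (use w_near in simp)
    have q: "(\<lambda>k. Q k z) \<longlonglongrightarrow> F z"
      by (rule lim_near[OF F, where c=1]) (use Q_near in simp)
    have "(\<lambda>k. b k z * w k z) \<longlonglongrightarrow> 1 * flow_average \<beta> F z"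
      by (intro tendsto_intros b1 w)
    then show "(\<lambda>k. v k z) \<longlonglongrightarrow> flow_average \<beta> F z"
      by (simp add: v_def)
    have "(\<lambda>k. b k z * (\<beta> * w k z - Q k z)) \<longlonglongrightarrow> 1 * (\<beta> * flow_average \<beta> F z - F z)"
      by (intro tendsto_intros b1 w q)
    then show "(\<lambda>k. Y k z) \<longlonglongrightarrow> \<beta> * flow_average \<beta> F z - F z"
      by (simp add: Y_def)
  qed
qed

end

section \<open>Orthonormal systems in separable Hilbert spaces\<close>

text \<open>\<open>sgn\<close> normalises and maps 0 to 0, so a vector depending linearly on its
  predecessors yields 0 without a case distinction.\<close>

fun gram_schmidt :: "(nat \<Rightarrow> 'a::real_inner) \<Rightarrow> nat \<Rightarrow> 'a" where
  "gram_schmidt d k = sgn (d k - (\<Sum>j<k. (gram_schmidt d j \<bullet> d k) *\<^sub>R gram_schmidt d j))"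

declare gram_schmidt.simps [simp del]

lemma gram_schmidt_normalized: "gram_schmidt d k = 0 \<or> norm (gram_schmidt d k) = 1"
  by (subst (1 2) gram_schmidt.simps) (auto simp: norm_sgn)

lemma gram_schmidt_orth_less: "j < k \<Longrightarrow> gram_schmidt d j \<bullet> gram_schmidt d k = 0"
proof (induction k arbitrary: j rule: less_induct)
  case (less k)
  let ?e = "gram_schmidt d"
  let ?r = "d k - (\<Sum>i<k. (?e i \<bullet> d k) *\<^sub>R ?e i)"
  have "?e j \<bullet> (\<Sum>i<k. (?e i \<bullet> d k) *\<^sub>R ?e i) = (\<Sum>i<k. (?e i \<bullet> d k) * (?e j \<bullet> ?e i))"
    by (simp add: inner_sum_right)
  also have "\<dots> = (\<Sum>i<k. if i = j then ?e j \<bullet> d k else 0)"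
  proof (intro sum.cong refl)
    fix i assume i: "i \<in> {..<k}"
    consider "i = j" | "i < j" | "j < i" by linarith
    then show "(?e i \<bullet> d k) * (?e j \<bullet> ?e i) = (if i = j then ?e j \<bullet> d k else 0)"
    proof cases
      case 1
      then show ?thesis
        using gram_schmidt_normalized[of d j] by (auto simp: norm_eq_sqrt_inner)
    next
      case 2
      then show ?thesis
        using less.IH[of j i] less.prems by (simp add: inner_commute)
    next
      case 3
      then show ?thesis
        using less.IH[of i j] i by simp
    qed
  qed
  also have "\<dots> = ?e j \<bullet> d k"
    using less.prems by simp
  finally have "?e j \<bullet> ?r = 0"
    by (simp add: inner_diff_right)
  then show ?case
    by (subst (2) gram_schmidt.simps) (simp add: sgn_div_norm)
qed

interpretation gram_schmidt: orthonormal_family "gram_schmidt d" for d :: "nat \<Rightarrow> 'a::real_inner"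
proof
  show "gram_schmidt d i \<bullet> gram_schmidt d j = 0" if "i \<noteq> j" for i j
    using gram_schmidt_orth_less[of i j d] gram_schmidt_orth_less[of j i d] that
    by (cases "i < j") (auto simp: inner_commute)
qed (rule gram_schmidt_normalized)

text \<open>The remainder of \<open>d k\<close> is a multiple of the \<open>k\<close>-th output
  vector, so \<open>d k\<close> lies in the span of the outputs up to \<open>k\<close> and its later
  coefficients vanish.\<close>

lemma gram_schmidt_proj:
  assumes "k < m"
  shows "gram_schmidt.proj d m (d k) = d k"
proof -
  let ?e = "gram_schmidt d"
  let ?P = "\<Sum>i<k. (?e i \<bullet> d k) *\<^sub>R ?e i"
  let ?r = "d k - ?P"
  have ek: "?e k = sgn ?r" by (rule gram_schmidt.simps)
  have *: "x = norm x *\<^sub>R sgn x" for x :: 'a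
    by (cases "x = 0") (auto simp: sgn_div_norm)
  have r: "?r = norm ?r *\<^sub>R ?e k"
    unfolding ek by (rule *)
  have orthP: "?e j \<bullet> ?P = 0" if "k \<le> j" for j
    unfolding inner_sum_right using that by (intro sum.neutral) (auto intro: gram_schmidt.orth)
  have 1: "(?e k \<bullet> d k) *\<^sub>R ?e k = ?r"
  proof -
    have "?e k \<bullet> d k = ?e k \<bullet> ?r"
      using orthP[of k] by (simp add: inner_diff_right)
    also have "\<dots> = norm ?r * (?e k \<bullet> ?e k)"
      by (subst r) simp
    finally have "(?e k \<bullet> d k) *\<^sub>R ?e k = (norm ?r * (?e k \<bullet> ?e k)) *\<^sub>R ?e k" by simp
    also have "\<dots> = norm ?r *\<^sub>R ?e k"
      using gram_schmidt_normalized[of d k] by (auto simp: norm_eq_sqrt_inner)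
    finally show ?thesis using r by simp
  qed
  have 2: "(?e j \<bullet> d k) *\<^sub>R ?e j = 0" if "k < j" for j
  proof -
    have "?e j \<bullet> d k = ?e j \<bullet> (?P + norm ?r *\<^sub>R ?e k)"
      using r by simp
    also have "\<dots> = 0"
      using orthP[of j] that by (simp add: inner_add_right gram_schmidt.orth)
    finally show ?thesis by simp
  qed
  have "gram_schmidt.proj d m (d k) = (\<Sum>i<Suc k. (?e i \<bullet> d k) *\<^sub>R ?e i)"
    unfolding gram_schmidt.proj_def
    by (rule sum.mono_neutral_right) (use assms 2 in auto)
  also have "\<dots> = ?P + ?r" using 1 by simp
  finally show ?thesis by simp
qed

context orthonormal_family
begin

lemma norm_proj_le: "norm (proj m x) \<le> norm x"
proof (rule power2_le_imp_le)
  have "x \<bullet> proj m x = (\<Sum>i<m. (e i \<bullet> x)\<^sup>2)"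
    by (simp add: proj_def inner_sum_right inner_commute power2_eq_square)
  then have "(norm (x - proj m x))\<^sup>2 = (norm x)\<^sup>2 - (norm (proj m x))\<^sup>2"
    using proj_norm2[of m x]
    by (simp add: power2_norm_eq_inner inner_diff_left inner_diff_right inner_commute)
  then show "(norm (proj m x))\<^sup>2 \<le> (norm x)\<^sup>2"
    using zero_le_power2[of "norm (x - proj m x)"] by linarith
qed simp

lemma proj_diff: "proj m (x - y) = proj m x - proj m y"
  using proj_lin[of m 1 x "-1" y] by simp

end

text \<open>Gram-Schmidt on a dense sequence. The projections are contractions and eventually fix
  each \<open>d k\<close>, so the error at \<open>x\<close> is eventually at most twice the distance
  from \<open>x\<close> to \<open>d k\<close>.\<close>

lemma orthonormal_system_exists:
  obtains e :: "nat \<Rightarrow> 'h::{real_inner, second_countable_topology}" where "orthonormal_system e"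
proof -
  obtain D :: "'h set" where D: "countable D" "\<And>X. open X \<Longrightarrow> X \<noteq> {} \<Longrightarrow> \<exists>d\<in>D. d \<in> X"
    using countable_dense_exists by blast
  have "D \<noteq> {}" using D(2)[of UNIV] by auto
  define d where "d = from_nat_into D"
  have dense: "\<exists>k. norm (x - d k) < \<epsilon>" if "0 < \<epsilon>" for x \<epsilon>
  proof -
    obtain y where "y \<in> D" "y \<in> ball x \<epsilon>" using D(2)[of "ball x \<epsilon>"] \<open>0 < \<epsilon>\<close> by auto
    moreover obtain k where "d k = y"
      using from_nat_into_surj[OF D(1) \<open>y \<in> D\<close>] by (auto simp: d_def)
    ultimately show ?thesis by (auto simp: dist_norm)
  qed
  have "orthonormal_system (gram_schmidt d)"
  proof (unfold_locales)
    fix x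
    show "(\<lambda>m. gram_schmidt.proj d m x) \<longlonglongrightarrow> x"
    proof (rule LIMSEQ_I)
      fix \<epsilon> :: real assume "0 < \<epsilon>"
      then obtain k where k: "norm (x - d k) < \<epsilon> / 2" using dense[of "\<epsilon> / 2" x] by auto
      show "\<exists>N. \<forall>m\<ge>N. norm (gram_schmidt.proj d m x - x) < \<epsilon>"
      proof (intro exI[of _ "Suc k"] allI impI)
        fix m assume "Suc k \<le> m"
        then have "gram_schmidt.proj d m x - x = gram_schmidt.proj d m (x - d k) - (x - d k)"
          using gram_schmidt_proj[of k m d] by (simp add: gram_schmidt.proj_diff)
        also have "norm \<dots> \<le> norm (x - d k) + norm (x - d k)"
          by (rule order_trans[OF norm_triangle_ineq4 add_right_mono[OF gram_schmidt.norm_proj_le]])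
        finally show "norm (gram_schmidt.proj d m x - x) < \<epsilon>" using k by simp
      qed
    qed
  qed
  then show ?thesis by (rule that)
qed

text \<open>Connects the sequence, with its zeros removed, to the bases over which the trace is
  taken in \<open>positive_trace_class\<close>.\<close>

lemma (in orthonormal_system) orthonormal_basis_range: "orthonormal_basis (range e - {0})"
  unfolding orthonormal_basis_def
proof (intro conjI ballI)
  show "norm x = 1" if "x \<in> range e - {0}" for x
    using that normalized by auto
  show "pairwise orthogonal (range e - {0})"
    unfolding pairwise_def orthogonal_def by (auto) (metis orth)
  have "proj m x \<in> span (range e - {0})" for m x
    unfolding proj_def
  proof (intro span_sum span_scale)
    show "e i \<in> span (range e - {0})" for i
      by (cases "e i = 0") (auto intro: span_base span_zero)
  qed
  then have "x \<in> closure (span (range e - {0}))" for x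
    unfolding closure_sequential by (intro exI[of _ "\<lambda>m. proj m x"] conjI complete) auto
  then show "closure (span (range e - {0})) = UNIV" by auto
qed

section \<open>Second moments\<close>

lemma gaussian_second_moment_inner:
  assumes \<nu>: "gaussian S \<nu>" and pos: "\<And>x. x \<noteq> 0 \<Longrightarrow> 0 < S x \<bullet> x" and h: "h \<noteq> 0"
  shows "(\<integral>\<^sup>+x. ennreal ((h \<bullet> x)\<^sup>2) \<partial>\<nu>) = ennreal (S h \<bullet> h)"
proof -
  define \<sigma> where "\<sigma> = sqrt (S h \<bullet> h)"
  have \<sigma>: "0 < \<sigma>" using pos[OF h] by (simp add: \<sigma>_def)
  have d: "distributed \<nu> lborel (\<lambda>x. h \<bullet> x) (\<lambda>y. ennreal (normal_density 0 \<sigma> y))"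
    using \<nu> h by (simp add: gaussian_def \<sigma>_def)
  have "(\<integral>\<^sup>+x. ennreal ((h \<bullet> x)\<^sup>2) \<partial>\<nu>) = (\<integral>\<^sup>+y. ennreal (normal_density 0 \<sigma> y) * ennreal (y\<^sup>2) \<partial>lborel)"
    using distributed_nn_integral[OF d, of "\<lambda>y. ennreal (y\<^sup>2)"] by simp
  also have "\<dots> = (\<integral>\<^sup>+y. ennreal (normal_density 0 \<sigma> y * y\<^sup>2) \<partial>lborel)"
    by (simp add: ennreal_mult)
  also have "\<dots> = ennreal (\<sigma>\<^sup>2)"
  proof -
    have "has_bochner_integral lborel (\<lambda>y. normal_density 0 \<sigma> y * y\<^sup>2) (\<sigma>\<^sup>2)"
      using normal_moment_even[of \<sigma> 0 1] \<sigma> by (simp add: power2_eq_square)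
    then show ?thesis
      by (subst nn_integral_eq_integral) (auto simp: has_bochner_integral_iff)
  qed
  finally show ?thesis using pos[OF h] by (simp add: \<sigma>_def less_imp_le)
qed

text \<open>By Parseval the expected squared norm is the sum of the variances in the basis
  directions, which is the trace of \<open>S\<close>.\<close>

lemma gaussian_second_moment:
  fixes \<nu> :: "'h::{real_inner, second_countable_topology} measure"
  assumes \<nu>: "gaussian S \<nu>" and S: "positive_trace_class S"
  shows "(\<integral>\<^sup>+x. ennreal ((norm x)\<^sup>2) \<partial>\<nu>) < \<infinity>"
proof -
  obtain e :: "nat \<Rightarrow> 'h" where "orthonormal_system e"
    by (rule orthonormal_system_exists)
  then interpret orthonormal_system e .
  have pos: "0 < S x \<bullet> x" if "x \<noteq> 0" for x
    using S that unfolding positive_trace_class_def by blast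
  have sets: "sets \<nu> = sets borel" using \<nu> by (simp add: gaussian_def)
  have S0: "S 0 \<bullet> 0 = 0" by simp
  have Snn: "0 \<le> S (e k) \<bullet> e k" for k
    using pos[of "e k"] by (cases "e k = 0") auto
  have "(\<lambda>x. S x \<bullet> x) summable_on (range e - {0})"
    using S orthonormal_basis_range unfolding positive_trace_class_def by blast
  also have "range e - {0} = e ` {k. e k \<noteq> 0}" by auto
  finally have "((\<lambda>x. S x \<bullet> x) \<circ> e) summable_on {k. e k \<noteq> 0}"
  proof (subst (asm) summable_on_reindex)
    show "inj_on e {k. e k \<noteq> 0}"
      by (rule inj_onI) (metis (mono_tags, lifting) inner_eq_zero_iff mem_Collect_eq orth)
  qed
  then have "(\<lambda>k. S (e k) \<bullet> e k) summable_on UNIV"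
    by (rule iffD1[OF summable_on_cong_neutral, rotated -1]) auto
  then have sum: "summable (\<lambda>k. S (e k) \<bullet> e k)"
    by (rule summable_on_imp_summable)
  have "(norm x)\<^sup>2 = (\<Sum>k. (e k \<bullet> x)\<^sup>2) \<and> summable (\<lambda>k. (e k \<bullet> x)\<^sup>2)" for x
  proof -
    have "(\<lambda>m. (norm (proj m x))\<^sup>2) \<longlonglongrightarrow> (norm x)\<^sup>2"
      by (intro tendsto_intros complete)
    then have "(\<lambda>k. (e k \<bullet> x)\<^sup>2) sums (norm x)\<^sup>2"
      by (simp add: proj_norm2 sums_def)
    then show ?thesis by (simp add: sums_iff)
  qed
  then have "(\<integral>\<^sup>+x. ennreal ((norm x)\<^sup>2) \<partial>\<nu>) = (\<integral>\<^sup>+x. (\<Sum>k. ennreal ((e k \<bullet> x)\<^sup>2)) \<partial>\<nu>)"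
    by (intro nn_integral_cong) (simp add: suminf_ennreal2)
  also have "\<dots> = (\<Sum>k. \<integral>\<^sup>+x. ennreal ((e k \<bullet> x)\<^sup>2) \<partial>\<nu>)"
    by (intro nn_integral_suminf) (simp add: measurable_cong_sets[OF sets refl])
  also have "\<dots> = (\<Sum>k. ennreal (S (e k) \<bullet> e k))"
  proof (intro suminf_cong)
    show "(\<integral>\<^sup>+x. ennreal ((e k \<bullet> x)\<^sup>2) \<partial>\<nu>) = ennreal (S (e k) \<bullet> e k)" for k
      using gaussian_second_moment_inner[OF \<nu> pos, of "e k"] by (cases "e k = 0") auto
  qed
  also have "\<dots> = ennreal (\<Sum>k. S (e k) \<bullet> e k)"
    by (rule suminf_ennreal2[OF Snn sum])
  finally show ?thesis by simp
qed

section \<open>Bounce rates\<close>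

text \<open>A linear isometric involution is symmetric, so each inner product with
  \<open>v - R n v\<close> is half of the one between \<open>g - R n g\<close> and
  \<open>v - R n v\<close>. The inequality between geometric and arithmetic mean and the
  normalisation of the reflections bound the sum by the squared norms of \<open>g\<close> and
  \<open>v\<close>; applied to unit vectors this scales to the product of the norms.\<close>

lemma reflections_sum:
  assumes refl: "boomerang_reflections S R"
  shows "summable (\<lambda>n. \<bar>g \<bullet> (v - R n v)\<bar>)" and "(\<Sum>n. \<bar>g \<bullet> (v - R n v)\<bar>) \<le> 2 * norm g * norm v"
proof -
  have lin: "linear (R n)" and inv: "R n (R n v) = v" and iso: "norm (R n v) = norm v"
    and sums: "(\<lambda>n. (norm (v - R n v))\<^sup>2) sums (4 * (norm v)\<^sup>2)" for n v
    using refl by (auto simp: boomerang_reflections_def)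
  have inner: "R n x \<bullet> R n y = x \<bullet> y" for n x y
  proof -
    have "R n x + R n y = R n (x + y)" using lin[of n] by (simp add: linear_add)
    then show ?thesis by (simp add: dot_norm iso)
  qed
  have sym: "R n x \<bullet> y = x \<bullet> R n y" for n x y
    using inner[of n x "R n y"] by (simp add: inv)
  have bound: "\<bar>g \<bullet> (v - R n v)\<bar> \<le> ((norm (g - R n g))\<^sup>2 + (norm (v - R n v))\<^sup>2) / 4" for g v n
  proof -
    have "g \<bullet> (v - R n v) = ((g - R n g) \<bullet> (v - R n v)) / 2"
      by (simp add: inner_diff_left inner_diff_right inner sym inv)
    also have "\<bar>\<dots>\<bar> \<le> (norm (g - R n g) * norm (v - R n v)) / 2"
      using Cauchy_Schwarz_ineq2[of "g - R n g" "v - R n v"] by simp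
    also have "\<dots> \<le> ((norm (g - R n g))\<^sup>2 + (norm (v - R n v))\<^sup>2) / 4"
      using sum_squares_bound[of "norm (g - R n g)" "norm (v - R n v)"] by simp
    finally show ?thesis .
  qed
  have ss: "(\<lambda>n. ((norm (g - R n g))\<^sup>2 + (norm (v - R n v))\<^sup>2) / 4) sums ((norm g)\<^sup>2 + (norm v)\<^sup>2)" for g v
    using sums_divide[OF sums_add[OF sums[of g] sums[of v]], of 4] by (simp add: add_divide_distrib)
  have 1: "summable (\<lambda>n. \<bar>g \<bullet> (v - R n v)\<bar>)" "(\<Sum>n. \<bar>g \<bullet> (v - R n v)\<bar>) \<le> (norm g)\<^sup>2 + (norm v)\<^sup>2" for g v
  proof -
    show s: "summable (\<lambda>n. \<bar>g \<bullet> (v - R n v)\<bar>)"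
      by (rule summable_comparison_test'[OF sums_summable[OF ss[of g v]], of 0]) (use bound in auto)
    show "(\<Sum>n. \<bar>g \<bullet> (v - R n v)\<bar>) \<le> (norm g)\<^sup>2 + (norm v)\<^sup>2"
      using suminf_le[OF bound s sums_summable[OF ss]] sums_unique[OF ss[of g v]] by simp
  qed
  show "summable (\<lambda>n. \<bar>g \<bullet> (v - R n v)\<bar>)" by (rule 1)
  show "(\<Sum>n. \<bar>g \<bullet> (v - R n v)\<bar>) \<le> 2 * norm g * norm v"
  proof (cases "g = 0 \<or> v = 0")
    case True
    moreover have "R n 0 = 0" for n using lin[of n] by (rule linear_0)
    ultimately show ?thesis by auto
  next
    case False
    then have pos: "0 < norm g" "0 < norm v" by auto
    have "g \<bullet> (v - R n v) = norm g * norm v * (sgn g \<bullet> (sgn v - R n (sgn v)))" for n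
    proof -
      have gv: "g = norm g *\<^sub>R sgn g" "v = norm v *\<^sub>R sgn v"
        using False by (auto simp: sgn_div_norm)
      have "R n v = norm v *\<^sub>R R n (sgn v)"
        by (subst gv(2)) (simp only: linear_scale[OF lin])
      then have "v - R n v = norm v *\<^sub>R (sgn v - R n (sgn v))"
        using gv(2) by (simp only: scaleR_diff_right)
      then have "g \<bullet> (v - R n v) = (norm g *\<^sub>R sgn g) \<bullet> (norm v *\<^sub>R (sgn v - R n (sgn v)))"
        using gv(1) by simp
      then show ?thesis by (simp only: inner_scaleR_left inner_scaleR_right ac_simps)
    qed
    then have "(\<Sum>n. \<bar>g \<bullet> (v - R n v)\<bar>) = norm g * norm v * (\<Sum>n. \<bar>sgn g \<bullet> (sgn v - R n (sgn v))\<bar>)"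
      by (simp add: abs_mult suminf_mult[OF 1(1)])
    also have "\<dots> \<le> norm g * norm v * ((norm (sgn g))\<^sup>2 + (norm (sgn v))\<^sup>2)"
      by (intro mult_left_mono 1) auto
    also have "\<dots> = 2 * norm g * norm v"
      using False by (simp add: norm_sgn)
    finally show ?thesis .
  qed
qed

lemma bounce_rate_summable:
  assumes "boomerang_reflections S R"
  shows "summable (\<lambda>n. bounce_rate \<Phi> R n z)"
    and "total_bounce_rate \<Phi> R z \<le> norm (grad \<Phi> (fst z)) * norm (snd z)"
proof -
  let ?a = "\<lambda>n. \<bar>grad \<Phi> (fst z) \<bullet> (snd z - R n (snd z))\<bar>"
  have le: "bounce_rate \<Phi> R n z \<le> ?a n / 2" for n
    by (simp add: bounce_rate_def)
  have s: "summable (\<lambda>n. ?a n / 2)"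
    by (intro summable_divide reflections_sum[OF assms])
  show 1: "summable (\<lambda>n. bounce_rate \<Phi> R n z)"
    by (rule summable_comparison_test'[OF s, of 0]) (use le in \<open>auto simp: bounce_rate_def\<close>)
  have "total_bounce_rate \<Phi> R z \<le> (\<Sum>n. ?a n / 2)"
    unfolding total_bounce_rate_def by (rule suminf_le[OF le 1 s])
  also have "\<dots> = (\<Sum>n. ?a n) / 2"
    by (rule suminf_divide[OF reflections_sum(1)[OF assms]])
  also have "\<dots> \<le> norm (grad \<Phi> (fst z)) * norm (snd z)"
    using reflections_sum(2)[OF assms, of "grad \<Phi> (fst z)" "snd z"] by simp
  finally show "total_bounce_rate \<Phi> R z \<le> norm (grad \<Phi> (fst z)) * norm (snd z)" .
qed

lemma grad_continuous:
  assumes "assumption_G \<Phi>"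
  shows "continuous_on UNIV (grad \<Phi>)"
proof (rule continuous_at_imp_continuous_on, rule ballI)
  fix x
  obtain L where "L-lipschitz_on (ball x 1) (grad \<Phi>)"
    using assms unfolding assumption_G_def using bounded_ball by blast
  then have "continuous_on (ball x 1) (grad \<Phi>)"
    by (rule lipschitz_on_continuous_on)
  then show "isCont (grad \<Phi>) x"
    by (rule continuous_on_interior) simp
qed

lemma bounce_measure_integral:
  assumes sum: "summable (\<lambda>n. bounce_rate \<Phi> R n z)" and pos: "0 < total_bounce_rate \<Phi> R z"
    and u: "continuous_on UNIV u" and A: "\<And>y. \<bar>u y\<bar> \<le> (A::real)"
  shows "total_bounce_rate \<Phi> R z * (\<integral>y. u y \<partial>bounce_measure \<Phi> R z) =
    (\<Sum>n. bounce_rate \<Phi> R n z * u (fst z, R n (snd z)))"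
proof -
  let ?p = "\<lambda>n. bounce_rate \<Phi> R n z / total_bounce_rate \<Phi> R z"
  have p0: "0 \<le> ?p n" for n using pos by (simp add: bounce_rate_def)
  have [measurable]: "u \<in> borel_measurable borel" by (rule borel_measurable_continuous_onI[OF u])
  have sn: "summable (\<lambda>n. norm (?p n * u (fst z, R n (snd z))))"
  proof (rule summable_comparison_test'[of _ 0])
    show "summable (\<lambda>n. A * ?p n)" by (intro summable_mult summable_divide sum)
    show "norm (norm (?p n * u (fst z, R n (snd z)))) \<le> A * ?p n" for n
    proof -
      have "\<bar>?p n * u (fst z, R n (snd z))\<bar> = ?p n * \<bar>u (fst z, R n (snd z))\<bar>"
        unfolding abs_mult abs_of_nonneg[OF p0[of n]] ..
      also have "\<dots> \<le> ?p n * A"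
        by (intro mult_left_mono A p0)
      finally show ?thesis by (simp only: real_norm_def abs_abs mult.commute[of A])
    qed
  qed
  from sn have i: "integrable (count_space UNIV) (\<lambda>n. ?p n * u (fst z, R n (snd z)))"
    by (simp add: integrable_count_space_nat_iff)
  have "(\<integral>y. u y \<partial>bounce_measure \<Phi> R z) =
      (\<integral>n. u (fst z, R n (snd z)) \<partial>density (count_space UNIV) (\<lambda>n. ennreal (?p n)))"
    unfolding bounce_measure_def by (rule integral_distr) auto
  also have "\<dots> = (\<integral>n. ?p n * u (fst z, R n (snd z)) \<partial>count_space UNIV)"
    using p0 by (subst integral_density) auto
  also have "\<dots> = (\<Sum>n. ?p n * u (fst z, R n (snd z)))"
    by (rule integral_count_space_nat[OF i])
  finally have eq: "(\<integral>y. u y \<partial>bounce_measure \<Phi> R z) = (\<Sum>n. ?p n * u (fst z, R n (snd z)))" .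
  have "summable (\<lambda>n. ?p n * u (fst z, R n (snd z)))"
    by (rule summable_norm_cancel[OF sn])
  then have "total_bounce_rate \<Phi> R z * (\<integral>y. u y \<partial>bounce_measure \<Phi> R z) =
      (\<Sum>n. total_bounce_rate \<Phi> R z * (?p n * u (fst z, R n (snd z))))"
    unfolding eq by (rule suminf_mult[symmetric])
  then show ?thesis using pos by simp
qed

lemma boomerang_locale:
  fixes S :: "'h::{real_inner, banach, second_countable_topology} \<Rightarrow> 'h"
  assumes \<nu>: "gaussian S \<nu>" and lr: "lr > 0" and refls: "boomerang_reflections S R"
    and G: "assumption_G \<Phi>" and I: "condition_I \<nu> \<Phi> lr R"
  shows "boomerang \<nu> \<Phi> lr R"
proof -
  let ?lb = "total_bounce_rate \<Phi> R"
  obtain N Qb where Qb: "\<And>z. ?lb z > 0 \<Longrightarrow> Qb z = bounce_measure \<Phi> R z"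
    and Ia: "condition_Ia boomerang_flow (\<lambda>_. lr) ?lb (refresh_kernel \<nu>) Qb N"
    using I unfolding condition_I_def by blast
  have lbc: "continuous_on UNIV ?lb" and lbb: "\<And>B. bounded B \<Longrightarrow> bounded (?lb ` B)"
    and Qc: "\<And>f::'h \<times> 'h \<Rightarrow> real. continuous_on UNIV f \<Longrightarrow> bounded (range f) \<Longrightarrow>
        continuous_on UNIV (\<lambda>z. \<integral>y. f y \<partial>refresh_kernel \<nu> z) \<and> continuous_on UNIV (\<lambda>z. \<integral>y. f y \<partial>Qb z)"
    using Ia unfolding condition_Ia_def by blast+
  have sets: "sets \<nu> = sets borel" and prob: "prob_space \<nu>"
    using \<nu> by (auto simp: gaussian_def)
  have lin: "linear (R n)" and iso: "norm (R n v) = norm v" for n v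
    using refls by (auto simp: boomerang_reflections_def)
  have Rc: "continuous_on UNIV (R n)" for n
  proof -
    have "bounded_linear (R n)"
      using lin[of n] iso by (intro bounded_linear_intro[where K=1]) (auto simp: linear_add linear_scale)
    then show ?thesis by (rule linear_continuous_on)
  qed
  note sum = bounce_rate_summable(1)[OF refls]
  show ?thesis
  proof (rule boomerang.intro)
    fix n
    show "continuous_on UNIV (bounce_rate \<Phi> R n)"
      unfolding bounce_rate_def[abs_def]
      by (intro continuous_intros continuous_on_compose2[OF grad_continuous[OF G]] continuous_on_compose2[OF Rc]) auto
  next
    fix u :: "'h \<times> 'h \<Rightarrow> real" assume u: "continuous_on UNIV u" "bounded (range u)"
    obtain A where A: "\<And>y. \<bar>u y\<bar> \<le> A"
      using u(2) unfolding bounded_iff by auto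
    \<comment> \<open>Where the total rate is 0 every single rate is 0, so both sides vanish for
      whatever kernel \<open>Qb\<close> is chosen there.\<close>
    have "(\<Sum>n. bounce_rate \<Phi> R n z * u (fst z, R n (snd z))) = ?lb z * (\<integral>y. u y \<partial>Qb z)" for z
    proof (cases "0 < ?lb z")
      case True
      then show ?thesis
        using bounce_measure_integral[OF sum True u(1) A] Qb[OF True] by simp
    next
      case False
      have "0 \<le> bounce_rate \<Phi> R n z" for n by (simp add: bounce_rate_def)
      moreover have "0 \<le> ?lb z"
        unfolding total_bounce_rate_def by (rule suminf_nonneg[OF sum]) fact
      ultimately have "bounce_rate \<Phi> R n z = 0" for n
        using False suminf_eq_zero_iff[OF sum] by (simp add: total_bounce_rate_def)
      with False \<open>0 \<le> ?lb z\<close> show ?thesis by simp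
    qed
    then show "continuous_on UNIV (\<lambda>z. \<Sum>n. bounce_rate \<Phi> R n z * u (fst z, R n (snd z)))"
      using Qc[OF u] by (simp add: continuous_on_mult lbc)
    have [measurable]: "u \<in> borel_measurable borel" by (rule borel_measurable_continuous_onI[OF u(1)])
    have "(\<integral>y. u y \<partial>refresh_kernel \<nu> z) = (\<integral>w. u (fst z, w) \<partial>\<nu>)" for z
    proof -
      have "(\<lambda>w. (fst z, w)) \<in> borel_measurable borel"
        by (intro borel_measurable_continuous_onI continuous_intros)
      then show ?thesis
        unfolding refresh_kernel_def by (intro integral_distr) (auto simp: measurable_cong_sets[OF sets refl])
    qed
    then show "continuous_on UNIV (\<lambda>z :: 'h \<times> 'h. \<integral>w. u (fst z, w) \<partial>\<nu>)"
      using Qc[OF u] by simp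
  qed (fact lr prob sets iso Rc sum lbc lbb)+
qed

section \<open>Density of the bounded continuous functions\<close>

context finite_measure
begin

definition approximable :: "('a \<Rightarrow> real) set \<Rightarrow> ('a \<Rightarrow> real) \<Rightarrow> bool" where
  "approximable D h \<longleftrightarrow> h \<in> L2 M \<and> (\<forall>\<epsilon>>0. \<exists>u\<in>D. L2_norm M (\<lambda>z. h z - u z) < \<epsilon>)"

lemma approximable_limit:
  assumes h: "\<And>n. approximable D (h n)" and f: "f \<in> L2 M" and D: "D \<subseteq> L2 M"
    and lim: "(\<lambda>n. L2_norm M (\<lambda>z. h n z - f z)) \<longlonglongrightarrow> 0"
  shows "approximable D f"
  unfolding approximable_def
proof (intro conjI f allI impI)
  fix \<epsilon> :: real assume "0 < \<epsilon>"
  then obtain n where n: "L2_norm M (\<lambda>z. h n z - f z) < \<epsilon> / 2"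
    using order_tendstoD(2)[OF lim, of "\<epsilon> / 2"] by (auto dest: eventually_happens)
  obtain u where u: "u \<in> D" "L2_norm M (\<lambda>z. h n z - u z) < \<epsilon> / 2"
    using h[of n] \<open>0 < \<epsilon>\<close> unfolding approximable_def by (meson half_gt_zero)
  have "L2_norm M (\<lambda>z. f z - u z) \<le> L2_norm M (\<lambda>z. f z - h n z) + L2_norm M (\<lambda>z. h n z - u z)"
    using f u D h[of n] by (intro L2_norm_triangle3) (auto simp: approximable_def)
  then show "\<exists>u\<in>D. L2_norm M (\<lambda>z. f z - u z) < \<epsilon>"
    using u n L2_norm_minus_commute[of M f "h n"] by force
qed

lemma approximable_lin:
  assumes h: "approximable D h" and k: "approximable D k" and D: "D \<subseteq> L2 M"
    and lin: "\<And>u v. u \<in> D \<Longrightarrow> v \<in> D \<Longrightarrow> (\<lambda>z. a * u z + b * v z) \<in> D"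
  shows "approximable D (\<lambda>z. a * h z + b * k z)"
  unfolding approximable_def
proof (intro conjI allI impI)
  have L: "h \<in> L2 M" "k \<in> L2 M" using h k by (auto simp: approximable_def)
  then show "(\<lambda>z. a * h z + b * k z) \<in> L2 M" by (rule L2_lin)
  fix \<epsilon> :: real assume "0 < \<epsilon>"
  define \<delta> where "\<delta> = \<epsilon> / (\<bar>a\<bar> + \<bar>b\<bar> + 1)"
  have \<delta>: "0 < \<delta>" using \<open>0 < \<epsilon>\<close> by (simp add: \<delta>_def)
  obtain u v where u: "u \<in> D" "L2_norm M (\<lambda>z. h z - u z) < \<delta>" and v: "v \<in> D" "L2_norm M (\<lambda>z. k z - v z) < \<delta>"
    using h k \<delta> unfolding approximable_def by blast
  have "L2_norm M (\<lambda>z. a * (h z - u z) + b * (k z - v z)) \<le>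
      L2_norm M (\<lambda>z. a * (h z - u z)) + L2_norm M (\<lambda>z. b * (k z - v z))"
    using L u v D by (intro L2_norm_triangle L2_scale L2_diff) auto
  also have "\<dots> \<le> \<bar>a\<bar> * \<delta> + \<bar>b\<bar> * \<delta>"
    unfolding L2_norm_scale using u v by (intro add_mono mult_left_mono) auto
  also have "\<dots> < (\<bar>a\<bar> + \<bar>b\<bar> + 1) * \<delta>"
    using \<delta> by (simp add: algebra_simps)
  also have "\<dots> = \<epsilon>"
  proof -
    have "\<bar>a\<bar> + \<bar>b\<bar> + 1 \<noteq> 0" by linarith
    then show ?thesis by (simp add: \<delta>_def)
  qed
  finally have "L2_norm M (\<lambda>z. (a * h z + b * k z) - (a * u z + b * v z)) < \<epsilon>"
    by (simp add: algebra_simps)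
  then show "\<exists>w\<in>D. L2_norm M (\<lambda>z. (a * h z + b * k z) - w z) < \<epsilon>"
    using lin[OF u(1) v(1)] by (intro bexI[of _ "\<lambda>z. a * u z + b * v z"])
qed

end

abbreviation bounded_continuous :: "('a::topological_space \<Rightarrow> real) set" where
  "bounded_continuous \<equiv> {u. continuous_on UNIV u \<and> bounded (range u)}"

lemma bounded_continuous_lin:
  assumes "u \<in> bounded_continuous" "v \<in> bounded_continuous"
  shows "(\<lambda>z. a * u z + b * v z) \<in> bounded_continuous"
proof -
  obtain A B where A: "\<And>z. \<bar>u z\<bar> \<le> A" and B: "\<And>z. \<bar>v z\<bar> \<le> B"
    using assms unfolding bounded_iff by auto
  have "\<bar>a * u z + b * v z\<bar> \<le> \<bar>a\<bar> * A + \<bar>b\<bar> * B" for z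
    by (rule order_trans[OF abs_triangle_ineq])
       (auto simp: abs_mult intro!: add_mono mult_left_mono A B)
  then have "bounded (range (\<lambda>z. a * u z + b * v z))"
    unfolding bounded_iff by auto
  then show ?thesis using assms by (auto intro!: continuous_intros)
qed

context
  fixes M :: "'a::metric_space measure"
  assumes fin: "finite_measure M" and sets_M: "sets M = sets borel"
begin

interpretation finite_measure M by (rule fin)

lemma bounded_continuous_L2: "bounded_continuous \<subseteq> L2 M"
proof
  fix u :: "'a \<Rightarrow> real" assume u: "u \<in> bounded_continuous"
  then obtain A where "\<And>z. \<bar>u z\<bar> \<le> A" unfolding bounded_iff by auto
  moreover have "u \<in> borel_measurable M"
    unfolding measurable_cong_sets[OF sets_M refl] using u by (auto intro: borel_measurable_continuous_onI)
  ultimately show "u \<in> L2 M" by (rule L2_bounded[rotated])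
qed

text \<open>The approximable sets form a Dynkin system, and the closed sets are a generator stable
  under intersection. For a closed set the functions \<open>max 0 (1 - n * infdist z S)\<close>
  decrease to the indicator.\<close>

lemma approximable_indicator:
  assumes "A \<in> sets borel"
  shows "approximable bounded_continuous (indicator A)"
proof -
  have meas: "(indicator A :: 'a \<Rightarrow> real) \<in> borel_measurable M" if "A \<in> sets borel" for A
    using that by (intro borel_measurable_indicator) (simp add: sets_M)
  have one: "(\<lambda>z. 1) \<in> L2 M" by (rule L2_bounded[of _ 1]) auto
  have ind: "(indicator A :: 'a \<Rightarrow> real) \<in> L2 M" if "A \<in> sets borel" for A
    by (rule L2_bounded[OF meas[OF that], of 1]) (auto simp: indicator_def)
  have self: "approximable bounded_continuous u" if "u \<in> bounded_continuous" for u
    unfolding approximable_def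
  proof (intro conjI allI impI bexI[of _ u])
    show "L2_norm M (\<lambda>z. u z - u z) < \<epsilon>" if "0 < \<epsilon>" for \<epsilon> using that by (simp add: L2_norm_def)
  qed (use that bounded_continuous_L2 in auto)
  have borel_eq: "sets (borel :: 'a measure) = sigma_sets UNIV (Collect closed)"
    by (simp add: borel_eq_closed)
  have "Int_stable (Collect closed :: 'a set set)" "Collect closed \<subseteq> Pow (UNIV :: 'a set)"
    by (auto simp: Int_stable_def)
  moreover have "A \<in> sigma_sets UNIV (Collect closed)" using assms by (simp add: borel_eq)
  ultimately show ?thesis
  proof (induction rule: sigma_sets_induct_disjoint)
    case (basic S)
    then have S: "closed S" by simp
    show ?case
    \<comment> \<open>The distance to the empty set is 0 by convention, so the functions below would
      approximate 1 instead of 0.\<close>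
    proof (cases "S = {}")
      case True
      have "(\<lambda>z. 0) \<in> bounded_continuous" by simp
      from self[OF this] True show ?thesis by (simp add: indicator_def[abs_def])
    next
      case False
      define u where "u n z = max 0 (1 - real n * infdist z S)" for n z
      have u: "u n \<in> bounded_continuous" for n
      proof -
        have "\<bar>u n z\<bar> \<le> 1" for z
          using infdist_nonneg[of z S] by (auto simp: u_def)
        moreover have "continuous_on UNIV (u n)"
          unfolding u_def by (intro continuous_intros)
        ultimately show ?thesis unfolding bounded_iff by auto
      qed
      have lim: "(\<lambda>n. u n z) \<longlonglongrightarrow> indicator S z" for z
      proof (cases "z \<in> S")
        case True
        then show ?thesis by (simp add: u_def)
      next
        case z: False
        then have "0 < infdist z S"
          using in_closed_iff_infdist_zero[OF S False, of z] infdist_nonneg[of z S] by linarith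
        moreover obtain N :: nat where "1 / infdist z S < real N"
          using reals_Archimedean2 by blast
        ultimately have N: "1 \<le> real N * infdist z S"
          by (simp add: field_simps)
        have "u n z = 0" if "N \<le> n" for n
        proof -
          have "real N * infdist z S \<le> real n * infdist z S"
            using that by (intro mult_right_mono infdist_nonneg) auto
          with N show ?thesis by (simp add: u_def)
        qed
        then show ?thesis
          using z by (intro tendsto_eventually eventually_sequentiallyI[of N]) auto
      qed
      have "(\<lambda>n. L2_norm M (\<lambda>z. u n z - indicator S z)) \<longlonglongrightarrow> 0"
      proof (rule L2_dominated_convergence(1)[OF one])
        show "u n \<in> borel_measurable M" for n
          using u bounded_continuous_L2 by (auto intro: L2_measurable)
        show "AE z in M. \<bar>u n z\<bar> \<le> 1" for n
          using infdist_nonneg[of _ S] by (auto simp: u_def)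
      qed (use lim S meas in auto)
      then show ?thesis
        using S by (intro approximable_limit[OF self[OF u] ind bounded_continuous_L2]) auto
    qed
  next
    case empty
    have "(\<lambda>z. 0) \<in> bounded_continuous" by simp
    from self[OF this] show ?case by (simp add: indicator_def[abs_def])
  next
    case (compl A)
    have "(\<lambda>z. 1) \<in> bounded_continuous" by simp
    from approximable_lin[OF self[OF this] compl(2) bounded_continuous_L2 bounded_continuous_lin, of 1 "-1"]
    moreover have "(\<lambda>z. 1 * 1 + -1 * indicator A z) = (indicator (UNIV - A) :: 'a \<Rightarrow> real)"
      by (auto simp: indicator_def)
    ultimately show ?case by simp
  next
    case (union A)
    have Ab: "A i \<in> sets borel" for i using union(2) by (auto simp: borel_eq)
    have part: "approximable bounded_continuous (\<lambda>z. \<Sum>i<n. indicator (A i) z)" for n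
    proof (induction n)
      case 0
      have "(\<lambda>z. 0) \<in> bounded_continuous" by simp
      from self[OF this] show ?case by simp
    next
      case (Suc n)
      from approximable_lin[OF Suc union(3)[of n] bounded_continuous_L2 bounded_continuous_lin, of 1 1]
      show ?case by simp
    qed
    have eq: "(\<Sum>i<n. indicator (A i) z) = (indicator (\<Union>i<n. A i) z :: real)" for n z
      using union(1) by (intro indicator_UN_disjoint[symmetric]) (auto simp: disjoint_family_on_def)
    have "(\<lambda>n. L2_norm M (\<lambda>z. (\<Sum>i<n. indicator (A i) z) - indicator (\<Union>i. A i) z)) \<longlonglongrightarrow> 0"
    proof (rule L2_dominated_convergence(1)[OF one])
      show "(indicator (\<Union>i. A i) :: 'a \<Rightarrow> real) \<in> borel_measurable M"
        using Ab by (intro meas) auto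
      show "AE z in M. \<bar>\<Sum>i<n. indicator (A i) z\<bar> \<le> (1::real)" for n
        unfolding eq by (auto simp: indicator_def)
      have "(\<lambda>n. indicator (\<Union>i<n. A i) z :: real) \<longlonglongrightarrow> indicator (\<Union>i. A i) z" for z
        by (rule LIMSEQ_indicator_UN)
      then show "AE z in M. (\<lambda>n. \<Sum>i<n. indicator (A i) z) \<longlonglongrightarrow> (indicator (\<Union>i. A i) z :: real)"
        unfolding eq by simp
    qed (use part in \<open>auto simp: approximable_def intro: L2_measurable\<close>)
    then show ?case
      by (intro approximable_limit[OF part ind bounded_continuous_L2]) (use Ab in auto)
  qed
qed

lemma bounded_continuous_dense:
  assumes "h \<in> L2 M"
  shows "approximable bounded_continuous h"
proof -
  have nonneg: "approximable bounded_continuous u" if u: "u \<in> L2 M" "\<And>z. 0 \<le> u z" for u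
  proof -
    \<comment> \<open>Membership in \<open>L2\<close> is part of the induction predicate. It passes
      to the pieces by rescaling or by domination, the pieces being nonnegative.\<close>
    have "u \<in> L2 M \<longrightarrow> approximable bounded_continuous u"
      using L2_measurable[OF u(1)] u(2)
    proof (induction u rule: borel_measurable_induct_real)
      case (set A)
      then show ?case using approximable_indicator[of A] by (simp add: sets_M)
    next
      case (mult u c)
      show ?case
      proof
        assume L: "(\<lambda>x. c * u x) \<in> L2 M"
        show "approximable bounded_continuous (\<lambda>x. c * u x)"
        proof (cases "c = 0")
          case True
          have "approximable bounded_continuous (\<lambda>z. 0)"
            using approximable_indicator[of "{}"] by (simp add: indicator_def[abs_def])
          then show ?thesis using True by simp
        next
          case False
          have "(\<lambda>x. inverse c * (c * u x)) \<in> L2 M" by (rule L2_scale[OF L])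
          with False mult(4) have "approximable bounded_continuous u" by (simp flip: mult.assoc)
          from approximable_lin[OF this this bounded_continuous_L2 bounded_continuous_lin, of c 0]
          show ?thesis by simp
        qed
      qed
    next
      case (add u v)
      show ?case
      proof
        assume L: "(\<lambda>x. v x + u x) \<in> L2 M"
        have "u \<in> L2 M" "v \<in> L2 M"
          by (rule L2_dominated[OF L]; use add in auto)+
        with add have "approximable bounded_continuous u" "approximable bounded_continuous v" by auto
        from approximable_lin[OF this(2,1) bounded_continuous_L2 bounded_continuous_lin, of 1 1]
        show "approximable bounded_continuous (\<lambda>x. v x + u x)" by simp
      qed
    next
      case (seq U)
      show ?case
      proof
        assume L: "u \<in> L2 M"
        have le: "U i z \<le> u z" if "z \<in> space M" for i z
        proof -
          have "incseq (\<lambda>i. U i z)" using \<open>incseq U\<close> by (auto simp: incseq_def le_fun_def)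
          then show ?thesis using seq(4)[OF that] by (rule incseq_le)
        qed
        have U: "U i \<in> L2 M" for i
          by (rule L2_dominated[OF L seq(1)]) (use le seq(2) in auto)
        have "(\<lambda>i. L2_norm M (\<lambda>z. U i z - u z)) \<longlonglongrightarrow> 0"
          by (rule L2_dominated_convergence(1)[OF L])
             (use le seq(1,2,4) L2_measurable[OF L] in auto)
        then show "approximable bounded_continuous u"
          using seq U by (intro approximable_limit[OF _ L bounded_continuous_L2]) auto
      qed
    qed
    with u show ?thesis by blast
  qed
  have L: "(\<lambda>z. max 0 (h z)) \<in> L2 M" "(\<lambda>z. max 0 (- h z)) \<in> L2 M"
  proof -
    have "(\<lambda>z. \<bar>h z\<bar>) \<in> L2 M" using assms L2_measurable[OF assms] by (simp add: L2_def)
    then show "(\<lambda>z. max 0 (h z)) \<in> L2 M" "(\<lambda>z. max 0 (- h z)) \<in> L2 M"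
      using L2_measurable[OF assms] by (auto intro: L2_dominated)
  qed
  have "approximable bounded_continuous (\<lambda>z. max 0 (h z))" "approximable bounded_continuous (\<lambda>z. max 0 (- h z))"
    by (rule nonneg[OF L(1)], simp, rule nonneg[OF L(2)], simp)
  from approximable_lin[OF this bounded_continuous_L2 bounded_continuous_lin, of 1 "-1"]
  have "approximable bounded_continuous (\<lambda>z. max 0 (h z) - max 0 (- h z))" by simp
  moreover have "(\<lambda>z. max 0 (h z) - max 0 (- h z)) = h" by auto
  ultimately show ?thesis by simp
qed

end

section \<open>Derivatives of cylinder functions along the flow\<close>

lemma MVT_unordered:
  fixes g :: "real \<Rightarrow> real"
  assumes "\<And>x. (g has_real_derivative g' x) (at x)"
  shows "\<exists>x. \<bar>x - a\<bar> \<le> \<bar>b - a\<bar> \<and> g b - g a = g' x * (b - a)"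
proof -
  consider "a < b" | "b < a" | "a = b" by linarith
  then show ?thesis
  proof cases
    case 1
    then obtain x where "a < x" "x < b" "g b - g a = (b - a) * g' x"
      using MVT2[of a b g g'] assms by blast
    then show ?thesis by (intro exI[of _ x]) (auto simp: mult.commute)
  next
    case 2
    then obtain x where "b < x" "x < a" "g a - g b = (a - b) * g' x"
      using MVT2[of b a g g'] assms by blast
    then show ?thesis by (intro exI[of _ x]) (auto simp: algebra_simps)
  qed auto
qed

text \<open>A chain rule from continuous partial derivatives. The auxiliary path \<open>p m\<close>
  moves only the first \<open>m\<close> coordinates; passing from \<open>m\<close> to
  \<open>Suc m\<close> changes one coordinate, and the mean value theorem produces a partial
  derivative at a point tending to \<open>\<gamma> 0\<close>.\<close>

lemma smooth_compact_support_chain: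
  assumes f: "smooth_compact_support n f"
    and \<gamma>: "\<And>i. i < n \<Longrightarrow> ((\<lambda>t. \<gamma> t i) has_real_derivative d i) (at 0)"
  shows "((\<lambda>t. f (\<gamma> t)) has_real_derivative (\<Sum>i<n. iterated_partial [i] f (\<gamma> 0) * d i)) (at 0)"
proof -
  have cont: "continuous_on UNIV (iterated_partial [i] f)" if "i < n" for i
    using f that unfolding smooth_compact_support_def by (auto dest!: spec[of _ "[i]"])
  have part: "((\<lambda>s. f (x(i := s))) has_real_derivative iterated_partial [i] f (x(i := r))) (at r)" if "i < n" for i x r
  proof -
    have "(\<lambda>s. f (y(i := s))) differentiable (at (y i))" for y
      using f that unfolding smooth_compact_support_def by (auto dest!: spec[of _ "[]"])
    from this[of "x(i := r)"] show ?thesis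
      by (simp add: DERIV_deriv_iff_real_differentiable)
  qed
  define p where "p m t i = (if i < m then \<gamma> t i else \<gamma> 0 i)" for m t i
  have "m \<le> n \<Longrightarrow> ((\<lambda>t. f (p m t)) has_real_derivative (\<Sum>i<m. iterated_partial [i] f (\<gamma> 0) * d i)) (at 0)" for m
  proof (induction m)
    case 0
    then show ?case by (simp add: p_def)
  next
    case (Suc m)
    then have m: "m < n" by simp
    let ?D = "iterated_partial [m] f"
    have p_Suc: "p (Suc m) t = (p m t)(m := \<gamma> t m)" and p_m: "p m t = (p m t)(m := \<gamma> 0 m)" for t
      by (auto simp: p_def)
    have "\<exists>x. \<bar>x - \<gamma> 0 m\<bar> \<le> \<bar>\<gamma> t m - \<gamma> 0 m\<bar> \<and>
        f (p (Suc m) t) - f (p m t) = ?D ((p m t)(m := x)) * (\<gamma> t m - \<gamma> 0 m)" for t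
      using MVT_unordered[OF part[OF m, of "p m t"], of "\<gamma> 0 m" "\<gamma> t m"]
      by (simp only: p_Suc[symmetric] p_m[symmetric])
    then obtain \<xi> where \<xi>: "\<And>t. \<bar>\<xi> t - \<gamma> 0 m\<bar> \<le> \<bar>\<gamma> t m - \<gamma> 0 m\<bar>"
      "\<And>t. f (p (Suc m) t) - f (p m t) = ?D ((p m t)(m := \<xi> t)) * (\<gamma> t m - \<gamma> 0 m)"
      by metis
    have \<gamma>_lim: "((\<lambda>t. \<gamma> t i) \<longlongrightarrow> \<gamma> 0 i) (at 0)" if "i < n" for i
      using DERIV_isCont[OF \<gamma>[OF that]] by (simp add: isCont_def)
    have \<xi>_lim: "(\<xi> \<longlongrightarrow> \<gamma> 0 m) (at 0)"
    proof -
      have "((\<lambda>t. \<xi> t - \<gamma> 0 m) \<longlongrightarrow> 0) (at 0)"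
      proof (rule Lim_null_comparison)
        show "\<forall>\<^sub>F t in at 0. norm (\<xi> t - \<gamma> 0 m) \<le> \<bar>\<gamma> t m - \<gamma> 0 m\<bar>"
          using \<xi>(1) by simp
        show "((\<lambda>t. \<bar>\<gamma> t m - \<gamma> 0 m\<bar>) \<longlongrightarrow> 0) (at 0)"
          using tendsto_rabs[OF tendsto_diff[OF \<gamma>_lim[OF m] tendsto_const[of "\<gamma> 0 m"]]] by simp
      qed
      then show ?thesis by (simp add: LIM_zero_iff)
    qed
    have "((\<lambda>t. (p m t)(m := \<xi> t)) \<longlongrightarrow> \<gamma> 0) (at 0)"
    proof -
      have lim: "((\<lambda>t. ((p m t)(m := \<xi> t)) i) \<longlongrightarrow> \<gamma> 0 i) (at 0)" for i
        using \<xi>_lim \<gamma>_lim[of i] m by (cases "i = m"; cases "i < m") (auto simp: p_def)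
      then have "limitin (product_topology (\<lambda>i. euclidean) UNIV) (\<lambda>t. (p m t)(m := \<xi> t)) (\<gamma> 0) (at 0)"
        by (auto simp: limitin_componentwise)
      then show ?thesis by (simp add: euclidean_product_topology)
    qed
    then have "((\<lambda>t. ?D ((p m t)(m := \<xi> t))) \<longlongrightarrow> ?D (\<gamma> 0)) (at 0)"
      by (rule continuous_on_tendsto_compose[OF cont[OF m]]) auto
    moreover have "((\<lambda>t. (\<gamma> t m - \<gamma> 0 m) / t) \<longlongrightarrow> d m) (at 0)"
      using \<gamma>[OF m] by (simp add: has_field_derivative_iff)
    ultimately have "((\<lambda>t. ?D ((p m t)(m := \<xi> t)) * ((\<gamma> t m - \<gamma> 0 m) / t)) \<longlongrightarrow> ?D (\<gamma> 0) * d m) (at 0)"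
      by (rule tendsto_mult)
    then have "((\<lambda>t. (f (p (Suc m) t) - f (p m t)) / t) \<longlongrightarrow> ?D (\<gamma> 0) * d m) (at 0)"
      by (simp add: \<xi>(2))
    moreover have "p k 0 = \<gamma> 0" for k by (auto simp: p_def)
    ultimately have "((\<lambda>t. f (p (Suc m) t) - f (p m t)) has_real_derivative ?D (\<gamma> 0) * d m) (at 0)"
      by (simp add: has_field_derivative_iff)
    from DERIV_add[OF Suc.IH this] Suc.prems show ?case by simp
  qed
  from this[of n] have "((\<lambda>t. f (p n t)) has_real_derivative (\<Sum>i<n. iterated_partial [i] f (\<gamma> 0) * d i)) (at 0)"
    by simp
  moreover have "f (p n t) = f (\<gamma> t)" for t
  proof -
    have "\<forall>x y. (\<forall>i<n. x i = y i) \<longrightarrow> f x = f y"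
      using f unfolding smooth_compact_support_def by blast
    then show ?thesis by (auto simp: p_def)
  qed
  ultimately show ?thesis by simp
qed

lemma compact_support_bounded:
  fixes g :: "(nat \<Rightarrow> real) \<Rightarrow> real"
  assumes g: "continuous_on UNIV g" and loc: "\<And>x y. (\<And>i. i < n \<Longrightarrow> x i = y i) \<Longrightarrow> g x = g y"
    and supp: "\<And>x i. i < n \<Longrightarrow> r < \<bar>x i\<bar> \<Longrightarrow> g x = 0"
  obtains A where "\<And>x. \<bar>g x\<bar> \<le> A"
proof -
  define S where "S = PiE UNIV (\<lambda>i. if i < n then {- \<bar>r\<bar>..\<bar>r\<bar>} else {0::real})"
  have "compactin (product_topology (\<lambda>i. euclidean) UNIV) S"
    unfolding S_def compactin_PiE by auto
  then have "compact S"
    by (simp add: euclidean_product_topology)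
  then have "compact (g ` S)"
    by (rule compact_continuous_image[rotated]) (use g in \<open>auto intro: continuous_on_subset\<close>)
  then have "bounded (g ` S)" by (rule compact_imp_bounded)
  then obtain A where A: "\<And>x. x \<in> S \<Longrightarrow> \<bar>g x\<bar> \<le> A"
    unfolding bounded_iff by auto
  have "\<bar>g x\<bar> \<le> \<bar>A\<bar>" for x
  proof (cases "\<exists>i<n. r < \<bar>x i\<bar>")
    case True
    then show ?thesis using supp by auto
  next
    case False
    define y where "y i = (if i < n then x i else 0)" for i
    have "- \<bar>r\<bar> \<le> x i \<and> x i \<le> \<bar>r\<bar>" if "i < n" for i
    proof -
      have "\<bar>x i\<bar> \<le> r" using False that by (meson not_less)
      then show ?thesis by linarith
    qed
    then have "y \<in> S" by (auto simp: S_def y_def)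
    moreover have "g x = g y" by (rule loc) (simp add: y_def)
    ultimately show ?thesis using A[of y] by simp
  qed
  then show ?thesis by (rule that)
qed

text \<open>The partial derivatives are bounded, but the support is compact only in the directions
  \<open>h i\<close>. The components of the vector field \<open>J\<close> along them can be
  unbounded there, hence linear growth and not boundedness.\<close>

lemma smooth_cylinder_flow_derivative:
  fixes u :: "'a::real_inner \<times> 'a \<Rightarrow> real"
  assumes "u \<in> smooth_cylinder_functions"
  obtains Xu A C where "continuous_on UNIV u" "\<And>z. \<bar>u z\<bar> \<le> A" "continuous_on UNIV Xu"
    "\<And>z. \<bar>Xu z\<bar> \<le> C * (1 + norm z)"
    "\<And>z. ((\<lambda>t. u (boomerang_flow t z)) has_real_derivative Xu z) (at 0)"
proof -
  obtain n h f where u: "u = (\<lambda>z. f (\<lambda>i. h i \<bullet> z))" and f: "smooth_compact_support n f"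
    using assms unfolding smooth_cylinder_functions_def by blast
  have loc: "f x = f y" if "\<And>i. i < n \<Longrightarrow> x i = y i" for x y
    using f that unfolding smooth_compact_support_def by blast
  obtain r where supp: "\<And>x i. i < n \<Longrightarrow> r < \<bar>x i\<bar> \<Longrightarrow> f x = 0"
    using f unfolding smooth_compact_support_def by blast
  have cf: "continuous_on UNIV f"
    using f unfolding smooth_compact_support_def by (auto dest!: spec[of _ "[]"])
  let ?D = "\<lambda>i. iterated_partial [i] f"
  have cD: "continuous_on UNIV (?D i)" if "i < n" for i
    using f that unfolding smooth_compact_support_def by (auto dest!: spec[of _ "[i]"])
  have "\<exists>A. \<forall>x. \<bar>f x\<bar> \<le> A"
  proof (rule compact_support_bounded[of f n r, OF cf])
    show "f x = f y" if "\<And>i. i < n \<Longrightarrow> x i = y i" for x y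
      using that by (rule loc)
    show "f x = 0" if "i < n" "r < \<bar>x i\<bar>" for x i
      using that by (rule supp)
  qed blast
  then obtain A where A: "\<And>x. \<bar>f x\<bar> \<le> A" by blast
  have "\<exists>B. \<forall>x. \<bar>?D i x\<bar> \<le> B" if i: "i < n" for i
  proof -
    have "\<exists>B. \<forall>x. \<bar>?D i x\<bar> \<le> B"
    proof (rule compact_support_bounded[of "?D i" n r, OF cD[OF i]])
      fix x y :: "nat \<Rightarrow> real" assume xy: "\<And>i. i < n \<Longrightarrow> x i = y i"
      have "(\<lambda>s. f (x(i := s))) = (\<lambda>s. f (y(i := s)))"
        using xy by (intro ext loc) auto
      then show "?D i x = ?D i y" using xy[OF i] by simp
    next
      fix x :: "nat \<Rightarrow> real" and j assume j: "j < n" "r < \<bar>x j\<bar>"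
      \<comment> \<open>If the large coordinate is the varied one, \<open>f\<close> vanishes for all
        nearby values of it; otherwise \<open>f\<close> vanishes on the whole line.\<close>
      have "((\<lambda>s. f (x(i := s))) has_real_derivative 0) (at (x i))"
      proof (cases "j = i")
        case True
        have "open {s :: real. r < \<bar>s\<bar>}"
          by (intro open_Collect_less continuous_intros)
        then show ?thesis
          by (rule has_field_derivative_transform_within_open[of "\<lambda>_. 0" 0, rotated 1])
             (use j True supp[OF i] in auto)
      next
        case False
        then have "(\<lambda>s. f (x(i := s))) = (\<lambda>s. 0)"
          using j by (intro ext supp[of j]) auto
        then show ?thesis by simp
      qed
      then show "?D i x = 0" by (simp add: DERIV_imp_deriv)
    qed blast
    then show ?thesis .
  qed
  then obtain B where B: "\<And>i x. i < n \<Longrightarrow> \<bar>?D i x\<bar> \<le> B i"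
    by metis
  define J where "J z = (snd z, - fst z)" for z :: "'a \<times> 'a"
  define Xu where "Xu z = (\<Sum>i<n. ?D i (\<lambda>i. h i \<bullet> z) * (h i \<bullet> J z))" for z
  have ch: "continuous_on UNIV (\<lambda>z. (\<lambda>i. h i \<bullet> z))"
    by (intro continuous_on_coordinatewise_then_product continuous_intros)
  show ?thesis
  proof (rule that[of A Xu "\<Sum>i<n. B i * norm (h i)"])
    show "continuous_on UNIV u"
      unfolding u by (rule continuous_on_compose2[OF cf ch]) auto
    show "\<bar>u z\<bar> \<le> A" for z unfolding u by (rule A)
    show "continuous_on UNIV Xu"
      unfolding Xu_def J_def
      by (intro continuous_intros continuous_on_compose2[OF cD ch]) auto
    show "\<bar>Xu z\<bar> \<le> (\<Sum>i<n. B i * norm (h i)) * (1 + norm z)" for z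
    proof -
      have nJ: "norm (J z) = norm z"
        by (cases z) (simp add: J_def norm_Pair add.commute)
      have "\<bar>Xu z\<bar> \<le> (\<Sum>i<n. \<bar>?D i (\<lambda>i. h i \<bullet> z) * (h i \<bullet> J z)\<bar>)"
        unfolding Xu_def by (rule sum_abs)
      also have "\<dots> \<le> (\<Sum>i<n. B i * norm (h i) * (1 + norm z))"
      proof (intro sum_mono)
        fix i assume i: "i \<in> {..<n}"
        have "\<bar>h i \<bullet> J z\<bar> \<le> norm (h i) * norm z"
          using Cauchy_Schwarz_ineq2[of "h i" "J z"] by (simp add: nJ)
        also have "\<dots> \<le> norm (h i) * (1 + norm z)"
          by (intro mult_left_mono) auto
        finally have "\<bar>h i \<bullet> J z\<bar> \<le> norm (h i) * (1 + norm z)" .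
        moreover have "\<bar>?D i (\<lambda>i. h i \<bullet> z)\<bar> \<le> B i" using B i by blast
        moreover from this have "0 \<le> B i" by linarith
        ultimately have "\<bar>?D i (\<lambda>i. h i \<bullet> z)\<bar> * \<bar>h i \<bullet> J z\<bar> \<le> B i * (norm (h i) * (1 + norm z))"
          by (intro mult_mono) simp_all
        then show "\<bar>?D i (\<lambda>i. h i \<bullet> z) * (h i \<bullet> J z)\<bar> \<le> B i * norm (h i) * (1 + norm z)"
          by (simp only: abs_mult mult.assoc)
      qed
      also have "\<dots> = (\<Sum>i<n. B i * norm (h i)) * (1 + norm z)"
        by (simp add: sum_distrib_right)
      finally show ?thesis .
    qed
    show "((\<lambda>t. u (boomerang_flow t z)) has_real_derivative Xu z) (at 0)" for z
    proof -
      have "((\<lambda>t. h i \<bullet> boomerang_flow t z) has_real_derivative h i \<bullet> J z) (at 0)" for i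
      proof -
        have "((\<lambda>t. cos t * (fst (h i) \<bullet> fst z) + sin t * (fst (h i) \<bullet> snd z) +
            (cos t * (snd (h i) \<bullet> snd z) - sin t * (snd (h i) \<bullet> fst z))) has_real_derivative h i \<bullet> J z) (at 0)"
          by (auto intro!: derivative_eq_intros simp: J_def inner_prod_def)
        then show ?thesis
          by (simp add: boomerang_flow_def inner_prod_def inner_add_right inner_diff_right)
      qed
      from smooth_compact_support_chain[OF f, of "\<lambda>t i. h i \<bullet> boomerang_flow t z", OF this]
      show ?thesis by (simp add: u Xu_def boomerang_flow_0)
    qed
  qed
qed

section \<open>Approximate resolvents\<close>

context boomerang
begin

lemma bounce_sum_diff:
  assumes "\<And>y. \<bar>u y\<bar> \<le> A" "\<And>y. \<bar>v y\<bar> \<le> B"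
  shows "bounce_sum (\<lambda>y. u y - v y) z = bounce_sum u z - bounce_sum v z"
  unfolding bounce_sum_def right_diff_distrib
  by (rule suminf_diff[symmetric]) (rule bounce_summable[OF assms(1)] bounce_summable[OF assms(2)])+

lemma refresh_integrable:
  fixes u :: "'h \<times> 'h \<Rightarrow> real"
  assumes u: "continuous_on UNIV u" and A: "\<And>y. \<bar>u y\<bar> \<le> A"
  shows "integrable \<nu> (\<lambda>w. u (fst z, w))"
proof (rule nu.integrable_const_bound[where B=A])
  have "continuous_on UNIV (\<lambda>w. u (fst z, w))"
    by (intro continuous_on_compose2[OF u] continuous_intros) auto
  then show "(\<lambda>w. u (fst z, w)) \<in> borel_measurable \<nu>"
    unfolding measurable_cong_sets[OF sets_nu refl] by (rule borel_measurable_continuous_onI)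
qed (use A in auto)

lemma refresh_diff:
  assumes "continuous_on UNIV u" "\<And>y. \<bar>u y\<bar> \<le> A" "continuous_on UNIV v" "\<And>y. \<bar>v y\<bar> \<le> B"
  shows "refresh (\<lambda>y. u y - v y) z = refresh u z - refresh v z"
  unfolding refresh_def
  by (rule Bochner_Integration.integral_diff) (rule refresh_integrable assms)+

definition damping :: "real \<Rightarrow> 'h \<times> 'h \<Rightarrow> real" where
  "damping \<rho> z = \<rho> / (\<rho> + lb z)"

lemma damping_bounds:
  assumes "0 < \<rho>"
  shows "0 < damping \<rho> z" "damping \<rho> z \<le> 1" "damping \<rho> z * lb z \<le> \<rho>"
proof -
  have p: "0 < \<rho> + lb z" using assms lb_nonneg[of z] by linarith
  show "0 < damping \<rho> z" "damping \<rho> z \<le> 1"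
    using assms p lb_nonneg[of z] unfolding damping_def by (simp_all only: divide_pos_pos pos_divide_le_eq) simp
  have "\<rho> * lb z \<le> \<rho> * (\<rho> + lb z)" using assms by (intro mult_left_mono) auto
  then show "damping \<rho> z * lb z \<le> \<rho>"
    using p by (simp add: damping_def pos_divide_le_eq)
qed

lemma continuous_damping: "0 < \<rho> \<Longrightarrow> continuous_on UNIV (damping \<rho>)"
  unfolding damping_def[abs_def]
  by (intro continuous_intros continuous_total_rate) (metis add_pos_nonneg lb_nonneg less_irrefl)

text \<open>Uniformisation: the rate \<open>\<rho> - damping \<rho> z * lb z\<close> left over by
  the thinned bounces is spent on fictitious jumps that stay put. The total rate is then the
  constant \<open>\<rho> + lr\<close>, which is also the norm bound of this operator.\<close>

definition damped_jumps :: "real \<Rightarrow> ('h \<times> 'h \<Rightarrow> real) \<Rightarrow> 'h \<times> 'h \<Rightarrow> real" where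
  "damped_jumps \<rho> u z =
     damping \<rho> z * bounce_sum u z + (\<rho> - damping \<rho> z * lb z) * u z + lr * refresh u z"

lemma continuous_damped_jumps:
  "0 < \<rho> \<Longrightarrow> continuous_on UNIV u \<Longrightarrow> bounded (range u) \<Longrightarrow> continuous_on UNIV (damped_jumps \<rho> u)"
  unfolding damped_jumps_def[abs_def]
  by (intro continuous_intros continuous_damping continuous_bounce_sum continuous_refresh' continuous_total_rate)

lemma damped_jumps_bound:
  assumes \<rho>: "0 < \<rho>" and A: "\<And>y. \<bar>u y\<bar> \<le> A"
  shows "\<bar>damped_jumps \<rho> u z\<bar> \<le> (\<rho> + lr) * A"
proof -
  let ?d = "damping \<rho> z"
  have "\<bar>?d * bounce_sum u z\<bar> \<le> ?d * (A * lb z)"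
    using bounce_summable(2)[OF A] damping_bounds[OF \<rho>, of z] by (simp add: abs_mult)
  moreover have "\<bar>(\<rho> - ?d * lb z) * u z\<bar> \<le> (\<rho> - ?d * lb z) * A"
    using A damping_bounds[OF \<rho>, of z] by (simp add: abs_mult mult_left_mono)
  moreover have "\<bar>lr * refresh u z\<bar> \<le> lr * A"
    using abs_refresh_le[OF A] lr_pos by (simp add: abs_mult)
  ultimately have "\<bar>damped_jumps \<rho> u z\<bar> \<le> ?d * (A * lb z) + (\<rho> - ?d * lb z) * A + lr * A"
    unfolding damped_jumps_def by linarith
  also have "\<dots> = (\<rho> + lr) * A" by (simp add: algebra_simps)
  finally show ?thesis .
qed

lemma damped_jumps_diff:
  assumes "continuous_on UNIV u" "\<And>y. \<bar>u y\<bar> \<le> A" "continuous_on UNIV v" "\<And>y. \<bar>v y\<bar> \<le> B"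
  shows "damped_jumps \<rho> (\<lambda>y. u y - v y) z = damped_jumps \<rho> u z - damped_jumps \<rho> v z"
  unfolding damped_jumps_def bounce_sum_diff[OF assms(2,4)] refresh_diff[OF assms]
  by (simp add: algebra_simps)

text \<open>The fixed point solves the resolvent equation of the process whose bounces are thinned by the
  factor \<open>damping \<rho>\<close>; thinning makes the total jump rate bounded, hence the fixed point map a
  contraction, and its effect disappears as \<open>\<rho> \<rightarrow> \<infinity>\<close>.\<close>

lemma resolvent_fixed_point:
  assumes \<alpha>: "0 < \<alpha>" and \<rho>: "0 < \<rho>" and f: "continuous_on UNIV f" and A: "\<And>z. \<bar>f z\<bar> \<le> A"
  obtains u where "continuous_on UNIV u" "\<And>z. \<bar>u z\<bar> \<le> A / \<alpha>"
    "u = flow_average (\<alpha> + \<rho> + lr) (\<lambda>z. f z + damped_jumps \<rho> u z)"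
proof -
  define \<beta> where "\<beta> = \<alpha> + \<rho> + lr"
  have \<beta>: "0 < \<beta>" using \<alpha> \<rho> lr_pos by (simp add: \<beta>_def)
  define F where "F u z = f z + damped_jumps \<rho> u z" for u z
  \<comment> \<open>Bounded continuous functions as a type are complete under the supremum distance,
    so Banach's theorem applies; the contraction factor is
    \<open>(\<rho> + lr) / \<beta>\<close>.\<close>
  define \<Psi> where "\<Psi> g = Bcontfun (flow_average \<beta> (F (apply_bcontfun g)))" for g :: "('h \<times> 'h) \<Rightarrow>\<^sub>C real"
  have g: "\<bar>apply_bcontfun g z\<bar> \<le> norm g" for g :: "('h \<times> 'h) \<Rightarrow>\<^sub>C real" and z
    using norm_bounded[of g z] by simp
  have Fc: "continuous_on UNIV (F (apply_bcontfun g))" for g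
    unfolding F_def[abs_def] using g
    by (intro continuous_intros f continuous_damped_jumps \<rho>) (auto simp: bounded_iff)
  have Fb: "\<bar>F (apply_bcontfun g) z\<bar> \<le> A + (\<rho> + lr) * norm g" for g z
    using A[of z] damped_jumps_bound[OF \<rho>, of "apply_bcontfun g" "norm g" z, OF g] unfolding F_def by linarith
  have bound: "\<bar>flow_average \<beta> (F (apply_bcontfun g)) z\<bar> \<le> (A + (\<rho> + lr) * norm g) / \<beta>" for g z
    by (rule flow_average_bound[OF \<beta> Fc Fb])
  have \<Psi>: "apply_bcontfun (\<Psi> g) = flow_average \<beta> (F (apply_bcontfun g))" for g
    unfolding \<Psi>_def
    by (rule Bcontfun_inverse, rule bcontfun_normI[OF flow_average_continuous[OF Fc]])
       (use bound in auto)
  have "dist (\<Psi> g) (\<Psi> h) \<le> (\<rho> + lr) / \<beta> * dist g h" for g h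
  proof (rule dist_bound)
    fix z
    have d: "\<bar>apply_bcontfun g y - apply_bcontfun h y\<bar> \<le> dist g h" for y
      using dist_bounded[of g y h] by (simp add: dist_real_def)
    have "F (apply_bcontfun g) y - F (apply_bcontfun h) y =
        damped_jumps \<rho> (\<lambda>y. apply_bcontfun g y - apply_bcontfun h y) y" for y
      unfolding F_def by (subst damped_jumps_diff[OF _ g _ g]) auto
    then have "\<bar>F (apply_bcontfun g) y - F (apply_bcontfun h) y\<bar> \<le> (\<rho> + lr) * dist g h" for y
      using damped_jumps_bound[OF \<rho> d] by simp
    then have "\<bar>flow_average \<beta> (F (apply_bcontfun g)) z - flow_average \<beta> (F (apply_bcontfun h)) z\<bar>
        \<le> ((\<rho> + lr) * dist g h) / \<beta>"
      by (intro flow_average_diff_le \<beta> Fc)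
    then show "dist (apply_bcontfun (\<Psi> g) z) (apply_bcontfun (\<Psi> h) z) \<le> (\<rho> + lr) / \<beta> * dist g h"
      by (simp add: \<Psi> dist_real_def)
  qed
  moreover have "0 \<le> (\<rho> + lr) / \<beta>" "(\<rho> + lr) / \<beta> < 1"
    using \<alpha> \<rho> lr_pos \<beta> by (simp_all add: \<beta>_def)
  ultimately obtain g where fixed: "\<Psi> g = g"
    using banach_fix_type[of "(\<rho> + lr) / \<beta>" \<Psi>] by auto
  have eq: "apply_bcontfun g = flow_average \<beta> (F (apply_bcontfun g))"
    using \<Psi>[of g] unfolding fixed .
  \<comment> \<open>Since \<open>\<beta> - (\<rho> + lr)\<close> is \<alpha>, absorbing the norm on
    the right gives the bound \<open>A / \<alpha>\<close>, independent of \<rho>.\<close>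
  have "norm g \<le> (A + (\<rho> + lr) * norm g) / \<beta>"
    using bound[of g] unfolding eq[symmetric] by (intro norm_bound) auto
  then have "\<alpha> * norm g \<le> A"
    using \<beta> by (simp add: pos_le_divide_eq) (simp add: \<beta>_def algebra_simps)
  then have "norm g \<le> A / \<alpha>" using \<alpha> by (simp add: pos_le_divide_eq mult.commute)
  then have "\<bar>apply_bcontfun g z\<bar> \<le> A / \<alpha>" for z using g[of g z] by linarith
  then show ?thesis
    using eq by (intro that[of "apply_bcontfun g"]) (auto simp: F_def[abs_def] \<beta>_def)
qed

text \<open>The second argument of \<open>generator\<close> is the flow derivative supplied by
  \<open>flow_average_derivative\<close>. After inserting it everything cancels except the bounces
  removed by thinning, which carry the factor \<open>1 - damping \<rho> z\<close>.\<close>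

lemma resolvent_residual:
  assumes \<rho>: "0 < \<rho>"
    and u: "u = flow_average (\<alpha> + \<rho> + lr) (\<lambda>z. f z + damped_jumps \<rho> u z)" and B: "\<And>z. \<bar>u z\<bar> \<le> B"
  shows "\<bar>\<alpha> * u z - generator u (\<lambda>z. (\<alpha> + \<rho> + lr) * u z - (f z + damped_jumps \<rho> u z)) z - f z\<bar>
    \<le> 2 * B * ((1 - damping \<rho> z) * lb z)"
proof -
  have "\<alpha> * u z - generator u (\<lambda>z. (\<alpha> + \<rho> + lr) * u z - (f z + damped_jumps \<rho> u z)) z - f z =
      - (1 - damping \<rho> z) * (bounce_sum u z - lb z * u z)"
    by (simp add: generator_def damped_jumps_def algebra_simps)
  then have "\<bar>\<alpha> * u z - generator u (\<lambda>z. (\<alpha> + \<rho> + lr) * u z - (f z + damped_jumps \<rho> u z)) z - f z\<bar> =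
      (1 - damping \<rho> z) * \<bar>bounce_sum u z - lb z * u z\<bar>"
    using damping_bounds[OF \<rho>, of z] by (simp add: abs_mult)
  also have "\<dots> \<le> (1 - damping \<rho> z) * (2 * B * lb z)"
    using bounce_summable(3)[of u B z, OF B] damping_bounds[OF \<rho>, of z] by (intro mult_left_mono) auto
  finally show ?thesis by (simp add: algebra_simps)
qed

end

section \<open>The generator on spaces of functions differentiable along the flow\<close>

context boomerang
begin

lemma abs_generator_le:
  assumes "\<And>y. \<bar>u y\<bar> \<le> A" "\<bar>Xu z\<bar> \<le> B"
  shows "\<bar>generator u Xu z\<bar> \<le> B + 2 * A * lb z + lr * (2 * A)"
proof -
  have "\<bar>refresh u z - u z\<bar> \<le> 2 * A"
    using abs_refresh_le[of u A z] assms(1)[of z] assms(1) by fastforce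
  then have "\<bar>lr * (refresh u z - u z)\<bar> \<le> lr * (2 * A)"
    using lr_pos by (simp add: abs_mult)
  then show ?thesis
    using assms(2) bounce_summable(3)[of u A z, OF assms(1)] unfolding generator_def by linarith
qed

text \<open>Bounded pointwise convergence passes through the refreshment integral by dominated
  convergence, and through the bounce series by Tannery's theorem with the summable majorant
  \<open>A * lam n z\<close>.\<close>

lemma generator_tendsto:
  assumes u: "\<And>j. continuous_on UNIV (u j)" and A: "\<And>j z. \<bar>u j z\<bar> \<le> A"
    and lim: "\<And>z. (\<lambda>j. u j z) \<longlonglongrightarrow> u' z" and X: "(\<lambda>j. X j z) \<longlonglongrightarrow> X' z"
  shows "(\<lambda>j. generator (u j) (X j) z) \<longlonglongrightarrow> generator u' X' z"
proof -
  have meas: "(\<lambda>w. u j (fst z, w)) \<in> borel_measurable \<nu>" for j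
    using refresh_integrable[OF u A] by (rule borel_measurable_integrable)
  have "(\<lambda>j. \<integral>w. u j (fst z, w) \<partial>\<nu>) \<longlonglongrightarrow> (\<integral>w. u' (fst z, w) \<partial>\<nu>)"
  proof (rule integral_dominated_convergence[of _ _ _ "\<lambda>_. A"])
    show "(\<lambda>w. u' (fst z, w)) \<in> borel_measurable \<nu>"
      by (rule borel_measurable_LIMSEQ_real[OF lim meas])
  qed (use meas lim A in auto)
  then have refresh: "(\<lambda>j. refresh (u j) z) \<longlonglongrightarrow> refresh u' z"
    by (simp add: refresh_def)
  have le: "norm (lam n z * u j (bounce n z)) \<le> A * lam n z" for n j
    using mult_left_mono[OF A[of j "bounce n z"], of "lam n z"] by (simp add: abs_mult mult.commute)
  have "(\<lambda>j. \<Sum>n. lam n z * u j (bounce n z)) \<longlonglongrightarrow> (\<Sum>n. lam n z * u' (bounce n z))"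
  proof (rule tannerys_theorem[THEN conjunct2, THEN conjunct2])
    show "\<forall>\<^sub>F (n, j) in sequentially \<times>\<^sub>F sequentially. norm (lam n z * u j (bounce n z)) \<le> A * lam n z"
      using le by (intro always_eventually) auto
    show "summable (\<lambda>n. A * lam n z)" by (intro summable_mult summable_bounce_rate)
  qed (auto intro!: tendsto_mult_left lim)
  then have bounces: "(\<lambda>j. bounce_sum (u j) z) \<longlonglongrightarrow> bounce_sum u' z"
    by (simp add: bounce_sum_def)
  show ?thesis
    unfolding generator_def by (intro tendsto_intros refresh bounces X lim)
qed

end

text \<open>The weight \<open>W\<close> dominates constants, linear growth and the bounce rate at
  once, so one square integrable majorant serves for every generator that occurs.\<close>

locale boomerang_L2 = boomerang \<nu> \<Phi> lr R + L2_semigroup M T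
  for \<nu> :: "'h::{real_inner, banach, second_countable_topology} measure" and \<Phi> lr R
    and M :: "('h \<times> 'h) measure" and T +
  fixes W :: "'h \<times> 'h \<Rightarrow> real" and K :: real
  assumes sets_M: "sets M = sets borel"
    and W_L2: "W \<in> L2 M"
    and norm_le_W: "1 + norm z \<le> W z"
    and total_rate_le: "total_bounce_rate \<Phi> R z \<le> K * W z"
    and extends: "0 \<le> t \<Longrightarrow> f \<in> boomerang_C0 \<nu> \<Phi> lr R \<Longrightarrow>
      AE z in M. T t f z = boomerang_semigroup \<nu> \<Phi> lr R t f z"
begin

lemma continuous_measurable: "continuous_on UNIV f \<Longrightarrow> f \<in> borel_measurable M" for f :: "'h \<times> 'h \<Rightarrow> real"
  unfolding measurable_cong_sets[OF sets_M refl] by (rule borel_measurable_continuous_onI)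

lemma one_le_W: "1 \<le> W z"
  using norm_le_W[of z] norm_ge_zero[of z] by linarith

text \<open>The Lipschitz estimate has two uses: it places \<open>u\<close> in
  \<open>boomerang_C0\<close>, where \<open>T\<close> is the pathwise semigroup, and it dominates
  the difference quotients by \<open>C\<close>. The pointwise derivative then becomes a limit in
  \<open>L2\<close>.\<close>

lemma bounded_generator:
  assumes u: "continuous_on UNIV u" and A: "\<And>z. \<bar>u z\<bar> \<le> A" and Xu: "continuous_on UNIV Xu"
    and deriv: "\<And>z. ((\<lambda>t. u (boomerang_flow t z)) has_real_derivative Xu z) (at 0)"
    and C: "\<And>z. \<bar>generator u Xu z\<bar> \<le> C"
  shows "(u, generator u Xu) \<in> semigroup_generator M T"
proof -
  let ?P = "boomerang_semigroup \<nu> \<Phi> lr R"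
  have bu: "bounded (range u)" using A by (auto simp: bounded_iff)
  have C0: "0 \<le> C" using C[of 0] by linarith
  note Lip = semigroup_Lipschitz[OF u A Xu deriv C]
  have "uniform_limit UNIV (\<lambda>t. ?P t u) u (at_right 0)"
    unfolding uniform_limit_iff
  proof (intro allI impI)
    fix e :: real assume "0 < e"
    show "\<forall>\<^sub>F t in at_right 0. \<forall>z\<in>UNIV. dist (?P t u z) (u z) < e"
      unfolding eventually_at_right_field
    proof (intro exI[of _ "e / (C + 1)"] conjI allI impI ballI)
      show "0 < e / (C + 1)" using \<open>0 < e\<close> C0 by simp
      fix t z assume t: "0 < t" "t < e / (C + 1)"
      have "dist (?P t u z) (u z) \<le> C * t" using Lip[of t z] t by (simp add: dist_real_def)
      also have "\<dots> \<le> (C + 1) * t" using t by (simp add: algebra_simps)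
      also have "\<dots> < e" using t C0 by (simp add: pos_less_divide_eq mult.commute)
      finally show "dist (?P t u z) (u z) < e" .
    qed
  qed
  then have uC0: "u \<in> boomerang_C0 \<nu> \<Phi> lr R" using u bu by (simp add: boomerang_C0_def)
  have uL: "u \<in> L2 M" by (rule L2_bounded[OF continuous_measurable[OF u] A])
  have mg: "generator u Xu \<in> borel_measurable M"
    by (intro continuous_measurable continuous_generator u bu Xu)
  have gL: "generator u Xu \<in> L2 M" by (rule L2_bounded[OF mg C])
  have "((\<lambda>t. L2_norm M (\<lambda>z. (T t u z - u z) / t - generator u Xu z)) \<longlongrightarrow> 0) (at_right 0)"
  \<comment> \<open>\<open>T t u\<close> is the pathwise semigroup only outside a null set depending
    on \<open>t\<close>. Along a sequence of times the union of these sets is still null.\<close>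
  proof (rule tendsto_at_right_sequentially[of 0 1])
    fix s :: "nat \<Rightarrow> real" assume s: "\<And>n. 0 < s n" "s \<longlonglongrightarrow> 0"
    have eq: "AE z in M. T (s n) u z = ?P (s n) u z" for n
      using extends[OF _ uC0, of "s n"] s(1)[of n] by simp
    then have all_eq: "AE z in M. \<forall>n. T (s n) u z = ?P (s n) u z"
      by (simp add: AE_all_countable)
    have s_right: "filterlim s (at_right 0) sequentially"
      using s by (simp add: filterlim_at eventually_sequentially less_imp_neq[symmetric])
    show "(\<lambda>n. L2_norm M (\<lambda>z. (T (s n) u z - u z) / s n - generator u Xu z)) \<longlonglongrightarrow> 0"
    proof (rule L2_dominated_convergence(1))
      show "(\<lambda>_. C) \<in> L2 M" by (rule L2_bounded[of _ C]) (use C0 in auto)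
      show "generator u Xu \<in> borel_measurable M" by (rule mg)
      show "(\<lambda>z. (T (s n) u z - u z) / s n) \<in> borel_measurable M" for n
        using L2_measurable[OF T_L2[OF _ uL, of "s n"]] L2_measurable[OF uL] s(1)[of n] by simp
      show "AE z in M. (\<lambda>n. (T (s n) u z - u z) / s n) \<longlonglongrightarrow> generator u Xu z"
        using all_eq
      proof eventually_elim
        case (elim z)
        have "(\<lambda>n. (?P (s n) u z - u z) / s n) \<longlonglongrightarrow> generator u Xu z"
          by (rule filterlim_compose[OF semigroup_derivative[OF u A Xu deriv C] s_right])
        with elim show ?case by simp
      qed
      show "AE z in M. \<bar>(T (s n) u z - u z) / s n\<bar> \<le> C" for n
        using eq[of n]
      proof eventually_elim
        case (elim z)
        with Lip[of "s n" z] s(1)[of n] show ?case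
          by (simp add: pos_divide_le_eq)
      qed
    qed
  qed simp
  then show ?thesis using uL gL by (simp add: semigroup_generator_def)
qed

text \<open>This controls the graph norm by pointwise convergence, provided that the functions are
  uniformly bounded and their flow derivatives have a common linear growth bound.\<close>

lemma generator_L2_limit:
  assumes u: "\<And>j. continuous_on UNIV (u j)" and A: "\<And>j z. \<bar>u j z\<bar> \<le> A"
    and X: "\<And>j. continuous_on UNIV (X j)" and B: "\<And>j z. \<bar>X j z\<bar> \<le> B * (1 + norm z)"
    and lim: "\<And>z. (\<lambda>j. u j z) \<longlonglongrightarrow> u' z" "\<And>z. (\<lambda>j. X j z) \<longlonglongrightarrow> X' z"
  shows "(\<lambda>j. L2_norm M (\<lambda>z. u j z - u' z)) \<longlonglongrightarrow> 0" and "u' \<in> L2 M"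
    and "(\<lambda>j. L2_norm M (\<lambda>z. generator (u j) (X j) z - generator u' X' z)) \<longlonglongrightarrow> 0"
    and "generator u' X' \<in> L2 M"
proof -
  have A0: "0 \<le> A" using A[of 0 0] by linarith
  have B0: "0 \<le> B"
    using order_trans[OF abs_ge_zero B[of 0 0]] by simp
  have mu: "u j \<in> borel_measurable M" and mg: "generator (u j) (X j) \<in> borel_measurable M" for j
    using A by (intro continuous_measurable continuous_generator u X; auto simp: bounded_iff)+
  have const: "(\<lambda>_. A) \<in> L2 M" by (rule L2_bounded[of _ A]) (use A0 in auto)
  have mu': "u' \<in> borel_measurable M"
    by (rule borel_measurable_LIMSEQ_real[OF lim(1) mu])
  have lu: "AE z in M. (\<lambda>j. u j z) \<longlonglongrightarrow> u' z" and bu: "\<And>j. AE z in M. \<bar>u j z\<bar> \<le> A"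
    using lim A by auto
  show "(\<lambda>j. L2_norm M (\<lambda>z. u j z - u' z)) \<longlonglongrightarrow> 0" "u' \<in> L2 M"
    using L2_dominated_convergence[OF const mu' mu lu bu] by blast+
  define D where "D = B + 2 * A * K + lr * (2 * A)"
  have W: "(\<lambda>z. D * W z) \<in> L2 M" by (rule L2_scale[OF W_L2])
  have glim: "(\<lambda>j. generator (u j) (X j) z) \<longlonglongrightarrow> generator u' X' z" for z
    by (rule generator_tendsto[OF u A lim])
  have mg': "generator u' X' \<in> borel_measurable M"
    by (rule borel_measurable_LIMSEQ_real[OF glim mg])
  have bound: "\<bar>generator (u j) (X j) z\<bar> \<le> D * W z" for j z
  proof -
    have "\<bar>generator (u j) (X j) z\<bar> \<le> B * (1 + norm z) + 2 * A * lb z + lr * (2 * A)"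
      by (rule abs_generator_le[OF A B])
    also have "\<dots> \<le> B * W z + 2 * A * (K * W z) + lr * (2 * A) * W z"
    proof (intro add_mono mult_left_mono norm_le_W total_rate_le)
      show "lr * (2 * A) \<le> lr * (2 * A) * W z"
        using mult_left_mono[OF one_le_W[of z], of "lr * (2 * A)"] lr_pos A0 by simp
    qed (use A0 B0 in auto)
    also have "\<dots> = D * W z" by (simp add: D_def algebra_simps)
    finally show ?thesis .
  qed
  have lg: "AE z in M. (\<lambda>j. generator (u j) (X j) z) \<longlonglongrightarrow> generator u' X' z"
    and bg: "\<And>j. AE z in M. \<bar>generator (u j) (X j) z\<bar> \<le> D * W z"
    using glim bound by auto
  show "(\<lambda>j. L2_norm M (\<lambda>z. generator (u j) (X j) z - generator u' X' z)) \<longlonglongrightarrow> 0"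
    "generator u' X' \<in> L2 M"
    using L2_dominated_convergence[OF W mg' mg lg bg] by blast+
qed

text \<open>The cut-off \<kappa> of the norm commutes with the flow derivative and the bounces, so
  the truncated function has a bounded generator. The limit is taken with
  \<open>generator_L2_limit\<close> and closedness.\<close>

lemma linear_growth_generator:
  assumes u: "continuous_on UNIV u" and A: "\<And>z. \<bar>u z\<bar> \<le> A" and Xu: "continuous_on UNIV Xu"
    and B: "\<And>z. \<bar>Xu z\<bar> \<le> B * (1 + norm z)"
    and deriv: "\<And>z. ((\<lambda>t. u (boomerang_flow t z)) has_real_derivative Xu z) (at 0)"
  shows "(u, generator u Xu) \<in> semigroup_generator M T"
proof -
  define \<kappa> where "\<kappa> j z = bump 0 ((norm z / real (Suc j))\<^sup>2)" for j and z :: "'h \<times> 'h"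
  have \<kappa>_cont: "continuous_on UNIV (\<kappa> j)" for j
    unfolding \<kappa>_def[abs_def]
    by (rule continuous_on_compose2[OF continuous_bump[of UNIV]]) (auto intro!: continuous_intros)
  have \<kappa>: "0 \<le> \<kappa> j z" "\<kappa> j z \<le> 1" for j z
    by (simp_all add: \<kappa>_def bump_nonneg bump_le_1)
  have \<kappa>_flow: "\<kappa> j (boomerang_flow t z) = \<kappa> j z" and \<kappa>_bounce: "\<kappa> j (bounce n z) = \<kappa> j z" for j n t z
    by (simp_all add: \<kappa>_def norm_boomerang_flow norm_bounce)
  have \<kappa>_0: "\<kappa> j z = 0" if "real (Suc j) \<le> norm z" for j z
  proof -
    have "1 \<le> norm z / real (Suc j)" using that by (simp add: pos_le_divide_eq)
    then have "1 \<le> (norm z / real (Suc j))\<^sup>2" by simp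
    then show ?thesis by (simp add: \<kappa>_def bump_eq_0)
  qed
  have \<kappa>_lim: "(\<lambda>j. \<kappa> j z) \<longlonglongrightarrow> 1" for z
  proof -
    have "(\<lambda>j. (norm z / real (Suc j))\<^sup>2) \<longlonglongrightarrow> 0"
      using tendsto_power[OF LIMSEQ_Suc[OF lim_const_over_n[of "norm z"]], of 2] by simp
    from continuous_on_tendsto_compose[OF continuous_bump[of UNIV 0] this]
    show ?thesis by (simp add: \<kappa>_def bump_0)
  qed
  define v where "v j z = \<kappa> j z * u z" for j z
  define Y where "Y j z = \<kappa> j z * Xu z" for j z
  have A0: "0 \<le> A" using A[of 0] by linarith
  have B0: "0 \<le> B" using order_trans[OF abs_ge_zero B[of 0]] by simp
  have v: "continuous_on UNIV (v j)" and Y: "continuous_on UNIV (Y j)" for j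
    unfolding v_def[abs_def] Y_def[abs_def] by (intro continuous_intros u Xu \<kappa>_cont)+
  have vle: "\<bar>v j z\<bar> \<le> \<bar>u z\<bar>" and Yle: "\<bar>Y j z\<bar> \<le> \<bar>Xu z\<bar>" for j z
    using \<kappa>[of j z] by (auto simp: v_def Y_def abs_mult intro!: mult_left_le_one_le)
  have vA: "\<bar>v j z\<bar> \<le> A" and YB: "\<bar>Y j z\<bar> \<le> B * (1 + norm z)" for j z
    using vle[of j z] A[of z] Yle[of j z] B[of z] by linarith+
  \<comment> \<open>Bounces preserve the norm, so the cut-off has the same value at all terms of the
    series and can be taken out.\<close>
  have bounce_v: "bounce_sum (v j) z - lb z * v j z = \<kappa> j z * (bounce_sum u z - lb z * u z)" for j z
  proof -
    have "bounce_sum (v j) z = \<kappa> j z * bounce_sum u z"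
      unfolding bounce_sum_def v_def \<kappa>_bounce
      by (subst suminf_mult[symmetric, OF bounce_summable(1)[OF A]]) (simp add: mult.left_commute)
    then show ?thesis by (simp add: v_def algebra_simps)
  qed
  have "(v j, generator (v j) (Y j)) \<in> semigroup_generator M T" for j
  proof -
    let ?r = "real (Suc j)"
    have "bounded (lb ` cball 0 ?r)" by (rule bounded_total_rate) simp
    then obtain L where "\<forall>x\<in>lb ` cball 0 ?r. norm x \<le> L"
      unfolding bounded_iff by blast
    then have L: "lb z \<le> L" if "norm z \<le> ?r" for z
      using that by simp
    define C where "C = B * (1 + ?r) + 2 * A * L + lr * (2 * A)"
    have L0: "0 \<le> L" using order_trans[OF lb_nonneg L[of 0]] by simp
    have "\<bar>generator (v j) (Y j) z\<bar> \<le> C" for z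
    proof (cases "norm z \<le> ?r")
      case True
      have "\<bar>generator (v j) (Y j) z\<bar> \<le> B * (1 + norm z) + 2 * A * lb z + lr * (2 * A)"
        by (rule abs_generator_le[OF vA YB])
      also have "\<dots> \<le> C"
        unfolding C_def using True A0 B0 L lr_pos by (intro add_mono mult_left_mono) auto
      finally show ?thesis .
    next
      case False
      then have "\<kappa> j z = 0" by (intro \<kappa>_0) simp
      \<comment> \<open>Outside the ball only refreshment can bring the process back to the support,
        and this happens at the bounded rate \<open>lr\<close>.\<close>
      then have "generator (v j) (Y j) z = lr * refresh (v j) z"
        unfolding generator_def bounce_v by (simp add: v_def Y_def)
      then have "\<bar>generator (v j) (Y j) z\<bar> \<le> lr * A"
        using abs_refresh_le[of "v j" A z, OF vA] lr_pos by (simp add: abs_mult)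
      also have "\<dots> \<le> lr * (2 * A)" using lr_pos A0 by (intro mult_left_mono) auto
      also have "\<dots> \<le> C" using A0 B0 L0 by (simp add: C_def)
      finally show ?thesis .
    qed
    moreover have "((\<lambda>t. v j (boomerang_flow t z)) has_real_derivative Y j z) (at 0)" for z
      unfolding v_def Y_def \<kappa>_flow by (rule DERIV_cmult[OF deriv])
    ultimately show ?thesis by (intro bounded_generator[OF v vA Y])
  qed
  moreover have "(\<lambda>j. v j z) \<longlonglongrightarrow> u z" "(\<lambda>j. Y j z) \<longlonglongrightarrow> Xu z" for z
    unfolding v_def Y_def using tendsto_mult_right[OF \<kappa>_lim[of z], of "u z"] tendsto_mult_right[OF \<kappa>_lim[of z], of "Xu z"] by simp_all
  note lim = generator_L2_limit[OF v vA Y YB this]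
  ultimately show ?thesis by (intro generator_closed[OF _ lim(2,4,1,3)])
qed

lemma smooth_cylinder_Domain: "smooth_cylinder_functions \<subseteq> Domain (semigroup_generator M T)"
proof
  fix u :: "'h \<times> 'h \<Rightarrow> real" assume "u \<in> smooth_cylinder_functions"
  then obtain Xu A C where "continuous_on UNIV u" "\<And>z. \<bar>u z\<bar> \<le> A" "continuous_on UNIV Xu"
    "\<And>z. \<bar>Xu z\<bar> \<le> C * (1 + norm z)"
    "\<And>z. ((\<lambda>t. u (boomerang_flow t z)) has_real_derivative Xu z) (at 0)"
    by (rule smooth_cylinder_flow_derivative) blast
  then have "(u, generator u Xu) \<in> semigroup_generator M T" by (rule linear_growth_generator)
  then show "u \<in> Domain (semigroup_generator M T)" by blast
qed

text \<open>The resolvent function is a graph limit of cylinder functions. Closedness puts it into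
  the domain, and the same sequence approximates it.\<close>

lemma flow_average_approx:
  assumes \<beta>: "0 < \<beta>" and F: "continuous_on UNIV F" and C: "\<And>z. \<bar>F z\<bar> \<le> C" and \<epsilon>: "0 < \<epsilon>"
  defines "u \<equiv> flow_average \<beta> F" and "Xu \<equiv> \<lambda>z. \<beta> * flow_average \<beta> F z - F z"
  shows "(u, generator u Xu) \<in> semigroup_generator M T"
    and "\<exists>v g. v \<in> smooth_cylinder_functions \<and> (v, g) \<in> semigroup_generator M T \<and>
      L2_norm M (\<lambda>z. u z - v z) < \<epsilon> \<and> L2_norm M (\<lambda>z. generator u Xu z - g z) < \<epsilon>"
proof -
  have C0: "0 \<le> C" using C[of 0] by linarith
  obtain e :: "nat \<Rightarrow> 'h" where "orthonormal_system e" by (rule orthonormal_system_exists)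
  then interpret orthonormal_system e .
  obtain v Y where v: "\<And>k. v k \<in> smooth_cylinder_functions"
    and cv: "\<And>k. continuous_on UNIV (v k)" and cY: "\<And>k. continuous_on UNIV (Y k)"
    and dv: "\<And>k z. ((\<lambda>t. v k (boomerang_flow t z)) has_real_derivative Y k z) (at 0)"
    and bv: "\<And>k z. \<bar>v k z\<bar> \<le> (C + 1) / \<beta>" and bY: "\<And>k z. \<bar>Y k z\<bar> \<le> 2 * (C + 1)"
    and lim: "\<And>z. (\<lambda>k. v k z) \<longlonglongrightarrow> flow_average \<beta> F z"
      "\<And>z. (\<lambda>k. Y k z) \<longlonglongrightarrow> \<beta> * flow_average \<beta> F z - F z"
    using smooth_cylinder_approx[OF \<beta> F C] by blast
  have bY': "\<bar>Y k z\<bar> \<le> 2 * (C + 1) * (1 + norm z)" for k z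
  proof -
    have "2 * (C + 1) * 1 \<le> 2 * (C + 1) * (1 + norm z)" using C0 by (intro mult_left_mono) auto
    with bY[of k z] show ?thesis by linarith
  qed
  note L = generator_L2_limit[OF cv bv cY bY' lim]
  have gen: "(v k, generator (v k) (Y k)) \<in> semigroup_generator M T" for k
    by (rule linear_growth_generator[OF cv bv cY bY' dv])
  show "(u, generator u Xu) \<in> semigroup_generator M T"
    unfolding u_def Xu_def by (rule generator_closed[OF gen L(2,4,1,3)])
  have "\<forall>\<^sub>F k in sequentially. L2_norm M (\<lambda>z. v k z - u z) < \<epsilon> \<and>
      L2_norm M (\<lambda>z. generator (v k) (Y k) z - generator u Xu z) < \<epsilon>"
    using order_tendstoD(2)[OF L(1) \<epsilon>] order_tendstoD(2)[OF L(3) \<epsilon>]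
    unfolding u_def Xu_def by (rule eventually_conj)
  then obtain k where k: "L2_norm M (\<lambda>z. v k z - u z) < \<epsilon>"
      "L2_norm M (\<lambda>z. generator (v k) (Y k) z - generator u Xu z) < \<epsilon>"
    by (auto dest: eventually_happens)
  have "L2_norm M (\<lambda>z. u z - v k z) < \<epsilon>" "L2_norm M (\<lambda>z. generator u Xu z - generator (v k) (Y k) z) < \<epsilon>"
    using k by (simp_all only: L2_norm_minus_commute[of M u] L2_norm_minus_commute[of M "generator u Xu"])
  then show "\<exists>v g. v \<in> smooth_cylinder_functions \<and> (v, g) \<in> semigroup_generator M T \<and>
      L2_norm M (\<lambda>z. u z - v z) < \<epsilon> \<and> L2_norm M (\<lambda>z. generator u Xu z - g z) < \<epsilon>"
    using v gen by blast
qed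

end

section \<open>Graph density\<close>

lemma linear_span_add_scaled:
  assumes "f \<in> linear_span D" "F \<in> D"
  shows "(\<lambda>z. f z + c * F z) \<in> linear_span D"
proof -
  obtain k :: nat and d G where f: "f = (\<lambda>z. \<Sum>i<k. d i * G i z)" and G: "\<forall>i<k. G i \<in> D"
    using assms(1) unfolding linear_span_def by blast
  have "(\<lambda>z. f z + c * F z) = (\<lambda>z. \<Sum>i<Suc k. (d(k := c)) i * (G(k := F)) i z)"
    unfolding f by (auto intro!: sum.cong)
  moreover have "\<forall>i<Suc k. (G(k := F)) i \<in> D" using G assms(2) by (auto simp: less_Suc_eq)
  ultimately show ?thesis unfolding linear_span_def by blast
qed

lemma linear_span_zero: "(\<lambda>_. 0) \<in> linear_span D"
  unfolding linear_span_def by (rule CollectI, rule exI[of _ 0]) auto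

lemma linear_span_superset: "D \<subseteq> linear_span D"
  using linear_span_add_scaled[OF linear_span_zero, of _ D 1] by auto

lemma linear_span_induct [consumes 1, case_names zero add_scaled]:
  assumes "f \<in> linear_span D" and "P (\<lambda>_. 0)"
    and step: "\<And>f F c. f \<in> linear_span D \<Longrightarrow> P f \<Longrightarrow> F \<in> D \<Longrightarrow> P (\<lambda>z. f z + c * F z)"
  shows "P f"
proof -
  obtain k :: nat and c F where f: "f = (\<lambda>z. \<Sum>i<k. c i * F i z)" and F: "\<forall>i<k. F i \<in> D"
    using assms(1) unfolding linear_span_def by blast
  have "m \<le> k \<Longrightarrow> (\<lambda>z. \<Sum>i<m. c i * F i z) \<in> linear_span D \<and> P (\<lambda>z. \<Sum>i<m. c i * F i z)" for m
  proof (induction m)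
    case 0
    then show ?case using assms(2) linear_span_zero by simp
  next
    case (Suc m)
    then show ?case
      using F step[of "\<lambda>z. \<Sum>i<m. c i * F i z" "F m" "c m"]
        linear_span_add_scaled[of "\<lambda>z. \<Sum>i<m. c i * F i z" D "F m" "c m"] by simp
  qed
  then show ?thesis using f by blast
qed

lemma linear_span_lin:
  assumes f: "f \<in> linear_span D" and g: "g \<in> linear_span D"
  shows "(\<lambda>z. a * f z + b * g z) \<in> linear_span D"
  using g
proof (induction rule: linear_span_induct)
  case zero
  show ?case
    using f
  proof (induction rule: linear_span_induct)
    case zero
    then show ?case by (simp add: linear_span_zero)
  next
    case (add_scaled f F c)
    from linear_span_add_scaled[OF this(3,2), of "a * c"] show ?case
      by (simp add: algebra_simps)
  qed
next
  case (add_scaled g F c)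
  from linear_span_add_scaled[OF this(3,2), of "b * c"] show ?case
    by (simp add: algebra_simps)
qed

text \<open>Passing to a larger set keeps density, and the span stays in the domain because the
  generator is linear.\<close>

lemma (in L2_semigroup) is_core_linear_span:
  assumes D: "graph_dense M (semigroup_generator M T) D" and "D \<noteq> {}"
  shows "is_core M (semigroup_generator M T) (linear_span D)"
proof -
  have sub: "D \<subseteq> Domain (semigroup_generator M T)" using D by (simp add: graph_dense_def)
  have "linear_span D \<subseteq> Domain (semigroup_generator M T)"
  proof
    fix f assume "f \<in> linear_span D"
    then show "f \<in> Domain (semigroup_generator M T)"
    proof (induction rule: linear_span_induct)
      case zero
      obtain f g where "(f, g) \<in> semigroup_generator M T" using sub \<open>D \<noteq> {}\<close> by blast
      from generator_lin[OF this this, of 0 0] show ?case by auto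
    next
      case (add_scaled f F c)
      then obtain g G where "(f, g) \<in> semigroup_generator M T" "(F, G) \<in> semigroup_generator M T"
        using sub by blast
      from generator_lin[OF this, of 1 c] show ?case by auto
    qed
  qed
  moreover have "\<exists>(f', g')\<in>semigroup_generator M T. f' \<in> linear_span D \<and>
      L2_norm M (\<lambda>z. f z - f' z) + L2_norm M (\<lambda>z. g z - g' z) < \<epsilon>"
    if fg: "(f, g) \<in> semigroup_generator M T" and \<epsilon>: "0 < \<epsilon>" for f g \<epsilon>
  proof -
    obtain f' g' where "(f', g') \<in> semigroup_generator M T" "f' \<in> D"
      "L2_norm M (\<lambda>z. f z - f' z) + L2_norm M (\<lambda>z. g z - g' z) < \<epsilon>"
      using D fg \<epsilon> unfolding graph_dense_def by blast
    then show ?thesis using linear_span_superset by blast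
  qed
  ultimately show ?thesis
    using linear_span_zero linear_span_lin unfolding is_core_def graph_dense_def by blast
qed

lemma smooth_cylinder_nonempty: "smooth_cylinder_functions \<noteq> {}"
proof -
  have "smooth_compact_support 0 (\<lambda>_. 0)" by (auto simp: smooth_compact_support_def)
  then show ?thesis unfolding smooth_cylinder_functions_def by blast
qed

context boomerang_L2
begin

text \<open>The factor \<open>1 - damping \<rho> z\<close> is \<open>lb z / (\<rho> + lb z)\<close>.
  It lies between 0 and 1 and tends to 0 pointwise as \<rho> grows, and \<open>B * K * W\<close> is
  a square integrable majorant.\<close>

lemma damping_residual_small:
  assumes B: "0 \<le> B" and \<delta>: "0 < \<delta>"
  obtains \<rho> where "0 < \<rho>" "(\<lambda>z. B * ((1 - damping \<rho> z) * lb z)) \<in> L2 M"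
    "L2_norm M (\<lambda>z. B * ((1 - damping \<rho> z) * lb z)) < \<delta>"
proof -
  define w where "w n z = B * ((1 - damping (real (Suc n)) z) * lb z)" for n z
  have mw: "w n \<in> borel_measurable M" for n
    unfolding w_def[abs_def]
    by (intro continuous_measurable continuous_intros continuous_damping continuous_total_rate) simp
  have W: "(\<lambda>z. B * K * W z) \<in> L2 M" by (rule L2_scale[OF W_L2])
  have bound: "\<bar>w n z\<bar> \<le> B * K * W z" for n z
  proof -
    have "0 \<le> 1 - damping (real (Suc n)) z" "1 - damping (real (Suc n)) z \<le> 1"
      using damping_bounds[of "real (Suc n)" z] by auto
    then have "0 \<le> (1 - damping (real (Suc n)) z) * lb z" "(1 - damping (real (Suc n)) z) * lb z \<le> lb z"
      by (auto intro: mult_left_le_one_le)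
    then have "\<bar>w n z\<bar> \<le> B * lb z"
      using B unfolding w_def by (simp add: abs_mult mult_left_mono)
    also have "\<dots> \<le> B * (K * W z)" by (intro mult_left_mono total_rate_le B)
    finally show ?thesis by simp
  qed
  have "(\<lambda>n. w n z) \<longlonglongrightarrow> 0" for z
  proof -
    have "(\<lambda>n. lb z / (real (Suc n) + lb z)) \<longlonglongrightarrow> 0"
      by (rule tendsto_divide_0[OF tendsto_const])
         (auto intro!: filterlim_at_top_imp_at_infinity filterlim_tendsto_add_at_top[OF tendsto_const]
           filterlim_compose[OF filterlim_real_sequentially filterlim_Suc] simp: add.commute[of _ "lb z"] simp del: of_nat_Suc)
    moreover have "1 - damping (real (Suc n)) z = lb z / (real (Suc n) + lb z)" for n
    proof -
      have "real (Suc n) + lb z \<noteq> 0" using lb_nonneg[of z] of_nat_0_less_iff[of "Suc n", where 'a=real] by linarith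
      then show ?thesis by (simp add: damping_def field_simps)
    qed
    ultimately have "(\<lambda>n. B * ((1 - damping (real (Suc n)) z) * lb z)) \<longlonglongrightarrow> B * (0 * lb z)"
      by (intro tendsto_intros) simp
    then show ?thesis by (simp add: w_def)
  qed
  then have "(\<lambda>n. L2_norm M (\<lambda>z. w n z - 0)) \<longlonglongrightarrow> 0"
    by (intro L2_dominated_convergence(1)[OF W _ mw]) (use bound in auto)
  then obtain n where "L2_norm M (w n) < \<delta>"
    using order_tendstoD(2)[of _ 0 sequentially \<delta>] \<delta> by (fastforce dest: eventually_happens)
  moreover have "w n \<in> L2 M" by (rule L2_dominated[OF W mw]) (use bound in auto)
  ultimately show ?thesis
    by (intro that[of "real (Suc n)"]) (auto simp: w_def[abs_def])
qed

text \<open>Given \<open>(f, g)\<close>, the function \<open>h = a f - g\<close> is replaced by a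
  bounded continuous \<open>f0\<close>, whose approximate solution \<open>u\<close> has a bound not
  depending on \<rho>; so \<rho> can be chosen after \<open>f0\<close> to make the residual small.
  The a priori estimate for \<open>f - u\<close> carries this back to the graph norm.\<close>

theorem graph_dense_smooth_cylinder:
  "graph_dense M (semigroup_generator M T) smooth_cylinder_functions"
  unfolding graph_dense_def
proof (intro conjI smooth_cylinder_Domain ballI, clarify)
  fix f g :: "'h \<times> 'h \<Rightarrow> real" and \<epsilon> :: real
  assume fg: "(f, g) \<in> semigroup_generator M T" and \<epsilon>: "0 < \<epsilon>"
  obtain a C where a: "0 < a" and C: "0 < C"
    and est: "\<And>w v. (w, v) \<in> semigroup_generator M T \<Longrightarrow> L2_norm M w \<le> C * L2_norm M (\<lambda>z. a * w z - v z)"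
    by (rule resolvent_estimate) blast
  \<comment> \<open>The errors add up to \<open>2 * C\<close> for \<open>f - u\<close>,
    \<open>2 * a * C + 2\<close> for \<open>g - L\<close>, and 1 each for passing from
    \<open>u\<close> and \<open>L\<close> to the cylinder function.\<close>
  define \<delta> where "\<delta> = \<epsilon> / (2 * C + 2 * a * C + 4)"
  have q: "0 < 2 * C + 2 * a * C + 4" using a C by (intro add_pos_pos mult_pos_pos) auto
  have \<delta>: "0 < \<delta>" using q \<epsilon> by (simp add: \<delta>_def)
  have fL: "f \<in> L2 M" and gL: "g \<in> L2 M" using fg by (auto simp: semigroup_generator_def)
  define h where "h z = a * f z - g z" for z
  have hL: "h \<in> L2 M" unfolding h_def[abs_def] using fL gL by (intro L2_diff L2_scale)
  obtain f0 where f0: "continuous_on UNIV f0" "bounded (range f0)" and hf0: "L2_norm M (\<lambda>z. h z - f0 z) < \<delta>"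
    using bounded_continuous_dense[OF finite_measure_axioms sets_M hL] \<delta> unfolding approximable_def by blast
  obtain A where A: "\<And>z. \<bar>f0 z\<bar> \<le> A" using f0(2) unfolding bounded_iff by auto
  have A0: "0 \<le> A" using A[of 0] by linarith
  have f0L: "f0 \<in> L2 M" by (rule L2_bounded[OF continuous_measurable[OF f0(1)] A])
  obtain \<rho> where \<rho>: "0 < \<rho>" and wL: "(\<lambda>z. 2 * (A / a) * ((1 - damping \<rho> z) * lb z)) \<in> L2 M"
    and w: "L2_norm M (\<lambda>z. 2 * (A / a) * ((1 - damping \<rho> z) * lb z)) < \<delta>"
    by (rule damping_residual_small[OF _ \<delta>, of "2 * (A / a)"]) (use a A0 in auto)
  obtain u where u: "continuous_on UNIV u" "\<And>z. \<bar>u z\<bar> \<le> A / a"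
    "u = flow_average (a + \<rho> + lr) (\<lambda>z. f0 z + damped_jumps \<rho> u z)"
    using resolvent_fixed_point[OF a \<rho> f0(1) A] by blast
  define F where "F z = f0 z + damped_jumps \<rho> u z" for z
  have cF: "continuous_on UNIV F"
    unfolding F_def[abs_def] using u by (intro continuous_intros f0 continuous_damped_jumps \<rho>) (auto simp: bounded_iff)
  have bF: "\<bar>F z\<bar> \<le> A + (\<rho> + lr) * (A / a)" for z
    using A[of z] damped_jumps_bound[of \<rho> u "A / a" z, OF \<rho> u(2)] unfolding F_def by linarith
  have \<beta>: "0 < a + \<rho> + lr" using a \<rho> lr_pos by linarith
  define L where "L = generator u (\<lambda>z. (a + \<rho> + lr) * u z - F z)"
  have uF: "flow_average (a + \<rho> + lr) F = u" using u(3) by (simp add: F_def[abs_def])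
  have uG: "(u, L) \<in> semigroup_generator M T"
    and "\<exists>v g'. v \<in> smooth_cylinder_functions \<and> (v, g') \<in> semigroup_generator M T \<and>
      L2_norm M (\<lambda>z. u z - v z) < \<delta> \<and> L2_norm M (\<lambda>z. L z - g' z) < \<delta>"
    using flow_average_approx[OF \<beta> cF bF \<delta>] unfolding uF L_def by blast+
  then obtain v g' where v: "v \<in> smooth_cylinder_functions" and vg: "(v, g') \<in> semigroup_generator M T"
    and uv: "L2_norm M (\<lambda>z. u z - v z) < \<delta>" and Lg': "L2_norm M (\<lambda>z. L z - g' z) < \<delta>" by blast
  have uL: "u \<in> L2 M" and LL: "L \<in> L2 M" and vL: "v \<in> L2 M" and g'L: "g' \<in> L2 M"
    using uG vg by (auto simp: semigroup_generator_def)
  have resL: "(\<lambda>z. a * u z - L z) \<in> L2 M" using uL LL by (intro L2_diff L2_scale)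
  have "L2_norm M (\<lambda>z. (a * u z - L z) - f0 z) \<le> L2_norm M (\<lambda>z. 2 * (A / a) * ((1 - damping \<rho> z) * lb z))"
  proof (rule L2_norm_mono[OF wL])
    show "(\<lambda>z. (a * u z - L z) - f0 z) \<in> borel_measurable M"
      by (rule L2_measurable[OF L2_diff[OF resL f0L]])
    show "AE z in M. \<bar>(a * u z - L z) - f0 z\<bar> \<le> 2 * (A / a) * ((1 - damping \<rho> z) * lb z)"
      using resolvent_residual[OF \<rho> u(3), of "A / a"] u(2) unfolding L_def F_def[abs_def] by simp
  qed
  then have res: "L2_norm M (\<lambda>z. f0 z - (a * u z - L z)) < \<delta>"
    using w by (simp add: L2_norm_minus_commute[of M f0])
  have hr: "L2_norm M (\<lambda>z. h z - (a * u z - L z)) < 2 * \<delta>"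
    using L2_norm_triangle3[OF hL f0L resL] hf0 res by linarith
  have "L2_norm M (\<lambda>z. f z - u z) \<le> C * L2_norm M (\<lambda>z. a * (f z - u z) - (g z - L z))"
    by (rule est[OF generator_diff[OF fg uG]])
  also have "(\<lambda>z. a * (f z - u z) - (g z - L z)) = (\<lambda>z. h z - (a * u z - L z))"
    by (auto simp: h_def algebra_simps)
  also have "C * L2_norm M \<dots> \<le> C * (2 * \<delta>)" using hr C by (intro mult_left_mono) auto
  finally have fu: "L2_norm M (\<lambda>z. f z - u z) \<le> C * (2 * \<delta>)" .
  \<comment> \<open>The second component is recovered from the first and the residual, since
    \<open>g\<close> is \<open>a * f - h\<close>.\<close>
  have "L2_norm M (\<lambda>z. g z - L z) = L2_norm M (\<lambda>z. a * (f z - u z) - (h z - (a * u z - L z)))"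
    by (simp add: h_def algebra_simps)
  also have "\<dots> \<le> L2_norm M (\<lambda>z. a * (f z - u z)) + L2_norm M (\<lambda>z. (h z - (a * u z - L z)) - 0)"
    using L2_norm_triangle3[OF L2_scale[OF L2_diff[OF fL uL]] L2_zero L2_diff[OF hL resL], of a]
    by (simp add: L2_norm_minus_commute[of M h])
  also have "\<dots> \<le> a * (C * (2 * \<delta>)) + 2 * \<delta>"
  proof (rule add_mono)
    show "L2_norm M (\<lambda>z. a * (f z - u z)) \<le> a * (C * (2 * \<delta>))"
      unfolding L2_norm_scale using fu a by simp
  qed (use hr in simp)
  finally have gL': "L2_norm M (\<lambda>z. g z - L z) \<le> a * (C * (2 * \<delta>)) + 2 * \<delta>" .
  have "L2_norm M (\<lambda>z. f z - v z) + L2_norm M (\<lambda>z. g z - g' z) <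
      (C * (2 * \<delta>) + \<delta>) + (a * (C * (2 * \<delta>)) + 2 * \<delta> + \<delta>)"
    using L2_norm_triangle3[OF fL uL vL] L2_norm_triangle3[OF gL LL g'L] fu gL' uv Lg' by linarith
  also have "\<dots> = (2 * C + 2 * a * C + 4) * \<delta>" by (simp add: algebra_simps)
  also have "\<dots> = \<epsilon>" using q by (simp add: \<delta>_def)
  finally show "\<exists>(f', g')\<in>semigroup_generator M T. f' \<in> smooth_cylinder_functions \<and>
      L2_norm M (\<lambda>z. f z - f' z) + L2_norm M (\<lambda>z. g z - g' z) < \<epsilon>"
    using v vg by blast
qed

end

section \<open>The target measure\<close>

context
  fixes \<nu> :: "'h::{real_inner, banach, second_countable_topology} measure" and \<Phi> :: "'h \<Rightarrow> real"
  assumes prob: "prob_space \<nu>" and sets_nu: "sets \<nu> = sets borel"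
    and \<Phi>: "continuous_on UNIV \<Phi>" "\<And>x. 0 \<le> \<Phi> x"
begin

interpretation nu: prob_space \<nu> by (rule prob)
interpretation pair: prob_space "\<nu> \<Otimes>\<^sub>M \<nu>" by (rule prob_space_pair[OF prob prob])

lemma sets_pair_nu: "sets (\<nu> \<Otimes>\<^sub>M \<nu>) = sets borel"
  unfolding borel_prod[symmetric] by (rule sets_pair_measure_cong[OF sets_nu sets_nu])

lemma sets_target: "sets (boomerang_target \<nu> \<Phi>) = sets borel"
  by (simp add: boomerang_target_def sets_pair_nu)

text \<open>The potential is nonnegative, so the density with respect to the product measure is at
  most the reciprocal of the normalising constant. Square integrability for the product measure is
  therefore inherited by the target.\<close>

lemma target_density:
  obtains d c where "boomerang_target \<nu> \<Phi> = density (\<nu> \<Otimes>\<^sub>M \<nu>) (\<lambda>z. ennreal (d z))"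
    "d \<in> borel_measurable (\<nu> \<Otimes>\<^sub>M \<nu>)" "\<And>z. 0 \<le> d z" "\<And>z. d z \<le> c"
proof -
  define Z where "Z = (\<integral>y. exp (- \<Phi> (fst y)) \<partial>(\<nu> \<Otimes>\<^sub>M \<nu>))"
  have Z: "0 \<le> Z" unfolding Z_def by (rule Bochner_Integration.integral_nonneg) simp
  show ?thesis
  proof (rule that[of "\<lambda>z. exp (- \<Phi> (fst z)) / Z" "1 / Z"])
    have "continuous_on UNIV (\<lambda>z. exp (- \<Phi> (fst z)) :: real)" for z :: "'h \<times> 'h"
      by (intro continuous_intros continuous_on_compose2[OF \<Phi>(1)]) auto
    then have "(\<lambda>z. exp (- \<Phi> (fst z))) \<in> borel_measurable (\<nu> \<Otimes>\<^sub>M \<nu>)"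
      unfolding measurable_cong_sets[OF sets_pair_nu refl] by (intro borel_measurable_continuous_onI) auto
    then show "(\<lambda>z. exp (- \<Phi> (fst z)) / Z) \<in> borel_measurable (\<nu> \<Otimes>\<^sub>M \<nu>)" by simp
    show "exp (- \<Phi> (fst z)) / Z \<le> 1 / Z" for z :: "'h \<times> 'h"
      using \<Phi>(2) Z by (intro divide_right_mono) auto
  qed (use Z in \<open>auto simp: boomerang_target_def Z_def\<close>)
qed

lemma finite_target: "finite_measure (boomerang_target \<nu> \<Phi>)"
proof -
  obtain d c where d: "boomerang_target \<nu> \<Phi> = density (\<nu> \<Otimes>\<^sub>M \<nu>) (\<lambda>z. ennreal (d z))"
    and [measurable]: "d \<in> borel_measurable (\<nu> \<Otimes>\<^sub>M \<nu>)" and "\<And>z. 0 \<le> d z" and c: "\<And>z. d z \<le> c"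
    by (rule target_density) blast
  have "emeasure (boomerang_target \<nu> \<Phi>) (space (boomerang_target \<nu> \<Phi>)) =
      (\<integral>\<^sup>+z. ennreal (d z) * indicator (space (\<nu> \<Otimes>\<^sub>M \<nu>)) z \<partial>(\<nu> \<Otimes>\<^sub>M \<nu>))"
    unfolding d space_density by (rule emeasure_density) auto
  also have "\<dots> \<le> (\<integral>\<^sup>+z. ennreal c \<partial>(\<nu> \<Otimes>\<^sub>M \<nu>))"
    using c by (intro nn_integral_mono) (auto simp: indicator_def ennreal_leI)
  also have "\<dots> = ennreal c" by (simp add: pair.emeasure_space_1)
  also have "\<dots> < \<infinity>" by simp
  finally show ?thesis by (intro finite_measureI) simp
qed

lemma target_L2:
  assumes "w \<in> L2 (\<nu> \<Otimes>\<^sub>M \<nu>)"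
  shows "w \<in> L2 (boomerang_target \<nu> \<Phi>)"
proof -
  obtain d c where d: "boomerang_target \<nu> \<Phi> = density (\<nu> \<Otimes>\<^sub>M \<nu>) (\<lambda>z. ennreal (d z))"
    and [measurable]: "d \<in> borel_measurable (\<nu> \<Otimes>\<^sub>M \<nu>)" and d0: "\<And>z. 0 \<le> d z" and c: "\<And>z. d z \<le> c"
    by (rule target_density) blast
  have [measurable]: "w \<in> borel_measurable (\<nu> \<Otimes>\<^sub>M \<nu>)" by (rule L2_measurable[OF assms])
  have c0: "0 \<le> c" using d0[of 0] c[of 0] by linarith
  have "integrable (\<nu> \<Otimes>\<^sub>M \<nu>) (\<lambda>z. c * (w z)\<^sup>2)" by (intro integrable_mult_right L2_integrable assms)
  then have "integrable (\<nu> \<Otimes>\<^sub>M \<nu>) (\<lambda>z. d z *\<^sub>R (w z)\<^sup>2)"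
    by (rule Bochner_Integration.integrable_bound)
       (use d0 c c0 in \<open>auto simp: abs_mult intro!: mult_right_mono\<close>)
  then have "integrable (boomerang_target \<nu> \<Phi>) (\<lambda>z. (w z)\<^sup>2)"
    unfolding d by (subst integrable_density) (use d0 in auto)
  moreover have "w \<in> borel_measurable (boomerang_target \<nu> \<Phi>)" unfolding d by simp
  ultimately show ?thesis by (rule L2_I[rotated])
qed

text \<open>The square of the weight is a product of a function of the position and one of the
  velocity. Under the product measure its integral factorises, so finite second moments of \<nu>
  suffice.\<close>

lemma product_weight_L2:
  assumes moment: "(\<integral>\<^sup>+x. ennreal ((norm x)\<^sup>2) \<partial>\<nu>) < \<infinity>"
  shows "(\<lambda>z. (1 + norm (fst z)) * (1 + norm (snd z))) \<in> L2 (\<nu> \<Otimes>\<^sub>M \<nu>)"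
proof (rule L2_I)
  let ?N = "\<lambda>x :: 'h. (1 + norm x)\<^sup>2"
  have mN [measurable]: "norm \<in> borel_measurable \<nu>"
    unfolding measurable_cong_sets[OF sets_nu refl] by simp
  show "(\<lambda>z. (1 + norm (fst z)) * (1 + norm (snd z))) \<in> borel_measurable (\<nu> \<Otimes>\<^sub>M \<nu>)"
    by measurable
  have "(\<integral>\<^sup>+x. ennreal (?N x) \<partial>\<nu>) \<le> (\<integral>\<^sup>+x. 2 + 2 * ennreal ((norm x)\<^sup>2) \<partial>\<nu>)"
  proof (rule nn_integral_mono)
    fix x
    have "?N x \<le> 2 + 2 * (norm x)\<^sup>2"
      using zero_le_power2[of "1 - norm x"] by (simp add: power2_eq_square algebra_simps)
    then have "ennreal (?N x) \<le> ennreal (2 + 2 * (norm x)\<^sup>2)" by (rule ennreal_leI)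
    then show "ennreal (?N x) \<le> 2 + 2 * ennreal ((norm x)\<^sup>2)"
      by (simp add: ennreal_plus ennreal_mult)
  qed
  also have "\<dots> = 2 + 2 * (\<integral>\<^sup>+x. ennreal ((norm x)\<^sup>2) \<partial>\<nu>)"
    by (simp add: nn_integral_add nn_integral_cmult nu.emeasure_space_1)
  also have "\<dots> < \<infinity>" using moment by (simp add: ennreal_mult_less_top)
  finally have fin: "(\<integral>\<^sup>+x. ennreal (?N x) \<partial>\<nu>) < \<infinity>" .
  have "(\<integral>\<^sup>+z. ennreal (?N (fst z)) * ennreal (?N (snd z)) \<partial>(\<nu> \<Otimes>\<^sub>M \<nu>)) =
      (\<integral>\<^sup>+x. \<integral>\<^sup>+y. ennreal (?N x) * ennreal (?N y) \<partial>\<nu> \<partial>\<nu>)"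
    by (subst nu.nn_integral_fst[symmetric]) auto
  also have "\<dots> = (\<integral>\<^sup>+x. ennreal (?N x) \<partial>\<nu>) * (\<integral>\<^sup>+x. ennreal (?N x) \<partial>\<nu>)"
    by (simp add: nn_integral_cmult nn_integral_multc)
  also have "\<dots> < \<infinity>" using fin by (simp add: ennreal_mult_less_top)
  finally have "(\<integral>\<^sup>+z. ennreal (((1 + norm (fst z)) * (1 + norm (snd z)))\<^sup>2) \<partial>(\<nu> \<Otimes>\<^sub>M \<nu>)) < \<infinity>"
    by (simp add: power_mult_distrib ennreal_mult)
  then show "integrable (\<nu> \<Otimes>\<^sub>M \<nu>) (\<lambda>z. ((1 + norm (fst z)) * (1 + norm (snd z)))\<^sup>2)"
    by (intro integrableI_nonneg) auto
qed

end

theorem theorem5p5: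
  fixes S :: "'h::{real_inner, banach, second_countable_topology} \<Rightarrow> 'h"
    and \<nu> :: "'h measure"
    and \<Phi> :: "'h \<Rightarrow> real"
    and lr :: real
    and R :: "nat \<Rightarrow> 'h \<Rightarrow> 'h"
    and T :: "real \<Rightarrow> ('h \<times> 'h \<Rightarrow> real) \<Rightarrow> 'h \<times> 'h \<Rightarrow> real"
  assumes "infinite_dimensional TYPE('h)"
    and "positive_trace_class S"
    and "gaussian S \<nu>"
    and "lr > 0"
    and "boomerang_reflections S R"
    and "assumption_G \<Phi>"
    and "C2_hess_locally_bounded \<Phi>"
    and "condition_I \<nu> \<Phi> lr R"
    and "strongly_continuous_semigroup (boomerang_target \<nu> \<Phi>) T"
    and "\<And>t f. t \<ge> 0 \<Longrightarrow> f \<in> boomerang_C0 \<nu> \<Phi> lr R \<Longrightarrow>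
           AE z in boomerang_target \<nu> \<Phi>. T t f z = boomerang_semigroup \<nu> \<Phi> lr R t f z"
  shows "graph_dense (boomerang_target \<nu> \<Phi>)
           (semigroup_generator (boomerang_target \<nu> \<Phi>) T) smooth_cylinder_functions \<and>
         is_core (boomerang_target \<nu> \<Phi>)
           (semigroup_generator (boomerang_target \<nu> \<Phi>) T) (linear_span smooth_cylinder_functions)"
proof -
  let ?M = "boomerang_target \<nu> \<Phi>"
  \<comment> \<open>A product rather than a power of the norm of the pair: it matches the bounce
    rate, which is at most a function of the position growing linearly times the norm of the
    velocity.\<close>
  let ?W = "\<lambda>z :: 'h \<times> 'h. (1 + norm (fst z)) * (1 + norm (snd z))"
  have prob: "prob_space \<nu>" and sets: "sets \<nu> = sets borel"
    using \<open>gaussian S \<nu>\<close> by (simp_all add: gaussian_def)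
  note growth = \<open>assumption_G \<Phi>\<close>[unfolded assumption_G_def, THEN conjunct1]
  have \<Phi>0: "0 \<le> \<Phi> x" and diff: "\<Phi> differentiable (at x)" for x
    using growth by (elim exE conjE; simp)+
  obtain K where K: "\<And>x. norm (grad \<Phi> x) \<le> K * (1 + norm x)"
    using growth by (elim exE conjE) (rule that, erule spec)
  have \<Phi>: "continuous_on UNIV \<Phi>"
    using diff by (simp add: continuous_at_imp_continuous_on differentiable_imp_continuous_within)
  interpret boomerang \<nu> \<Phi> lr R
    by (rule boomerang_locale) (rule assms)+
  have "?W \<in> L2 (\<nu> \<Otimes>\<^sub>M \<nu>)"
    by (rule product_weight_L2[OF prob sets \<Phi> \<Phi>0 gaussian_second_moment]) (rule assms)+
  then have W: "?W \<in> L2 ?M"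
    by (rule target_L2[OF prob sets \<Phi> \<Phi>0])
  \<comment> \<open>The linear growth of the gradient is combined with the bound from the
    reflections. The absolute value of \<open>K\<close> keeps the constant nonnegative, as no sign
    is given.\<close>
  have total: "total_bounce_rate \<Phi> R z \<le> \<bar>K\<bar> * ?W z" for z
  proof -
    have "total_bounce_rate \<Phi> R z \<le> norm (grad \<Phi> (fst z)) * norm (snd z)"
      by (rule bounce_rate_summable(2)[OF \<open>boomerang_reflections S R\<close>])
    also have "\<dots> \<le> (\<bar>K\<bar> * (1 + norm (fst z))) * (1 + norm (snd z))"
    proof (rule mult_mono)
      have "K * (1 + norm (fst z)) \<le> \<bar>K\<bar> * (1 + norm (fst z))" by (intro mult_right_mono) auto
      then show "norm (grad \<Phi> (fst z)) \<le> \<bar>K\<bar> * (1 + norm (fst z))" using K[of "fst z"] by linarith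
    qed auto
    finally show ?thesis by (simp add: mult.assoc)
  qed
  have norm: "1 + norm z \<le> ?W z" for z
  proof -
    have "norm z \<le> norm (fst z) + norm (snd z)"
      using norm_Pair_le[of "fst z" "snd z"] by simp
    moreover have "0 \<le> norm (fst z) * norm (snd z)" by simp
    moreover have "?W z = 1 + (norm (fst z) + norm (snd z)) + norm (fst z) * norm (snd z)"
      by (simp add: algebra_simps)
    ultimately show ?thesis by linarith
  qed
  interpret finite_measure ?M by (rule finite_target[OF prob sets \<Phi> \<Phi>0])
  interpret boomerang_L2 \<nu> \<Phi> lr R ?M T ?W "\<bar>K\<bar>"
  proof unfold_locales
    show "sets ?M = sets borel" by (rule sets_target[OF prob sets \<Phi> \<Phi>0])
    show "AE z in ?M. T t f z = boomerang_semigroup \<nu> \<Phi> lr R t f z"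
      if "0 \<le> t" "f \<in> boomerang_C0 \<nu> \<Phi> lr R" for t f
      using that by (rule assms(10))
  qed (rule W norm total assms(9))+
  show ?thesis
    using graph_dense_smooth_cylinder is_core_linear_span[OF graph_dense_smooth_cylinder smooth_cylinder_nonempty]
    by blast
qed

end
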